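(* Let $\Omega\subset\mathbb{R}^n$, $n\le 2$, be a bounded Lipschitz domain, let $\alpha>0$, and assume $u_0\in H_0^2(\Omega)$. Then for every $T>0$ there exists a unique weak solution of the Rosenau–Burgers problem $u_t+\Delta^2u_t-\alpha\Delta u-\nabla\cdot g(u)=0$ in $\Omega\times(0,T]$ with initial data $u_0$, in the following sense: there is a unique $u\in L^\infty(I;H_0^2(\Omega))\cap L^2(I;H_0^1(\Omega))$ with $u_t\in L^2(I;H^2(\Omega))$ such that $$(u_t(t),\chi)+(\Delta u_t(t),\Delta\chi)+\alpha(\nabla u(t),\nabla\chi)=(\nabla\cdot g(u(t)),\chi)\quad\text{for all }\chi\in H_0^2(\Omega)$$ for (a.e.) $t\in I$, and $u(x,0)=u_0(x)$ for $x\in\Omega$.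
   Context: $I=(0,T)$. $(\cdot,\cdot)$ and $\|\cdot\|$ are the $L^2(\Omega)$ inner product and norm. The nonlinearity is $g:\mathbb{R}\to\mathbb{R}^n$, $g=(g_1,\dots,g_n)^T$, $g_i(u)=-(u+\tfrac12u^2)$ for $i=1,\dots,n$. Norms: $\|u\|_1^2=\|u\|^2+\|\nabla u\|^2$, $\|u\|_2^2=\|u\|^2+\|\nabla u\|^2+\|\Delta u\|^2$; $H^m(\Omega)=\{u:\|u\|_m<\infty\}$ for $m=1,2$. $H_0^1(\Omega)=\{u\in H^1(\Omega): u|_{\partial\Omega}=0\}$ and $H_0^2(\Omega)=\{u\in H^2(\Omega): u|_{\partial\Omega}=0,\ \partial u/\partial n|_{\partial\Omega}=0\}$, with $n$ the outward unit normal. $L^p(I;\mathcal Z)$ denotes the usual Bochner space with values in the Banach space $\mathcal Z$; $u_t$ is the time derivative. *)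

theory Defs
  imports "HOL-Analysis.Analysis"
begin

section \<open>Hausdorff measure\<close>

text \<open>Normalised such that the \<open>n\<close>-dimensional Hausdorff measure on \<open>\<real>\<^sup>n\<close> is the Lebesgue measure;
  in dimension 0 it is the counting measure.\<close>

definition hausdorff_weight :: "nat \<Rightarrow> 'a::metric_space set \<Rightarrow> ennreal" where
  "hausdorff_weight s U =
     (if U = {} then 0 else ennreal (unit_ball_vol (real s) * (diameter U / 2) ^ s))"

definition hausdorff_covers :: "real \<Rightarrow> 'a::metric_space set \<Rightarrow> (nat \<Rightarrow> 'a set) set" where
  "hausdorff_covers \<delta> A =
     {U. A \<subseteq> (\<Union>i. U i) \<and> (\<forall>i. bounded (U i) \<and> diameter (U i) \<le> \<delta>)}"

definition hausdorff_premeasure :: "nat \<Rightarrow> real \<Rightarrow> 'a::metric_space set \<Rightarrow> ennreal" where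
  "hausdorff_premeasure s \<delta> A = (INF U\<in>hausdorff_covers \<delta> A. \<Sum>i. hausdorff_weight s (U i))"

definition hausdorff_outer :: "nat \<Rightarrow> 'a::metric_space set \<Rightarrow> ennreal" where
  "hausdorff_outer s A = (SUP \<delta>\<in>{0<..}. hausdorff_premeasure s \<delta> A)"

definition hausdorff_measure :: "nat \<Rightarrow> 'a::metric_space measure" where
  "hausdorff_measure s = measure_of UNIV (sets borel) (hausdorff_outer s)"

text \<open>Since \<^const>\<open>measure_of\<close> silently yields the zero measure for set functions that are not
  countably additive, we verify that this does not happen here.\<close>

lemma hausdorff_premeasure_empty: "0 < \<delta> \<Longrightarrow> hausdorff_premeasure s \<delta> {} = 0"
proof -
  assume "0 < \<delta>"
  then have "(\<lambda>_. {}) \<in> hausdorff_covers \<delta> ({} :: 'a set)"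
    by (auto simp: hausdorff_covers_def)
  then have "hausdorff_premeasure s \<delta> ({} :: 'a set) \<le> (\<Sum>i::nat. hausdorff_weight s ({} :: 'a set))"
    unfolding hausdorff_premeasure_def by (rule INF_lower)
  then show ?thesis by (simp add: hausdorff_weight_def)
qed

lemma hausdorff_premeasure_mono: "A \<subseteq> B \<Longrightarrow> hausdorff_premeasure s \<delta> A \<le> hausdorff_premeasure s \<delta> B"
  unfolding hausdorff_premeasure_def
  by (rule INF_superset_mono) (auto simp: hausdorff_covers_def)

lemma hausdorff_premeasure_antimono:
  "\<delta> \<le> \<delta>' \<Longrightarrow> hausdorff_premeasure s \<delta>' A \<le> hausdorff_premeasure s \<delta> A"
  unfolding hausdorff_premeasure_def
  by (rule INF_superset_mono) (auto simp: hausdorff_covers_def intro: order_trans)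

lemma hausdorff_premeasure_subadditive:
  assumes "0 < \<delta>"
  shows "hausdorff_premeasure s \<delta> (\<Union>i. A i) \<le> (\<Sum>i. hausdorff_premeasure s \<delta> (A i))"
proof (cases "(\<Sum>i. hausdorff_premeasure s \<delta> (A i)) = top")
  case False
  show ?thesis
  proof (rule ennreal_le_epsilon)
    fix e :: real assume e: "0 < e"
    have "\<exists>U\<in>hausdorff_covers \<delta> (A i). (\<Sum>j. hausdorff_weight s (U j))
            \<le> hausdorff_premeasure s \<delta> (A i) + ennreal (e * (1/2) ^ Suc i)" for i
    proof -
      have fin: "hausdorff_premeasure s \<delta> (A i) < top"
        using False ennreal_suminf_lessD[of "\<lambda>i. hausdorff_premeasure s \<delta> (A i)" top i]
        by (simp add: less_top)
      have "(INF U\<in>hausdorff_covers \<delta> (A i). \<Sum>j. hausdorff_weight s (U j))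
              < hausdorff_premeasure s \<delta> (A i) + ennreal (e * (1/2) ^ Suc i)"
        using fin e by (simp add: hausdorff_premeasure_def[symmetric] ennreal_zero_less_mult_iff)
      then show ?thesis by (auto simp: INF_less_iff intro: less_imp_le)
    qed
    then obtain U where U: "\<And>i. U i \<in> hausdorff_covers \<delta> (A i)"
      and le: "\<And>i. (\<Sum>j. hausdorff_weight s (U i j))
                 \<le> hausdorff_premeasure s \<delta> (A i) + ennreal (e * (1/2) ^ Suc i)"
      by metis
    define V where "V k = (case prod_decode k of (i, j) \<Rightarrow> U i j)" for k
    have V: "V \<in> hausdorff_covers \<delta> (\<Union>i. A i)"
      unfolding hausdorff_covers_def
    proof (intro CollectI conjI allI subsetI)
      fix x assume "x \<in> (\<Union>i. A i)"
      then obtain i where "x \<in> A i" by auto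
      moreover have "A i \<subseteq> (\<Union>j. U i j)" using U by (auto simp: hausdorff_covers_def)
      ultimately obtain j where "x \<in> U i j" by blast
      then have "x \<in> V (prod_encode (i, j))" by (simp add: V_def)
      then show "x \<in> (\<Union>k. V k)" by blast
    next
      fix k
      show "bounded (V k)" "diameter (V k) \<le> \<delta>"
        using U by (auto simp: V_def hausdorff_covers_def split: prod.split)
    qed
    have "hausdorff_premeasure s \<delta> (\<Union>i. A i) \<le> (\<Sum>k. hausdorff_weight s (V k))"
      unfolding hausdorff_premeasure_def by (rule INF_lower[OF V])
    also have "\<dots> = (\<Sum>i. \<Sum>j. hausdorff_weight s (U i j))"
      using suminf_ennreal_2dimen[of "\<lambda>i. \<Sum>j. hausdorff_weight s (U i j)"
          "\<lambda>(i, j). hausdorff_weight s (U i j)"]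
      by (simp add: V_def o_def split_beta)
    also have "\<dots> \<le> (\<Sum>i. hausdorff_premeasure s \<delta> (A i) + ennreal (e * (1/2) ^ Suc i))"
      by (intro suminf_le le) auto
    also have "\<dots> = (\<Sum>i. hausdorff_premeasure s \<delta> (A i)) + (\<Sum>i. ennreal (e * (1/2) ^ Suc i))"
      by (rule suminf_add[symmetric]) auto
    also have "(\<Sum>i. ennreal (e * (1/2) ^ Suc i)) = ennreal e"
      using sums_mult[OF power_half_series, of e] e
      by (intro suminf_ennreal_eq) auto
    finally show "hausdorff_premeasure s \<delta> (\<Union>i. A i)
        \<le> (\<Sum>i. hausdorff_premeasure s \<delta> (A i)) + ennreal e" .
  qed
qed simp

lemma hausdorff_premeasure_separated:
  assumes "0 < \<delta>" "\<delta> < d" "\<And>a b. a \<in> A \<Longrightarrow> b \<in> B \<Longrightarrow> d \<le> dist a b"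
  shows "hausdorff_premeasure s \<delta> A + hausdorff_premeasure s \<delta> B \<le> hausdorff_premeasure s \<delta> (A \<union> B)"
proof -
  have "hausdorff_premeasure s \<delta> A + hausdorff_premeasure s \<delta> B \<le> (\<Sum>i. hausdorff_weight s (U i))"
    if U: "U \<in> hausdorff_covers \<delta> (A \<union> B)" for U
  proof -
    define V where "V C i = (if U i \<inter> C = {} then {} else U i)" for C i
    have cov: "V C \<in> hausdorff_covers \<delta> C" if "C \<subseteq> A \<union> B" for C
      using U that assms(1) unfolding hausdorff_covers_def V_def by (auto; blast)
    have "U i \<inter> A = {} \<or> U i \<inter> B = {}" for i
    proof (rule ccontr)
      assume "\<not> ?thesis"
      then obtain a b where ab: "a \<in> U i" "a \<in> A" "b \<in> U i" "b \<in> B" by auto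
      then have "dist a b \<le> diameter (U i)" "diameter (U i) \<le> \<delta>"
        using U by (auto simp: hausdorff_covers_def intro: diameter_bounded_bound)
      then show False using assms(2) assms(3)[OF ab(2,4)] by simp
    qed
    then have le: "hausdorff_weight s (V A i) + hausdorff_weight s (V B i) \<le> hausdorff_weight s (U i)" for i
      by (auto simp: V_def hausdorff_weight_def)
    have "hausdorff_premeasure s \<delta> A + hausdorff_premeasure s \<delta> B
        \<le> (\<Sum>i. hausdorff_weight s (V A i)) + (\<Sum>i. hausdorff_weight s (V B i))"
      unfolding hausdorff_premeasure_def by (intro add_mono INF_lower cov) auto
    also have "\<dots> = (\<Sum>i. hausdorff_weight s (V A i) + hausdorff_weight s (V B i))"
      by (rule suminf_add) auto
    also have "\<dots> \<le> (\<Sum>i. hausdorff_weight s (U i))"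
      by (intro suminf_le le) auto
    finally show ?thesis .
  qed
  then show ?thesis
    unfolding hausdorff_premeasure_def[of s \<delta> "A \<union> B"] by (rule INF_greatest)
qed

lemma hausdorff_premeasure_le_outer: "0 < \<delta> \<Longrightarrow> hausdorff_premeasure s \<delta> A \<le> hausdorff_outer s A"
  unfolding hausdorff_outer_def by (rule SUP_upper) simp

lemma hausdorff_outer_empty: "hausdorff_outer s {} = 0"
  by (simp add: hausdorff_outer_def hausdorff_premeasure_empty bot_ennreal)

lemma hausdorff_outer_mono: "A \<subseteq> B \<Longrightarrow> hausdorff_outer s A \<le> hausdorff_outer s B"
  unfolding hausdorff_outer_def by (intro SUP_mono) (auto intro: hausdorff_premeasure_mono)

lemma hausdorff_outer_subadditive: "hausdorff_outer s (\<Union>i. A i) \<le> (\<Sum>i. hausdorff_outer s (A i))"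
proof -
  have "hausdorff_premeasure s \<delta> (\<Union>i. A i) \<le> (\<Sum>i. hausdorff_outer s (A i))" if "0 < \<delta>" for \<delta>
    using hausdorff_premeasure_subadditive[OF that]
    by (rule order_trans) (intro suminf_le hausdorff_premeasure_le_outer that; simp)
  then show ?thesis
    unfolding hausdorff_outer_def[of s "\<Union>i. A i"] by (intro SUP_least) simp
qed

lemma hausdorff_outer_subadditive2: "hausdorff_outer s (A \<union> B) \<le> hausdorff_outer s A + hausdorff_outer s B"
proof -
  have "hausdorff_outer s (\<Union>i. binaryset A B i) \<le> (\<Sum>i. hausdorff_outer s (binaryset A B i))"
    by (rule hausdorff_outer_subadditive)
  also have "\<dots> = hausdorff_outer s A + hausdorff_outer s B"
    by (rule suminf_binaryset_eq) (simp add: hausdorff_outer_empty)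
  finally show ?thesis by (simp add: UN_binaryset_eq)
qed

lemma hausdorff_outer_separated:
  assumes "0 < d" "\<And>a b. a \<in> A \<Longrightarrow> b \<in> B \<Longrightarrow> d \<le> dist a b"
  shows "hausdorff_outer s A + hausdorff_outer s B \<le> hausdorff_outer s (A \<union> B)"
proof -
  have *: "hausdorff_premeasure s \<delta> A + hausdorff_premeasure s \<delta>' B \<le> hausdorff_outer s (A \<union> B)"
    if "0 < \<delta>" "0 < \<delta>'" for \<delta> \<delta>'
  proof -
    define \<epsilon> where "\<epsilon> = min (min \<delta> \<delta>') (d / 2)"
    have \<epsilon>: "0 < \<epsilon>" "\<epsilon> < d" "\<epsilon> \<le> \<delta>" "\<epsilon> \<le> \<delta>'" using that assms(1) by (auto simp: \<epsilon>_def)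
    have "hausdorff_premeasure s \<delta> A + hausdorff_premeasure s \<delta>' B
        \<le> hausdorff_premeasure s \<epsilon> A + hausdorff_premeasure s \<epsilon> B"
      by (intro add_mono hausdorff_premeasure_antimono \<epsilon>)
    also have "\<dots> \<le> hausdorff_premeasure s \<epsilon> (A \<union> B)"
      by (rule hausdorff_premeasure_separated[OF \<epsilon>(1,2) assms(2)])
    also have "\<dots> \<le> hausdorff_outer s (A \<union> B)" by (rule hausdorff_premeasure_le_outer[OF \<epsilon>(1)])
    finally show ?thesis .
  qed
  have "hausdorff_outer s A + hausdorff_premeasure s \<delta>' B \<le> hausdorff_outer s (A \<union> B)" if "0 < \<delta>'" for \<delta>'
    unfolding hausdorff_outer_def[of s A]
    by (subst ennreal_SUP_add_left[symmetric]) (use * that in \<open>auto intro!: SUP_least\<close>)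
  then show ?thesis
    unfolding hausdorff_outer_def[of s B]
    by (subst add.commute, subst ennreal_SUP_add_left[symmetric])
      (auto intro!: SUP_least simp: add.commute)
qed

lemma ennreal_suminf_tail:
  fixes f :: "nat \<Rightarrow> ennreal"
  assumes "(\<Sum>k. f k) \<noteq> top"
  shows "(\<lambda>n. \<Sum>k. f (k + n)) \<longlonglongrightarrow> 0"
proof -
  define g where "g k = enn2real (f k)" for k
  have f: "f k = ennreal (g k)" for k
    using assms ennreal_suminf_lessD[of f top k] by (simp add: g_def less_top)
  have g: "0 \<le> g k" for k by (simp add: g_def)
  have sm: "summable g" by (rule summable_suminf_not_top) (use assms g f in auto)
  have "(\<lambda>n. suminf g - (\<Sum>k<n. g k)) \<longlonglongrightarrow> suminf g - suminf g"
    by (intro tendsto_intros summable_LIMSEQ sm)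
  then have "(\<lambda>n. \<Sum>k. g (k + n)) \<longlonglongrightarrow> 0"
    by (simp add: suminf_minus_initial_segment[OF sm])
  then have "(\<lambda>n. ennreal (\<Sum>k. g (k + n))) \<longlonglongrightarrow> ennreal 0"
    by (rule tendsto_ennrealI)
  moreover have "(\<Sum>k. f (k + n)) = ennreal (\<Sum>k. g (k + n))" for n
    unfolding f by (rule suminf_ennreal2) (use g sm summable_iff_shift[of g n] in auto)
  ultimately show ?thesis by simp
qed

lemma hausdorff_outer_closed:
  fixes C X :: "'a::metric_space set"
  assumes C: "closed C"
  shows "hausdorff_outer s (X \<inter> C) + hausdorff_outer s (X - C) \<le> hausdorff_outer s X"
proof (cases "C = {} \<or> hausdorff_outer s X = top")
  case True
  then show ?thesis by (auto simp: hausdorff_outer_empty)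
next
  case False
  let ?H = "hausdorff_outer s :: 'a set \<Rightarrow> ennreal"
  have ne: "C \<noteq> {}" and fin: "?H X < top" using False by (auto simp: less_top)
  define P where "P n = {x \<in> X. 1 / real (Suc n) \<le> infdist x C}" for n
  define R where "R n = {x \<in> X. 1 / real (Suc (Suc n)) \<le> infdist x C \<and> infdist x C < 1 / real (Suc n)}" for n
  have sepR: "1 / real (Suc (Suc n)) - 1 / real (Suc m) \<le> dist a b"
    if "a \<in> R n" "b \<in> R m" for n m a b
    using that infdist_triangle[of a C b] by (auto simp: R_def)
  have parity: "(\<Sum>k<N. ?H (R (2 * k + j))) \<le> ?H (\<Union>k<N. R (2 * k + j))" for N j
  proof (induction N)
    case (Suc N)
    have d: "0 < 1 / real (2 * N + j) - 1 / real (Suc (2 * N + j))" if "N > 0"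
      using that by (simp add: frac_less2)
    have "?H (\<Union>k<N. R (2 * k + j)) + ?H (R (2 * N + j))
        \<le> ?H ((\<Union>k<N. R (2 * k + j)) \<union> R (2 * N + j))"
    proof (cases "N = 0")
      case False
      show ?thesis
      proof (rule hausdorff_outer_separated[OF d])
        fix a b assume "a \<in> (\<Union>k<N. R (2 * k + j))" "b \<in> R (2 * N + j)"
        then obtain k where k: "k < N" "a \<in> R (2 * k + j)" by auto
        have "1 / real (2 * N + j) \<le> 1 / real (Suc (Suc (2 * k + j)))"
          using k(1) by (intro divide_left_mono) auto
        then show "1 / real (2 * N + j) - 1 / real (Suc (2 * N + j)) \<le> dist a b"
          using sepR[OF k(2) \<open>b \<in> R (2 * N + j)\<close>] by linarith
      qed (use False in simp)
    qed (simp add: hausdorff_outer_empty)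
    moreover have "(\<Union>k<Suc N. R (2 * k + j)) = (\<Union>k<N. R (2 * k + j)) \<union> R (2 * N + j)"
      by (auto simp: lessThan_Suc)
    ultimately show ?case using Suc.IH by (simp add: add_mono order_trans[OF add_right_mono])
  qed (simp add: hausdorff_outer_empty)
  have parity': "(\<Sum>k<N. ?H (R (2 * k + j))) \<le> ?H X" for N j
    using parity by (rule order_trans) (auto intro!: hausdorff_outer_mono simp: R_def)
  have split: "(\<Sum>k<2 * N. f k) = (\<Sum>k<N. f (2 * k + 0)) + (\<Sum>k<N. f (2 * k + 1))"
    for N and f :: "nat \<Rightarrow> ennreal"
    by (induction N) (auto simp: algebra_simps)
  have "(\<Sum>k<n. ?H (R k)) \<le> ?H X + ?H X" for n
  proof -
    have "(\<Sum>k<n. ?H (R k)) \<le> (\<Sum>k<2 * n. ?H (R k))" by (intro sum_mono2) auto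
    also have "\<dots> \<le> ?H X + ?H X" unfolding split by (intro add_mono parity')
    finally show ?thesis .
  qed
  then have "(\<Sum>k. ?H (R k)) \<le> ?H X + ?H X" by (intro suminf_le_const) auto
  then have "(\<Sum>k. ?H (R k)) \<noteq> top" using fin by (auto simp: top_unique)
  then have tail: "(\<lambda>n. \<Sum>k. ?H (R (k + n))) \<longlonglongrightarrow> 0"
    by (rule ennreal_suminf_tail)
  have "?H (X \<inter> C) + ?H (X - C) \<le> ?H X + (\<Sum>k. ?H (R (k + n)))" for n
  proof -
    have "X - C \<subseteq> P n \<union> (\<Union>k. R (k + n))"
    proof
      fix x assume x: "x \<in> X - C"
      then have pos: "0 < infdist x C"
        using C ne by (metis DiffD2 in_closed_iff_infdist_zero infdist_nonneg less_eq_real_def)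
      define m where "m = (LEAST m. 1 / real (Suc m) \<le> infdist x C)"
      obtain m0 where "1 / real (Suc m0) \<le> infdist x C"
        using pos nat_approx_posE less_imp_le by metis
      then have m: "1 / real (Suc m) \<le> infdist x C"
        unfolding m_def by (rule LeastI)
      show "x \<in> P n \<union> (\<Union>k. R (k + n))"
      proof (cases "m \<le> n")
        case True
        then have "1 / real (Suc n) \<le> 1 / real (Suc m)" by (intro divide_left_mono) auto
        then show ?thesis using m x by (auto simp: P_def)
      next
        case False
        then obtain k where k: "m = Suc (k + n)" using less_imp_Suc_add[of n m] by (auto simp: add.commute)
        then have "\<not> 1 / real (Suc (k + n)) \<le> infdist x C"
          using not_less_Least[of "k + n" "\<lambda>m. 1 / real (Suc m) \<le> infdist x C"] by (simp add: m_def)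
        then have "x \<in> R (k + n)" using m x by (simp add: R_def k)
        then show ?thesis by blast
      qed
    qed
    then have "?H (X - C) \<le> ?H (P n) + ?H (\<Union>k. R (k + n))"
      by (rule order_trans[OF hausdorff_outer_mono hausdorff_outer_subadditive2])
    also have "\<dots> \<le> ?H (P n) + (\<Sum>k. ?H (R (k + n)))"
      by (intro add_left_mono hausdorff_outer_subadditive)
    finally have "?H (X \<inter> C) + ?H (X - C) \<le> (?H (X \<inter> C) + ?H (P n)) + (\<Sum>k. ?H (R (k + n)))"
      by (simp add: add.assoc add_left_mono)
    also have "?H (X \<inter> C) + ?H (P n) \<le> ?H (X \<inter> C \<union> P n)"
    proof (rule hausdorff_outer_separated)
      show "0 < 1 / real (Suc n)" by simp
      fix a b assume "a \<in> X \<inter> C" "b \<in> P n"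
      then show "1 / real (Suc n) \<le> dist a b"
        using infdist_le[of a C b] by (auto simp: P_def dist_commute)
    qed
    also have "\<dots> \<le> ?H X" by (intro hausdorff_outer_mono) (auto simp: P_def)
    finally show ?thesis by (simp add: add_right_mono)
  qed
  moreover have "(\<lambda>n. ?H X + (\<Sum>k. ?H (R (k + n)))) \<longlonglongrightarrow> ?H X + 0"
    by (intro tendsto_intros tail)
  ultimately show ?thesis by (intro LIMSEQ_le_const) auto
qed

lemma measure_space_hausdorff_outer:
  "measure_space UNIV (sets (borel :: 'a::metric_space measure)) (hausdorff_outer s)"
proof -
  let ?H = "hausdorff_outer s :: 'a set \<Rightarrow> ennreal"
  interpret sigma_algebra UNIV "UNIV :: 'a set set"
    by (metis Pow_UNIV sigma_algebra_Pow)
  have oms: "outer_measure_space UNIV ?H"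
    by (auto simp: outer_measure_space_def positive_def increasing_def countably_subadditive_def
        hausdorff_outer_empty intro: hausdorff_outer_mono hausdorff_outer_subadditive)
  let ?L = "lambda_system UNIV UNIV ?H"
  have ms: "measure_space UNIV ?L ?H" by (rule caratheodory_lemma[OF oms])
  then interpret L: sigma_algebra UNIV ?L by (simp add: measure_space_def)
  have "C \<in> ?L" if "closed C" for C
  proof -
    have "?H X \<le> ?H (X \<inter> C) + ?H (X - C)" for X
      using hausdorff_outer_subadditive2[of s "X \<inter> C" "X - C"] by (simp add: Int_Diff_Un)
    then show ?thesis
      using hausdorff_outer_closed[OF that, of s] by (auto simp: lambda_system_eq intro: antisym)
  qed
  then have "sigma_sets UNIV (Collect closed) \<subseteq> ?L"
    by (intro L.sigma_sets_subset) auto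
  then have "sets borel \<subseteq> ?L" by (simp add: borel_eq_closed)
  then show ?thesis
    using measure_down[OF ms] by (metis sets.sigma_algebra_axioms space_borel)
qed

lemma emeasure_hausdorff_measure:
  "A \<in> sets borel \<Longrightarrow> emeasure (hausdorff_measure s) A = hausdorff_outer s A"
  using measure_space_hausdorff_outer[of s, where 'a = 'a] unfolding hausdorff_measure_def
  by (intro emeasure_measure_of_sigma) (auto simp: measure_space_def)

section \<open>Domains and test functions\<close>

text \<open>Near each boundary point, in coordinates with some unit vector \<open>e\<close> as vertical axis, the domain
  is the part of a ball strictly above the graph of a Lipschitz function on the hyperplane \<open>e\<^sup>\<bottom>\<close>.\<close>

definition lipschitz_boundary :: "'a::euclidean_space set \<Rightarrow> bool" where
  "lipschitz_boundary \<Omega> \<longleftrightarrow>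
     (\<forall>p\<in>frontier \<Omega>. \<exists>r>0. \<exists>e L. \<exists>h :: 'a \<Rightarrow> real.
        norm e = 1 \<and> L-lipschitz_on {y. y \<bullet> e = 0} h \<and>
        \<Omega> \<inter> ball p r = {x \<in> ball p r. h (x - (x \<bullet> e) *\<^sub>R e) < x \<bullet> e})"

definition bounded_lipschitz_domain :: "'a::euclidean_space set \<Rightarrow> bool" where
  "bounded_lipschitz_domain \<Omega> \<longleftrightarrow>
     open \<Omega> \<and> connected \<Omega> \<and> \<Omega> \<noteq> {} \<and> bounded \<Omega> \<and> lipschitz_boundary \<Omega>"

definition partial :: "'a::euclidean_space \<Rightarrow> ('a \<Rightarrow> real) \<Rightarrow> 'a \<Rightarrow> real" where
  "partial b f x = frechet_derivative f (at x) b"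

primrec C_k :: "nat \<Rightarrow> ('a::euclidean_space \<Rightarrow> real) \<Rightarrow> bool" where
  "C_k 0 f \<longleftrightarrow> continuous_on UNIV f"
| "C_k (Suc k) f \<longleftrightarrow> (\<forall>x. f differentiable (at x)) \<and> (\<forall>b\<in>Basis. C_k k (partial b f))"

definition smooth :: "('a::euclidean_space \<Rightarrow> real) \<Rightarrow> bool" where
  "smooth f \<longleftrightarrow> (\<forall>k. C_k k f)"

definition test_function :: "'a::euclidean_space set \<Rightarrow> ('a \<Rightarrow> real) \<Rightarrow> bool" where
  "test_function \<Omega> \<phi> \<longleftrightarrow>
     smooth \<phi> \<and> compact (closure {x. \<phi> x \<noteq> 0}) \<and> closure {x. \<phi> x \<noteq> 0} \<subseteq> \<Omega>"

section \<open>Square integrable functions and weak derivatives\<close>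

text \<open>Elements of function spaces on \<open>\<Omega>\<close> are represented by functions on the whole space, of which only
  the values almost everywhere in \<open>\<Omega>\<close> matter.\<close>

definition L2 :: "'a::euclidean_space set \<Rightarrow> ('a \<Rightarrow> 'b::euclidean_space) set" where
  "L2 \<Omega> = {f. f \<in> borel_measurable (lebesgue_on \<Omega>) \<and>
              integrable (lebesgue_on \<Omega>) (\<lambda>x. (norm (f x))\<^sup>2)}"

definition L2_inner ::
    "'a::euclidean_space set \<Rightarrow> ('a \<Rightarrow> 'b::euclidean_space) \<Rightarrow> ('a \<Rightarrow> 'b) \<Rightarrow> real" where
  "L2_inner \<Omega> f g = (LINT x|lebesgue_on \<Omega>. f x \<bullet> g x)"

definition L2_norm :: "'a::euclidean_space set \<Rightarrow> ('a \<Rightarrow> 'b::euclidean_space) \<Rightarrow> real" where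
  "L2_norm \<Omega> f = sqrt (L2_inner \<Omega> f f)"

definition locally_integrable ::
    "'a::euclidean_space set \<Rightarrow> ('a \<Rightarrow> 'b::euclidean_space) \<Rightarrow> bool" where
  "locally_integrable \<Omega> f \<longleftrightarrow>
     (\<forall>K. compact K \<longrightarrow> K \<subseteq> \<Omega> \<longrightarrow> integrable (lebesgue_on K) f)"

definition has_weak_gradient ::
    "(real^'n) set \<Rightarrow> (real^'n \<Rightarrow> real) \<Rightarrow> (real^'n \<Rightarrow> real^'n) \<Rightarrow> bool" where
  "has_weak_gradient \<Omega> u G \<longleftrightarrow>
     locally_integrable \<Omega> u \<and> locally_integrable \<Omega> G \<and>
     (\<forall>\<phi>. test_function \<Omega> \<phi> \<longrightarrow>
        (\<forall>i. (LINT x|lebesgue_on \<Omega>. u x * partial (axis i 1) \<phi> x) =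
             - (LINT x|lebesgue_on \<Omega>. G x $ i * \<phi> x)))"

definition has_weak_divergence ::
    "(real^'n) set \<Rightarrow> (real^'n \<Rightarrow> real^'n) \<Rightarrow> (real^'n \<Rightarrow> real) \<Rightarrow> bool" where
  "has_weak_divergence \<Omega> F d \<longleftrightarrow>
     locally_integrable \<Omega> F \<and> locally_integrable \<Omega> d \<and>
     (\<forall>\<phi>. test_function \<Omega> \<phi> \<longrightarrow>
        (LINT x|lebesgue_on \<Omega>. (\<Sum>i\<in>UNIV. F x $ i * partial (axis i 1) \<phi> x)) =
        - (LINT x|lebesgue_on \<Omega>. d x * \<phi> x))"

text \<open>Weak derivatives are unique up to null sets when they exist, and meaningless otherwise.\<close>

definition weak_gradient :: "(real^'n) set \<Rightarrow> (real^'n \<Rightarrow> real) \<Rightarrow> real^'n \<Rightarrow> real^'n" where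
  "weak_gradient \<Omega> u = (SOME G. has_weak_gradient \<Omega> u G)"

definition weak_divergence :: "(real^'n) set \<Rightarrow> (real^'n \<Rightarrow> real^'n) \<Rightarrow> real^'n \<Rightarrow> real" where
  "weak_divergence \<Omega> F = (SOME d. has_weak_divergence \<Omega> F d)"

definition weak_laplacian :: "(real^'n) set \<Rightarrow> (real^'n \<Rightarrow> real) \<Rightarrow> real^'n \<Rightarrow> real" where
  "weak_laplacian \<Omega> u = weak_divergence \<Omega> (weak_gradient \<Omega> u)"

section \<open>Sobolev spaces\<close>

definition H1 :: "(real^'n) set \<Rightarrow> (real^'n \<Rightarrow> real) set" where
  "H1 \<Omega> = {u \<in> L2 \<Omega>. (\<exists>G. has_weak_gradient \<Omega> u G) \<and> weak_gradient \<Omega> u \<in> L2 \<Omega>}"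

definition H2 :: "(real^'n) set \<Rightarrow> (real^'n \<Rightarrow> real) set" where
  "H2 \<Omega> = {u \<in> H1 \<Omega>. (\<exists>d. has_weak_divergence \<Omega> (weak_gradient \<Omega> u) d) \<and>
                       weak_laplacian \<Omega> u \<in> L2 \<Omega>}"

definition H1_norm :: "(real^'n) set \<Rightarrow> (real^'n \<Rightarrow> real) \<Rightarrow> real" where
  "H1_norm \<Omega> u = sqrt ((L2_norm \<Omega> u)\<^sup>2 + (L2_norm \<Omega> (weak_gradient \<Omega> u))\<^sup>2)"

definition H2_norm :: "(real^'n) set \<Rightarrow> (real^'n \<Rightarrow> real) \<Rightarrow> real" where
  "H2_norm \<Omega> u = sqrt ((L2_norm \<Omega> u)\<^sup>2 + (L2_norm \<Omega> (weak_gradient \<Omega> u))\<^sup>2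
                        + (L2_norm \<Omega> (weak_laplacian \<Omega> u))\<^sup>2)"

text \<open>The trace operator from \<open>H\<^sup>1(\<Omega>)\<close> to \<open>L\<^sup>2(\<partial>\<Omega>)\<close> is the continuous extension of the restriction
  of smooth functions to the boundary; \<open>\<partial>\<Omega>\<close> carries the surface measure. The following is the graph
  of this operator.\<close>

definition surface_measure :: "(real^'n) set \<Rightarrow> (real^'n) measure" where
  "surface_measure \<Omega> = restrict_space (hausdorff_measure (CARD('n) - 1)) (frontier \<Omega>)"

definition has_trace :: "(real^'n) set \<Rightarrow> (real^'n \<Rightarrow> real) \<Rightarrow> (real^'n \<Rightarrow> real) \<Rightarrow> bool" where
  "has_trace \<Omega> u h \<longleftrightarrow>
     u \<in> H1 \<Omega> \<and> h \<in> borel_measurable (surface_measure \<Omega>) \<and>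
     (\<exists>\<phi> :: nat \<Rightarrow> real^'n \<Rightarrow> real. (\<forall>k. smooth (\<phi> k)) \<and>
        (\<lambda>k. H1_norm \<Omega> (\<lambda>x. u x - \<phi> k x)) \<longlonglongrightarrow> 0 \<and>
        (\<lambda>k. \<integral>\<^sup>+x. ennreal ((h x - \<phi> k x)\<^sup>2) \<partial>surface_measure \<Omega>) \<longlonglongrightarrow> 0)"

text \<open>For \<open>u\<close> with \<open>\<nabla>u\<close> and \<open>\<Delta>u\<close> in \<open>L\<^sup>2(\<Omega>)\<close> only, the normal derivative is the functional on boundary
  traces given by Green's formula:
  \<open>\<integral>\<^bsub>\<partial>\<Omega>\<^esub> (\<partial>u/\<partial>n) v ds = \<integral>\<^bsub>\<Omega>\<^esub> (\<nabla>u \<bullet> \<nabla>v + \<Delta>u v) dx\<close> for \<open>v \<in> H\<^sup>1(\<Omega>)\<close>.\<close>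

definition normal_derivative ::
    "(real^'n) set \<Rightarrow> (real^'n \<Rightarrow> real) \<Rightarrow> (real^'n \<Rightarrow> real) \<Rightarrow> real" where
  "normal_derivative \<Omega> u v =
     L2_inner \<Omega> (weak_gradient \<Omega> u) (weak_gradient \<Omega> v) + L2_inner \<Omega> (weak_laplacian \<Omega> u) v"

definition H10 :: "(real^'n) set \<Rightarrow> (real^'n \<Rightarrow> real) set" where
  "H10 \<Omega> = {u \<in> H1 \<Omega>. has_trace \<Omega> u (\<lambda>_. 0)}"

definition H20 :: "(real^'n) set \<Rightarrow> (real^'n \<Rightarrow> real) set" where
  "H20 \<Omega> = {u \<in> H2 \<Omega>. has_trace \<Omega> u (\<lambda>_. 0) \<and> (\<forall>v\<in>H1 \<Omega>. normal_derivative \<Omega> u v = 0)}"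

section \<open>Bochner spaces\<close>

text \<open>A Banach space \<open>Z\<close> of (classes of) functions is given by the set of its representatives and
  its norm \<open>N\<close>. A simple function on \<open>I\<close> is given by a list of pairs \<open>(A, z)\<close>, standing for
  \<open>\<Sum> 1\<^sub>A z\<close>. The time intervals in use are bounded, so that all \<open>A\<close> have finite measure.\<close>

type_synonym 'a simple = "(real set \<times> ('a \<Rightarrow> real)) list"

definition simples :: "real set \<Rightarrow> ('a \<Rightarrow> real) set \<Rightarrow> 'a simple set" where
  "simples I Z = {s. \<forall>(A, z)\<in>set s. A \<in> sets lebesgue \<and> A \<subseteq> I \<and> z \<in> Z}"

definition simple_value :: "'a simple \<Rightarrow> real \<Rightarrow> 'a \<Rightarrow> real" where
  "simple_value s t x = (\<Sum>(A, z)\<leftarrow>s. indicator A t * z x)"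

definition simple_integral :: "'a simple \<Rightarrow> 'a \<Rightarrow> real" where
  "simple_integral s x = (\<Sum>(A, z)\<leftarrow>s. measure lebesgue A * z x)"

definition strongly_measurable ::
    "real set \<Rightarrow> ('a \<Rightarrow> real) set \<Rightarrow> (('a \<Rightarrow> real) \<Rightarrow> real) \<Rightarrow> (real \<Rightarrow> 'a \<Rightarrow> real) \<Rightarrow> bool" where
  "strongly_measurable I Z N f \<longleftrightarrow>
     (AE t in lebesgue_on I. f t \<in> Z) \<and>
     (\<exists>s. (\<forall>k. s k \<in> simples I Z) \<and>
          (AE t in lebesgue_on I. (\<lambda>k::nat. N (\<lambda>x. f t x - simple_value (s k) t x)) \<longlonglongrightarrow> 0))"

definition has_integral_in ::
    "real set \<Rightarrow> ('a \<Rightarrow> real) set \<Rightarrow> (('a \<Rightarrow> real) \<Rightarrow> real) \<Rightarrow> (real \<Rightarrow> 'a \<Rightarrow> real) \<Rightarrow> ('a \<Rightarrow> real) \<Rightarrow> bool"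
  where
  "has_integral_in I Z N f J \<longleftrightarrow>
     strongly_measurable I Z N f \<and> J \<in> Z \<and>
     (\<exists>s. (\<forall>k. s k \<in> simples I Z) \<and>
          (\<lambda>k::nat. \<integral>\<^sup>+t. ennreal (N (\<lambda>x. f t x - simple_value (s k) t x)) \<partial>lebesgue_on I) \<longlonglongrightarrow> 0 \<and>
          (\<lambda>k. N (\<lambda>x. J x - simple_integral (s k) x)) \<longlonglongrightarrow> 0)"

definition bochner_Lp ::
    "real \<Rightarrow> real set \<Rightarrow> ('a \<Rightarrow> real) set \<Rightarrow> (('a \<Rightarrow> real) \<Rightarrow> real) \<Rightarrow> (real \<Rightarrow> 'a \<Rightarrow> real) set" where
  "bochner_Lp p I Z N =
     {f. strongly_measurable I Z N f \<and> (\<integral>\<^sup>+t. ennreal (N (f t) powr p) \<partial>lebesgue_on I) < \<infinity>}"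

definition bochner_Linf ::
    "real set \<Rightarrow> ('a \<Rightarrow> real) set \<Rightarrow> (('a \<Rightarrow> real) \<Rightarrow> real) \<Rightarrow> (real \<Rightarrow> 'a \<Rightarrow> real) set" where
  "bochner_Linf I Z N =
     {f. strongly_measurable I Z N f \<and> (\<exists>C. AE t in lebesgue_on I. N (f t) \<le> C)}"

text \<open>\<open>v\<close> is the (distributional) time derivative of \<open>u\<close>: \<open>\<integral> \<theta>' u dt = - \<integral> \<theta> v dt\<close> in \<open>Z\<close>.\<close>

definition has_time_derivative ::
    "real set \<Rightarrow> ('a \<Rightarrow> real) set \<Rightarrow> (('a \<Rightarrow> real) \<Rightarrow> real) \<Rightarrow>
       (real \<Rightarrow> 'a \<Rightarrow> real) \<Rightarrow> (real \<Rightarrow> 'a \<Rightarrow> real) \<Rightarrow> bool" where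
  "has_time_derivative I Z N u v \<longleftrightarrow>
     (\<forall>\<theta>. test_function I \<theta> \<longrightarrow>
        (\<exists>J. has_integral_in I Z N (\<lambda>t x. deriv \<theta> t * u t x) J \<and>
             has_integral_in I Z N (\<lambda>t x. - (\<theta> t * v t x)) J))"

definition continuous_in ::
    "real set \<Rightarrow> ('a \<Rightarrow> real) set \<Rightarrow> (('a \<Rightarrow> real) \<Rightarrow> real) \<Rightarrow> (real \<Rightarrow> 'a \<Rightarrow> real) \<Rightarrow> bool" where
  "continuous_in S Z N f \<longleftrightarrow>
     (\<forall>t\<in>S. f t \<in> Z \<and> ((\<lambda>r. N (\<lambda>x. f r x - f t x)) \<longlongrightarrow> 0) (at t within S))"

section \<open>The Rosenau--Burgers problem\<close>

definition flux :: "real \<Rightarrow> real^'n" where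
  "flux u = (\<chi> i. - (u + u\<^sup>2 / 2))"

text \<open>A function of time with values in \<open>H\<^sup>2(\<Omega>)\<close> that has a time derivative in \<open>L\<^sup>2(I; H\<^sup>2(\<Omega>))\<close> has
  a unique representative in \<open>C([0,T]; H\<^sup>2(\<Omega>))\<close>; the initial value is that of this representative.\<close>

definition has_initial_value ::
    "(real^'n) set \<Rightarrow> real \<Rightarrow> (real \<Rightarrow> real^'n \<Rightarrow> real) \<Rightarrow> (real^'n \<Rightarrow> real) \<Rightarrow> bool" where
  "has_initial_value \<Omega> T u u0 \<longleftrightarrow>
     (\<exists>w. continuous_in {0..T} (H2 \<Omega>) (H2_norm \<Omega>) w \<and>
          (AE t in lebesgue_on {0<..<T}. AE x in lebesgue_on \<Omega>. w t x = u t x) \<and>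
          (AE x in lebesgue_on \<Omega>. w 0 x = u0 x))"

definition weak_solution ::
    "(real^'n) set \<Rightarrow> real \<Rightarrow> real \<Rightarrow> (real^'n \<Rightarrow> real) \<Rightarrow> (real \<Rightarrow> real^'n \<Rightarrow> real) \<Rightarrow> bool" where
  "weak_solution \<Omega> \<alpha> T u0 u \<longleftrightarrow>
     u \<in> bochner_Linf {0<..<T} (H20 \<Omega>) (H2_norm \<Omega>) \<inter> bochner_Lp 2 {0<..<T} (H10 \<Omega>) (H1_norm \<Omega>) \<and>
     (\<exists>ut \<in> bochner_Lp 2 {0<..<T} (H2 \<Omega>) (H2_norm \<Omega>).
        has_time_derivative {0<..<T} (H2 \<Omega>) (H2_norm \<Omega>) u ut \<and>
        (AE t in lebesgue_on {0<..<T}. \<forall>w\<in>H20 \<Omega>.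
           L2_inner \<Omega> (ut t) w
           + L2_inner \<Omega> (weak_laplacian \<Omega> (ut t)) (weak_laplacian \<Omega> w)
           + \<alpha> * L2_inner \<Omega> (weak_gradient \<Omega> (u t)) (weak_gradient \<Omega> w)
           = L2_inner \<Omega> (weak_divergence \<Omega> (\<lambda>x. flux (u t x))) w)) \<and>
     has_initial_value \<Omega> T u u0"

end

theory Submission
  imports Defs
begin

text \<open>The class of \<open>(u, \<Delta>u)\<close> maps \<open>H\<^sub>0\<^sup>2(\<Omega>)\<close> onto a closed subspace \<open>V\<close> of a Hilbert space, because
  \<open>\<parallel>\<nabla>u\<parallel>\<^sup>2 = - (\<Delta>u, u)\<close> there. The weak equation becomes the ordinary differential equation
  \<open>\<langle>U', w\<rangle> = l(U, w)\<close> for \<open>w \<in> V\<close>, where \<open>l(u, w) = - \<alpha> (\<nabla>u, \<nabla>w) + (\<nabla> \<bullet> g(u), w)\<close>. In dimension at most 2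
  a Ladyzhenskaya inequality bounds \<open>u\<^sup>2\<close> in \<open>L\<^sup>2\<close>, so that \<open>l\<close> is locally Lipschitz in \<open>u\<close>; and
  \<open>l(u, u) \<le> 0\<close>, so that \<open>\<parallel>U\<parallel>\<close> does not increase and the solution exists for all times. For
  uniqueness, a solution has a continuous representative that satisfies the time integrated equation
  (du Bois-Reymond), and Gronwall's lemma applies to the difference of two of them.

  Traces vanish in the sense of approximation by smooth functions that are small in \<open>L\<^sup>2(\<partial>\<Omega>)\<close>. The
  only link between the interior and the Hausdorff measure of the boundary that is needed is an
  inequality: on almost every line parallel to an axis the sum over the boundary points is controlled
  by the surface integral. This bounds \<open>\<bar>\<integral>\<^sub>\<Omega> \<partial>\<^sub>i \<phi>\<bar>\<close> and yields the Ladyzhenskaya inequality, for any bounded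
  open set.\<close>

section \<open>Evolution equations in Hilbert spaces\<close>

text \<open>The H2 norm contains the Laplacian in place of the Hessian, so all estimates rest on
  \<open>u\<close>, its gradient and its Laplacian in L2. The obstacle is the quadratic term: the
  divergence of the flux is -(1 + u) times the sum of the partial derivatives, and its quadratic
  part, a product of an L4 and an L2 function, need not be square integrable. It is tested as (sum
  of partials, \<open>u * w\<close>), with \<open>u * w\<close> in L2 because both factors are in
  L4; hence the L4 bound. Integration by parts is carried out on smooth approximants, with an error
  controlled by their boundary integrals, and then passes to the limit in L2 and L4. The time
  derivative of a weak solution is only known to lie in H2, not in H20; the equation sees it through
  pairings with elements of H20, and these determine the evolution because the solution itself stays
  in the closed subspace. The vector field is merely locally Lipschitz: a radial cutoff makes it
  globally Lipschitz, and the energy estimate shows that the cutoff is never active.\<close>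

lemma riesz_closed_subspace:
  fixes V :: "'h::{real_inner,banach} set" and \<phi> :: "'h \<Rightarrow> real"
  assumes V: "subspace V" "closed V"
    and add: "\<And>v w. v \<in> V \<Longrightarrow> w \<in> V \<Longrightarrow> \<phi> (v + w) = \<phi> v + \<phi> w"
    and scale: "\<And>r w. w \<in> V \<Longrightarrow> \<phi> (r *\<^sub>R w) = r * \<phi> w"
    and bound: "\<And>w. w \<in> V \<Longrightarrow> \<bar>\<phi> w\<bar> \<le> B * norm w"
  shows "\<exists>v\<in>V. \<forall>w\<in>V. inner v w = \<phi> w"
proof -
  \<comment> \<open>Riesz by minimisation: the Euler equation of a minimiser \<open>v\<close> of
    \<open>J\<close> on \<open>V\<close> is (v, w) = \<phi> w.\<close>
  define J where "J v = (norm v)\<^sup>2 / 2 - \<phi> v" for v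
  have lower: "- (B\<^sup>2 / 2) \<le> J v" if "v \<in> V" for v
  proof -
    have "0 \<le> (norm v - B)\<^sup>2" by simp
    then have "B * norm v \<le> (norm v)\<^sup>2 / 2 + B\<^sup>2 / 2" by (simp add: power2_diff algebra_simps)
    then show ?thesis using bound[OF that] by (simp add: J_def)
  qed
  have V0: "0 \<in> V" using V(1) by (rule subspace_0)
  define m where "m = Inf (J ` V)"
  have bdd: "bdd_below (J ` V)" using lower by (auto intro!: bdd_belowI2)
  have m_le: "m \<le> J v" if "v \<in> V" for v
    unfolding m_def by (rule cInf_lower[OF imageI[OF that] bdd])
  have "\<exists>v\<in>V. J v < m + 1 / Suc k" for k
  proof -
    have "Inf (J ` V) < m + 1 / Suc k" by (simp add: m_def)
    then show ?thesis using cInf_less_iff[OF _ bdd] V0 by auto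
  qed
  then obtain X where X: "\<And>k. X k \<in> V" and JX: "\<And>k. J (X k) < m + 1 / Suc k" by metis
  \<comment> \<open>Parallelogram identity: the midpoint of two almost minimisers lies in
    \<open>V\<close> and has energy at least \<open>m\<close>, which forces the two to be
    close.\<close>
  have diff: "(norm (X k - X l))\<^sup>2 \<le> 4 * (1 / Suc k + 1 / Suc l)" for k l
  proof -
    have in_V: "(1/2) *\<^sub>R (X k + X l) \<in> V"
      using V(1) X by (intro subspace_scale subspace_add)
    have "\<phi> ((1/2) *\<^sub>R (X k + X l)) = (\<phi> (X k) + \<phi> (X l)) / 2"
      using scale[of "X k + X l"] add X V(1) by (simp add: subspace_add)
    then have "(norm (X k - X l))\<^sup>2 = 4 * (J (X k) + J (X l) - 2 * J ((1/2) *\<^sub>R (X k + X l)))"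
      by (simp add: J_def power2_norm_eq_inner inner_diff_left inner_diff_right inner_add_left
          inner_add_right inner_commute field_simps)
    also have "\<dots> \<le> 4 * (1 / Suc k + 1 / Suc l)"
      using JX[of k] JX[of l] m_le[OF in_V] by simp
    finally show ?thesis .
  qed
  have "Cauchy X"
  proof (rule metric_CauchyI)
    fix e :: real assume e: "0 < e"
    obtain M where M: "1 / Suc M < e\<^sup>2 / 8"
      using nat_approx_posE[of "e\<^sup>2 / 8"] e by auto
    have "dist (X k) (X l) < e" if "M \<le> k" "M \<le> l" for k l
    proof -
      have "1 / real (Suc k) \<le> 1 / Suc M" "1 / real (Suc l) \<le> 1 / Suc M"
        using that by (auto intro!: divide_left_mono)
      then have "(norm (X k - X l))\<^sup>2 < e\<^sup>2" using diff[of k l] M by simp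
      then show ?thesis using e by (simp add: dist_norm power2_less_imp_less)
    qed
    then show "\<exists>M. \<forall>m\<ge>M. \<forall>n\<ge>M. dist (X m) (X n) < e" by blast
  qed
  then obtain v where v: "X \<longlonglongrightarrow> v" using Cauchy_convergent convergent_def by blast
  have "v \<in> V" using closed_sequentially[OF V(2)] X v by blast
  moreover have "inner v w = \<phi> w" if w: "w \<in> V" for w
  proof -
    define a where "a k = inner (X k) w - \<phi> w" for k
    define q where "q = (norm w)\<^sup>2"
    have "(a k)\<^sup>2 \<le> 2 * (q + 1) * (1 / Suc k)" for k
    proof -
      \<comment> \<open>Almost the optimal step along \<open>w\<close>; \<open>q + 1\<close> in
        place of \<open>q\<close> avoids a division by zero for w = 0. It bounds the defect of the
        Euler equation at \<open>X k\<close> by a quantity that tends to 0, so that only inner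
        products have to pass to the limit.\<close>
      define s where "s = - a k / (q + 1)"
      have q1: "0 < q + 1" "0 \<le> q" by (auto simp: q_def add_nonneg_pos)
      have "m \<le> J (X k + s *\<^sub>R w)"
        using V(1) X w by (intro m_le subspace_add subspace_scale)
      also have "J (X k + s *\<^sub>R w) = J (X k) + (s * a k + s\<^sup>2 * q / 2)"
        using add[OF X subspace_scale[OF V(1) w]] scale[OF w]
        unfolding J_def a_def q_def power2_norm_eq_inner
        by (simp add: inner_add_left inner_add_right inner_commute power2_eq_square algebra_simps)
      finally have "- (1 / Suc k) \<le> s * a k + s\<^sup>2 * q / 2" using JX[of k] by simp
      also have "\<dots> \<le> s * a k + s\<^sup>2 * (q + 1) / 2" by (simp add: mult_left_mono)
      also have "\<dots> = - ((a k)\<^sup>2 / (2 * (q + 1)))"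
      proof -
        have ak: "a k = - s * (q + 1)" using q1 by (simp add: s_def)
        have "(a k)\<^sup>2 / (2 * (q + 1)) = s\<^sup>2 * (q + 1) / 2"
          unfolding ak power_mult_distrib power2_eq_square[of "q + 1"]
          using q1 nonzero_mult_divide_mult_cancel_right[of "q + 1" "s\<^sup>2 * (q + 1)" 2]
          by (simp add: mult_ac)
        then show ?thesis by (simp add: ak power2_eq_square)
      qed
      finally have "(a k)\<^sup>2 / (2 * (q + 1)) \<le> 1 / Suc k" by simp
      then show ?thesis using q1 by (simp add: field_simps)
    qed
    moreover have "(\<lambda>k. 2 * (q + 1) * (1 / Suc k)) \<longlonglongrightarrow> 2 * (q + 1) * 0"
      using LIMSEQ_inverse_real_of_nat by (intro tendsto_mult tendsto_const) (simp add: inverse_eq_divide)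
    moreover have "(\<lambda>k. (a k)\<^sup>2) \<longlonglongrightarrow> (inner v w - \<phi> w)\<^sup>2"
      unfolding a_def by (intro tendsto_intros v)
    ultimately have "(inner v w - \<phi> w)\<^sup>2 \<le> 2 * (q + 1) * 0"
      by (intro LIMSEQ_le) auto
    then show ?thesis by simp
  qed
  ultimately show ?thesis by blast
qed

text \<open>Let \<open>p\<close> be the orthogonal projection of the integral onto \<open>V\<close>,
  obtained from Riesz. The remainder is orthogonal to all values of \<open>f\<close>, hence to their
  integral, and it is orthogonal to \<open>p\<close>; so it vanishes.\<close>

lemma integral_in_closed_subspace:
  fixes f :: "real \<Rightarrow> 'h::{real_inner,banach}"
  assumes V: "subspace V" "closed V"
    and f: "f integrable_on S" "\<And>t. t \<in> S \<Longrightarrow> f t \<in> V"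
  shows "integral S f \<in> V"
proof -
  let ?x = "integral S f"
  obtain p where p: "p \<in> V" "\<And>w. w \<in> V \<Longrightarrow> inner p w = inner ?x w"
    using riesz_closed_subspace[OF V, of "inner ?x" "norm ?x"]
    by (auto simp: inner_add_right Cauchy_Schwarz_ineq2)
  have "inner (?x - p) ?x = integral S (\<lambda>t. inner (?x - p) (f t))"
    using integral_linear[OF f(1) bounded_linear_inner_right[of "?x - p"]] by (simp add: o_def)
  also have "\<dots> = integral S (\<lambda>t. 0)"
    using p(2) f(2) by (intro integral_cong) (simp add: inner_diff_left)
  finally have "inner (?x - p) ?x = 0" by simp
  moreover have "inner (?x - p) p = 0" using p by (simp add: inner_diff_left)
  ultimately have "inner (?x - p) (?x - p) = 0" by (simp add: inner_diff_right)
  then show ?thesis using p(1) by simp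
qed

text \<open>One unit of the constant 2 comes from the change of the vector, the other from the
  change of the scaling factor.\<close>

lemma radial_cutoff_lipschitz:
  fixes u v :: "'a::real_normed_vector"
  assumes "0 < R"
  shows "norm ((R / max R (norm u)) *\<^sub>R u - (R / max R (norm v)) *\<^sub>R v) \<le> 2 * norm (u - v)"
proof -
  define a where "a = max R (norm u)"
  define b where "b = max R (norm v)"
  have ab: "0 < a" "0 < b" "R \<le> a" "R \<le> b" "norm v \<le> b"
    using assms by (auto simp: a_def b_def)
  have "(R / a) *\<^sub>R u - (R / b) *\<^sub>R v = (R / a) *\<^sub>R (u - v) + (R / a - R / b) *\<^sub>R v"
    by (simp add: algebra_simps)
  then have "norm ((R / a) *\<^sub>R u - (R / b) *\<^sub>R v) \<le> R / a * norm (u - v) + \<bar>R / a - R / b\<bar> * norm v"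
    using norm_triangle_ineq[of "(R / a) *\<^sub>R (u - v)" "(R / a - R / b) *\<^sub>R v"] assms ab by simp
  also have "R / a * norm (u - v) \<le> 1 * norm (u - v)"
    using assms ab by (intro mult_right_mono) auto
  also have "\<bar>R / a - R / b\<bar> * norm v \<le> \<bar>R / a - R / b\<bar> * b"
    using ab by (intro mult_left_mono) auto
  also have "\<bar>R / a - R / b\<bar> * b = R / a * \<bar>b - a\<bar>"
  proof -
    have "R / a - R / b = R * (b - a) / (a * b)" using ab by (simp add: field_simps)
    then show ?thesis using ab assms by (simp add: abs_mult abs_divide)
  qed
  also have "\<dots> \<le> 1 * \<bar>b - a\<bar>" using assms ab by (intro mult_right_mono) auto
  also have "\<bar>b - a\<bar> \<le> norm (u - v)"
    using norm_triangle_ineq3[of u v] by (simp add: a_def b_def)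
  finally show ?thesis by (simp add: a_def b_def)
qed

text \<open>Picard's fixed point on all of [0, T] at once, with Bielecki's weight: the unknown is
  exp(-K t) U(t), and the weight turns the integral operator into a contraction. The values stay in
  \<open>V\<close> because a closed subspace contains the integrals of its elements.\<close>

lemma lipschitz_ode_exists:
  fixes V :: "'h::{real_inner,banach} set" and F :: "'h \<Rightarrow> 'h"
  assumes V: "subspace V" "closed V"
    and FV: "\<And>u. u \<in> V \<Longrightarrow> F u \<in> V"
    and lip: "\<And>u v. u \<in> V \<Longrightarrow> v \<in> V \<Longrightarrow> norm (F u - F v) \<le> L * norm (u - v)"
    and L: "0 \<le> L" and u0: "u0 \<in> V" and T: "0 < T"
  shows "\<exists>U. U 0 = u0 \<and> continuous_on {0..T} U \<and> (\<forall>t\<in>{0..T}. U t \<in> V \<and>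
            (U has_vector_derivative F (U t)) (at t within {0..T}))"
proof -
  \<comment> \<open>The contraction factor is L / K. This choice keeps it at most 1/2, and keeps
    \<open>K\<close> positive when L = 0.\<close>
  define K where "K = 2 * L + 1"
  have K: "0 < K" "L / K \<le> 1/2" using L by (auto simp: K_def field_simps)
  \<comment> \<open>The elements of the complete space are functions on the whole line, so time is
    clamped to [0, T].\<close>
  define cl where "cl t = max 0 (min T t)" for t :: real
  have cl: "cl t \<in> {0..T}" "continuous_on A cl" "t \<in> {0..T} \<Longrightarrow> cl t = t" for t A
    using T by (auto simp: cl_def intro!: continuous_intros)
  have Fc: "continuous_on V F"
    by (rule lipschitz_on_continuous_on[of L]) (use lip L in \<open>auto simp: lipschitz_on_def dist_norm\<close>)
  define S where "S = (PiC UNIV (\<lambda>_. V) :: (real \<Rightarrow>\<^sub>C 'h) set)"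
  have S_iff: "g \<in> S \<longleftrightarrow> (\<forall>t. g t \<in> V)" for g by (auto simp: S_def mem_PiC_iff)
  define G where "G g s = F (exp (K * s) *\<^sub>R apply_bcontfun g s)" for g s
  have arg: "exp (K * s) *\<^sub>R apply_bcontfun g s \<in> V" if "g \<in> S" for g s
    using that V(1) by (simp add: S_iff subspace_scale)
  have GV: "G g s \<in> V" if "g \<in> S" for g s
    unfolding G_def by (rule FV[OF arg[OF that]])
  have Gc: "continuous_on A (G g)" if "g \<in> S" for g A
    unfolding G_def
    by (rule continuous_on_compose2[OF Fc, of A "\<lambda>s. exp (K * s) *\<^sub>R apply_bcontfun g s"])
       (use arg[OF that] in \<open>auto intro!: continuous_intros\<close>)
  have Gi: "G g integrable_on {a..b}" if "g \<in> S" for g a b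
    by (rule integrable_continuous_real[OF Gc[OF that]])
  define P where "P g t = exp (- K * t) *\<^sub>R (u0 + integral {0..t} (G g))" for g t
  have Pc: "continuous_on {0..T} (P g)" if "g \<in> S" for g
    unfolding P_def by (intro continuous_intros indefinite_integral_continuous_1 Gi that)
  have PV: "P g t \<in> V" if "g \<in> S" for g t
    unfolding P_def
    by (intro subspace_scale subspace_add V u0 integral_in_closed_subspace Gi that GV)
  define \<Phi> where "\<Phi> g = Bcontfun (\<lambda>t. P g (cl t))" for g
  have mem: "(\<lambda>t. P g (cl t)) \<in> bcontfun" if "g \<in> S" for g
  proof -
    have "continuous_on UNIV (\<lambda>t. P g (cl t))"
      by (rule continuous_on_compose2[OF Pc[OF that]]) (use cl in auto)
    moreover have "bounded (P g ` {0..T})"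
      by (intro compact_imp_bounded compact_continuous_image Pc that) auto
    then have "bounded (range (\<lambda>t. P g (cl t)))" by (rule bounded_subset) (use cl in auto)
    ultimately show ?thesis by (simp add: bcontfun_def)
  qed
  have \<Phi>: "apply_bcontfun (\<Phi> g) t = P g (cl t)" if "g \<in> S" for g t
    unfolding \<Phi>_def by (simp add: Bcontfun_inverse[OF mem[OF that]])
  have "\<exists>!g\<in>S. \<Phi> g = g"
  proof (rule Banach_fix)
    have "closed S" unfolding S_def by (rule closed_PiC) (use V in auto)
    then show "complete S" by (rule complete_closed_subset[OF _ subset_UNIV complete_UNIV])
    show "S \<noteq> {}" using subspace_0[OF V(1)] S_iff[of 0] by auto
    show "\<Phi> ` S \<subseteq> S" by (auto simp: S_iff[of "\<Phi> _"] \<Phi> PV)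
    fix g h assume gh: "g \<in> S" "h \<in> S"
    show "dist (\<Phi> g) (\<Phi> h) \<le> 1/2 * dist g h"
    proof (rule dist_bound)
      fix t0
      define t where "t = cl t0"
      have t: "0 \<le> t" "t \<le> T" using cl(1)[of t0] by (auto simp: t_def)
      have "P g t - P h t = exp (- K * t) *\<^sub>R integral {0..t} (\<lambda>s. G g s - G h s)"
        by (simp add: P_def scaleR_diff_right[symmetric] integral_diff[OF Gi Gi] gh)
      also have "norm \<dots> \<le> exp (- K * t) * integral {0..t} (\<lambda>s. L * dist g h * exp (K * s))"
      proof -
        have "norm (integral {0..t} (\<lambda>s. G g s - G h s)) \<le> integral {0..t} (\<lambda>s. L * dist g h * exp (K * s))"
        proof (rule integral_norm_bound_integral)
          show "(\<lambda>s. G g s - G h s) integrable_on {0..t}" by (intro integrable_diff Gi gh)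
          show "(\<lambda>s. L * dist g h * exp (K * s)) integrable_on {0..t}"
            by (intro integrable_continuous_real continuous_intros)
          fix s assume "s \<in> {0..t}"
          have "norm (G g s - G h s) \<le> L * norm (exp (K * s) *\<^sub>R apply_bcontfun g s - exp (K * s) *\<^sub>R apply_bcontfun h s)"
            unfolding G_def by (rule lip) (use arg gh in auto)
          also have "\<dots> = L * (exp (K * s) * dist (apply_bcontfun g s) (apply_bcontfun h s))"
            by (simp add: scaleR_diff_right[symmetric] dist_norm)
          also have "\<dots> \<le> L * (exp (K * s) * dist g h)"
            using L by (intro mult_left_mono dist_bounded) auto
          finally show "norm (G g s - G h s) \<le> L * dist g h * exp (K * s)" by (simp add: mult_ac)
        qed
        then show ?thesis by simp
      qed
      also have "integral {0..t} (\<lambda>s. L * dist g h * exp (K * s)) = L * dist g h * ((exp (K * t) - 1) / K)"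
      proof -
        have "((\<lambda>s. L * dist g h * exp (K * s)) has_integral
            (L * dist g h * (exp (K * t) / K) - L * dist g h * (exp (K * 0) / K))) {0..t}"
          using K t by (intro fundamental_theorem_of_calculus)
            (auto intro!: derivative_eq_intros simp: has_real_derivative_iff_has_vector_derivative[symmetric])
        from integral_unique[OF this] show ?thesis by (simp add: right_diff_distrib diff_divide_distrib)
      qed
      also have "exp (- K * t) * \<dots> = (L / K) * dist g h * (1 - exp (- K * t))"
        using K by (simp add: field_simps exp_minus)
      also have "\<dots> \<le> (L / K) * dist g h * 1"
        using L K by (intro mult_left_mono) auto
      also have "\<dots> \<le> 1/2 * dist g h" using mult_right_mono[OF K(2) zero_le_dist[of g h]] by simp
      finally show "dist (apply_bcontfun (\<Phi> g) t0) (apply_bcontfun (\<Phi> h) t0) \<le> 1/2 * dist g h"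
        using \<Phi>[OF gh(1)] \<Phi>[OF gh(2)] by (simp add: dist_norm t_def)
    qed
  qed auto
  then obtain g where g: "g \<in> S" "\<Phi> g = g" by blast
  define U where "U t = exp (K * t) *\<^sub>R apply_bcontfun g t" for t
  have gP: "apply_bcontfun g t = P g t" if "t \<in> {0..T}" for t
    using \<Phi>[OF g(1), of t] g(2) cl(3)[OF that] by simp
  have U: "U t = u0 + integral {0..t} (\<lambda>s. F (U s))" if "t \<in> {0..T}" for t
    using gP[OF that] by (simp add: U_def[abs_def] P_def G_def[abs_def] exp_minus)
  have FU: "(\<lambda>s. F (U s)) = G g" by (simp add: G_def U_def fun_eq_iff)
  have "(U has_vector_derivative F (U t)) (at t within {0..T})" if t: "t \<in> {0..T}" for t
  proof -
    have "((\<lambda>t. u0 + integral {0..t} (\<lambda>s. F (U s))) has_vector_derivative 0 + F (U t)) (at t within {0..T})"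
      unfolding FU by (intro has_vector_derivative_add has_vector_derivative_const)
        (use integral_has_vector_derivative[OF Gc[OF g(1)] t] in \<open>simp add: FU[THEN fun_cong]\<close>)
    from has_vector_derivative_transform[OF t U this] show ?thesis by simp
  qed
  moreover have "U t \<in> V" for t unfolding U_def by (rule arg[OF g(1)])
  moreover have "U 0 = u0" using U[of 0] T by simp
  moreover have "continuous_on {0..T} U" unfolding U_def by (intro continuous_intros) auto
  ultimately show ?thesis by blast
qed

lemma DERIV_within_nonpos_imp_nonincreasing:
  fixes f :: "real \<Rightarrow> real"
  assumes "a \<le> b"
    and f: "\<And>x. a \<le> x \<Longrightarrow> x \<le> b \<Longrightarrow> \<exists>y. (f has_real_derivative y) (at x within {a..b}) \<and> y \<le> 0"
  shows "f b \<le> f a"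
proof (rule DERIV_nonpos_imp_decreasing_open[OF \<open>a \<le> b\<close>])
  show "\<exists>y. DERIV f x :> y \<and> y \<le> 0" if "a < x" "x < b" for x
    using f[of x] that at_within_Icc_at[OF that] by auto
  show "continuous_on {a..b} f"
    unfolding continuous_on_eq_continuous_within using f by (meson DERIV_continuous atLeastAtMost_iff)
qed

text \<open>Riesz turns the form into a vector field \<open>F\<close> on \<open>V\<close> that is
  Lipschitz on balls; composed with the radial cutoff it is Lipschitz globally. The cutoff rescales
  its argument by a positive factor, so the sign of l(u, u) still makes the norm of the solution
  nonincreasing, and the solution stays where the cutoff is the identity.\<close>

lemma energy_ode_exists:
  fixes V :: "'h::{real_inner,banach} set" and l :: "'h \<Rightarrow> 'h \<Rightarrow> real"
  assumes V: "subspace V" "closed V"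
    and add: "\<And>u v w. u \<in> V \<Longrightarrow> v \<in> V \<Longrightarrow> w \<in> V \<Longrightarrow> l u (v + w) = l u v + l u w"
    and scale: "\<And>u r w. u \<in> V \<Longrightarrow> w \<in> V \<Longrightarrow> l u (r *\<^sub>R w) = r * l u w"
    and zero: "\<And>w. w \<in> V \<Longrightarrow> l 0 w = 0"
    and lip: "\<And>u v w. u \<in> V \<Longrightarrow> v \<in> V \<Longrightarrow> w \<in> V \<Longrightarrow>
       \<bar>l u w - l v w\<bar> \<le> C * (1 + norm u + norm v) * norm (u - v) * norm w"
    and C: "0 \<le> C"
    and dissipative: "\<And>u. u \<in> V \<Longrightarrow> l u u \<le> 0"
    and u0: "u0 \<in> V" and T: "0 < T"
  shows "\<exists>U U'. U 0 = u0 \<and> continuous_on {0..T} U' \<and> (\<forall>t\<in>{0..T}. U t \<in> V \<and> U' t \<in> V \<and>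
            (U has_vector_derivative U' t) (at t within {0..T}) \<and> (\<forall>w\<in>V. inner (U' t) w = l (U t) w))"
proof -
  have V0: "0 \<in> V" using V(1) by (rule subspace_0)
  have "\<exists>F\<in>V. \<forall>w\<in>V. inner F w = l u w" if "u \<in> V" for u
  proof (rule riesz_closed_subspace[OF V])
    show "\<bar>l u w\<bar> \<le> C * (1 + norm u) * norm u * norm w" if "w \<in> V" for w
      using lip[OF \<open>u \<in> V\<close> V0 that] zero[OF that] by simp
  qed (use add scale that in auto)
  then obtain F where FV: "\<And>u. u \<in> V \<Longrightarrow> F u \<in> V"
    and F: "\<And>u w. u \<in> V \<Longrightarrow> w \<in> V \<Longrightarrow> inner (F u) w = l u w" by metis
  have F_lip: "norm (F u - F v) \<le> C * (1 + norm u + norm v) * norm (u - v)"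
    if "u \<in> V" "v \<in> V" for u v
  proof (cases "F u = F v")
    case False
    have d: "F u - F v \<in> V" using FV that V(1) by (simp add: subspace_diff)
    have "(norm (F u - F v))\<^sup>2 = l u (F u - F v) - l v (F u - F v)"
      unfolding power2_norm_eq_inner using F[OF that(1) d] F[OF that(2) d] by (simp add: inner_diff_left)
    also have "\<dots> \<le> C * (1 + norm u + norm v) * norm (u - v) * norm (F u - F v)"
      using lip[OF that d] by simp
    finally show ?thesis using False by (simp add: power2_eq_square)
  qed (use C in simp)
  \<comment> \<open>The norm of the solution never exceeds that of \<open>u0\<close>; the added 1
    makes the radius positive also for u0 = 0.\<close>
  define R where "R = norm u0 + 1"
  have R: "0 < R" by (simp add: R_def add_nonneg_pos)
  define \<rho> where "\<rho> u = (R / max R (norm u)) *\<^sub>R u" for u :: 'h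
  have \<rho>V: "\<rho> u \<in> V" if "u \<in> V" for u using that V(1) by (simp add: \<rho>_def subspace_scale)
  have \<rho>R: "norm (\<rho> u) \<le> R" for u
    using R by (simp add: \<rho>_def field_simps max_def)
  have \<rho>_lip: "norm (\<rho> u - \<rho> v) \<le> 2 * norm (u - v)" for u v
    unfolding \<rho>_def by (rule radial_cutoff_lipschitz[OF R])
  have "\<exists>U. U 0 = u0 \<and> continuous_on {0..T} U \<and> (\<forall>t\<in>{0..T}. U t \<in> V \<and>
            (U has_vector_derivative F (\<rho> (U t))) (at t within {0..T}))"
  proof (rule lipschitz_ode_exists[OF V])
    fix u v assume uv: "u \<in> V" "v \<in> V"
    show "F (\<rho> u) \<in> V" by (intro FV \<rho>V uv)
    have "norm (F (\<rho> u) - F (\<rho> v)) \<le> C * (1 + norm (\<rho> u) + norm (\<rho> v)) * norm (\<rho> u - \<rho> v)"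
      by (intro F_lip \<rho>V uv)
    also have "\<dots> \<le> C * (1 + R + R) * (2 * norm (u - v))"
      using C R by (intro mult_mono mult_left_mono add_mono \<rho>R \<rho>_lip) auto
    finally show "norm (F (\<rho> u) - F (\<rho> v)) \<le> (2 * C * (1 + 2 * R)) * norm (u - v)"
      by (simp add: algebra_simps)
  qed (use C R u0 T in auto)
  then obtain U where U: "U 0 = u0" "continuous_on {0..T} U" "\<And>t. t \<in> {0..T} \<Longrightarrow> U t \<in> V"
    and U': "\<And>t. t \<in> {0..T} \<Longrightarrow> (U has_vector_derivative F (\<rho> (U t))) (at t within {0..T})" by blast
  \<comment> \<open>The cutoff multiplies \<open>u\<close> by a positive \<open>c\<close>, so this
    has the sign of l(\<rho> u, \<rho> u).\<close>
  have decay: "inner (F (\<rho> u)) u \<le> 0" if "u \<in> V" for u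
  proof -
    define c where "c = R / max R (norm u)"
    have c: "0 < c" using R by (simp add: c_def less_max_iff_disj)
    have "c * inner (F (\<rho> u)) u = inner (F (\<rho> u)) (\<rho> u)" by (simp add: \<rho>_def c_def)
    also have "\<dots> \<le> 0" using F[OF \<rho>V[OF that] \<rho>V[OF that]] dissipative[OF \<rho>V[OF that]] by simp
    finally show ?thesis using c by (simp add: mult_le_0_iff)
  qed
  have bound: "norm (U t) \<le> R" if t: "t \<in> {0..T}" for t
  proof -
    have "((\<lambda>t. inner (U t) (U t)) has_real_derivative 2 * inner (F (\<rho> (U s))) (U s)) (at s within {0..T})"
      if "s \<in> {0..T}" for s
      unfolding has_real_derivative_iff_has_vector_derivative
      by (rule bounded_bilinear.has_vector_derivative[OF bounded_bilinear_inner U'[OF that] U'[OF that], THEN has_vector_derivative_eq_rhs])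
        (simp add: inner_commute)
    then have "((\<lambda>t. inner (U t) (U t)) has_real_derivative 2 * inner (F (\<rho> (U s))) (U s)) (at s within {0..t})"
        "2 * inner (F (\<rho> (U s))) (U s) \<le> 0" if "0 \<le> s" "s \<le> t" for s
      using t that decay[OF U(3)[of s]] by (auto intro: DERIV_subset[of _ _ s "{0..T}"])
    then have "inner (U t) (U t) \<le> inner (U 0) (U 0)"
      using t by (intro DERIV_within_nonpos_imp_nonincreasing[of 0 t "\<lambda>t. inner (U t) (U t)"]) (simp, blast)
    then have "(norm (U t))\<^sup>2 \<le> (norm u0)\<^sup>2" by (simp add: U(1) power2_norm_eq_inner)
    then have "norm (U t) \<le> norm u0" by (rule power2_le_imp_le) simp
    then show ?thesis by (simp add: R_def)
  qed
  have \<rho>U: "\<rho> (U t) = U t" if "t \<in> {0..T}" for t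
    using bound[OF that] R by (simp add: \<rho>_def max_def)
  have "continuous_on V F"
  proof -
    have "(F \<longlongrightarrow> F u) (at u within V)" if u: "u \<in> V" for u
    proof (rule Lim_null[THEN iffD2], rule Lim_null_comparison)
      show "\<forall>\<^sub>F v in at u within V. norm (F v - F u) \<le> C * (1 + norm v + norm u) * norm (v - u)"
        using F_lip u by (auto simp: eventually_at_filter)
      show "((\<lambda>v. C * (1 + norm v + norm u) * norm (v - u)) \<longlongrightarrow> 0) (at u within V)"
        by (auto intro!: tendsto_eq_intros)
    qed
    then show ?thesis by (simp add: continuous_on_def)
  qed
  then have "continuous_on {0..T} (\<lambda>t. F (U t))"
    by (rule continuous_on_compose2[OF _ U(2)]) (use U(3) in auto)
  moreover have "\<forall>t\<in>{0..T}. U t \<in> V \<and> F (U t) \<in> V \<and>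
            (U has_vector_derivative F (U t)) (at t within {0..T}) \<and> (\<forall>w\<in>V. inner (F (U t)) w = l (U t) w)"
    using U' \<rho>U U(3) FV F by auto
  ultimately show ?thesis using U(1) by blast
qed

text \<open>With I(t) the integral of \<phi> up to t, exp(-K t) I(t) has derivative exp(-K t)
  (\<phi> t - K I(t)), which is nonpositive. As I(0) = 0, this gives I(t) \<le> 0.\<close>

lemma gronwall_zero:
  fixes \<phi> :: "real \<Rightarrow> real"
  assumes \<phi>: "continuous_on {0..T} \<phi>" "\<And>t. t \<in> {0..T} \<Longrightarrow> 0 \<le> \<phi> t"
    and le: "\<And>t. t \<in> {0..T} \<Longrightarrow> \<phi> t \<le> K * integral {0..t} \<phi>" and K: "0 \<le> K"
    and t: "t \<in> {0..T}"
  shows "\<phi> t = 0"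
proof -
  define I where "I t = integral {0..t} \<phi>" for t
  have I': "(I has_real_derivative \<phi> s) (at s within {0..T})" if "s \<in> {0..T}" for s
    unfolding I_def has_real_derivative_iff_has_vector_derivative
    by (rule integral_has_vector_derivative[OF \<phi>(1) that])
  have "exp (- K * t) * I t \<le> exp (- K * 0) * I 0"
  proof (rule DERIV_within_nonpos_imp_nonincreasing[of 0 t "\<lambda>s. exp (- K * s) * I s"])
    fix s assume s: "0 \<le> s" "s \<le> t"
    have "((\<lambda>s. exp (- K * s) * I s) has_real_derivative exp (- K * s) * (\<phi> s - K * I s)) (at s within {0..t})"
      by (rule derivative_eq_intros DERIV_subset[OF I'] refl | use s t in \<open>simp add: algebra_simps\<close>)+
    then show "\<exists>y. ((\<lambda>s. exp (- K * s) * I s) has_real_derivative y) (at s within {0..t}) \<and> y \<le> 0"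
      using le[of s] s t by (intro exI conjI) (auto simp: I_def mult_le_0_iff)
  qed (use t in auto)
  then have "I t \<le> 0" by (simp add: I_def mult_le_0_iff)
  then have "\<phi> t \<le> 0" using le[OF t] K mult_nonneg_nonpos[of K "I t"] by (simp add: I_def)
  then show ?thesis using \<phi>(2)[OF t] by simp
qed

section \<open>The Hilbert space of square integrable functions\<close>

lemma L2_measurable: "f \<in> L2 \<Omega> \<Longrightarrow> f \<in> borel_measurable (lebesgue_on \<Omega>)"
  and L2_integrable: "f \<in> L2 \<Omega> \<Longrightarrow> integrable (lebesgue_on \<Omega>) (\<lambda>x. (norm (f x))\<^sup>2)"
  by (auto simp: L2_def)

lemma L2_add: "f \<in> L2 \<Omega> \<Longrightarrow> g \<in> L2 \<Omega> \<Longrightarrow> (\<lambda>x. f x + g x) \<in> L2 \<Omega>"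
proof -
  assume f: "f \<in> L2 \<Omega>" and g: "g \<in> L2 \<Omega>"
  have "(norm (f x + g x))\<^sup>2 \<le> 2 * (norm (f x))\<^sup>2 + 2 * (norm (g x))\<^sup>2" for x
    using norm_triangle_ineq[of "f x" "g x"] sum_squares_bound[of "norm (f x)" "norm (g x)"]
      power_mono[of "norm (f x + g x)" "norm (f x) + norm (g x)" 2]
    by (simp add: power2_sum)
  then have "integrable (lebesgue_on \<Omega>) (\<lambda>x. (norm (f x + g x))\<^sup>2)"
    using L2_measurable[OF f] L2_measurable[OF g]
    by (intro Bochner_Integration.integrable_bound[OF Bochner_Integration.integrable_add[OF
          integrable_mult_right[OF L2_integrable[OF f], of 2] integrable_mult_right[OF L2_integrable[OF g], of 2]]])
      auto
  then show ?thesis using f g by (auto simp: L2_def intro: borel_measurable_add)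
qed

lemma L2_scaleR: "f \<in> L2 \<Omega> \<Longrightarrow> (\<lambda>x. c *\<^sub>R f x) \<in> L2 \<Omega>"
  by (auto simp: L2_def power_mult_distrib)

lemma L2_uminus: "f \<in> L2 \<Omega> \<Longrightarrow> (\<lambda>x. - f x) \<in> L2 \<Omega>"
  by (auto simp: L2_def)

lemma L2_diff: "f \<in> L2 \<Omega> \<Longrightarrow> g \<in> L2 \<Omega> \<Longrightarrow> (\<lambda>x. f x - g x) \<in> L2 \<Omega>"
  using L2_add[OF _ L2_uminus, of f \<Omega> g] by simp

lemma L2_zero: "(\<lambda>x. 0) \<in> L2 \<Omega>"
  by (simp add: L2_def)

lemma integrable_inner_L2:
  assumes f: "f \<in> L2 \<Omega>" and g: "g \<in> L2 \<Omega>"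
  shows "integrable (lebesgue_on \<Omega>) (\<lambda>x. f x \<bullet> g x)"
proof (rule Bochner_Integration.integrable_bound[OF Bochner_Integration.integrable_add[OF L2_integrable[OF f] L2_integrable[OF g]]])
  have "norm (a \<bullet> b) \<le> (norm a)\<^sup>2 + (norm b)\<^sup>2" for a b :: 'b
    using Cauchy_Schwarz_ineq2[of a b] sum_squares_bound[of "norm a" "norm b"]
      mult_nonneg_nonneg[OF norm_ge_zero[of a] norm_ge_zero[of b]] by simp
  then show "AE x in lebesgue_on \<Omega>. norm (f x \<bullet> g x) \<le> norm ((norm (f x))\<^sup>2 + (norm (g x))\<^sup>2)"
    by simp
qed (use L2_measurable[OF f] L2_measurable[OF g] in \<open>auto intro: borel_measurable_inner\<close>)

lemma measurable_lebesgue_on_AE: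
  fixes f g :: "'a::euclidean_space \<Rightarrow> 'b::euclidean_space"
  assumes f: "f \<in> borel_measurable (lebesgue_on \<Omega>)" and eq: "AE x in lebesgue_on \<Omega>. f x = g x" and \<Omega>: "\<Omega> \<in> sets lebesgue"
  shows "g \<in> borel_measurable (lebesgue_on \<Omega>)"
proof -
  have "(\<lambda>x. indicator \<Omega> x *\<^sub>R f x) \<in> borel_measurable lebesgue"
    using f \<Omega> by (simp add: borel_measurable_restrict_space_iff)
  moreover have "AE x in lebesgue. indicator \<Omega> x *\<^sub>R f x = indicator \<Omega> x *\<^sub>R g x"
    using eq \<Omega> by (subst (asm) AE_restrict_space_iff) (auto simp: indicator_def elim: eventually_mono)
  ultimately have "(\<lambda>x. indicator \<Omega> x *\<^sub>R g x) \<in> borel_measurable lebesgue"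
    by (rule borel_measurable_AE)
  then show ?thesis using \<Omega> by (simp add: borel_measurable_restrict_space_iff)
qed

lemma L2_cong_AE:
  assumes f: "f \<in> L2 \<Omega>" and eq: "AE x in lebesgue_on \<Omega>. f x = g x" and \<Omega>: "\<Omega> \<in> sets lebesgue"
  shows "g \<in> L2 \<Omega>"
proof -
  have g: "g \<in> borel_measurable (lebesgue_on \<Omega>)"
    by (rule measurable_lebesgue_on_AE[OF L2_measurable[OF f] eq \<Omega>])
  have "integrable (lebesgue_on \<Omega>) (\<lambda>x. (norm (g x))\<^sup>2)"
  proof (rule integrable_cong_AE_imp[OF L2_integrable[OF f]])
    show "AE x in lebesgue_on \<Omega>. (norm (f x))\<^sup>2 = (norm (g x))\<^sup>2" using eq by (rule AE_mp) simp
  qed (use g in auto)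
  then show ?thesis using g by (simp add: L2_def)
qed

lemma L2_indicator_iff:
  assumes \<Omega>: "\<Omega> \<in> sets lebesgue"
  shows "(\<lambda>x. indicator \<Omega> x *\<^sub>R f x) \<in> L2 UNIV \<longleftrightarrow> f \<in> L2 \<Omega>"
proof -
  have "(norm (indicator \<Omega> x *\<^sub>R f x))\<^sup>2 = indicator \<Omega> x *\<^sub>R (norm (f x))\<^sup>2" for x
    by (auto simp: indicator_def)
  then show ?thesis
    using \<Omega> by (simp add: L2_def borel_measurable_restrict_space_iff integrable_restrict_space
        lebesgue_on_UNIV_eq)
qed

text \<open>Equality almost everywhere, restricted to square integrable functions: a partial
  equivalence, whose classes are exactly the elements of L2 of the whole space.\<close>

definition L2_eq :: "('a::euclidean_space \<Rightarrow> 'b::euclidean_space) \<Rightarrow> ('a \<Rightarrow> 'b) \<Rightarrow> bool" where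
  "L2_eq f g \<longleftrightarrow> f \<in> L2 UNIV \<and> g \<in> L2 UNIV \<and> (AE x in lebesgue. f x = g x)"

quotient_type (overloaded) ('a, 'b) l2 = "'a::euclidean_space \<Rightarrow> 'b::euclidean_space" / partial: L2_eq
proof (rule part_equivpI)
  show "\<exists>f :: 'a \<Rightarrow> 'b. L2_eq f f" by (rule exI[of _ "\<lambda>x. 0"]) (simp add: L2_eq_def L2_zero)
  show "symp (L2_eq :: ('a \<Rightarrow> 'b) \<Rightarrow> _)" by (auto simp: symp_def L2_eq_def)
  show "transp (L2_eq :: ('a \<Rightarrow> 'b) \<Rightarrow> _)" by (auto simp: transp_def L2_eq_def)
qed

instantiation l2 :: (euclidean_space, euclidean_space) real_inner
begin

lift_definition zero_l2 :: "('a, 'b) l2" is "\<lambda>x. 0" by (simp add: L2_eq_def L2_zero)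

lift_definition plus_l2 :: "('a, 'b) l2 \<Rightarrow> ('a, 'b) l2 \<Rightarrow> ('a, 'b) l2" is "\<lambda>f g x. f x + g x"
  by (auto simp: L2_eq_def L2_add)

lift_definition minus_l2 :: "('a, 'b) l2 \<Rightarrow> ('a, 'b) l2 \<Rightarrow> ('a, 'b) l2" is "\<lambda>f g x. f x - g x"
  by (auto simp: L2_eq_def L2_diff)

lift_definition uminus_l2 :: "('a, 'b) l2 \<Rightarrow> ('a, 'b) l2" is "\<lambda>f x. - f x"
  by (auto simp: L2_eq_def L2_uminus)

lift_definition scaleR_l2 :: "real \<Rightarrow> ('a, 'b) l2 \<Rightarrow> ('a, 'b) l2" is "\<lambda>c f x. c *\<^sub>R f x"
  by (auto simp: L2_eq_def L2_scaleR)

lift_definition inner_l2 :: "('a, 'b) l2 \<Rightarrow> ('a, 'b) l2 \<Rightarrow> real" is "\<lambda>f g. L2_inner UNIV f g"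
  unfolding L2_eq_def L2_inner_def lebesgue_on_UNIV_eq
  by (intro integral_cong_AE) (auto simp: L2_def lebesgue_on_UNIV_eq)

definition "norm_l2 (f :: ('a, 'b) l2) = sqrt (f \<bullet> f)"
definition "dist_l2 (f :: ('a, 'b) l2) g = norm (f - g)"
definition "sgn_l2 (f :: ('a, 'b) l2) = inverse (norm f) *\<^sub>R f"
definition "uniformity_l2 = (INF e\<in>{0 <..}. principal {(x :: ('a, 'b) l2, y). dist x y < e})"
definition open_l2 :: "('a, 'b) l2 set \<Rightarrow> bool" where
  "open_l2 U \<longleftrightarrow> (\<forall>x\<in>U. \<forall>\<^sub>F (x', y) in uniformity. x' = x \<longrightarrow> y \<in> U)"

instance
proof
  fix f g h :: "('a, 'b) l2" and r s :: real
  show "f + g + h = f + (g + h)" by transfer (auto simp: L2_eq_def L2_add add.assoc)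
  show "f + g = g + f" by transfer (auto simp: L2_eq_def L2_add add.commute)
  show "0 + f = f" by transfer (simp add: L2_eq_def)
  show "- f + f = 0" by transfer (simp add: L2_eq_def L2_zero)
  show "f - g = f + - g" by transfer (auto simp: L2_eq_def L2_diff)
  show "r *\<^sub>R (f + g) = r *\<^sub>R f + r *\<^sub>R g"
    by transfer (auto simp: L2_eq_def scaleR_add_right intro!: L2_add L2_scaleR)
  show "(r + s) *\<^sub>R f = r *\<^sub>R f + s *\<^sub>R f"
    by transfer (auto simp: L2_eq_def scaleR_add_left intro!: L2_add L2_scaleR)
  show "r *\<^sub>R s *\<^sub>R f = (r * s) *\<^sub>R f" by transfer (auto simp: L2_eq_def intro!: L2_scaleR)
  show "1 *\<^sub>R f = f" by transfer (auto simp: L2_eq_def)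
  show "f \<bullet> g = g \<bullet> f" by transfer (simp add: L2_inner_def inner_commute)
  show "(f + g) \<bullet> h = f \<bullet> h + g \<bullet> h"
    by transfer (simp add: L2_inner_def inner_add_left L2_eq_def integrable_inner_L2)
  show "(r *\<^sub>R f) \<bullet> g = r * (f \<bullet> g)" by transfer (simp add: L2_inner_def)
  show "0 \<le> f \<bullet> f" by transfer (simp add: L2_inner_def)
  show "f \<bullet> f = 0 \<longleftrightarrow> f = 0"
  proof transfer
    fix f :: "'a \<Rightarrow> 'b" assume f: "L2_eq f f"
    have "L2_inner UNIV f f = 0 \<longleftrightarrow> (AE x in lebesgue_on UNIV. f x \<bullet> f x = 0)"
      unfolding L2_inner_def using f
      by (intro integral_nonneg_eq_0_iff_AE integrable_inner_L2) (auto simp: L2_eq_def)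
    then show "L2_inner UNIV f f = 0 \<longleftrightarrow> L2_eq f (\<lambda>x. 0)"
      using f unfolding lebesgue_on_UNIV_eq by (simp add: L2_eq_def L2_zero)
  qed
qed (simp_all add: norm_l2_def dist_l2_def sgn_l2_def uniformity_l2_def open_l2_def)

end

lemma rep_l2_exists: "\<exists>f\<in>L2 UNIV. h = abs_l2 f"
  by (metis L2_eq_def Quotient_l2 Quotient_rep_abs Quotient_abs_rep Quotient_rel_rep Quotient_def)

lemma abs_l2_diff: "f \<in> L2 UNIV \<Longrightarrow> g \<in> L2 UNIV \<Longrightarrow> abs_l2 f - abs_l2 g = abs_l2 (\<lambda>x. f x - g x)"
  by (rule minus_l2.abs_eq) (auto simp: L2_eq_def)

lemma norm_abs_l2: "f \<in> L2 UNIV \<Longrightarrow> (norm (abs_l2 f))\<^sup>2 = (\<integral>x. (norm (f x))\<^sup>2 \<partial>lebesgue)"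
  unfolding power2_norm_eq_inner
  by (subst inner_l2.abs_eq) (auto simp: L2_eq_def L2_inner_def lebesgue_on_UNIV_eq power2_norm_eq_inner)

lemma nn_integral_abs_l2:
  "f \<in> L2 UNIV \<Longrightarrow> (\<integral>\<^sup>+x. ennreal ((norm (f x))\<^sup>2) \<partial>lebesgue) = ennreal ((norm (abs_l2 f))\<^sup>2)"
  unfolding norm_abs_l2
  by (intro nn_integral_eq_integral) (auto simp: L2_def lebesgue_on_UNIV_eq)

lemma Cauchy_fast_subseq:
  fixes X :: "nat \<Rightarrow> 'a::metric_space" and e :: "nat \<Rightarrow> real"
  assumes X: "Cauchy X" and e: "\<And>n. 0 < e n"
  shows "\<exists>r. strict_mono r \<and> (\<forall>n. \<forall>m\<ge>n. dist (X (r m)) (X (r n)) < e n)"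
proof -
  have "\<exists>M. \<forall>m\<ge>M. \<forall>k\<ge>M. dist (X m) (X k) < e n" for n
    using X e by (auto simp: Cauchy_def)
  then obtain M where M: "\<And>n m k. M n \<le> m \<Longrightarrow> M n \<le> k \<Longrightarrow> dist (X m) (X k) < e n" by metis
  \<comment> \<open>The partial sums exceed every earlier threshold, and the added \<open>n\<close>
    makes the sequence strictly increasing.\<close>
  define r where "r n = (\<Sum>i\<le>n. M i) + n" for n
  have r: "strict_mono r" by (auto simp: r_def strict_mono_Suc_iff)
  have Mr: "M n \<le> r m" if "n \<le> m" for n m
    using member_le_sum[of n "{..m}" M] that by (auto simp: r_def)
  show ?thesis using r M Mr by (intro exI[of _ r]) auto
qed

text \<open>Riesz-Fischer: a subsequence with quickly decaying steps converges almost everywhere,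
  and Fatou's lemma shows that the pointwise limit is also the limit in the norm.\<close>

instance l2 :: (euclidean_space, euclidean_space) banach
proof
  fix X :: "nat \<Rightarrow> ('a, 'b) l2" assume X: "Cauchy X"
  obtain r where r: "strict_mono r" and fast: "\<And>n m. n \<le> m \<Longrightarrow> dist (X (r m)) (X (r n)) < (1/4) ^ n"
    using Cauchy_fast_subseq[OF X, of "\<lambda>n. (1/4) ^ n"] by auto
  have "\<forall>n. \<exists>f\<in>L2 UNIV. X (r n) = abs_l2 f" using rep_l2_exists by blast
  then obtain f where f: "\<And>n. f n \<in> L2 UNIV" and Xf: "\<And>n. X (r n) = abs_l2 (f n)" by metis
  have [measurable]: "f n \<in> borel_measurable lebesgue" for n
    using f[of n] by (simp add: L2_def lebesgue_on_UNIV_eq)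
  have d: "(\<integral>\<^sup>+x. ennreal ((norm (f m x - f n x))\<^sup>2) \<partial>lebesgue) \<le> ennreal (((1/4) ^ n)\<^sup>2)" if "n \<le> m" for n m
  proof -
    have "norm (abs_l2 (\<lambda>x. f m x - f n x)) \<le> (1/4) ^ n"
      using fast[OF that] by (simp add: Xf abs_l2_diff f dist_norm)
    then show ?thesis
      using nn_integral_abs_l2[OF L2_diff[OF f f], of m n] by (simp add: power_mono)
  qed
  \<comment> \<open>The squared steps have integrals at most 16^-n. With the factor 4^n the
    integrals are still summable, and where the sum is finite it bounds the n-th step by a multiple
    of 2^-n.\<close>
  define s where "s x n = (2 ^ n)\<^sup>2 * (norm (f (Suc n) x - f n x))\<^sup>2" for x n
  have "(\<integral>\<^sup>+x. (\<Sum>n. ennreal (s x n)) \<partial>lebesgue) = (\<Sum>n. \<integral>\<^sup>+x. ennreal (s x n) \<partial>lebesgue)"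
    unfolding s_def by (rule nn_integral_suminf) measurable
  also have "\<dots> \<le> (\<Sum>n. ennreal ((1/4) ^ n))"
  proof (rule suminf_le)
    fix n
    have "(\<integral>\<^sup>+x. ennreal (s x n) \<partial>lebesgue)
        = ennreal ((2 ^ n)\<^sup>2) * (\<integral>\<^sup>+x. ennreal ((norm (f (Suc n) x - f n x))\<^sup>2) \<partial>lebesgue)"
      unfolding s_def by (subst nn_integral_cmult[symmetric]) (auto simp: ennreal_mult)
    also have "\<dots> \<le> ennreal ((2 ^ n)\<^sup>2) * ennreal (((1/4) ^ n)\<^sup>2)"
      by (intro mult_left_mono d) auto
    also have "\<dots> = ennreal ((1/4) ^ n)"
      by (simp add: ennreal_mult[symmetric] power_mult_distrib[symmetric] power2_eq_square)
    finally show "(\<integral>\<^sup>+x. ennreal (s x n) \<partial>lebesgue) \<le> ennreal ((1/4) ^ n)" .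
  qed auto
  also have "\<dots> < \<infinity>"
    by (subst suminf_ennreal2) (auto intro!: summable_geometric)
  finally have fin: "(\<integral>\<^sup>+x. (\<Sum>n. ennreal (s x n)) \<partial>lebesgue) \<noteq> \<infinity>" by simp
  have "AE x in lebesgue. (\<Sum>n. ennreal (s x n)) \<noteq> \<infinity>"
    using fin unfolding s_def by (intro nn_integral_PInf_AE) auto
  then have conv: "AE x in lebesgue. convergent (\<lambda>n. f n x)"
  proof (rule AE_mp, intro AE_I2 impI)
    fix x assume "(\<Sum>n. ennreal (s x n)) \<noteq> \<infinity>"
    then have sm: "summable (s x)"
      by (intro summable_suminf_not_top) (auto simp: s_def)
    define c where "c = suminf (s x)"
    have "norm (f (Suc n) x - f n x) \<le> sqrt c * (1/2) ^ n" for n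
    proof -
      have "s x n \<le> c" unfolding c_def
        using sum_le_suminf[OF sm, of "{n}"] by (auto simp: s_def)
      then have "sqrt (s x n) \<le> sqrt c" by simp
      then show ?thesis by (simp add: s_def real_sqrt_mult field_simps power_one_over)
    qed
    then have "summable (\<lambda>n. f (Suc n) x - f n x)"
      by (intro summable_comparison_test[OF _ summable_mult[OF summable_geometric[of "1/2 :: real"]], of _ "sqrt c"]) auto
    then have "convergent (\<lambda>n. \<Sum>i<n. f (Suc i) x - f i x)" by (simp add: summable_iff_convergent)
    then have "convergent (\<lambda>n. f n x - f 0 x)" unfolding sum_lessThan_telescope[of "\<lambda>i. f i x"] .
    then show "convergent (\<lambda>n. f n x)" using convergent_add[OF _ convergent_const, of "\<lambda>n. f n x - f 0 x" "f 0 x"] by simp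
  qed
  define g where "g x = lim (\<lambda>n. f n x)" for x
  have [measurable]: "g \<in> borel_measurable lebesgue" unfolding g_def by measurable
  have lim: "AE x in lebesgue. (\<lambda>n. f n x) \<longlonglongrightarrow> g x"
    using conv unfolding g_def by (simp add: convergent_LIMSEQ_iff)
  have gd: "(\<integral>\<^sup>+x. ennreal ((norm (g x - f n x))\<^sup>2) \<partial>lebesgue) \<le> ennreal (((1/4) ^ n)\<^sup>2)" for n
  proof -
    have "(\<integral>\<^sup>+x. ennreal ((norm (g x - f n x))\<^sup>2) \<partial>lebesgue)
        = (\<integral>\<^sup>+x. liminf (\<lambda>m. ennreal ((norm (f m x - f n x))\<^sup>2)) \<partial>lebesgue)"
    proof (rule nn_integral_cong_AE, rule AE_mp[OF lim], intro AE_I2 impI)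
      fix x assume "(\<lambda>n. f n x) \<longlonglongrightarrow> g x"
      then have "(\<lambda>m. ennreal ((norm (f m x - f n x))\<^sup>2)) \<longlonglongrightarrow> ennreal ((norm (g x - f n x))\<^sup>2)"
        by (intro tendsto_intros)
      from lim_imp_Liminf[OF _ this] show "ennreal ((norm (g x - f n x))\<^sup>2) = liminf (\<lambda>m. ennreal ((norm (f m x - f n x))\<^sup>2))"
        by simp
    qed
    also have "\<dots> \<le> liminf (\<lambda>m. \<integral>\<^sup>+x. ennreal ((norm (f m x - f n x))\<^sup>2) \<partial>lebesgue)"
      by (rule nn_integral_liminf) measurable
    also have "\<dots> \<le> ennreal (((1/4) ^ n)\<^sup>2)"
      using d by (intro Liminf_le) (auto simp: eventually_sequentially)
    finally show ?thesis .
  qed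
  have gf: "(\<lambda>x. g x - f n x) \<in> L2 UNIV" for n
    using le_less_trans[OF gd[of n] ennreal_less_top] f[of n]
    by (auto simp: L2_def lebesgue_on_UNIV_eq intro!: integrableI_bounded borel_measurable_diff)
  have g: "g \<in> L2 UNIV" using L2_add[OF gf[of 0] f[of 0]] by simp
  have "norm (abs_l2 g - X (r n)) \<le> (1/4) ^ n" for n
  proof -
    have "ennreal ((norm (abs_l2 g - X (r n)))\<^sup>2) \<le> ennreal (((1/4) ^ n)\<^sup>2)"
      using gd[of n] nn_integral_abs_l2[OF gf[of n]] by (simp add: Xf abs_l2_diff f g)
    then show ?thesis by (auto intro: power2_le_imp_le)
  qed
  then have "(\<lambda>n. X (r n)) \<longlonglongrightarrow> abs_l2 g"
    by (intro LIM_zero_cancel[OF Lim_null_comparison[OF _ LIMSEQ_realpow_zero[of "1/4"]]])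
      (auto simp: norm_minus_commute intro!: always_eventually)
  then show "convergent X"
    using Cauchy_converges_subseq[OF X r] by (auto simp: convergent_def o_def)
qed

section \<open>Smooth functions and test functions\<close>

lemma partial_eq: "(f has_derivative f') (at x) \<Longrightarrow> partial b f x = f' b"
  by (simp add: partial_def frechet_derivative_at[symmetric])

lemma differentiable_partial:
  "f differentiable (at x) \<Longrightarrow> (f has_derivative (\<lambda>h. frechet_derivative f (at x) h)) (at x)"
  by (simp add: frechet_derivative_works[symmetric])

lemma C_k_imp_continuous: "C_k k f \<Longrightarrow> continuous_on A f"
  by (cases k) (auto intro: continuous_on_subset simp: continuous_at_imp_continuous_on differentiable_imp_continuous_within)

lemma C_k_Suc_imp: "C_k (Suc k) f \<Longrightarrow> C_k k f"
proof (induction k arbitrary: f)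
  case 0
  then show ?case using C_k_imp_continuous[of "Suc 0" f UNIV] by simp
qed auto

lemma C_k_const: "C_k k (\<lambda>x. c)"
proof (induction k arbitrary: c)
  case (Suc k)
  have "partial b (\<lambda>x::'a. c) = (\<lambda>x. 0)" for b
    by (rule ext) (rule partial_eq[OF has_derivative_const])
  then show ?case using Suc by simp
qed simp

lemma partial_add:
  assumes "\<And>x. f differentiable (at x)" "\<And>x. g differentiable (at x)"
  shows "partial b (\<lambda>x. f x + g x) = (\<lambda>x. partial b f x + partial b g x)"
  by (rule ext) (rule partial_eq[OF has_derivative_add[OF differentiable_partial differentiable_partial,
          OF assms], folded partial_def])

lemma partial_mult:
  fixes f g :: "'a::euclidean_space \<Rightarrow> real"
  assumes "\<And>x. f differentiable (at x)" "\<And>x. g differentiable (at x)"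
  shows "partial b (\<lambda>x. f x * g x) = (\<lambda>x. f x * partial b g x + partial b f x * g x)"
  by (rule ext) (rule partial_eq[OF has_derivative_mult[OF differentiable_partial differentiable_partial,
          OF assms], folded partial_def])

lemma C_k_add: "C_k k f \<Longrightarrow> C_k k g \<Longrightarrow> C_k k (\<lambda>x. f x + g x)"
proof (induction k arbitrary: f g)
  case (Suc k)
  then show ?case by (auto simp: partial_add intro: differentiable_add)
qed (auto intro: continuous_intros)

lemma C_k_mult: "C_k k f \<Longrightarrow> C_k k g \<Longrightarrow> C_k k (\<lambda>x. f x * g x)"
proof (induction k arbitrary: f g)
  case (Suc k)
  have "C_k k f" "C_k k g" using Suc.prems by (auto intro: C_k_Suc_imp)
  then show ?case using Suc by (auto simp: partial_mult intro!: differentiable_mult C_k_add)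
qed (auto intro: continuous_intros)

lemma partial_affine:
  fixes g :: "real \<Rightarrow> real"
  assumes "\<And>y. g differentiable (at y)"
  shows "partial b (\<lambda>x. g (x \<bullet> c + d)) = (\<lambda>x. (b \<bullet> c) * partial 1 g (x \<bullet> c + d))"
proof
  fix x
  have "(g has_derivative frechet_derivative g (at (x \<bullet> c + d))) (at (x \<bullet> c + d))"
    by (rule differentiable_partial[OF assms])
  moreover have "((\<lambda>x. x \<bullet> c + d) has_derivative (\<lambda>h. h \<bullet> c)) (at x)"
    by (auto intro!: derivative_eq_intros)
  ultimately have *: "((\<lambda>x. g (x \<bullet> c + d)) has_derivative (\<lambda>h. frechet_derivative g (at (x \<bullet> c + d)) (h \<bullet> c))) (at x)"
    by (rule has_derivative_compose[rotated])
  have "linear (frechet_derivative g (at (x \<bullet> c + d)))"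
    by (rule linear_frechet_derivative[OF assms])
  then show "partial b (\<lambda>x. g (x \<bullet> c + d)) x = (b \<bullet> c) * partial 1 g (x \<bullet> c + d)"
    using linear_scale[of "frechet_derivative g (at (x \<bullet> c + d))" "b \<bullet> c" 1]
    by (simp add: partial_eq[OF *] partial_def[of 1])
qed

lemma C_k_affine: "C_k k g \<Longrightarrow> C_k k (\<lambda>x. g (x \<bullet> c + d))"
proof (induction k arbitrary: g)
  case (Suc k)
  have "(\<lambda>x. g (x \<bullet> c + d)) differentiable at x" for x
    by (rule differentiable_compose[of g]) (use Suc.prems in \<open>auto intro!: derivative_intros\<close>)
  then show ?case using Suc by (auto simp: partial_affine intro!: C_k_mult C_k_const)
qed (auto intro!: continuous_intros intro: continuous_on_compose2)

lemma C_k_inverse: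
  fixes f :: "'a::euclidean_space \<Rightarrow> real"
  assumes "\<And>x. f x \<noteq> 0"
  shows "C_k k f \<Longrightarrow> C_k k (\<lambda>x. inverse (f x))"
proof (induction k)
  case (Suc k)
  have IH: "C_k k (\<lambda>x. inverse (f x))" using Suc by (simp add: C_k_Suc_imp)
  have d: "f differentiable at x" for x using Suc.prems by simp
  have "partial b (\<lambda>x. inverse (f x)) = (\<lambda>x. - 1 * (inverse (f x) * partial b f x * inverse (f x)))" for b
    using partial_eq[OF Deriv.has_derivative_inverse[OF assms differentiable_partial[OF d]]]
    by (intro ext) (simp add: partial_def)
  moreover have "(\<lambda>x. inverse (f x)) differentiable at x" for x
    using d assms by (rule differentiable_inverse)
  ultimately show ?case using Suc.prems IH
    by (simp only: C_k.simps) (intro conjI allI ballI C_k_mult C_k_const, auto)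
qed (use assms in \<open>auto intro!: continuous_intros\<close>)

lemma smooth_const: "smooth (\<lambda>x. c)"
  and smooth_add: "smooth f \<Longrightarrow> smooth g \<Longrightarrow> smooth (\<lambda>x. f x + g x)"
  and smooth_mult: "smooth f \<Longrightarrow> smooth g \<Longrightarrow> smooth (\<lambda>x. f x * g x)"
  and smooth_affine: "smooth h \<Longrightarrow> smooth (\<lambda>x. h (x \<bullet> c' + d))"
  by (auto simp: smooth_def C_k_const C_k_add C_k_mult C_k_affine)

lemma smooth_inverse: "(\<And>x. f x \<noteq> 0) \<Longrightarrow> smooth f \<Longrightarrow> smooth (\<lambda>x. inverse (f x))"
  for f :: "'a::euclidean_space \<Rightarrow> real"
  by (auto simp: smooth_def C_k_inverse)

lemma smooth_cmult: "smooth f \<Longrightarrow> smooth (\<lambda>x. c * f x)"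
  by (intro smooth_mult smooth_const)

lemma smooth_diff: "smooth f \<Longrightarrow> smooth g \<Longrightarrow> smooth (\<lambda>x. f x - g x)"
  using smooth_add[OF _ smooth_cmult[of g "-1"], of f] by simp

lemma smooth_prod: "finite A \<Longrightarrow> (\<And>i. i \<in> A \<Longrightarrow> smooth (f i)) \<Longrightarrow> smooth (\<lambda>x. \<Prod>i\<in>A. f i x)"
  by (induction A rule: finite_induct) (auto intro: smooth_const smooth_mult)

lemma smooth_power: "smooth f \<Longrightarrow> smooth (\<lambda>x. f x ^ k)"
  by (induction k) (auto intro: smooth_const smooth_mult)

lemma smooth_differentiable: "smooth f \<Longrightarrow> f differentiable (at x)"
  unfolding smooth_def by (metis C_k.simps(2))

lemma smooth_partial: "smooth f \<Longrightarrow> b \<in> Basis \<Longrightarrow> smooth (partial b f)"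
  unfolding smooth_def by (metis C_k.simps(2))

lemma smooth_continuous: "smooth f \<Longrightarrow> continuous_on A f"
  unfolding smooth_def using C_k_imp_continuous by blast

lemma smooth_has_derivative: "smooth f \<Longrightarrow> (f has_derivative (\<lambda>h. partial h f x)) (at x)"
  using differentiable_partial[OF smooth_differentiable, of f x] by (simp add: partial_def)

lemma partial_real: "(f has_real_derivative D) (at x) \<Longrightarrow> partial 1 f x = D"
  using partial_eq[of f "(*) D" x 1] by (simp add: has_field_derivative_def)

lemma smooth_real_derivative: "smooth f \<Longrightarrow> (f has_real_derivative partial 1 f x) (at x)"
  for f :: "real \<Rightarrow> real"
  using smooth_differentiable[of f x] partial_real
  by (metis DERIV_deriv_iff_real_differentiable)

text \<open>The derivatives of \<open>p(1/x) exp(-1/x)\<close> have the same form, with another polynomial \<open>p\<close>.\<close>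

definition exp_flat :: "real poly \<Rightarrow> real \<Rightarrow> real" where
  "exp_flat p x = (if 0 < x then poly p (1 / x) * exp (- (1 / x)) else 0)"

lemma poly_div_exp_tendsto_0: "((\<lambda>y. poly p y / exp y) \<longlongrightarrow> (0::real)) at_top"
proof -
  have "((\<lambda>y. \<Sum>i\<le>degree p. coeff p i * (y ^ i / exp y)) \<longlongrightarrow> (\<Sum>i\<le>degree p. coeff p i * 0)) at_top"
    by (intro tendsto_sum tendsto_mult tendsto_const tendsto_power_div_exp_0)
  then show ?thesis by (simp add: poly_altdef sum_divide_distrib)
qed

text \<open>With y = 1/x the chain rule gives y^2 (p(y) - p'(y)) exp(-y), and
  \<open>[:0, 0, 1:]\<close> is y^2. At 0 the right difference quotient is y p(y) exp(-y) for y
  tending to infinity, hence tends to 0.\<close>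

lemma exp_flat_deriv:
  "(exp_flat p has_real_derivative exp_flat ([:0, 0, 1:] * (p - pderiv p)) x) (at x)"
proof -
  consider "x < 0" | "0 < x" | "x = 0" by linarith
  then show ?thesis
  proof cases
    case 1
    have "(exp_flat p has_real_derivative 0) (at x)"
      by (rule has_field_derivative_transform_within_open[OF DERIV_const[of 0], of "{..<0}"])
        (use 1 in \<open>auto simp: exp_flat_def\<close>)
    then show ?thesis using 1 by (simp add: exp_flat_def)
  next
    case 2
    have "((\<lambda>x. poly p (1 / x) * exp (- (1 / x))) has_real_derivative
       exp_flat ([:0, 0, 1:] * (p - pderiv p)) x) (at x)"
      using 2 by (auto intro!: derivative_eq_intros DERIV_chain2[OF poly_DERIV]
          simp: exp_flat_def power2_eq_square field_simps)
    then show ?thesis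
      by (rule has_field_derivative_transform_within_open[of _ _ _ "{0<..}"])
        (use 2 in \<open>auto simp: exp_flat_def\<close>)
  next
    case 3
    have r: "((\<lambda>h. exp_flat p h / h) \<longlongrightarrow> 0) (at_right 0)"
    proof -
      have "((\<lambda>h. poly ([:0, 1:] * p) (inverse h) / exp (inverse h)) \<longlongrightarrow> 0) (at_right 0)"
        by (rule filterlim_compose[OF poly_div_exp_tendsto_0 filterlim_inverse_at_top_right])
      then show ?thesis
        by (rule Lim_transform_eventually)
          (auto simp: eventually_at_filter exp_flat_def exp_minus field_simps)
    qed
    have l: "((\<lambda>h. exp_flat p h / h) \<longlongrightarrow> 0) (at_left 0)"
      by (rule Lim_transform_eventually[OF tendsto_const]) (auto simp: eventually_at_filter exp_flat_def)
    have "((\<lambda>h. exp_flat p h / h) \<longlongrightarrow> 0) (at 0)"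
      using l r by (simp add: filterlim_at_split)
    then show ?thesis using 3 by (simp add: DERIV_def exp_flat_def)
  qed
qed

lemma smooth_exp_flat: "smooth (exp_flat p)"
proof -
  have "C_k k (exp_flat p)" for k
  proof (induction k arbitrary: p)
    case 0
    show ?case unfolding C_k.simps by (rule DERIV_continuous_on) (rule exp_flat_deriv)
  next
    case (Suc k)
    have "partial 1 (exp_flat p) = exp_flat ([:0, 0, 1:] * (p - pderiv p))"
      by (rule ext) (rule partial_real[OF exp_flat_deriv])
    moreover have "exp_flat p differentiable (at x)" for x
      unfolding real_differentiable_def using exp_flat_deriv by blast
    ultimately show ?case unfolding C_k.simps using Suc by simp
  qed
  then show ?thesis by (simp add: smooth_def)
qed

text \<open>A smooth transition from 0 to 1 on [0, 1]. The denominator is positive because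
  \<open>x\<close> and \<open>1 - x\<close> cannot both be nonpositive.\<close>

definition smooth_step :: "real \<Rightarrow> real" where
  "smooth_step x = exp_flat 1 x * inverse (exp_flat 1 x + exp_flat 1 (1 - x))"

lemma smooth_step: "smooth smooth_step"
proof -
  have "exp_flat 1 x + exp_flat 1 (1 - x) \<noteq> 0" for x
    by (cases "0 < x"; cases "0 < 1 - x") (auto simp: exp_flat_def add_nonneg_eq_0_iff)
  moreover have "smooth (\<lambda>x::real. exp_flat 1 (1 - x))"
    using smooth_affine[OF smooth_exp_flat, of 1 "-1 :: real" 1] by (simp add: algebra_simps)
  ultimately show ?thesis
    unfolding smooth_step_def[abs_def]
    by (intro smooth_mult smooth_inverse smooth_add smooth_exp_flat) auto
qed

lemma smooth_step_0: "x \<le> 0 \<Longrightarrow> smooth_step x = 0"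
  and smooth_step_1: "1 \<le> x \<Longrightarrow> smooth_step x = 1"
  and smooth_step_nonneg: "0 \<le> smooth_step x"
  and smooth_step_le_1: "smooth_step x \<le> 1"
  by (auto simp: smooth_step_def exp_flat_def field_simps add_pos_nonneg)

text \<open>A smooth function supported in the closed box from \<open>a\<close> to \<open>b\<close>;
  as the slope parameter \<open>k\<close> grows, it tends pointwise to the indicator of the open
  box.\<close>

definition box_bump :: "nat \<Rightarrow> 'a::euclidean_space \<Rightarrow> 'a \<Rightarrow> 'a \<Rightarrow> real" where
  "box_bump k a b x = (\<Prod>i\<in>Basis. smooth_step (k * (x \<bullet> i - a \<bullet> i)) * smooth_step (k * (b \<bullet> i - x \<bullet> i)))"

lemma box_bump_smooth: "smooth (box_bump k a b)"
proof -
  have "smooth (\<lambda>x. smooth_step (k * (x \<bullet> i - a \<bullet> i)))" "smooth (\<lambda>x. smooth_step (k * (b \<bullet> i - x \<bullet> i)))" for i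
    using smooth_affine[OF smooth_step, of "real k *\<^sub>R i" "- k * (a \<bullet> i)"]
      smooth_affine[OF smooth_step, of "- real k *\<^sub>R i" "k * (b \<bullet> i)"]
    by (simp_all add: algebra_simps)
  then show ?thesis unfolding box_bump_def[abs_def] by (intro smooth_prod smooth_mult) auto
qed

lemma box_bump_bounds: "0 \<le> box_bump k a b x" "box_bump k a b x \<le> 1"
  unfolding box_bump_def
  by (auto intro!: prod_nonneg prod_le_1 mult_nonneg_nonneg mult_le_one smooth_step_nonneg smooth_step_le_1)

lemma box_bump_support: "box_bump k a b x \<noteq> 0 \<Longrightarrow> x \<in> box a b"
proof -
  assume nz: "box_bump k a b x \<noteq> 0"
  have "a \<bullet> i < x \<bullet> i \<and> x \<bullet> i < b \<bullet> i" if "i \<in> Basis" for i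
  proof -
    have "smooth_step (k * (x \<bullet> i - a \<bullet> i)) \<noteq> 0" "smooth_step (k * (b \<bullet> i - x \<bullet> i)) \<noteq> 0"
      using nz that by (auto simp: box_bump_def)
    then have "0 < k * (x \<bullet> i - a \<bullet> i)" "0 < k * (b \<bullet> i - x \<bullet> i)"
      using smooth_step_0 not_le by blast+
    then show ?thesis by (simp add: zero_less_mult_iff)
  qed
  then show ?thesis by (simp add: mem_box)
qed

lemma box_bump_tendsto: "(\<lambda>k. box_bump k a b x) \<longlonglongrightarrow> indicator (box a b) x"
proof (cases "x \<in> box a b")
  case True
  have ev: "\<forall>\<^sub>F k in sequentially. 1 \<le> real k * c" if "0 < c" for c :: real
  proof -
    obtain n where n: "1 / c < real n" using reals_Archimedean2 by blast
    have "1 \<le> real k * c" if "n \<le> k" for k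
    proof -
      have "1 / c \<le> real k" using n that by linarith
      then show ?thesis using \<open>0 < c\<close> by (simp add: field_simps)
    qed
    then show ?thesis by (auto simp: eventually_sequentially)
  qed
  have "\<forall>\<^sub>F k in sequentially. \<forall>i\<in>Basis. 1 \<le> real k * (x \<bullet> i - a \<bullet> i) \<and> 1 \<le> real k * (b \<bullet> i - x \<bullet> i)"
    using True by (intro eventually_ball_finite ballI eventually_conj ev) (auto simp: mem_box)
  then have "\<forall>\<^sub>F k in sequentially. box_bump k a b x = 1"
    by eventually_elim (simp add: box_bump_def smooth_step_1)
  then show ?thesis using True by (simp add: tendsto_eventually)
next
  case False
  then have "box_bump k a b x = 0" for k using box_bump_support by blast
  then show ?thesis using False by simp
qed

lemma box_bump_test_function: "cbox a b \<subseteq> \<Omega> \<Longrightarrow> test_function \<Omega> (box_bump k a b)"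
proof -
  assume ab: "cbox a b \<subseteq> \<Omega>"
  have "closure {x. box_bump k a b x \<noteq> 0} \<subseteq> cbox a b"
    using box_bump_support box_subset_cbox by (intro closure_minimal) blast+
  moreover from this have "compact (closure {x. box_bump k a b x \<noteq> 0})"
    by (simp add: compact_eq_bounded_closed bounded_subset[OF bounded_cbox])
  ultimately show ?thesis using ab by (simp add: test_function_def box_bump_smooth)
qed

text \<open>Bumps that increase to the indicator of a box show, by dominated convergence, that
  \<open>f\<close> has integral 0 over every closed box in the open set. Lebesgue differentiation
  along such boxes gives f = 0 almost everywhere in each box, and countably many boxes cover the
  set.\<close>

lemma fundamental_lemma_variations:
  fixes f :: "'a::euclidean_space \<Rightarrow> real"
  assumes \<Omega>: "open \<Omega>" and f: "locally_integrable \<Omega> f"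
    and zero: "\<And>\<phi>. test_function \<Omega> \<phi> \<Longrightarrow> (LINT x|lebesgue_on \<Omega>. f x * \<phi> x) = 0"
  shows "AE x in lebesgue_on \<Omega>. f x = 0"
proof -
  have \<Omega>m: "\<Omega> \<in> sets lebesgue" using \<Omega> by (simp add: borel_open)
  have int: "set_integrable lebesgue (cbox a b) f" if "cbox a b \<subseteq> \<Omega>" for a b
  proof -
    have "integrable (lebesgue_on (cbox a b)) f" using f that by (simp add: locally_integrable_def)
    then show ?thesis by (simp add: integrable_restrict_space set_integrable_def)
  qed
  have box0: "integral (cbox a b) f = 0" if ab: "cbox a b \<subseteq> \<Omega>" for a b
  proof -
    define F where "F x = indicator (cbox a b) x *\<^sub>R f x" for x
    have F: "integrable lebesgue F" using int[OF ab] by (simp add: F_def[abs_def] set_integrable_def)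
    have bm: "box_bump k a b \<in> borel_measurable lebesgue" for k
      using smooth_continuous[OF box_bump_smooth, of UNIV k a b]
      by (intro measurable_completion) (simp add: borel_measurable_continuous_onI)
    have "(LINT x|lebesgue. F x * box_bump k a b x) = 0" for k
    proof -
      have "indicator \<Omega> x *\<^sub>R (f x * box_bump k a b x) = F x * box_bump k a b x" for x
        using box_bump_support[of k a b x] box_subset_cbox[of a b] ab
        by (auto simp: F_def indicator_def)
      then have "(LINT x|lebesgue. F x * box_bump k a b x) = (LINT x|lebesgue. indicator \<Omega> x *\<^sub>R (f x * box_bump k a b x))"
        by (simp only:)
      also have "\<dots> = (LINT x|lebesgue_on \<Omega>. f x * box_bump k a b x)"
        using \<Omega>m by (simp add: integral_restrict_space)
      finally have "(LINT x|lebesgue. F x * box_bump k a b x) = (LINT x|lebesgue_on \<Omega>. f x * box_bump k a b x)" .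
      then show ?thesis using zero[OF box_bump_test_function[OF ab]] by simp
    qed
    moreover have "(\<lambda>k. LINT x|lebesgue. F x * box_bump k a b x) \<longlonglongrightarrow> (LINT x|lebesgue. F x * indicator (box a b) x)"
    proof (rule integral_dominated_convergence[where w = "\<lambda>x. norm (F x)"])
      show "(\<lambda>x. F x * indicat_real (box a b) x) \<in> borel_measurable lebesgue"
        by (intro borel_measurable_times borel_measurable_integrable[OF F] borel_measurable_indicator) auto
      show "(\<lambda>x. F x * box_bump k a b x) \<in> borel_measurable lebesgue" for k
        by (intro borel_measurable_times borel_measurable_integrable[OF F] bm)
      show "AE x in lebesgue. (\<lambda>k. F x * box_bump k a b x) \<longlonglongrightarrow> F x * indicat_real (box a b) x"
        by (intro AE_I2 tendsto_mult tendsto_const box_bump_tendsto)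
      show "AE x in lebesgue. norm (F x * box_bump k a b x) \<le> norm (F x)" for k
        using box_bump_bounds[of k a b] by (intro AE_I2) (simp add: abs_mult mult_left_le)
    qed (use F in auto)
    ultimately have z: "(LINT x|lebesgue. F x * indicator (box a b) x) = 0"
      by (simp add: LIMSEQ_const_iff)
    have eq: "F x * indicator (box a b) x = indicator (box a b) x *\<^sub>R f x" for x
      using box_subset_cbox[of a b] by (auto simp: F_def indicator_def)
    have "set_integrable lebesgue (box a b) f"
      by (rule set_integrable_subset[OF int[OF ab]]) (use box_subset_cbox in auto)
    from set_lebesgue_integral_eq_integral(2)[OF this] show ?thesis
      using z by (simp add: eq set_lebesgue_integral_def integral_open_interval)
  qed
  have neg: "negligible {x \<in> cbox a b. f x \<noteq> 0}" if ab: "cbox a b \<subseteq> \<Omega>" for a b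
  proof -
    define F where "F x = (if x \<in> cbox a b then f x else 0)" for x
    have "f integrable_on cbox a b" using int[OF ab] by (rule set_lebesgue_integral_eq_integral(1))
    then have "F integrable_on UNIV" unfolding F_def by (simp add: integrable_restrict_UNIV)
    then have "F integrable_on cbox c d" for c d by (rule integrable_on_subcbox) simp
    then obtain N where N: "negligible N" and lim: "\<And>x e. \<lbrakk>x \<notin> N; 0 < e\<rbrakk> \<Longrightarrow>
        \<exists>d>0. \<forall>h. 0 < h \<and> h < d \<longrightarrow> norm (integral (cbox x (x + h *\<^sub>R One)) F /\<^sub>R h ^ DIM('a) - F x) < e"
      using integrable_ccontinuous_explicit by metis
    have "f x = 0" if x: "x \<in> box a b" "x \<notin> N" for x
    proof (rule ccontr)
      assume nz: "f x \<noteq> 0"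
      obtain d where d: "0 < d" "\<And>h. 0 < h \<Longrightarrow> h < d \<Longrightarrow>
          norm (integral (cbox x (x + h *\<^sub>R One)) F /\<^sub>R h ^ DIM('a) - F x) < norm (f x)"
        using lim[OF x(2), of "norm (f x)"] nz by auto
      \<comment> \<open>The shrinking boxes have \<open>x\<close> as their lower corner, so only the
        upper faces of the given box limit their size.\<close>
      define m where "m = Min ((\<lambda>i. b \<bullet> i - x \<bullet> i) ` Basis)"
      have m: "0 < m" "\<And>i. i \<in> Basis \<Longrightarrow> m \<le> b \<bullet> i - x \<bullet> i"
        using x(1) by (auto simp: m_def mem_box)
      define h where "h = min (d / 2) m"
      have h: "0 < h" "h < d" "h \<le> m" using d m by (auto simp: h_def)
      have sub: "cbox x (x + h *\<^sub>R One) \<subseteq> cbox a b"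
      proof
        fix y assume "y \<in> cbox x (x + h *\<^sub>R One)"
        then have "x \<bullet> i \<le> y \<bullet> i \<and> y \<bullet> i \<le> x \<bullet> i + h" if "i \<in> Basis" for i
          using that by (auto simp: mem_box inner_add_left)
        then show "y \<in> cbox a b" using x(1) h(3) m(2) by (fastforce simp: mem_box)
      qed
      have "integral (cbox x (x + h *\<^sub>R One)) F = integral (cbox x (x + h *\<^sub>R One)) f"
        using sub by (intro integral_cong) (auto simp: F_def)
      also have "\<dots> = 0" using sub ab by (intro box0) auto
      finally show False
        using d(2)[OF h(1,2)] x(1) box_subset_cbox[of a b] by (auto simp: F_def)
    qed
    then have "{x \<in> cbox a b. f x \<noteq> 0} \<subseteq> N \<union> (cbox a b - box a b)" by auto
    then show ?thesis
      using N negligible_frontier_interval[of a b] negligible_Un negligible_subset by blast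
  qed
  obtain D where D: "countable D" "\<And>X. X \<in> D \<Longrightarrow> X \<subseteq> \<Omega>" "\<And>X. X \<in> D \<Longrightarrow> \<exists>a b. X = cbox a b" "\<Union>D = \<Omega>"
    by (rule open_countable_Union_open_cbox[OF \<Omega>]) blast
  have "negligible (\<Union>X\<in>D. {x \<in> X. f x \<noteq> 0})"
  proof (rule negligible_countable_Union)
    show "countable ((\<lambda>X. {x \<in> X. f x \<noteq> 0}) ` D)" using D(1) by simp
    fix Y assume "Y \<in> (\<lambda>X. {x \<in> X. f x \<noteq> 0}) ` D"
    then obtain X where X: "X \<in> D" "Y = {x \<in> X. f x \<noteq> 0}" by blast
    obtain a b where "X = cbox a b" using D(3)[OF X(1)] by blast
    then show "negligible Y" using neg[of a b] D(2)[OF X(1)] X(2) by simp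
  qed
  moreover have "{x \<in> \<Omega>. f x \<noteq> 0} = (\<Union>X\<in>D. {x \<in> X. f x \<noteq> 0})" using D(4) by auto
  ultimately have "{x \<in> \<Omega>. f x \<noteq> 0} \<in> null_sets lebesgue" by (simp add: negligible_iff_null_sets)
  then have "AE x in lebesgue. x \<in> \<Omega> \<longrightarrow> f x = 0"
    by (rule AE_I') auto
  then show ?thesis using \<Omega>m by (simp add: AE_restrict_space_iff)
qed

section \<open>The du Bois-Reymond lemma on an interval\<close>

lemma smooth_step_derivative_support:
  assumes "y < 0 \<or> 1 < y"
  shows "partial 1 smooth_step y = 0"
proof (rule partial_real)
  show "(smooth_step has_real_derivative 0) (at y)"
  proof (cases "y < 0")
    case True
    show ?thesis
      by (rule has_field_derivative_transform_within_open[OF DERIV_const[of 0], of "{..<0}"])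
        (use True in \<open>auto simp: smooth_step_0\<close>)
  next
    case False
    show ?thesis
      by (rule has_field_derivative_transform_within_open[OF DERIV_const[of 1], of "{1<..}"])
        (use False assms in \<open>auto simp: smooth_step_1\<close>)
  qed
qed

lemma smooth_step_affine_deriv:
  "((\<lambda>t. smooth_step (k * (t - a))) has_real_derivative k * partial 1 smooth_step (k * (t - a))) (at t within S)"
proof -
  have "((\<lambda>t. smooth_step (k * (t - a))) has_real_derivative
      partial 1 smooth_step (k * (t - a)) * (k * (1 - 0))) (at t within S)"
    by (rule DERIV_chain2[OF smooth_real_derivative[OF smooth_step]])
      (auto intro!: derivative_eq_intros)
  then show ?thesis by (simp add: mult.commute)
qed

text \<open>The kernel k s'(k (t - a)), with s the smooth step, has integral 1 and is supported in
  [a, a + 1/k]. Its size is controlled by k M, where \<open>M\<close> bounds s'; where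
  \<open>r\<close> deviates from r(a) by at most e / (2 M), the error is therefore at most e /
  2.\<close>

lemma smooth_step_approx_identity:
  fixes r :: "real \<Rightarrow> real"
  assumes r: "continuous_on {0..T} r" and a: "0 < a" "a < T"
  shows "(\<lambda>k. integral {0..T} (\<lambda>t. real k * partial 1 smooth_step (k * (t - a)) * r t)) \<longlonglongrightarrow> r a"
proof (rule LIMSEQ_I)
  fix e :: real assume e: "0 < e"
  let ?d = "partial 1 smooth_step"
  have dc: "continuous_on A ?d" for A
    by (rule smooth_continuous[OF smooth_partial[OF smooth_step]]) simp
  have "bounded (?d ` {0..1})"
    by (intro compact_imp_bounded compact_continuous_image dc) auto
  then obtain M where M: "0 < M" "\<And>y. y \<in> {0..1} \<Longrightarrow> \<bar>?d y\<bar> \<le> M"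
    by (auto simp: bounded_pos)
  have Mle: "\<bar>?d y\<bar> \<le> (if y \<in> {0..1} then M else 0)" for y
    using M(2) smooth_step_derivative_support[of y] by auto
  obtain \<delta> where \<delta>: "0 < \<delta>" "\<And>t. t \<in> {0..T} \<Longrightarrow> \<bar>t - a\<bar> < \<delta> \<Longrightarrow> \<bar>r t - r a\<bar> < e / (2 * M)"
  proof -
    have "\<exists>d>0. \<forall>t\<in>{0..T}. dist t a < d \<longrightarrow> dist (r t) (r a) < e / (2 * M)"
      using r a e M(1) unfolding continuous_on_iff by simp
    then show ?thesis using that by (auto simp: dist_real_def)
  qed
  obtain n where n: "1 / min \<delta> (T - a) < real n" using reals_Archimedean2 by blast
  have "norm (integral {0..T} (\<lambda>t. real k * ?d (k * (t - a)) * r t) - r a) < e" if k: "n \<le> k" for k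
  proof -
    have kp: "0 < real k" "1 / real k < \<delta>" "1 / real k < T - a"
    proof -
      have mp: "0 < min \<delta> (T - a)" using \<delta>(1) a by simp
      have "1 / min \<delta> (T - a) < real k" using n k by linarith
      then show "0 < real k" using mp by (meson less_trans zero_less_divide_1_iff)
      then have "1 / real k < min \<delta> (T - a)"
        using \<open>1 / min \<delta> (T - a) < real k\<close> mp pos_divide_less_eq[of "min \<delta> (T - a)" 1 k]
          pos_divide_less_eq[of "real k" 1 "min \<delta> (T - a)"] by (simp add: mult.commute)
      then show "1 / real k < \<delta>" "1 / real k < T - a" by auto
    qed
    let ?g = "\<lambda>t. real k * ?d (k * (t - a))"
    have dkc: "continuous_on {0..T} (\<lambda>t. ?d (k * (t - a)))"
      by (intro continuous_intros continuous_on_compose2[OF dc[of UNIV]]) auto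
    have int: "(\<lambda>t. ?g t * r t) integrable_on {0..T}" "(\<lambda>t. ?g t * c) integrable_on {0..T}"
      "(\<lambda>t. ?g t * (r t - c)) integrable_on {0..T}" for c
      by (intro integrable_continuous_real continuous_intros dkc r)+
    have "(?g has_integral smooth_step (k * (T - a)) - smooth_step (k * (0 - a))) {0..T}"
      using a smooth_step_affine_deriv[of k a]
      by (intro fundamental_theorem_of_calculus)
        (auto simp: has_real_derivative_iff_has_vector_derivative[symmetric])
    moreover have "1 \<le> k * (T - a)" "k * (0 - a) \<le> 0"
      using kp a by (auto simp: field_simps)
    then have "smooth_step (k * (T - a)) = 1" "smooth_step (k * (0 - a)) = 0"
      by (auto intro: smooth_step_1 smooth_step_0)
    ultimately have g1: "integral {0..T} ?g = 1"
      by (metis diff_zero integral_unique)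
    have "integral {0..T} (\<lambda>t. ?g t * r t) - r a = integral {0..T} (\<lambda>t. ?g t * r t) - integral {0..T} (\<lambda>t. ?g t * r a)"
      using g1 by simp
    also have "\<dots> = integral {0..T} (\<lambda>t. ?g t * (r t - r a))" (is "_ = ?E")
      by (subst integral_diff[symmetric, OF int(1,2)]) (intro integral_cong right_diff_distrib[symmetric])
    finally have E: "integral {0..T} (\<lambda>t. ?g t * r t) - r a = ?E" .
    have "norm ?E \<le> integral {0..T} (\<lambda>t. if t \<in> {a..a + 1 / k} then k * (e / 2) else 0)"
    proof (rule integral_norm_bound_integral)
      show "(\<lambda>t. ?g t * (r t - r a)) integrable_on {0..T}"
        by (rule int)
      show "(\<lambda>t. if t \<in> {a..a + 1 / k} then k * (e / 2) else 0) integrable_on {0..T}"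
        unfolding integrable_restrict_Int by (simp add: Int_atLeastAtMost integrable_const_ivl)
      fix t assume t: "t \<in> {0..T}"
      show "norm (?g t * (r t - r a)) \<le> (if t \<in> {a..a + 1 / k} then k * (e / 2) else 0)"
      proof (cases "t \<in> {a..a + 1 / k}")
        case True
        then have "k * (t - a) \<in> {0..1}" using kp by (auto simp: field_simps)
        then have "\<bar>?d (k * (t - a))\<bar> \<le> M" by (rule M(2))
        moreover have "\<bar>r t - r a\<bar> \<le> e / (2 * M)" using True kp by (intro less_imp_le \<delta>(2)[OF t]) auto
        ultimately have "\<bar>?d (k * (t - a))\<bar> * \<bar>r t - r a\<bar> \<le> M * (e / (2 * M))"
          using M(1) by (intro mult_mono) auto
        then show ?thesis using True M(1) kp by (simp add: abs_mult mult.assoc)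
      next
        case False
        then have "k * (t - a) < 0 \<or> 1 < k * (t - a)" using kp by (auto simp: field_simps mult_less_0_iff)
        then show ?thesis by (simp only: False if_False) (simp add: smooth_step_derivative_support)
      qed
    qed
    also have "\<dots> = integral {a..a + 1 / k} (\<lambda>t. k * (e / 2))"
    proof -
      have "a + 1 / k \<le> T" using kp(3) by linarith
      then have "{a..a + 1 / k} \<inter> {0..T} = {a..a + 1 / k}" using a(1) by (intro Int_absorb2) (simp add: atLeastatMost_subset_iff)
      then show ?thesis unfolding integral_restrict_Int by simp
    qed
    also have "\<dots> < e" using kp e by simp
    finally show ?thesis unfolding E .
  qed
  then show "\<exists>no. \<forall>k\<ge>no. norm (integral {0..T} (\<lambda>t. real k * ?d (k * (t - a)) * r t) - r a) < e" by blast
qed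

text \<open>The difference of two smooth steps placed at \<open>a\<close> and at \<open>b\<close> is
  a test function whose derivative is a difference of two approximate identities. In the limit the
  hypothesis reads r(a) = r(b).\<close>

lemma du_bois_reymond:
  fixes r :: "real \<Rightarrow> real"
  assumes r: "continuous_on {0..T} r" and T: "0 < T"
    and zero: "\<And>\<theta>. test_function {0<..<T} \<theta> \<Longrightarrow> integral {0..T} (\<lambda>t. deriv \<theta> t * r t) = 0"
    and t: "t \<in> {0..T}"
  shows "r t = r 0"
proof -
  have eq: "r a = r b" if ab: "0 < a" "a < b" "b < T" for a b
  proof -
    let ?I = "\<lambda>k c. integral {0..T} (\<lambda>t. real k * partial 1 smooth_step (k * (t - c)) * r t)"
    have lim: "(\<lambda>k. ?I k a - ?I k b) \<longlonglongrightarrow> r a - r b"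
      using ab by (intro tendsto_diff smooth_step_approx_identity r) auto
    obtain n where n: "1 / (T - b) < real n" using reals_Archimedean2 by blast
    have "?I k a - ?I k b = 0" if k: "n \<le> k" for k
    proof -
      have kp: "0 < real k" "b + 1 / real k < T"
      proof -
        have "1 / (T - b) < real k" using n k by linarith
        then show "0 < real k" using ab by (meson diff_gt_0_iff_gt less_trans zero_less_divide_1_iff)
        then show "b + 1 / real k < T"
          using \<open>1 / (T - b) < real k\<close> ab by (simp add: field_simps)
      qed
      \<comment> \<open>Both steps are 0 to the left of \<open>a\<close> and both are 1 from b + 1/k
        on, so the support is compact in (0, T) once b + 1/k < T.\<close>
      define \<theta> where "\<theta> t = smooth_step (k * (t - a)) - smooth_step (k * (t - b))" for t
      have sm: "smooth (\<lambda>t. smooth_step (k * (t - c)))" for c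
        using smooth_affine[OF smooth_step, of "real k" "- k * c"] by (simp add: algebra_simps)
      have "\<theta> t = 0" if "t \<notin> {a..b + 1 / k}" for t
      proof (cases "t < a")
        case True
        then show ?thesis using kp ab by (simp add: \<theta>_def smooth_step_0 mult_nonneg_nonpos)
      next
        case False
        then have "1 \<le> k * (t - b)" using that kp by (simp add: field_simps)
        moreover have "k * (t - b) \<le> k * (t - a)" using ab kp by simp
        ultimately show ?thesis by (simp add: \<theta>_def smooth_step_1)
      qed
      then have "{t. \<theta> t \<noteq> 0} \<subseteq> {a..b + 1 / k}" by blast
      then have cl: "closure {t. \<theta> t \<noteq> 0} \<subseteq> {a..b + 1 / k}" by (rule closure_minimal) simp
      then have "bounded (closure {t. \<theta> t \<noteq> 0})" by (rule bounded_subset[rotated]) simp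
      then have "test_function {0<..<T} \<theta>"
        using cl kp ab smooth_diff[OF sm sm, of a b]
        by (auto simp: test_function_def \<theta>_def[abs_def] compact_eq_bounded_closed)
      note z = zero[OF this]
      have d: "deriv \<theta> t = k * partial 1 smooth_step (k * (t - a)) - k * partial 1 smooth_step (k * (t - b))" for t
        unfolding \<theta>_def by (intro DERIV_imp_deriv DERIV_diff smooth_step_affine_deriv)
      have "continuous_on {0..T} (\<lambda>t. partial 1 smooth_step (k * (t - c)))" for c
        by (intro continuous_on_compose2[OF smooth_continuous[OF smooth_partial[OF smooth_step], of 1 UNIV]] continuous_intros) auto
      then have "integral {0..T} (\<lambda>t. deriv \<theta> t * r t) = ?I k a - ?I k b"
        unfolding d left_diff_distrib
        by (intro integral_diff integrable_continuous_real continuous_intros r)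
      then show ?thesis using z by simp
    qed
    then have "(\<lambda>k. ?I k a - ?I k b) \<longlonglongrightarrow> 0"
      by (intro tendsto_eventually) (auto simp: eventually_sequentially)
    from LIMSEQ_unique[OF lim this] show ?thesis by simp
  qed
  have cl: "closure {0<..<T} = {0..T}" using T by simp
  have "r t = r (T / 2)" if "t \<in> {0..T}" for t
  proof (rule continuous_constant_on_closure[of "{0<..<T}" r "r (T/2)"])
    show "continuous_on (closure {0<..<T}) r" using r cl by simp
    show "r x = r (T/2)" if "x \<in> {0<..<T}" for x
    proof -
      have x: "0 < x" "x < T" "0 < T / 2" "T / 2 < T" using that T by simp_all
      consider "x < T / 2" | "x = T / 2" | "T / 2 < x" by linarith
      then show ?thesis
      proof cases
        case 1 from eq[OF x(1) this x(4)] show ?thesis .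
      next
        case 2 then show ?thesis by (rule arg_cong)
      next
        case 3 from eq[OF x(3) this x(2)] show ?thesis by (rule sym)
      qed
    qed
    show "t \<in> closure {0<..<T}" unfolding cl by (rule that)
  qed
  from this[OF t] this[of 0] show ?thesis using T by simp
qed

section \<open>Square integrable functions on a domain and their classes\<close>

lemma L2_bounded_linear:
  assumes A: "bounded_linear A" and f: "f \<in> L2 \<Omega>"
  shows "(\<lambda>x. A (f x)) \<in> L2 \<Omega>"
proof -
  obtain K where K: "\<And>x. norm (A x) \<le> norm x * K" "0 \<le> K"
    using bounded_linear.nonneg_bounded[OF A] by blast
  have m: "(\<lambda>x. A (f x)) \<in> borel_measurable (lebesgue_on \<Omega>)"
    by (rule measurable_compose[OF L2_measurable[OF f]])
      (intro borel_measurable_continuous_onI bounded_linear.continuous_on[OF A] continuous_on_id)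
  have "(norm (A (f x)))\<^sup>2 \<le> K\<^sup>2 * (norm (f x))\<^sup>2" for x
    using power_mono[OF K(1)[of "f x"], of 2] by (simp add: power_mult_distrib mult.commute)
  then have "integrable (lebesgue_on \<Omega>) (\<lambda>x. (norm (A (f x)))\<^sup>2)"
    using m by (intro Bochner_Integration.integrable_bound[OF integrable_mult_right[OF L2_integrable[OF f], of "K\<^sup>2"]]) auto
  then show ?thesis using m by (simp add: L2_def)
qed

lemma L2_Pair: "f \<in> L2 \<Omega> \<Longrightarrow> g \<in> L2 \<Omega> \<Longrightarrow> (\<lambda>x. (f x, g x)) \<in> L2 \<Omega>"
  unfolding L2_def by (auto simp: norm_Pair)

lemma L2_inner_Pair:
  assumes "f \<in> L2 \<Omega>" "g \<in> L2 \<Omega>" "f' \<in> L2 \<Omega>" "g' \<in> L2 \<Omega>"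
  shows "L2_inner \<Omega> (\<lambda>x. (f x, g x)) (\<lambda>x. (f' x, g' x)) = L2_inner \<Omega> f f' + L2_inner \<Omega> g g'"
  unfolding L2_inner_def by (simp add: integrable_inner_L2 assms)

lemma L2_bounded:
  fixes f :: "'a::euclidean_space \<Rightarrow> 'b::euclidean_space"
  assumes "\<Omega> \<in> lmeasurable" "f \<in> borel_measurable (lebesgue_on \<Omega>)" "\<And>x. x \<in> \<Omega> \<Longrightarrow> norm (f x) \<le> B"
  shows "f \<in> L2 \<Omega>"
proof -
  interpret finite_measure "lebesgue_on \<Omega>" using assms(1) by (rule finite_measure_lebesgue_on)
  have "integrable (lebesgue_on \<Omega>) (\<lambda>x. (norm (f x))\<^sup>2)"
    using assms by (intro integrable_const_bound[of _ "B\<^sup>2"]) (auto intro!: AE_I2 power_mono)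
  then show ?thesis using assms by (simp add: L2_def)
qed

lemma L2_subset:
  assumes "f \<in> L2 \<Omega>" "\<Omega> \<in> sets lebesgue" "K \<in> sets lebesgue" "K \<subseteq> \<Omega>"
  shows "f \<in> L2 K"
proof -
  have "f \<in> borel_measurable (lebesgue_on K)"
    using measurable_lebesgue_cong measurable_restrict_mono[OF L2_measurable[OF assms(1)] assms(4)] by auto
  moreover have "integrable (lebesgue_on K) (\<lambda>x. (norm (f x))\<^sup>2)"
    using set_integrable_subset[of lebesgue \<Omega> "\<lambda>x. (norm (f x))\<^sup>2" K] L2_integrable[OF assms(1)] assms(2-4)
    by (simp add: integrable_restrict_space set_integrable_def)
  ultimately show ?thesis by (simp add: L2_def)
qed

lemma integrable_L2:
  fixes f :: "'a::euclidean_space \<Rightarrow> 'b::euclidean_space"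
  assumes f: "f \<in> L2 \<Omega>" and \<Omega>: "\<Omega> \<in> lmeasurable"
  shows "integrable (lebesgue_on \<Omega>) f"
proof -
  interpret finite_measure "lebesgue_on \<Omega>" using \<Omega> by (rule finite_measure_lebesgue_on)
  have le: "norm a \<le> 1 + (norm a)\<^sup>2" for a :: 'b
  proof -
    have "2 * norm a \<le> (norm a)\<^sup>2 + 1" using sum_squares_bound[of "norm a" 1] by simp
    then show ?thesis using norm_ge_zero[of a] by linarith
  qed
  show ?thesis
  proof (rule Bochner_Integration.integrable_bound)
    show "integrable (lebesgue_on \<Omega>) (\<lambda>x. 1 + (norm (f x))\<^sup>2)"
      by (intro Bochner_Integration.integrable_add L2_integrable[OF f]) simp
    show "AE x in lebesgue_on \<Omega>. norm (f x) \<le> norm (1 + (norm (f x))\<^sup>2)"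
      using le by (intro AE_I2) (simp add: abs_of_nonneg add_nonneg_nonneg)
  qed (rule L2_measurable[OF f])
qed

lemma locally_integrable_L2:
  assumes f: "f \<in> L2 \<Omega>" and \<Omega>: "\<Omega> \<in> sets lebesgue"
  shows "locally_integrable \<Omega> f"
  unfolding locally_integrable_def
proof (intro allI impI)
  fix K assume K: "compact K" "K \<subseteq> \<Omega>"
  have "K \<in> lmeasurable" using K(1) by (rule lmeasurable_compact)
  then show "integrable (lebesgue_on K) f"
    using K by (intro integrable_L2 L2_subset[OF f \<Omega>]) auto
qed

text \<open>A type cannot depend on the domain, so functions on it are extended by zero and enter
  the L2 space of the whole space.\<close>

definition to_l2 :: "'a::euclidean_space set \<Rightarrow> ('a \<Rightarrow> 'b::euclidean_space) \<Rightarrow> ('a, 'b) l2" where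
  "to_l2 \<Omega> f = abs_l2 (\<lambda>x. indicator \<Omega> x *\<^sub>R f x)"

context
  fixes \<Omega> :: "'a::euclidean_space set"
  assumes \<Omega>: "\<Omega> \<in> sets lebesgue"
begin

lemma L2_indicator: "f \<in> L2 \<Omega> \<Longrightarrow> (\<lambda>x. indicator \<Omega> x *\<^sub>R f x) \<in> L2 UNIV"
  by (simp add: L2_indicator_iff[OF \<Omega>])

lemma to_l2_diff: "f \<in> L2 \<Omega> \<Longrightarrow> g \<in> L2 \<Omega> \<Longrightarrow> to_l2 \<Omega> (\<lambda>x. f x - g x) = to_l2 \<Omega> f - to_l2 \<Omega> g"
  unfolding to_l2_def by (simp add: abs_l2_diff L2_indicator scaleR_diff_right)

lemma to_l2_add: "f \<in> L2 \<Omega> \<Longrightarrow> g \<in> L2 \<Omega> \<Longrightarrow> to_l2 \<Omega> (\<lambda>x. f x + g x) = to_l2 \<Omega> f + to_l2 \<Omega> g"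
  unfolding to_l2_def scaleR_add_right
  by (rule plus_l2.abs_eq[symmetric]) (auto simp: L2_eq_def L2_indicator)

lemma to_l2_scaleR: "f \<in> L2 \<Omega> \<Longrightarrow> to_l2 \<Omega> (\<lambda>x. c *\<^sub>R f x) = c *\<^sub>R to_l2 \<Omega> f"
  unfolding to_l2_def scaleR_left_commute[of _ c]
  by (rule scaleR_l2.abs_eq[symmetric]) (auto simp: L2_eq_def L2_indicator)

lemma inner_to_l2:
  assumes "f \<in> L2 \<Omega>" "g \<in> L2 \<Omega>"
  shows "to_l2 \<Omega> f \<bullet> to_l2 \<Omega> g = L2_inner \<Omega> f g"
proof -
  have "to_l2 \<Omega> f \<bullet> to_l2 \<Omega> g = L2_inner UNIV (\<lambda>x. indicator \<Omega> x *\<^sub>R f x) (\<lambda>x. indicator \<Omega> x *\<^sub>R g x)"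
    unfolding to_l2_def by (rule inner_l2.abs_eq) (auto simp: L2_eq_def L2_indicator assms)
  also have "\<dots> = (LINT x|lebesgue. indicator \<Omega> x *\<^sub>R (f x \<bullet> g x))"
    unfolding L2_inner_def lebesgue_on_UNIV_eq by (intro Bochner_Integration.integral_cong) (auto simp: indicator_def)
  also have "\<dots> = L2_inner \<Omega> f g"
    unfolding L2_inner_def using \<Omega> by (simp add: integral_restrict_space)
  finally show ?thesis .
qed

lemma norm_to_l2: "f \<in> L2 \<Omega> \<Longrightarrow> norm (to_l2 \<Omega> f) = L2_norm \<Omega> f"
  by (simp add: norm_eq_sqrt_inner inner_to_l2 L2_norm_def)

lemma to_l2_eq_0_iff:
  assumes f: "f \<in> L2 \<Omega>"
  shows "to_l2 \<Omega> f = 0 \<longleftrightarrow> (AE x in lebesgue_on \<Omega>. f x = 0)"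
proof -
  have "to_l2 \<Omega> f = 0 \<longleftrightarrow> to_l2 \<Omega> f \<bullet> to_l2 \<Omega> f = 0" by simp
  also have "\<dots> \<longleftrightarrow> (LINT x|lebesgue_on \<Omega>. f x \<bullet> f x) = 0" by (simp add: inner_to_l2 f L2_inner_def)
  also have "\<dots> \<longleftrightarrow> (AE x in lebesgue_on \<Omega>. f x \<bullet> f x = 0)"
    by (intro integral_nonneg_eq_0_iff_AE integrable_inner_L2 f) auto
  finally show ?thesis by simp
qed

lemma to_l2_eq_iff:
  assumes "f \<in> L2 \<Omega>" "g \<in> L2 \<Omega>"
  shows "to_l2 \<Omega> f = to_l2 \<Omega> g \<longleftrightarrow> (AE x in lebesgue_on \<Omega>. f x = g x)"
  using to_l2_eq_0_iff[OF L2_diff[OF assms]] by (simp add: to_l2_diff assms)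

text \<open>Restricting a representative of the limit to the domain cannot increase its distance to
  functions that vanish outside. The sequence thus converges to the restriction as well, and limits
  are unique.\<close>

lemma to_l2_closed:
  fixes f :: "nat \<Rightarrow> 'a \<Rightarrow> 'b::euclidean_space"
  assumes f: "\<And>k. f k \<in> L2 \<Omega>" and lim: "(\<lambda>k. to_l2 \<Omega> (f k)) \<longlonglongrightarrow> h"
  shows "\<exists>g\<in>L2 \<Omega>. h = to_l2 \<Omega> g"
proof -
  obtain g where g: "g \<in> L2 UNIV" "h = abs_l2 g" using rep_l2_exists by blast
  have g\<Omega>: "g \<in> L2 \<Omega>" using L2_subset[OF g(1)] \<Omega> by simp
  have "norm (to_l2 \<Omega> (f k) - to_l2 \<Omega> g) \<le> norm (to_l2 \<Omega> (f k) - h)" for k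
  proof (rule power2_le_imp_le)
    have i: "(\<lambda>x. indicator \<Omega> x *\<^sub>R (f k x - g x)) \<in> L2 UNIV" "(\<lambda>x. indicator \<Omega> x *\<^sub>R f k x - g x) \<in> L2 UNIV"
      by (intro L2_indicator L2_diff f g\<Omega>) (intro L2_indicator L2_diff f g)
    have "(norm (to_l2 \<Omega> (f k) - to_l2 \<Omega> g))\<^sup>2 = (\<integral>x. (norm (indicator \<Omega> x *\<^sub>R (f k x - g x)))\<^sup>2 \<partial>lebesgue)"
      unfolding to_l2_diff[OF f g\<Omega>, symmetric] unfolding to_l2_def by (rule norm_abs_l2[OF i(1)])
    also have "\<dots> \<le> (\<integral>x. (norm (indicator \<Omega> x *\<^sub>R f k x - g x))\<^sup>2 \<partial>lebesgue)"
      using i by (intro integral_mono) (auto simp: L2_def lebesgue_on_UNIV_eq indicator_def)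
    also have "\<dots> = (norm (to_l2 \<Omega> (f k) - h))\<^sup>2"
      unfolding to_l2_def g(2) abs_l2_diff[OF L2_indicator[OF f] g(1)] by (rule norm_abs_l2[OF i(2), symmetric])
    finally show "(norm (to_l2 \<Omega> (f k) - to_l2 \<Omega> g))\<^sup>2 \<le> (norm (to_l2 \<Omega> (f k) - h))\<^sup>2" .
  qed simp
  then have le: "\<forall>\<^sub>F k in sequentially. norm (to_l2 \<Omega> (f k) - to_l2 \<Omega> g) \<le> norm (to_l2 \<Omega> (f k) - h)"
    by simp
  have "(\<lambda>k. norm (to_l2 \<Omega> (f k) - h)) \<longlonglongrightarrow> 0"
    using lim by (simp add: LIM_zero tendsto_norm_zero)
  from Lim_null_comparison[OF le this]
  have "(\<lambda>k. to_l2 \<Omega> (f k) - to_l2 \<Omega> g) \<longlonglongrightarrow> 0" .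
  from LIMSEQ_unique[OF lim LIM_zero_cancel[OF this]] have "h = to_l2 \<Omega> g" .
  then show ?thesis using g\<Omega> by blast
qed

lemma to_l2_tendsto_AE_subseq:
  assumes f: "\<And>k. f k \<in> L2 \<Omega>" "g \<in> L2 \<Omega>" and lim: "(\<lambda>k. to_l2 \<Omega> (f k)) \<longlonglongrightarrow> to_l2 \<Omega> g"
  shows "\<exists>r. strict_mono r \<and> (AE x in lebesgue_on \<Omega>. (\<lambda>k. f (r k) x) \<longlonglongrightarrow> g x)"
proof -
  have n: "(LINT x|lebesgue_on \<Omega>. norm ((norm (f k x - g x))\<^sup>2)) = (norm (to_l2 \<Omega> (f k) - to_l2 \<Omega> g))\<^sup>2" for k
    unfolding to_l2_diff[OF f, symmetric] power2_norm_eq_inner inner_to_l2[OF L2_diff[OF f] L2_diff[OF f]] L2_inner_def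
    by simp
  have "(\<lambda>k. norm (to_l2 \<Omega> (f k) - to_l2 \<Omega> g)) \<longlonglongrightarrow> 0"
    using lim by (simp add: LIM_zero tendsto_norm_zero)
  then have "(\<lambda>k. (norm (to_l2 \<Omega> (f k) - to_l2 \<Omega> g))\<^sup>2) \<longlonglongrightarrow> 0\<^sup>2" by (rule tendsto_power)
  then have "(\<lambda>k. LINT x|lebesgue_on \<Omega>. norm ((norm (f k x - g x))\<^sup>2)) \<longlonglongrightarrow> 0" unfolding n by simp
  from tendsto_L1_AE_subseq[OF L2_integrable[OF L2_diff[OF f]] this]
  obtain r where r: "strict_mono r" "AE x in lebesgue_on \<Omega>. (\<lambda>k. (norm (f (r k) x - g x))\<^sup>2) \<longlonglongrightarrow> 0" by auto
  have "AE x in lebesgue_on \<Omega>. (\<lambda>k. f (r k) x) \<longlonglongrightarrow> g x"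
    using r(2)
  proof eventually_elim
    case (elim x)
    then have "(\<lambda>k. sqrt ((norm (f (r k) x - g x))\<^sup>2)) \<longlonglongrightarrow> sqrt 0" by (rule tendsto_real_sqrt)
    then show ?case by (simp add: tendsto_norm_zero_iff LIM_zero_iff)
  qed
  then show ?thesis using r(1) by blast
qed

text \<open>Membership in L4 is expressed by the square being in L2; both claims are the
  Cauchy-Schwarz inequality for the two squares.\<close>

lemma L2_mult_L4:
  fixes a b :: "'a \<Rightarrow> real"
  assumes m: "a \<in> borel_measurable (lebesgue_on \<Omega>)" "b \<in> borel_measurable (lebesgue_on \<Omega>)"
    and a: "(\<lambda>x. (a x)\<^sup>2) \<in> L2 \<Omega>" and b: "(\<lambda>x. (b x)\<^sup>2) \<in> L2 \<Omega>"
  shows "(\<lambda>x. a x * b x) \<in> L2 \<Omega>"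
    and "(L2_norm \<Omega> (\<lambda>x. a x * b x))\<^sup>2 \<le> L2_norm \<Omega> (\<lambda>x. (a x)\<^sup>2) * L2_norm \<Omega> (\<lambda>x. (b x)\<^sup>2)"
proof -
  have eq: "(norm (a x * b x))\<^sup>2 = (a x)\<^sup>2 \<bullet> (b x)\<^sup>2" for x by (simp add: power_mult_distrib)
  show ab: "(\<lambda>x. a x * b x) \<in> L2 \<Omega>"
    using integrable_inner_L2[OF a b] m by (simp add: L2_def power_mult_distrib)
  have "(L2_norm \<Omega> (\<lambda>x. a x * b x))\<^sup>2 = L2_inner \<Omega> (\<lambda>x. (a x)\<^sup>2) (\<lambda>x. (b x)\<^sup>2)"
    unfolding norm_to_l2[OF ab, symmetric] power2_norm_eq_inner inner_to_l2[OF ab ab] L2_inner_def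
    by (intro Bochner_Integration.integral_cong) (auto simp: power2_eq_square)
  also have "\<dots> \<le> norm (to_l2 \<Omega> (\<lambda>x. (a x)\<^sup>2)) * norm (to_l2 \<Omega> (\<lambda>x. (b x)\<^sup>2))"
    unfolding inner_to_l2[OF a b, symmetric] by (rule norm_cauchy_schwarz)
  finally show "(L2_norm \<Omega> (\<lambda>x. a x * b x))\<^sup>2 \<le> L2_norm \<Omega> (\<lambda>x. (a x)\<^sup>2) * L2_norm \<Omega> (\<lambda>x. (b x)\<^sup>2)"
    by (simp add: norm_to_l2 a b)
qed

end

section \<open>Boundary integrals and slicing\<close>

definition slab :: "'a::euclidean_space \<Rightarrow> 'a set" where
  "slab b = {x. 0 \<le> x \<bullet> b \<and> x \<bullet> b < 1}"

lemma slab_borel [measurable]: "slab b \<in> sets borel"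
  unfolding slab_def by measurable

lemma nn_integral_lborel_translate:
  fixes F :: "'a::euclidean_space \<Rightarrow> ennreal"
  assumes [measurable]: "F \<in> borel_measurable borel"
  shows "(\<integral>\<^sup>+x. F (x + c) \<partial>lborel) = (\<integral>\<^sup>+x. F x \<partial>lborel)"
proof -
  have "(\<integral>\<^sup>+x. F x \<partial>lborel) = (\<integral>\<^sup>+x. F x \<partial>distr lborel borel ((+) c))"
    by (simp add: lborel_distr_plus)
  also have "\<dots> = (\<integral>\<^sup>+x. F (x + c) \<partial>lborel)"
    by (subst nn_integral_distr) (auto simp: add.commute)
  finally show ?thesis by simp
qed

text \<open>Fubini along the direction \<open>b\<close> without splitting off a coordinate: the slab meets every line
  parallel to \<open>b\<close> in a segment of length 1.\<close>

lemma nn_integral_slab: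
  fixes F :: "'a::euclidean_space \<Rightarrow> ennreal"
  assumes [measurable]: "F \<in> borel_measurable borel" and b: "b \<in> Basis"
  shows "(\<integral>\<^sup>+x. indicator (slab b) x * (\<integral>\<^sup>+t. F (x + t *\<^sub>R b) \<partial>lborel) \<partial>lborel) = (\<integral>\<^sup>+x. F x \<partial>lborel)"
proof -
  have "(\<integral>\<^sup>+x. indicator (slab b) x * (\<integral>\<^sup>+t. F (x + t *\<^sub>R b) \<partial>lborel) \<partial>lborel)
      = (\<integral>\<^sup>+x. (\<integral>\<^sup>+t. indicator (slab b) x * F (x + t *\<^sub>R b) \<partial>lborel) \<partial>lborel)"
    by (subst nn_integral_cmult) auto
  also have "\<dots> = (\<integral>\<^sup>+t. (\<integral>\<^sup>+x. indicator (slab b) x * F (x + t *\<^sub>R b) \<partial>lborel) \<partial>lborel)"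
    by (rule lborel_pair.Fubini') measurable
  also have "\<dots> = (\<integral>\<^sup>+t. (\<integral>\<^sup>+x. indicator (slab b) (x - t *\<^sub>R b) * F x \<partial>lborel) \<partial>lborel)"
  proof (rule nn_integral_cong)
    fix t :: real
    show "(\<integral>\<^sup>+x. indicator (slab b) x * F (x + t *\<^sub>R b) \<partial>lborel)
        = (\<integral>\<^sup>+x. indicator (slab b) (x - t *\<^sub>R b) * F x \<partial>lborel)"
      using nn_integral_lborel_translate[of "\<lambda>x. indicator (slab b) (x - t *\<^sub>R b) * F x" "t *\<^sub>R b"] by simp
  qed
  also have "\<dots> = (\<integral>\<^sup>+x. (\<integral>\<^sup>+t. indicator (slab b) (x - t *\<^sub>R b) * F x \<partial>lborel) \<partial>lborel)"
    by (rule lborel_pair.Fubini'[symmetric]) measurable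
  also have "\<dots> = (\<integral>\<^sup>+x. F x \<partial>lborel)"
  proof (intro nn_integral_cong)
    fix x
    \<comment> \<open>The parameters \<open>t\<close> that move \<open>x\<close> back into the slab
      form a half-open interval of length 1.\<close>
    have "indicator (slab b) (x - t *\<^sub>R b) = (indicator {x \<bullet> b - 1<..x \<bullet> b} t :: ennreal)" for t
      using b by (auto simp: slab_def inner_diff_left indicator_def)
    then show "(\<integral>\<^sup>+t. indicator (slab b) (x - t *\<^sub>R b) * F x \<partial>lborel) = F x"
      by (simp add: nn_integral_multc)
  qed
  finally show ?thesis .
qed

section \<open>Boundary values against derivatives on open subsets of the line\<close>

lemma nn_integral_count_space_le:
  fixes f :: "'a \<Rightarrow> ennreal"
  assumes A: "countable A" and le: "\<And>B. finite B \<Longrightarrow> B \<subseteq> A \<Longrightarrow> (\<Sum>x\<in>B. f x) \<le> N"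
  shows "(\<integral>\<^sup>+x. f x \<partial>count_space A) \<le> N"
proof (cases "finite A")
  case True
  then show ?thesis using le[of A] by (simp add: nn_integral_count_space_finite)
next
  case False
  then have bij: "bij_betw (from_nat_into A) UNIV A" by (rule bij_betw_from_nat_into[OF A])
  have "(\<integral>\<^sup>+x. f x \<partial>count_space A) = (\<integral>\<^sup>+n. f (from_nat_into A n) \<partial>count_space UNIV)"
    by (rule nn_integral_bij_count_space[OF bij, symmetric])
  also have "\<dots> = (\<Sum>n. f (from_nat_into A n))" by (rule nn_integral_count_space_nat)
  also have "\<dots> \<le> N"
  proof (rule suminf_le_const)
    fix n
    have inj: "inj_on (from_nat_into A) {..<n}" using bij by (auto simp: bij_betw_def intro: inj_on_subset)
    have "(\<Sum>i<n. f (from_nat_into A i)) = (\<Sum>x\<in>from_nat_into A ` {..<n}. f x)"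
      by (simp add: sum.reindex[OF inj])
    also have "\<dots> \<le> N" using bij by (intro le) (auto simp: bij_betw_def)
    finally show "(\<Sum>i<n. f (from_nat_into A i)) \<le> N" .
  qed simp
  finally show ?thesis .
qed

lemma component_of_bounded_open_real:
  fixes S :: "real set"
  assumes S: "open S" "bounded S" and C: "C \<in> components S"
  obtains c d where "c < d" "C = {c<..<d}" "c \<in> frontier S" "d \<in> frontier S"
proof -
  have Co: "open C" using open_components[OF S(1) C] .
  have Cc: "is_interval C" using in_components_connected[OF C] by (simp add: is_interval_connected_1)
  have Cn: "C \<noteq> {}" using in_components_nonempty[OF C] .
  have Cb: "bounded C" using bounded_subset[OF S(2) in_components_subset[OF C]] .
  note bdd = bounded_imp_bdd_above[OF Cb] bounded_imp_bdd_below[OF Cb]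
  have "C = {Inf C<..<Sup C}"
  proof (intro subset_antisym subsetI)
    fix y assume y: "y \<in> C"
    then obtain e where e: "0 < e" "cball y e \<subseteq> C" using Co open_contains_cball by blast
    have "y - e \<in> C" "y + e \<in> C" using e by (auto simp: subset_iff dist_real_def)
    then have "Inf C \<le> y - e" "y + e \<le> Sup C" using bdd by (auto intro: cInf_lower cSup_upper)
    then show "y \<in> {Inf C<..<Sup C}" using e(1) by auto
  next
    fix y assume "y \<in> {Inf C<..<Sup C}"
    then obtain u v where "u \<in> C" "u < y" "v \<in> C" "y < v"
      using cInf_less_iff[OF Cn bdd(2)] less_cSup_iff[OF Cn bdd(1)] by auto
    then show "y \<in> C" using mem_is_interval_1_I[OF Cc, of u v y] by auto
  qed
  moreover from this have lt: "Inf C < Sup C" using Cn by (metis greaterThanLessThan_empty_iff not_le)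
  moreover have "frontier C \<subseteq> frontier S" by (rule frontier_of_components_subset[OF C])
  moreover have "frontier {Inf C<..<Sup C} = {Inf C, Sup C}"
    using lt by (auto simp: frontier_def)
  ultimately show ?thesis using that[of "Inf C" "Sup C"] by (metis insert_subset)
qed

context
  fixes S :: "real set" and \<psi> \<psi>' :: "real \<Rightarrow> real" and N :: ennreal
  assumes S: "open S" "bounded S"
    and \<psi>: "\<And>t. (\<psi> has_real_derivative \<psi>' t) (at t)" and \<psi>'c: "continuous_on UNIV \<psi>'"
    and N: "\<And>B. finite B \<Longrightarrow> B \<subseteq> frontier S \<Longrightarrow> ennreal (\<Sum>t\<in>B. \<bar>\<psi> t\<bar>) \<le> N"
begin

lemma \<psi>'_measurable [measurable]: "\<psi>' \<in> borel_measurable borel"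
  using \<psi>'c by (rule borel_measurable_continuous_onI)

lemma interval_increment:
  assumes "c \<le> d"
  shows "(LINT t|lborel. indicator {c<..<d} t *\<^sub>R \<psi>' t) = \<psi> d - \<psi> c"
    and "set_integrable lborel {c<..<d} \<psi>'"
proof -
  have i: "set_integrable lborel {c..d} \<psi>'"
    by (intro borel_integrable_atLeastAtMost' continuous_on_subset[OF \<psi>'c]) auto
  then show i': "set_integrable lborel {c<..<d} \<psi>'"
    by (rule set_integrable_subset) auto
  have "(\<psi>' has_integral (\<psi> d - \<psi> c)) {c..d}"
    using assms \<psi> by (intro fundamental_theorem_of_calculus)
      (auto simp: has_real_derivative_iff_has_vector_derivative[symmetric] intro: DERIV_subset)
  then have "integral {c<..<d} \<psi>' = \<psi> d - \<psi> c"
    using integral_open_interval_real[of c d \<psi>'] integral_unique by metis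
  then show "(LINT t|lborel. indicator {c<..<d} t *\<^sub>R \<psi>' t) = \<psi> d - \<psi> c"
    using set_borel_integral_eq_integral(2)[OF i'] by (simp add: set_lebesgue_integral_def)
qed

text \<open>From \<open>t\<close> the path runs back to the left end \<open>c\<close> of its
  component. There the value is one of the boundary terms that \<open>N\<close> dominates, and the
  change on the way is at most the integral of the modulus of the derivative.\<close>

lemma slice_boundary_bound:
  assumes t: "t \<in> S"
  shows "ennreal \<bar>\<psi> t\<bar> \<le> (\<integral>\<^sup>+s. indicator S s * ennreal \<bar>\<psi>' s\<bar> \<partial>lborel) + N"
proof -
  obtain C where C: "C \<in> components S" "t \<in> C"
    using t by (metis Union_components UnionE)
  obtain c d where cd: "c < d" "C = {c<..<d}" "c \<in> frontier S"
    using component_of_bounded_open_real[OF S C(1)] by metis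
  have ct: "c \<le> t" "{c<..<t} \<subseteq> S"
    using C cd(2) in_components_subset[OF C(1)] by auto
  note inc = interval_increment[OF ct(1)]
  have "\<bar>\<psi> t\<bar> \<le> \<bar>LINT s|lborel. indicator {c<..<t} s *\<^sub>R \<psi>' s\<bar> + \<bar>\<psi> c\<bar>"
    unfolding inc(1) by linarith
  also have "\<bar>LINT s|lborel. indicator {c<..<t} s *\<^sub>R \<psi>' s\<bar> \<le> (LINT s|lborel. norm (indicator {c<..<t} s *\<^sub>R \<psi>' s))"
    using integral_norm_bound[of lborel "\<lambda>s. indicator {c<..<t} s *\<^sub>R \<psi>' s"] by simp
  finally have "ennreal \<bar>\<psi> t\<bar> \<le> ennreal (LINT s|lborel. norm (indicator {c<..<t} s *\<^sub>R \<psi>' s)) + ennreal \<bar>\<psi> c\<bar>"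
    by (simp add: ennreal_plus[symmetric] del: ennreal_plus)
  also have "ennreal (LINT s|lborel. norm (indicator {c<..<t} s *\<^sub>R \<psi>' s)) = (\<integral>\<^sup>+s. ennreal (norm (indicator {c<..<t} s *\<^sub>R \<psi>' s)) \<partial>lborel)"
    using inc(2) by (intro nn_integral_eq_integral[symmetric]) (auto simp: set_integrable_def)
  also have "\<dots> \<le> (\<integral>\<^sup>+s. indicator S s * ennreal \<bar>\<psi>' s\<bar> \<partial>lborel)"
    using ct(2) by (intro nn_integral_mono) (auto simp: indicator_def)
  also have "ennreal \<bar>\<psi> c\<bar> \<le> N" using N[of "{c}"] cd(3) by simp
  finally show ?thesis by (simp add: add_mono)
qed

text \<open>The fundamental theorem of calculus on each component leaves its two end values.
  Distinct components have distinct left ends and distinct right ends, so each family is dominated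
  by \<open>N\<close>; a point may be the right end of one component and the left end of another,
  hence 2 \<open>N\<close>. Positive and negative parts stay on different sides so that nothing is
  subtracted in \<open>ennreal\<close>.\<close>

lemma slice_divergence_bound:
  "(\<integral>\<^sup>+s. indicator S s * ennreal (\<psi>' s) \<partial>lborel) \<le> (\<integral>\<^sup>+s. indicator S s * ennreal (- \<psi>' s) \<partial>lborel) + 2 * N"
proof -
  let ?\<C> = "components S"
  have cnt: "countable ?\<C>"
    using pairwise_disjoint_components[of S]
    by (intro countable_disjoint_open_subsets open_components[OF S(1)]) (auto simp: disjnt_def pairwise_def)
  have "\<forall>C\<in>?\<C>. \<exists>c d. c < d \<and> C = {c<..<d} \<and> c \<in> frontier S \<and> d \<in> frontier S"
    using component_of_bounded_open_real[OF S] by metis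
  then obtain l u where lu: "\<And>C. C \<in> ?\<C> \<Longrightarrow> l C < u C" "\<And>C. C \<in> ?\<C> \<Longrightarrow> C = {l C<..<u C}"
    and fr: "\<And>C. C \<in> ?\<C> \<Longrightarrow> l C \<in> frontier S" "\<And>C. C \<in> ?\<C> \<Longrightarrow> u C \<in> frontier S" by metis
  have disj: "C = C'" if "C \<in> ?\<C>" "C' \<in> ?\<C>" "t \<in> C" "t \<in> C'" for C C' t
    using components_nonoverlap[OF that(1,2)] that(3,4) by blast
  have inj_l: "inj_on l ?\<C>"
  proof (rule inj_onI)
    fix C C' assume C: "C \<in> ?\<C>" "C' \<in> ?\<C>" "l C = l C'"
    define t where "t = (l C + min (u C) (u C')) / 2"
    have "l C < t" "t < u C" "t < u C'" using lu(1)[OF C(1)] lu(1)[OF C(2)] C(3) by (auto simp: t_def min_def)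
    then have "t \<in> {l C<..<u C}" "t \<in> {l C'<..<u C'}" using C(3) by auto
    then show "C = C'" using disj[OF C(1,2)] lu(2)[OF C(1)] lu(2)[OF C(2)] by blast
  qed
  have inj_u: "inj_on u ?\<C>"
  proof (rule inj_onI)
    fix C C' assume C: "C \<in> ?\<C>" "C' \<in> ?\<C>" "u C = u C'"
    define t where "t = (u C + max (l C) (l C')) / 2"
    have "t < u C" "l C < t" "l C' < t" using lu(1)[OF C(1)] lu(1)[OF C(2)] C(3) by (auto simp: t_def max_def)
    then have "t \<in> {l C<..<u C}" "t \<in> {l C'<..<u C'}" using C(3) by auto
    then show "C = C'" using disj[OF C(1,2)] lu(2)[OF C(1)] lu(2)[OF C(2)] by blast
  qed
  \<comment> \<open>The components are disjoint and countably many; the sum over them is written as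
    an integral for the counting measure.\<close>
  have split: "(\<integral>\<^sup>+s. indicator S s * f s \<partial>lborel) = (\<integral>\<^sup>+C. \<integral>\<^sup>+s. indicator C s * f s \<partial>lborel \<partial>count_space ?\<C>)"
    if [measurable]: "f \<in> borel_measurable borel" for f :: "real \<Rightarrow> ennreal"
  proof -
    have "indicator S s * f s = (\<integral>\<^sup>+C. indicator C s * f s \<partial>count_space ?\<C>)" for s
    proof (cases "s \<in> S")
      case True
      then obtain C where C: "C \<in> ?\<C>" "s \<in> C" by (metis Union_components UnionE)
      have "(\<integral>\<^sup>+C'. indicator C' s * f s \<partial>count_space ?\<C>) = (\<integral>\<^sup>+C'. f s * indicator {C} C' \<partial>count_space ?\<C>)"
        using C disj by (intro nn_integral_cong) (auto simp: indicator_def)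
      also have "\<dots> = f s * emeasure (count_space ?\<C>) {C}" using C by (intro nn_integral_cmult_indicator) auto
      finally show ?thesis using True C(1) by simp
    next
      case False
      then have "indicator C s = (0::ennreal)" if "C \<in> ?\<C>" for C
        using in_components_subset[OF that] by (auto simp: indicator_def)
      then have "(\<integral>\<^sup>+C. indicator C s * f s \<partial>count_space ?\<C>) = (\<integral>\<^sup>+C. 0 \<partial>count_space ?\<C>)"
        by (intro nn_integral_cong) simp
      then show ?thesis using False by simp
    qed
    then have "(\<integral>\<^sup>+s. indicator S s * f s \<partial>lborel) = (\<integral>\<^sup>+s. (\<integral>\<^sup>+C. indicator C s * f s \<partial>count_space ?\<C>) \<partial>lborel)"
      by simp
    also have "\<dots> = (\<integral>\<^sup>+C. (\<integral>\<^sup>+s. indicator C s * f s \<partial>lborel) \<partial>count_space ?\<C>)"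
    proof (rule nn_integral_count_space_nn_integral[OF cnt])
      fix C assume "C \<in> ?\<C>"
      then have "C \<in> sets borel" using lu(2) by (metis greaterThanLessThan_borel)
      then show "(\<lambda>s. indicator C s * f s) \<in> borel_measurable lborel" by simp
    qed
    finally show ?thesis .
  qed
  have comp: "(\<integral>\<^sup>+s. indicator C s * ennreal (\<psi>' s) \<partial>lborel)
      \<le> (\<integral>\<^sup>+s. indicator C s * ennreal (- \<psi>' s) \<partial>lborel) + (ennreal \<bar>\<psi> (l C)\<bar> + ennreal \<bar>\<psi> (u C)\<bar>)"
    if C: "C \<in> ?\<C>" for C
  proof -
    note inc = interval_increment[OF less_imp_le[OF lu(1)[OF C]], folded lu(2)[OF C]]
    define h where "h s = indicator C s *\<^sub>R \<psi>' s" for s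
    have h: "integrable lborel h" using inc(2) by (simp add: h_def[abs_def] set_integrable_def)
    have p: "integrable lborel (\<lambda>s. max 0 (h s))" "integrable lborel (\<lambda>s. max 0 (- h s))"
      using h by (auto intro!: Bochner_Integration.integrable_max)
    have n: "(\<integral>\<^sup>+s. indicator C s * ennreal (\<psi>' s) \<partial>lborel) = ennreal (LINT s|lborel. max 0 (h s))"
      by (subst nn_integral_eq_integral[symmetric, OF p(1)], simp)
        (intro nn_integral_cong, simp add: h_def indicator_def max_def ennreal_neg)
    have n': "(\<integral>\<^sup>+s. indicator C s * ennreal (- \<psi>' s) \<partial>lborel) = ennreal (LINT s|lborel. max 0 (- h s))"
      by (subst nn_integral_eq_integral[symmetric, OF p(2)], simp)
        (intro nn_integral_cong, simp add: h_def indicator_def max_def ennreal_neg)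
    have "(LINT s|lborel. max 0 (h s)) - (LINT s|lborel. max 0 (- h s)) = (LINT s|lborel. max 0 (h s) - max 0 (- h s))"
      by (rule Bochner_Integration.integral_diff[symmetric]) (use p in auto)
    also have "\<dots> = (LINT s|lborel. h s)" by (intro Bochner_Integration.integral_cong) (auto simp: max_def)
    also have "\<dots> = \<psi> (u C) - \<psi> (l C)" using inc(1) by (simp add: h_def)
    finally have "(LINT s|lborel. max 0 (h s)) \<le> (LINT s|lborel. max 0 (- h s)) + (\<bar>\<psi> (l C)\<bar> + \<bar>\<psi> (u C)\<bar>)"
      by linarith
    then show ?thesis
      unfolding n n' by (simp add: ennreal_plus[symmetric] del: ennreal_plus)
  qed
  have bdry: "(\<integral>\<^sup>+C. ennreal \<bar>\<psi> (e C)\<bar> \<partial>count_space ?\<C>) \<le> N"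
    if e: "inj_on e ?\<C>" "\<And>C. C \<in> ?\<C> \<Longrightarrow> e C \<in> frontier S" for e
  proof (rule nn_integral_count_space_le[OF cnt])
    fix B assume B: "finite B" "B \<subseteq> ?\<C>"
    have "(\<Sum>C\<in>B. ennreal \<bar>\<psi> (e C)\<bar>) = ennreal (\<Sum>t\<in>e ` B. \<bar>\<psi> t\<bar>)"
      using inj_on_subset[OF e(1) B(2)] by (simp add: sum.reindex)
    also have "\<dots> \<le> N" using B e(2) by (intro N) auto
    finally show "(\<Sum>C\<in>B. ennreal \<bar>\<psi> (e C)\<bar>) \<le> N" .
  qed
  have "(\<integral>\<^sup>+s. indicator S s * ennreal (\<psi>' s) \<partial>lborel)
      = (\<integral>\<^sup>+C. \<integral>\<^sup>+s. indicator C s * ennreal (\<psi>' s) \<partial>lborel \<partial>count_space ?\<C>)"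
    by (rule split) measurable
  also have "\<dots> \<le> (\<integral>\<^sup>+C. (\<integral>\<^sup>+s. indicator C s * ennreal (- \<psi>' s) \<partial>lborel) + (ennreal \<bar>\<psi> (l C)\<bar> + ennreal \<bar>\<psi> (u C)\<bar>) \<partial>count_space ?\<C>)"
    using comp by (intro nn_integral_mono) simp
  also have "\<dots> = (\<integral>\<^sup>+C. (\<integral>\<^sup>+s. indicator C s * ennreal (- \<psi>' s) \<partial>lborel) \<partial>count_space ?\<C>)
      + ((\<integral>\<^sup>+C. ennreal \<bar>\<psi> (l C)\<bar> \<partial>count_space ?\<C>) + (\<integral>\<^sup>+C. ennreal \<bar>\<psi> (u C)\<bar> \<partial>count_space ?\<C>))"
    by (simp add: nn_integral_add)
  also have "(\<integral>\<^sup>+C. (\<integral>\<^sup>+s. indicator C s * ennreal (- \<psi>' s) \<partial>lborel) \<partial>count_space ?\<C>)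
      = (\<integral>\<^sup>+s. indicator S s * ennreal (- \<psi>' s) \<partial>lborel)"
    by (rule split[symmetric]) measurable
  also have "(\<integral>\<^sup>+C. ennreal \<bar>\<psi> (l C)\<bar> \<partial>count_space ?\<C>) + (\<integral>\<^sup>+C. ennreal \<bar>\<psi> (u C)\<bar> \<partial>count_space ?\<C>) \<le> N + N"
    by (intro add_mono bdry inj_l inj_u fr)
  finally show ?thesis by (simp add: mult_2 add_left_mono)
qed

end


section \<open>Coverings of the boundary and majorants on lines\<close>

lemma hausdorff_weight_mono: "V \<subseteq> U \<Longrightarrow> bounded U \<Longrightarrow> hausdorff_weight s V \<le> hausdorff_weight s U"
  unfolding hausdorff_weight_def
  by (auto intro!: ennreal_leI mult_left_mono power_mono divide_right_mono diameter_subset diameter_ge_0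
      unit_ball_vol_nonneg intro: bounded_subset)

text \<open>A weighted covering: on each dyadic layer \<open>2\<^sup>k \<le> f < 2\<^sup>k\<^sup>+\<^sup>1\<close> the measure is finite, and the layer
  is covered by sets whose total weight is close to it.\<close>

lemma hausdorff_weighted_cover:
  fixes f :: "'a::metric_space \<Rightarrow> real"
  assumes K: "K \<in> sets borel" and f [measurable]: "f \<in> borel_measurable borel"
    and I: "(\<integral>\<^sup>+x. ennreal (f x) * indicator K x \<partial>hausdorff_measure s) < \<infinity>"
    and \<delta>: "0 < \<delta>" and \<epsilon>: "0 < \<epsilon>"
  shows "\<exists>U c. (\<forall>i::nat. bounded (U i) \<and> diameter (U i) \<le> \<delta>) \<and> (\<forall>i. 0 \<le> (c i :: real)) \<and>
           {x \<in> K. 0 < f x} \<subseteq> (\<Union>i. U i) \<and> (\<forall>i. \<forall>x\<in>U i. f x \<le> c i) \<and>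
           (\<Sum>i. ennreal (c i) * hausdorff_weight s (U i))
             \<le> 2 * (\<integral>\<^sup>+x. ennreal (f x) * indicator K x \<partial>hausdorff_measure s) + ennreal \<epsilon>"
proof -
  let ?H = "hausdorff_measure s :: 'a measure"
  let ?I = "\<integral>\<^sup>+x. ennreal (f x) * indicator K x \<partial>?H"
  have sH: "sets ?H = sets borel" "space ?H = UNIV" by (simp_all add: hausdorff_measure_def sets.sigma_sets_eq[of borel, simplified])
  have fH [measurable]: "f \<in> borel_measurable ?H" and KH [measurable]: "K \<in> sets ?H"
    using f K by (simp_all add: sH measurable_def)
  \<comment> \<open>The layers are indexed by integers; \<open>int_decode\<close> turns this into a
    sequence.\<close>
  define p :: "nat \<Rightarrow> real" where "p k = 2 powr real_of_int (int_decode k)" for k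
  define L where "L k = {x \<in> K. 0 < f x \<and> \<lfloor>log 2 (f x)\<rfloor> = int_decode k}" for k
  have p: "0 < p k" for k by (simp add: p_def)
  have L_iff: "x \<in> L k \<longleftrightarrow> x \<in> K \<and> p k \<le> f x \<and> f x < 2 * p k" for x k
  proof (cases "0 < f x")
    case True
    have "\<lfloor>log 2 (f x)\<rfloor> = int_decode k \<longleftrightarrow>
        real_of_int (int_decode k) \<le> log 2 (f x) \<and> log 2 (f x) < real_of_int (int_decode k) + 1"
      by (simp add: floor_eq_iff)
    also have "\<dots> \<longleftrightarrow> p k \<le> f x \<and> f x < 2 * p k"
      using True by (simp add: p_def le_log_iff log_less_iff powr_add mult.commute)
    finally show ?thesis using True by (auto simp: L_def)
  next
    case False
    then show ?thesis using p[of k] by (auto simp: L_def)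
  qed
  have Lb: "L k \<in> sets borel" for k
  proof -
    have "L k = K \<inter> {x \<in> space borel. p k \<le> f x \<and> f x < 2 * p k}" using L_iff by auto
    moreover have "{x \<in> space borel. p k \<le> f x \<and> f x < 2 * p k} \<in> sets borel" by measurable
    ultimately show ?thesis using K by auto
  qed
  have L_disj: "disjoint_family L"
    by (auto simp: disjoint_family_on_def L_def dest: injD[OF bij_is_inj[OF bij_int_decode]])
  define D where "D = density ?H (\<lambda>x. ennreal (f x) * indicator K x)"
  have D: "emeasure D A = (\<integral>\<^sup>+x. ennreal (f x) * indicator K x * indicator A x \<partial>?H)" if "A \<in> sets borel" for A
    unfolding D_def using that by (intro emeasure_density) (auto simp: sH)
  have "(\<Sum>k. emeasure D (L k)) = emeasure D (\<Union>k. L k)"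
    using Lb L_disj by (intro suminf_emeasure) (auto simp: D_def sH)
  also have "\<dots> \<le> emeasure D (space D)" by (rule emeasure_space)
  also have "\<dots> = ?I" using D[of UNIV] by (simp add: D_def sH)
  finally have sumD: "(\<Sum>k. emeasure D (L k)) \<le> ?I" .
  have HL: "ennreal (p k) * hausdorff_outer s (L k) \<le> emeasure D (L k)" for k
  proof -
    have "ennreal (p k) * hausdorff_outer s (L k) = (\<integral>\<^sup>+x. ennreal (p k) * indicator (L k) x \<partial>?H)"
      using Lb[of k] by (subst nn_integral_cmult_indicator) (auto simp: sH emeasure_hausdorff_measure)
    also have "\<dots> \<le> (\<integral>\<^sup>+x. ennreal (f x) * indicator K x * indicator (L k) x \<partial>?H)"
      using L_iff p by (intro nn_integral_mono) (auto simp: indicator_def intro!: ennreal_leI)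
    also have "\<dots> = emeasure D (L k)" by (rule D[OF Lb, symmetric])
    finally show ?thesis .
  qed
  \<comment> \<open>The weights on layer \<open>k\<close> are later multiplied by the constant 2
    \<open>p k\<close>. Dividing by it leaves the error \<epsilon> / 2^(k+1), and these errors add
    up to \<epsilon>.\<close>
  define tol where "tol k = \<epsilon> * (1/2) ^ Suc k / (2 * p k)" for k
  have tol: "0 < tol k" for k using \<epsilon> p by (simp add: tol_def)
  have "\<exists>V\<in>hausdorff_covers \<delta> (L k). (\<Sum>j. hausdorff_weight s (V j)) \<le> hausdorff_outer s (L k) + ennreal (tol k)" for k
  proof -
    have "ennreal (p k) * hausdorff_outer s (L k) \<le> ?I"
      using HL[of k] sumD emeasure_mono[of "L k" "space D" D] \<open>emeasure D (space D) = ?I\<close>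
      by (metis emeasure_space order_trans)
    then have "ennreal (p k) * hausdorff_outer s (L k) \<noteq> \<infinity>" using I by auto
    then have fin: "hausdorff_outer s (L k) < top" using p[of k] by (auto simp: ennreal_mult_eq_top_iff less_top)
    have "hausdorff_premeasure s \<delta> (L k) \<le> hausdorff_outer s (L k)" by (rule hausdorff_premeasure_le_outer[OF \<delta>])
    also have "\<dots> < hausdorff_outer s (L k) + ennreal (tol k)"
      using fin tol[of k]
      by (cases "hausdorff_outer s (L k)") (auto simp: ennreal_plus[symmetric] ennreal_lessI simp del: ennreal_plus)
    finally show ?thesis unfolding hausdorff_premeasure_def by (auto simp: INF_less_iff intro: less_imp_le)
  qed
  then obtain V where V: "\<And>k. V k \<in> hausdorff_covers \<delta> (L k)"
    and VH: "\<And>k. (\<Sum>j. hausdorff_weight s (V k j)) \<le> hausdorff_outer s (L k) + ennreal (tol k)" by metis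
  have Vb: "bounded (V k j)" "diameter (V k j) \<le> \<delta>" "L k \<subseteq> (\<Union>j. V k j)" for k j
    using V[of k] by (auto simp: hausdorff_covers_def)
  \<comment> \<open>Intersecting with the layer makes f \<le> 2 \<open>p k\<close> true on the whole
    covering set. As f \<ge> \<open>p k\<close> there, the constant loses a factor of at most 2,
    which is the 2 in the bound.\<close>
  define U where "U i = (case prod_decode i of (k, j) \<Rightarrow> V k j \<inter> L k)" for i
  define c where "c i = (case prod_decode i of (k, j) \<Rightarrow> 2 * p k)" for i
  have Ub: "bounded (U i) \<and> diameter (U i) \<le> \<delta>" for i
  proof -
    obtain k j where kj: "prod_decode i = (k, j)" by force
    have "diameter (V k j \<inter> L k) \<le> diameter (V k j)" by (rule diameter_subset[OF Int_lower1 Vb(1)])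
    then show ?thesis using Vb(1,2)[of k j] kj by (auto simp: U_def intro: bounded_subset)
  qed
  moreover have "0 \<le> c i" for i using p by (auto simp: c_def less_imp_le split: prod.split)
  moreover have "{x \<in> K. 0 < f x} \<subseteq> (\<Union>i. U i)"
  proof
    fix x assume x: "x \<in> {x \<in> K. 0 < f x}"
    obtain k where "int_decode k = \<lfloor>log 2 (f x)\<rfloor>" using surj_int_decode by (metis surjD)
    then have "x \<in> L k" using x by (simp add: L_def)
    moreover from this obtain j where "x \<in> V k j" using Vb(3) by blast
    ultimately have "x \<in> U (prod_encode (k, j))" by (simp add: U_def)
    then show "x \<in> (\<Union>i. U i)" by blast
  qed
  moreover have "\<forall>x\<in>U i. f x \<le> c i" for i
    using L_iff by (auto simp: U_def c_def less_imp_le split: prod.splits)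
  moreover have "(\<Sum>i. ennreal (c i) * hausdorff_weight s (U i)) \<le> 2 * ?I + ennreal \<epsilon>"
  proof -
    have "(\<Sum>i. ennreal (c i) * hausdorff_weight s (U i))
        = (\<Sum>k. \<Sum>j. ennreal (2 * p k) * hausdorff_weight s (V k j \<inter> L k))"
      using suminf_ennreal_2dimen[of "\<lambda>k. \<Sum>j. ennreal (2 * p k) * hausdorff_weight s (V k j \<inter> L k)"
          "\<lambda>(k, j). ennreal (2 * p k) * hausdorff_weight s (V k j \<inter> L k)"]
      by (simp add: U_def c_def o_def split_beta)
    also have "\<dots> \<le> (\<Sum>k. 2 * emeasure D (L k) + ennreal (\<epsilon> * (1/2) ^ Suc k))"
    proof (rule suminf_le)
      fix k
      have "(\<Sum>j. ennreal (2 * p k) * hausdorff_weight s (V k j \<inter> L k))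
          \<le> (\<Sum>j. ennreal (2 * p k) * hausdorff_weight s (V k j))"
        by (intro suminf_le mult_left_mono hausdorff_weight_mono Vb) auto
      also have "\<dots> = ennreal (2 * p k) * (\<Sum>j. hausdorff_weight s (V k j))" by simp
      also have "\<dots> \<le> ennreal (2 * p k) * (hausdorff_outer s (L k) + ennreal (tol k))"
        by (intro mult_left_mono VH) simp
      also have "\<dots> = 2 * (ennreal (p k) * hausdorff_outer s (L k)) + ennreal (2 * p k * tol k)"
        using p[of k] tol[of k] by (simp add: distrib_left ennreal_mult mult.assoc)
      also have "2 * p k * tol k = \<epsilon> * (1/2) ^ Suc k" using p[of k] by (simp add: tol_def)
      also have "2 * (ennreal (p k) * hausdorff_outer s (L k)) \<le> 2 * emeasure D (L k)"
        by (intro mult_left_mono HL) simp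
      finally show "(\<Sum>j. ennreal (2 * p k) * hausdorff_weight s (V k j \<inter> L k))
          \<le> 2 * emeasure D (L k) + ennreal (\<epsilon> * (1/2) ^ Suc k)" by (simp add: add_mono)
    qed auto
    also have "\<dots> = 2 * (\<Sum>k. emeasure D (L k)) + (\<Sum>k. ennreal (\<epsilon> * (1/2) ^ Suc k))"
      by (subst suminf_add[symmetric]) auto
    also have "(\<Sum>k. ennreal (\<epsilon> * (1/2) ^ Suc k)) = ennreal \<epsilon>"
      using sums_mult[OF power_half_series, of \<epsilon>] \<epsilon> by (intro suminf_ennreal_eq) auto
    also have "2 * (\<Sum>k. emeasure D (L k)) \<le> 2 * ?I" by (intro mult_left_mono sumD) simp
    finally show ?thesis by (simp add: add_right_mono)
  qed
  ultimately show ?thesis by blast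
qed

lemma finite_separated:
  fixes B :: "'a::metric_space set"
  assumes "finite B"
  shows "\<exists>d>0. \<forall>y\<in>B. \<forall>z\<in>B. y \<noteq> z \<longrightarrow> d \<le> dist y z"
proof -
  define D where "D = insert 1 ((\<lambda>(y, z). dist y z) ` {(y, z) \<in> B \<times> B. y \<noteq> z})"
  have "finite {(y, z) \<in> B \<times> B. y \<noteq> z}" by (rule finite_subset[of _ "B \<times> B"]) (use assms in auto)
  then have "finite D" "D \<noteq> {}" by (auto simp: D_def)
  then have "0 < Min D" by (subst Min_gr_iff) (auto simp: D_def)
  moreover have "Min D \<le> dist y z" if "y \<in> B" "z \<in> B" "y \<noteq> z" for y z
    using that \<open>finite D\<close> by (intro Min_le) (auto simp: D_def)
  ultimately show ?thesis by blast
qed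

text \<open>A Borel cylinder in direction \<open>b\<close> that contains every line in this
  direction that meets \<open>U\<close>. Its cross section is a cube around some point of
  \<open>U\<close> with half side \<open>diameter U\<close>, so that its size is comparable to the
  Hausdorff weight of \<open>U\<close>.\<close>

definition strip :: "'a::euclidean_space \<Rightarrow> 'a set \<Rightarrow> 'a set" where
  "strip b U = (if U = {} then {} else {x. \<forall>a\<in>Basis - {b}. \<bar>(x - (SOME y. y \<in> U)) \<bullet> a\<bar> \<le> diameter U})"

lemma strip_borel [measurable]: "strip b U \<in> sets borel"
proof (cases "U = {}")
  case False
  have "closed (\<Inter>a\<in>Basis - {b}. {x. \<bar>(x - y) \<bullet> a\<bar> \<le> d})" for y :: 'a and d
    by (intro closed_INT ballI closed_Collect_le continuous_intros)
  moreover have "{x. \<forall>a\<in>Basis - {b}. \<bar>(x - y) \<bullet> a\<bar> \<le> d} = (\<Inter>a\<in>Basis - {b}. {x. \<bar>(x - y) \<bullet> a\<bar> \<le> d})"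
    for y :: 'a and d by blast
  ultimately have "closed {x. \<forall>a\<in>Basis - {b}. \<bar>(x - y) \<bullet> a\<bar> \<le> d}" for y :: 'a and d
    by (simp only:)
  then show ?thesis using False by (simp add: strip_def borel_closed)
qed (simp add: strip_def)

lemma strip_translate: "b \<in> Basis \<Longrightarrow> x + t *\<^sub>R b \<in> strip b U \<longleftrightarrow> x \<in> strip b U"
  by (auto simp: strip_def inner_diff_left inner_add_left inner_Basis)

lemma strip_contains_lines:
  assumes b: "b \<in> Basis" and U: "bounded U" "x + t *\<^sub>R b \<in> U"
  shows "x \<in> strip b U"
proof -
  define y where "y = (SOME y. y \<in> U)"
  have y: "y \<in> U" unfolding y_def using U(2) by (rule someI)
  have "\<bar>(x + t *\<^sub>R b - y) \<bullet> a\<bar> \<le> diameter U" if "a \<in> Basis" for a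
    using Basis_le_norm[OF that, of "x + t *\<^sub>R b - y"] diameter_bounded_bound[OF U(1,2) y]
    by (simp add: dist_norm)
  then have "x + t *\<^sub>R b \<in> strip b U" using y by (auto simp: strip_def y_def[symmetric])
  then show ?thesis using strip_translate[OF b] by blast
qed

text \<open>The slab cuts the cylinder to length 1, so the volume is at most that of a cube of side
  2 d in dimension s = \<open>DIM('a) - 1\<close>. The constant compares (2 d)^s = 4^s (d / 2)^s
  with the weight, which is (d / 2)^s times the volume of the unit ball.\<close>

lemma emeasure_slab_strip:
  assumes b: "b \<in> (Basis :: 'a::euclidean_space set)" and U: "bounded U"
  shows "emeasure lborel (slab b \<inter> strip b U)
    \<le> ennreal (4 ^ (DIM('a) - 1) / unit_ball_vol (real (DIM('a) - 1))) * hausdorff_weight (DIM('a) - 1) U"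
proof (cases "U = {}")
  case False
  let ?s = "DIM('a) - 1"
  define y where "y = (SOME y. y \<in> U)"
  define d where "d = diameter U"
  have d: "0 \<le> d" using U by (simp add: d_def diameter_ge_0)
  define lo where "lo = (\<Sum>a\<in>Basis. (if a = b then 0 else y \<bullet> a - d) *\<^sub>R a)"
  define hi where "hi = (\<Sum>a\<in>Basis. (if a = b then 1 else y \<bullet> a + d) *\<^sub>R a)"
  have lohi: "lo \<bullet> a = (if a = b then 0 else y \<bullet> a - d)" "hi \<bullet> a = (if a = b then 1 else y \<bullet> a + d)"
    if "a \<in> Basis" for a using that by (simp_all add: lo_def hi_def)
  have "slab b \<inter> strip b U \<subseteq> cbox lo hi"
  proof
    fix x assume x: "x \<in> slab b \<inter> strip b U"
    have "lo \<bullet> a \<le> x \<bullet> a \<and> x \<bullet> a \<le> hi \<bullet> a" if a: "a \<in> Basis" for a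
    proof (cases "a = b")
      case True
      then show ?thesis using x lohi[OF a] by (simp add: slab_def)
    next
      case False
      then have "\<bar>(x - y) \<bullet> a\<bar> \<le> d" using x a \<open>U \<noteq> {}\<close> by (simp add: strip_def y_def d_def)
      then show ?thesis using lohi[OF a] False by (simp add: inner_diff_left abs_le_iff)
    qed
    then show "x \<in> cbox lo hi" by (simp add: mem_box)
  qed
  then have "emeasure lborel (slab b \<inter> strip b U) \<le> emeasure lborel (cbox lo hi)"
    by (intro emeasure_mono) auto
  also have "\<dots> = ennreal (\<Prod>a\<in>Basis. (hi - lo) \<bullet> a)"
    using d lohi by (intro emeasure_lborel_cbox) auto
  also have "(\<Prod>a\<in>Basis. (hi - lo) \<bullet> a) = (\<Prod>a\<in>Basis. if a = b then 1 else 2 * d)"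
    using lohi by (intro prod.cong) (auto simp: inner_diff_left)
  also have "\<dots> = (\<Prod>a\<in>Basis - {b}. if a = b then 1 else 2 * d)"
    by (subst prod.remove[OF finite_Basis b]) simp
  also have "\<dots> = (\<Prod>a\<in>Basis - {b}. 2 * d)" by (intro prod.cong) auto
  also have "\<dots> = (2 * d) ^ ?s" using b by (simp add: card_Diff_singleton)
  also have "\<dots> = 4 ^ ?s / unit_ball_vol ?s * (unit_ball_vol ?s * (d / 2) ^ ?s)"
  proof -
    have "(2 * d) ^ ?s = 4 ^ ?s * (d / 2) ^ ?s" unfolding power_mult_distrib[symmetric] by simp
    moreover have "0 < u \<Longrightarrow> p / u * (u * q) = p * q" for p q u :: real by simp
    ultimately show ?thesis using unit_ball_vol_pos[of "real ?s"] by (metis of_nat_0_le_iff)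
  qed
  finally show ?thesis
    using False d by (simp add: hausdorff_weight_def d_def ennreal_mult[symmetric])
qed (simp add: strip_def)

text \<open>The 2 is the loss from the dyadic layers, the quotient the loss from enclosing covering
  sets in cubes.\<close>

definition slice_const :: "nat \<Rightarrow> real" where
  "slice_const n = 2 * (4 ^ (n - 1) / unit_ball_vol (real (n - 1)))"

lemma slice_const_nonneg: "0 \<le> slice_const n"
  by (simp add: slice_const_def)

text \<open>An Eilenberg type inequality for the projection along \<open>b\<close>; the majorant \<open>N\<close> stands for the
  upper integrand, which need not be measurable.\<close>

lemma line_majorant:
  fixes f :: "'a::euclidean_space \<Rightarrow> real"
  assumes b: "b \<in> Basis" and K: "K \<in> sets borel" and f: "f \<in> borel_measurable borel" "\<And>x. 0 \<le> f x"
    and I: "(\<integral>\<^sup>+x. ennreal (f x) * indicator K x \<partial>hausdorff_measure (DIM('a) - 1)) < \<infinity>"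
  shows "\<exists>N. N \<in> borel_measurable borel \<and> (\<forall>x t. N (x + t *\<^sub>R b) = N x) \<and>
     (\<forall>x B. finite B \<longrightarrow> B \<subseteq> K \<longrightarrow> (\<forall>y\<in>B. \<exists>t. y = x + t *\<^sub>R b) \<longrightarrow> ennreal (\<Sum>y\<in>B. f y) \<le> N x) \<and>
     (\<integral>\<^sup>+x. indicator (slab b) x * N x \<partial>lborel)
       \<le> ennreal (slice_const DIM('a)) * (\<integral>\<^sup>+x. ennreal (f x) * indicator K x \<partial>hausdorff_measure (DIM('a) - 1))"
proof -
  let ?s = "DIM('a) - 1"
  let ?I = "\<integral>\<^sup>+x. ennreal (f x) * indicator K x \<partial>hausdorff_measure ?s"
  define \<kappa> where "\<kappa> = 4 ^ ?s / unit_ball_vol (real ?s)"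
  have \<kappa>: "0 \<le> \<kappa>" by (simp add: \<kappa>_def)
  obtain r where r: "?I = ennreal r" "0 \<le> r" using I by (cases ?I) auto
  \<comment> \<open>The n-th weighted cover has mesh and error 1 / (n + 1).\<close>
  define Q where "Q n U c \<longleftrightarrow> (\<forall>i::nat. bounded (U i) \<and> diameter (U i) \<le> 1 / Suc n) \<and> (\<forall>i. 0 \<le> (c i :: real)) \<and>
           {x \<in> K. 0 < f x} \<subseteq> (\<Union>i. U i) \<and> (\<forall>i. \<forall>x\<in>U i. f x \<le> c i) \<and>
           (\<Sum>i. ennreal (c i) * hausdorff_weight ?s (U i)) \<le> 2 * ?I + ennreal (1 / Suc n)" for n U c
  have "\<exists>U c. Q n U c" for n
    unfolding Q_def by (rule hausdorff_weighted_cover[OF K f(1) I]) auto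
  then obtain U c where "\<And>n. Q n (U n) (c n)" by metis
  note Q = this[unfolded Q_def]
  have U: "bounded (U n i)" "diameter (U n i) \<le> 1 / Suc n" and c: "0 \<le> c n i"
    and cov: "{x \<in> K. 0 < f x} \<subseteq> (\<Union>i. U n i)" and fc: "x \<in> U n i \<Longrightarrow> f x \<le> c n i"
    and sum: "(\<Sum>i. ennreal (c n i) * hausdorff_weight ?s (U n i)) \<le> 2 * ?I + ennreal (1 / Suc n)" for n i x
    using Q[of n] by blast+
  \<comment> \<open>Each covering set is charged with its constant to all lines that run through its
    cylinder.\<close>
  define g where "g n x = (\<Sum>i. ennreal (c n i) * indicator (strip b (U n i)) x)" for n x
  have g [measurable]: "g n \<in> borel_measurable borel" for n unfolding g_def[abs_def] by measurable
  have g_int: "(\<integral>\<^sup>+x. indicator (slab b) x * g n x \<partial>lborel) \<le> ennreal (\<kappa> * (2 * r + 1 / Suc n))" for n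
  proof -
    have "(\<integral>\<^sup>+x. indicator (slab b) x * g n x \<partial>lborel)
        = (\<integral>\<^sup>+x. (\<Sum>i. ennreal (c n i) * indicator (slab b \<inter> strip b (U n i)) x) \<partial>lborel)"
      unfolding g_def by (intro nn_integral_cong) (auto simp: indicator_def)
    also have "\<dots> = (\<Sum>i. ennreal (c n i) * emeasure lborel (slab b \<inter> strip b (U n i)))"
      by (subst nn_integral_suminf) (auto simp: nn_integral_cmult_indicator)
    also have "\<dots> \<le> (\<Sum>i. ennreal \<kappa> * (ennreal (c n i) * hausdorff_weight ?s (U n i)))"
    proof (rule suminf_le)
      fix i
      have "ennreal (c n i) * emeasure lborel (slab b \<inter> strip b (U n i))
          \<le> ennreal (c n i) * (ennreal \<kappa> * hausdorff_weight ?s (U n i))"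
        unfolding \<kappa>_def by (intro mult_left_mono emeasure_slab_strip b U) simp
      then show "ennreal (c n i) * emeasure lborel (slab b \<inter> strip b (U n i))
          \<le> ennreal \<kappa> * (ennreal (c n i) * hausdorff_weight ?s (U n i))" by (simp add: mult_ac)
    qed auto
    also have "\<dots> = ennreal \<kappa> * (\<Sum>i. ennreal (c n i) * hausdorff_weight ?s (U n i))" by simp
    also have "\<dots> \<le> ennreal \<kappa> * (2 * ?I + ennreal (1 / Suc n))" by (intro mult_left_mono sum) simp
    also have "\<dots> = ennreal (\<kappa> * (2 * r + 1 / Suc n))"
    proof -
      have "2 * ?I + ennreal (1 / Suc n) = ennreal (2 * r + 1 / Suc n)"
        unfolding r(1) using r(2) by (subst ennreal_plus) (auto simp: ennreal_mult)
      then show ?thesis using r(2) \<kappa> by (simp only:) (rule ennreal_mult[symmetric], simp_all)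
    qed
    finally show ?thesis .
  qed
  \<comment> \<open>The lower limit suits both sides: Fatou's lemma bounds its integral, and a lower
    bound valid for all large \<open>n\<close> passes to it.\<close>
  define N where "N x = liminf (\<lambda>n. g n x)" for x
  have "N \<in> borel_measurable borel" unfolding N_def[abs_def] by measurable
  moreover have "N (x + t *\<^sub>R b) = N x" for x t
    by (simp add: N_def g_def indicator_def strip_translate[OF b])
  moreover have "ennreal (\<Sum>y\<in>B. f y) \<le> N x" if B: "finite B" "B \<subseteq> K" "\<forall>y\<in>B. \<exists>t. y = x + t *\<^sub>R b" for x B
  proof -
    \<comment> \<open>The covers only reach points where \<open>f\<close> is positive; the other
      points contribute 0 to the sum.\<close>
    define B' where "B' = {y \<in> B. 0 < f y}"
    have B': "finite B'" "B' \<subseteq> {x \<in> K. 0 < f x}" using B by (auto simp: B'_def)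
    have "(\<Sum>y\<in>B. f y) = (\<Sum>y\<in>B'. f y)"
      using B(1) f(2) by (intro sum.mono_neutral_right) (auto simp: B'_def less_le)
    obtain d where d: "0 < d" "\<And>y z. y \<in> B' \<Longrightarrow> z \<in> B' \<Longrightarrow> y \<noteq> z \<Longrightarrow> d \<le> dist y z"
      using finite_separated[OF B'(1)] by metis
    obtain m where m: "1 / Suc m < d" using nat_approx_posE[OF d(1)] by metis
    have "ennreal (\<Sum>y\<in>B'. f y) \<le> g n x" if n: "m \<le> n" for n
    proof -
      have "\<forall>y\<in>B'. \<exists>i. y \<in> U n i" using cov[of n] B'(2) by blast
      then obtain \<iota> where \<iota>: "\<And>y. y \<in> B' \<Longrightarrow> y \<in> U n (\<iota> y)" by metis
      \<comment> \<open>Once the mesh is below the distance between the points, each of them lies in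
        a covering set of its own, so the terms of \<open>g n\<close> are not counted twice.\<close>
      have inj: "inj_on \<iota> B'"
      proof (rule inj_onI, rule ccontr)
        fix y z assume yz: "y \<in> B'" "z \<in> B'" "\<iota> y = \<iota> z" "y \<noteq> z"
        have "z \<in> U n (\<iota> y)" using \<iota>[OF yz(2)] yz(3) by simp
        then have "dist y z \<le> 1 / Suc n"
          using diameter_bounded_bound[OF U(1) \<iota>[OF yz(1)]] U(2)[of n "\<iota> y"] by (meson order_trans)
        also have "\<dots> \<le> 1 / Suc m" using n by (intro divide_left_mono) auto
        finally show False using d(2)[OF yz(1,2,4)] m by linarith
      qed
      have "ennreal (\<Sum>y\<in>B'. f y) = (\<Sum>y\<in>B'. ennreal (f y))" using f(2) by simp
      also have "\<dots> \<le> (\<Sum>y\<in>B'. ennreal (c n (\<iota> y)) * indicator (strip b (U n (\<iota> y))) x)"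
      proof (rule sum_mono)
        fix y assume y: "y \<in> B'"
        then obtain t where "y = x + t *\<^sub>R b" using B(3) by (auto simp: B'_def)
        then have "x \<in> strip b (U n (\<iota> y))" using strip_contains_lines[OF b U(1)] \<iota>[OF y] by metis
        then show "ennreal (f y) \<le> ennreal (c n (\<iota> y)) * indicator (strip b (U n (\<iota> y))) x"
          using fc[OF \<iota>[OF y]] by (simp add: ennreal_leI)
      qed
      also have "\<dots> = (\<Sum>i\<in>\<iota> ` B'. ennreal (c n i) * indicator (strip b (U n i)) x)"
        by (simp add: sum.reindex[OF inj])
      also have "\<dots> \<le> g n x" unfolding g_def using B'(1) by (intro sum_le_suminf) auto
      finally show ?thesis .
    qed
    then have "\<forall>\<^sub>F n in sequentially. ennreal (\<Sum>y\<in>B'. f y) \<le> g n x"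
      by (auto simp: eventually_sequentially)
    then show ?thesis
      unfolding N_def \<open>(\<Sum>y\<in>B. f y) = (\<Sum>y\<in>B'. f y)\<close> by (rule Liminf_bounded)
  qed
  moreover have "(\<integral>\<^sup>+x. indicator (slab b) x * N x \<partial>lborel) \<le> ennreal (slice_const DIM('a)) * ?I"
  proof -
    have "(\<integral>\<^sup>+x. indicator (slab b) x * N x \<partial>lborel) = (\<integral>\<^sup>+x. liminf (\<lambda>n. indicator (slab b) x * g n x) \<partial>lborel)"
      by (intro nn_integral_cong) (auto simp: N_def indicator_def Liminf_const)
    also have "\<dots> \<le> liminf (\<lambda>n. \<integral>\<^sup>+x. indicator (slab b) x * g n x \<partial>lborel)"
      by (rule nn_integral_liminf) measurable
    also have "\<dots> \<le> liminf (\<lambda>n. ennreal (\<kappa> * (2 * r + 1 / Suc n)))"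
      by (intro Liminf_mono always_eventually allI g_int)
    also have "\<dots> = ennreal (\<kappa> * (2 * r + 0))"
    proof (rule lim_imp_Liminf)
      have "(\<lambda>n. 1 / real (Suc n)) \<longlonglongrightarrow> 0"
        using LIMSEQ_inverse_real_of_nat by (simp add: inverse_eq_divide)
      then show "(\<lambda>n. ennreal (\<kappa> * (2 * r + 1 / Suc n))) \<longlonglongrightarrow> ennreal (\<kappa> * (2 * r + 0))"
        by (intro tendsto_ennrealI tendsto_mult tendsto_add tendsto_const)
    qed simp
    also have "\<dots> = ennreal (slice_const DIM('a)) * ?I"
      unfolding r(1) using r(2) \<kappa> by (simp add: slice_const_def \<kappa>_def ennreal_mult[symmetric])
    finally show ?thesis .
  qed
  ultimately show ?thesis by blast
qed

section \<open>Divergence and Ladyzhenskaya inequalities with boundary terms\<close>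

definition boundary_integral :: "'a::euclidean_space set \<Rightarrow> ('a \<Rightarrow> real) \<Rightarrow> ennreal" where
  "boundary_integral \<Omega> f = (\<integral>\<^sup>+x. ennreal (f x) * indicator (frontier \<Omega>) x \<partial>hausdorff_measure (DIM('a) - 1))"

lemma smooth_line_derivative:
  assumes "smooth \<phi>"
  shows "((\<lambda>t. \<phi> (x + t *\<^sub>R b)) has_real_derivative partial b \<phi> (x + t *\<^sub>R b)) (at t)"
proof -
  have d: "(\<phi> has_derivative (\<lambda>h. partial h \<phi> (x + t *\<^sub>R b))) (at (x + t *\<^sub>R b))"
    by (rule smooth_has_derivative[OF assms])
  have "((\<lambda>t. x + t *\<^sub>R b) has_derivative (\<lambda>h. h *\<^sub>R b)) (at t)"
    by (auto intro!: derivative_eq_intros)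
  from has_derivative_compose[OF this d]
  have "((\<lambda>t. \<phi> (x + t *\<^sub>R b)) has_derivative (\<lambda>h. partial (h *\<^sub>R b) \<phi> (x + t *\<^sub>R b))) (at t)" .
  moreover have "partial (h *\<^sub>R b) \<phi> (x + t *\<^sub>R b) = partial b \<phi> (x + t *\<^sub>R b) * h" for h
    using linear_scale[OF has_derivative_linear[OF d], of h b] by simp
  ultimately show ?thesis by (simp add: has_field_derivative_def)
qed

lemma smooth_measurable: "smooth f \<Longrightarrow> f \<in> borel_measurable borel"
  by (rule borel_measurable_continuous_onI[OF smooth_continuous])

context
  fixes \<Omega> :: "'a::euclidean_space set" and x b :: 'a
  assumes \<Omega>: "open \<Omega>" "bounded \<Omega>" and b: "b \<in> Basis"
begin

lemma line_slice_open: "open {t. x + t *\<^sub>R b \<in> \<Omega>}"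
  using open_vimage[OF \<Omega>(1), of "\<lambda>t. x + t *\<^sub>R b"] by (simp add: vimage_def continuous_intros)

lemma line_slice_bounded: "bounded {t. x + t *\<^sub>R b \<in> \<Omega>}"
proof -
  obtain R where R: "\<And>y. y \<in> \<Omega> \<Longrightarrow> norm y \<le> R" using \<Omega>(2) by (auto simp: bounded_iff)
  have "norm t \<le> R + norm x" if "x + t *\<^sub>R b \<in> \<Omega>" for t
  proof -
    have "norm (t *\<^sub>R b) \<le> norm (x + t *\<^sub>R b) + norm x"
      using norm_triangle_ineq4[of "x + t *\<^sub>R b" x] by simp
    then show ?thesis using R[OF that] b by simp
  qed
  then show ?thesis by (auto simp: bounded_iff)
qed

text \<open>A frontier point of the slice is a limit of parameters whose points lie in the open set,
  while its own point does not lie there.\<close>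

lemma line_slice_frontier: "t \<in> frontier {t. x + t *\<^sub>R b \<in> \<Omega>} \<Longrightarrow> x + t *\<^sub>R b \<in> frontier \<Omega>"
proof -
  let ?S = "{t. x + t *\<^sub>R b \<in> \<Omega>}"
  assume "t \<in> frontier ?S"
  then have t: "t \<in> closure ?S" "t \<notin> ?S" using interior_open[OF line_slice_open] by (auto simp: frontier_def)
  have "(\<lambda>t. x + t *\<^sub>R b) ` closure ?S \<subseteq> closure \<Omega>"
    by (rule image_closure_subset) (auto intro!: continuous_intros intro: subsetD[OF closure_subset])
  then show ?thesis using t interior_open[OF \<Omega>(1)] by (auto simp: frontier_def)
qed

lemma line_slice_sum:
  assumes N: "\<And>B. finite B \<Longrightarrow> B \<subseteq> frontier \<Omega> \<Longrightarrow> (\<forall>y\<in>B. \<exists>t. y = x + t *\<^sub>R b) \<Longrightarrow> ennreal (\<Sum>y\<in>B. f y) \<le> N"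
    and B: "finite B" "B \<subseteq> frontier {t. x + t *\<^sub>R b \<in> \<Omega>}"
  shows "ennreal (\<Sum>t\<in>B. f (x + t *\<^sub>R b)) \<le> N"
proof -
  have inj: "inj_on (\<lambda>t. x + t *\<^sub>R b) B" using b by (auto simp: inj_on_def)
  have "ennreal (\<Sum>y\<in>(\<lambda>t. x + t *\<^sub>R b) ` B. f y) \<le> N"
    using B line_slice_frontier by (intro N) auto
  then show ?thesis by (simp add: sum.reindex[OF inj])
qed

end

context
  fixes \<Omega> :: "'a::euclidean_space set" and \<phi> :: "'a \<Rightarrow> real" and b :: 'a
  assumes \<Omega>: "open \<Omega>" "bounded \<Omega>" and b: "b \<in> Basis" and \<phi>: "smooth \<phi>"
    and fin: "boundary_integral \<Omega> (\<lambda>x. \<bar>\<phi> x\<bar>) < \<infinity>"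
begin

lemma boundary_line_majorant:
  "\<exists>N. N \<in> borel_measurable borel \<and> (\<forall>x t. N (x + t *\<^sub>R b) = N x) \<and>
     (\<forall>x B. finite B \<longrightarrow> B \<subseteq> frontier \<Omega> \<longrightarrow> (\<forall>y\<in>B. \<exists>t. y = x + t *\<^sub>R b) \<longrightarrow> ennreal (\<Sum>y\<in>B. \<bar>\<phi> y\<bar>) \<le> N x) \<and>
     (\<integral>\<^sup>+x. indicator (slab b) x * N x \<partial>lborel) \<le> ennreal (slice_const DIM('a)) * boundary_integral \<Omega> (\<lambda>x. \<bar>\<phi> x\<bar>)"
  unfolding boundary_integral_def using fin smooth_measurable[OF \<phi>]
  by (intro line_majorant b) (auto simp: boundary_integral_def)

lemma partial_measurable [measurable]: "partial b \<phi> \<in> borel_measurable borel"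
  by (rule smooth_measurable[OF smooth_partial[OF \<phi> b]])

lemma open_measurable [measurable]: "\<Omega> \<in> sets borel"
  using \<Omega>(1) by (rule borel_open)

lemma line_partial_continuous: "continuous_on UNIV (\<lambda>t. partial b \<phi> (x + t *\<^sub>R b))"
  by (rule continuous_on_compose2[OF smooth_continuous[OF smooth_partial[OF \<phi> b], of UNIV]])
    (auto intro!: continuous_intros)

text \<open>The bound on slices, integrated over the slab, which represents every line once with
  length 1.\<close>

lemma divergence_one_sided:
  "(\<integral>\<^sup>+x. indicator \<Omega> x * ennreal (partial b \<phi> x) \<partial>lborel)
    \<le> (\<integral>\<^sup>+x. indicator \<Omega> x * ennreal (- partial b \<phi> x) \<partial>lborel)
      + 2 * (ennreal (slice_const DIM('a)) * boundary_integral \<Omega> (\<lambda>x. \<bar>\<phi> x\<bar>))"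
proof -
  obtain N where N [measurable]: "N \<in> borel_measurable borel"
    and sum: "\<And>x B. finite B \<Longrightarrow> B \<subseteq> frontier \<Omega> \<Longrightarrow> (\<forall>y\<in>B. \<exists>t. y = x + t *\<^sub>R b) \<Longrightarrow> ennreal (\<Sum>y\<in>B. \<bar>\<phi> y\<bar>) \<le> N x"
    and int: "(\<integral>\<^sup>+x. indicator (slab b) x * N x \<partial>lborel) \<le> ennreal (slice_const DIM('a)) * boundary_integral \<Omega> (\<lambda>x. \<bar>\<phi> x\<bar>)"
    using boundary_line_majorant by blast
  define F where "F s x = indicator \<Omega> x * ennreal (s * partial b \<phi> x)" for s x
  have F [measurable]: "F s \<in> borel_measurable borel" for s unfolding F_def[abs_def] by measurable
  have slice: "(\<integral>\<^sup>+t. F 1 (x + t *\<^sub>R b) \<partial>lborel) \<le> (\<integral>\<^sup>+t. F (-1) (x + t *\<^sub>R b) \<partial>lborel) + 2 * N x" for x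
  proof -
    let ?S = "{t. x + t *\<^sub>R b \<in> \<Omega>}"
    have "(\<integral>\<^sup>+t. indicator ?S t * ennreal (partial b \<phi> (x + t *\<^sub>R b)) \<partial>lborel)
        \<le> (\<integral>\<^sup>+t. indicator ?S t * ennreal (- partial b \<phi> (x + t *\<^sub>R b)) \<partial>lborel) + 2 * N x"
      by (rule slice_divergence_bound[OF line_slice_open[OF \<Omega>] line_slice_bounded[OF \<Omega> b]
            smooth_line_derivative[OF \<phi>] line_partial_continuous line_slice_sum[OF \<Omega> b sum]]) (rule b)
    then show ?thesis by (simp add: F_def indicator_def)
  qed
  have "(\<integral>\<^sup>+x. F 1 x \<partial>lborel) = (\<integral>\<^sup>+x. indicator (slab b) x * (\<integral>\<^sup>+t. F 1 (x + t *\<^sub>R b) \<partial>lborel) \<partial>lborel)"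
    by (rule nn_integral_slab[OF F b, symmetric])
  also have "\<dots> \<le> (\<integral>\<^sup>+x. indicator (slab b) x * (\<integral>\<^sup>+t. F (-1) (x + t *\<^sub>R b) \<partial>lborel) + 2 * (indicator (slab b) x * N x) \<partial>lborel)"
    using slice by (intro nn_integral_mono) (auto simp: indicator_def)
  also have "\<dots> = (\<integral>\<^sup>+x. indicator (slab b) x * (\<integral>\<^sup>+t. F (-1) (x + t *\<^sub>R b) \<partial>lborel) \<partial>lborel)
      + 2 * (\<integral>\<^sup>+x. indicator (slab b) x * N x \<partial>lborel)"
    by (subst nn_integral_add) (auto simp: nn_integral_cmult)
  also have "(\<integral>\<^sup>+x. indicator (slab b) x * (\<integral>\<^sup>+t. F (-1) (x + t *\<^sub>R b) \<partial>lborel) \<partial>lborel) = (\<integral>\<^sup>+x. F (-1) x \<partial>lborel)"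
    by (rule nn_integral_slab[OF F b])
  also have "2 * (\<integral>\<^sup>+x. indicator (slab b) x * N x \<partial>lborel) \<le> 2 * (ennreal (slice_const DIM('a)) * boundary_integral \<Omega> (\<lambda>x. \<bar>\<phi> x\<bar>))"
    by (intro mult_left_mono int) simp
  finally show ?thesis by (simp add: F_def add_left_mono)
qed

text \<open>\<open>A\<close> is the variation of \<phi> along the whole line inside the set plus the
  boundary majorant of that line. It depends on the line only and dominates \<phi> at all points of
  the set on it.\<close>

lemma slice_sup_majorant:
  "\<exists>A. A \<in> borel_measurable borel \<and> (\<forall>x t. A (x + t *\<^sub>R b) = A x) \<and> (\<forall>x\<in>\<Omega>. ennreal \<bar>\<phi> x\<bar> \<le> A x) \<and>
     (\<integral>\<^sup>+x. indicator (slab b) x * A x \<partial>lborel)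
       \<le> (\<integral>\<^sup>+x. indicator \<Omega> x * ennreal \<bar>partial b \<phi> x\<bar> \<partial>lborel)
         + ennreal (slice_const DIM('a)) * boundary_integral \<Omega> (\<lambda>x. \<bar>\<phi> x\<bar>)"
proof -
  obtain N where N [measurable]: "N \<in> borel_measurable borel" and inv: "\<And>x t. N (x + t *\<^sub>R b) = N x"
    and sum: "\<And>x B. finite B \<Longrightarrow> B \<subseteq> frontier \<Omega> \<Longrightarrow> (\<forall>y\<in>B. \<exists>t. y = x + t *\<^sub>R b) \<Longrightarrow> ennreal (\<Sum>y\<in>B. \<bar>\<phi> y\<bar>) \<le> N x"
    and int: "(\<integral>\<^sup>+x. indicator (slab b) x * N x \<partial>lborel) \<le> ennreal (slice_const DIM('a)) * boundary_integral \<Omega> (\<lambda>x. \<bar>\<phi> x\<bar>)"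
    using boundary_line_majorant by blast
  define F where "F x = indicator \<Omega> x * ennreal \<bar>partial b \<phi> x\<bar>" for x
  have F [measurable]: "F \<in> borel_measurable borel" unfolding F_def[abs_def] by measurable
  define A where "A x = (\<integral>\<^sup>+t. F (x + t *\<^sub>R b) \<partial>lborel) + N x" for x
  have "A \<in> borel_measurable borel" unfolding A_def[abs_def] by measurable
  moreover have "A (x + t *\<^sub>R b) = A x" for x t
  proof -
    have "(\<integral>\<^sup>+s. F (x + t *\<^sub>R b + s *\<^sub>R b) \<partial>lborel) = (\<integral>\<^sup>+s. F (x + (s + t) *\<^sub>R b) \<partial>lborel)"
      by (simp add: algebra_simps)
    also have "\<dots> = (\<integral>\<^sup>+s. F (x + s *\<^sub>R b) \<partial>lborel)"
      by (rule nn_integral_lborel_translate) measurable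
    finally show ?thesis by (simp add: A_def inv)
  qed
  moreover have "ennreal \<bar>\<phi> x\<bar> \<le> A x" if "x \<in> \<Omega>" for x
  proof -
    let ?S = "{t. x + t *\<^sub>R b \<in> \<Omega>}"
    have "ennreal \<bar>\<phi> (x + 0 *\<^sub>R b)\<bar> \<le> (\<integral>\<^sup>+t. indicator ?S t * ennreal \<bar>partial b \<phi> (x + t *\<^sub>R b)\<bar> \<partial>lborel) + N x"
      by (rule slice_boundary_bound[OF line_slice_open[OF \<Omega>] line_slice_bounded[OF \<Omega> b]
            smooth_line_derivative[OF \<phi>] line_partial_continuous line_slice_sum[OF \<Omega> b sum]]) (use that b in simp_all)
    then show ?thesis by (simp add: A_def F_def indicator_def)
  qed
  moreover have "(\<integral>\<^sup>+x. indicator (slab b) x * A x \<partial>lborel) \<le> (\<integral>\<^sup>+x. F x \<partial>lborel)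
         + ennreal (slice_const DIM('a)) * boundary_integral \<Omega> (\<lambda>x. \<bar>\<phi> x\<bar>)"
  proof -
    have "(\<integral>\<^sup>+x. indicator (slab b) x * A x \<partial>lborel)
        = (\<integral>\<^sup>+x. indicator (slab b) x * (\<integral>\<^sup>+t. F (x + t *\<^sub>R b) \<partial>lborel) + indicator (slab b) x * N x \<partial>lborel)"
      by (simp add: A_def distrib_left)
    also have "\<dots> = (\<integral>\<^sup>+x. indicator (slab b) x * (\<integral>\<^sup>+t. F (x + t *\<^sub>R b) \<partial>lborel) \<partial>lborel)
        + (\<integral>\<^sup>+x. indicator (slab b) x * N x \<partial>lborel)"
      by (subst nn_integral_add) auto
    also have "(\<integral>\<^sup>+x. indicator (slab b) x * (\<integral>\<^sup>+t. F (x + t *\<^sub>R b) \<partial>lborel) \<partial>lborel) = (\<integral>\<^sup>+x. F x \<partial>lborel)"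
      by (rule nn_integral_slab[OF F b])
    finally show ?thesis using int by (simp add: add_left_mono)
  qed
  ultimately show ?thesis unfolding F_def by blast
qed

end

lemma smooth_integrable_bounded:
  fixes f :: "'a::euclidean_space \<Rightarrow> real"
  assumes f: "smooth f" and \<Omega>: "open \<Omega>" "bounded \<Omega>"
  shows "integrable lborel (\<lambda>x. indicator \<Omega> x *\<^sub>R f x)"
proof -
  have "set_integrable lborel (closure \<Omega>) f"
    unfolding set_integrable_def
    by (rule borel_integrable_compact) (use \<Omega> smooth_continuous[OF f] in \<open>auto simp: compact_closure\<close>)
  then have "set_integrable lborel \<Omega> f"
    by (rule set_integrable_subset) (use \<Omega> closure_subset in auto)
  then show ?thesis by (simp add: set_integrable_def)
qed

lemma LINT_lebesgue_on_borel:
  fixes f :: "'a::euclidean_space \<Rightarrow> real"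
  assumes "\<Omega> \<in> sets borel" "f \<in> borel_measurable borel"
  shows "(LINT x|lebesgue_on \<Omega>. f x) = (LINT x|lborel. indicator \<Omega> x *\<^sub>R f x)"
  using assms by (simp add: integral_restrict_space integral_completion)

text \<open>The one-sided estimate for \<phi> and for -\<phi>. This inequality takes the place of
  the divergence theorem: small boundary integrals make the integral of a derivative small.\<close>

lemma divergence_boundary_bound:
  fixes \<phi> :: "'a::euclidean_space \<Rightarrow> real"
  assumes \<Omega>: "open \<Omega>" "bounded \<Omega>" and b: "b \<in> Basis" and \<phi>: "smooth \<phi>"
    and fin: "boundary_integral \<Omega> (\<lambda>x. \<bar>\<phi> x\<bar>) < \<infinity>"
  shows "\<bar>LINT x|lebesgue_on \<Omega>. partial b \<phi> x\<bar> \<le> 2 * slice_const DIM('a) * enn2real (boundary_integral \<Omega> (\<lambda>x. \<bar>\<phi> x\<bar>))"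
proof -
  define I where "I = enn2real (boundary_integral \<Omega> (\<lambda>x. \<bar>\<phi> x\<bar>))"
  have I: "boundary_integral \<Omega> (\<lambda>x. \<bar>\<phi> x\<bar>) = ennreal I" "0 \<le> I" using fin by (auto simp: I_def)
  have neg: "partial b (\<lambda>x. - 1 * \<phi> x) = (\<lambda>x. - partial b \<phi> x)"
  proof -
    have "partial b (\<lambda>x::'a. - 1 :: real) x = 0" for x by (rule partial_eq[OF has_derivative_const])
    then show ?thesis using smooth_differentiable[OF \<phi>] by (subst partial_mult) auto
  qed
  define h where "h x = indicator \<Omega> x *\<^sub>R partial b \<phi> x" for x
  have h: "integrable lborel h"
    unfolding h_def by (rule smooth_integrable_bounded[OF smooth_partial[OF \<phi> b] \<Omega>])
  have p: "integrable lborel (\<lambda>x. max 0 (h x))" "integrable lborel (\<lambda>x. max 0 (- h x))"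
    using h by (auto intro!: Bochner_Integration.integrable_max)
  have n: "(\<integral>\<^sup>+x. indicator \<Omega> x * ennreal (partial b \<phi> x) \<partial>lborel) = ennreal (LINT x|lborel. max 0 (h x))"
    by (subst nn_integral_eq_integral[symmetric, OF p(1)], simp)
      (intro nn_integral_cong, simp add: h_def indicator_def max_def ennreal_neg)
  have n': "(\<integral>\<^sup>+x. indicator \<Omega> x * ennreal (- partial b \<phi> x) \<partial>lborel) = ennreal (LINT x|lborel. max 0 (- h x))"
    by (subst nn_integral_eq_integral[symmetric, OF p(2)], simp)
      (intro nn_integral_cong, simp add: h_def indicator_def max_def ennreal_neg)
  have c: "2 * (ennreal (slice_const DIM('a)) * ennreal I) = ennreal (2 * slice_const DIM('a) * I)"
    using I(2) slice_const_nonneg by (simp add: ennreal_mult mult.assoc)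
  have ineq: "u \<le> v + k" if "ennreal u \<le> ennreal v + ennreal k" "0 \<le> v" "0 \<le> k" for u v k
    using that by (simp add: ennreal_plus[symmetric] del: ennreal_plus)
  have k0: "0 \<le> 2 * slice_const DIM('a) * I" using I(2) slice_const_nonneg by simp
  have "(LINT x|lborel. max 0 (h x)) \<le> (LINT x|lborel. max 0 (- h x)) + 2 * slice_const DIM('a) * I"
    using divergence_one_sided[OF \<Omega> b \<phi> fin] k0 unfolding n n' I(1) c by (intro ineq) auto
  moreover have "(LINT x|lborel. max 0 (- h x)) \<le> (LINT x|lborel. max 0 (h x)) + 2 * slice_const DIM('a) * I"
    using divergence_one_sided[OF \<Omega> b smooth_cmult[OF \<phi>, of "- 1"]] fin k0
    unfolding neg by (intro ineq) (simp_all add: n n' I(1) c)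
  moreover have "(LINT x|lborel. max 0 (h x)) - (LINT x|lborel. max 0 (- h x)) = (LINT x|lborel. max 0 (h x) - max 0 (- h x))"
    by (rule Bochner_Integration.integral_diff[symmetric]) (fact p)+
  moreover have "\<dots> = (LINT x|lborel. h x)" by (intro Bochner_Integration.integral_cong) (auto simp: max_def)
  moreover have "(LINT x|lebesgue_on \<Omega>. partial b \<phi> x) = (LINT x|lborel. h x)"
    unfolding h_def using \<Omega> smooth_measurable[OF smooth_partial[OF \<phi> b]]
    by (intro LINT_lebesgue_on_borel) auto
  ultimately show ?thesis unfolding I_def[symmetric] by linarith
qed

lemma one_le_emeasure_unit_box:
  "1 \<le> emeasure lborel (\<Inter>b\<in>Basis. slab b :: 'a::euclidean_space set)"
proof -
  have "box 0 One \<subseteq> (\<Inter>b\<in>Basis. slab b :: 'a set)" by (auto simp: slab_def mem_box less_imp_le)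
  then have "emeasure lborel (box 0 One :: 'a set) \<le> emeasure lborel (\<Inter>b\<in>Basis. slab b :: 'a set)"
    by (intro emeasure_mono) auto
  then show ?thesis by (simp add: emeasure_lborel_box)
qed

text \<open>In the plane, the square of \<psi> is at most the product of two majorants, one constant
  along each axis; its integral then factorises into two line integrals, each at most
  \<open>J\<close>. On the line the majorant is a constant at most \<open>J\<close>, and integrating
  its square costs the volume. The factor 1 + volume serves both cases.\<close>

lemma ladyzhenskaya_boundary:
  fixes \<psi> :: "'a::euclidean_space \<Rightarrow> real"
  assumes dim: "DIM('a) \<le> 2" and \<Omega>: "open \<Omega>" "bounded \<Omega>" and \<psi>: "smooth \<psi>"
    and fin: "boundary_integral \<Omega> (\<lambda>x. \<bar>\<psi> x\<bar>) < \<infinity>"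
    and J: "\<And>b. b \<in> Basis \<Longrightarrow> (\<integral>\<^sup>+x. indicator \<Omega> x * ennreal \<bar>partial b \<psi> x\<bar> \<partial>lborel)
         + ennreal (slice_const DIM('a)) * boundary_integral \<Omega> (\<lambda>x. \<bar>\<psi> x\<bar>) \<le> J"
  shows "(\<integral>\<^sup>+x. indicator \<Omega> x * ennreal ((\<psi> x)\<^sup>2) \<partial>lborel) \<le> (1 + emeasure lborel \<Omega>) * J\<^sup>2"
proof -
  have [measurable]: "\<Omega> \<in> sets borel" using \<Omega>(1) by (rule borel_open)
  define P where "P b A \<longleftrightarrow> A \<in> borel_measurable borel \<and> (\<forall>x t. A (x + t *\<^sub>R b) = A x) \<and>
     (\<forall>x\<in>\<Omega>. ennreal \<bar>\<psi> x\<bar> \<le> A x) \<and> (\<integral>\<^sup>+x. indicator (slab b) x * A x \<partial>lborel) \<le> J" for b and A :: "'a \<Rightarrow> ennreal"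
  have "\<exists>A. P b A" if b: "b \<in> Basis" for b
  proof -
    obtain A where A: "A \<in> borel_measurable borel" "\<forall>x t. A (x + t *\<^sub>R b) = A x" "\<forall>x\<in>\<Omega>. ennreal \<bar>\<psi> x\<bar> \<le> A x"
      "(\<integral>\<^sup>+x. indicator (slab b) x * A x \<partial>lborel) \<le> (\<integral>\<^sup>+x. indicator \<Omega> x * ennreal \<bar>partial b \<psi> x\<bar> \<partial>lborel)
         + ennreal (slice_const DIM('a)) * boundary_integral \<Omega> (\<lambda>x. \<bar>\<psi> x\<bar>)"
      using slice_sup_majorant[OF \<Omega> b \<psi> fin] by (elim exE conjE) (rule that)
    have "P b A" unfolding P_def by (intro conjI A(1,2,3) order_trans[OF A(4) J[OF b]])
    then show ?thesis by (rule exI[of _ A])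
  qed
  then obtain A where A: "\<And>b. b \<in> Basis \<Longrightarrow> P b (A b)" by metis
  have Am: "A b \<in> borel_measurable borel" and inv: "A b (x + t *\<^sub>R b) = A b x"
    and maj: "x \<in> \<Omega> \<Longrightarrow> ennreal \<bar>\<psi> x\<bar> \<le> A b x" and int: "(\<integral>\<^sup>+x. indicator (slab b) x * A b x \<partial>lborel) \<le> J"
    if "b \<in> Basis" for b x t
    using A[OF that] by (simp_all add: P_def)
  have sq: "ennreal ((\<psi> x)\<^sup>2) \<le> A a x * A b x" if "x \<in> \<Omega>" "a \<in> Basis" "b \<in> Basis" for x a b
  proof -
    have "ennreal ((\<psi> x)\<^sup>2) = ennreal \<bar>\<psi> x\<bar> * ennreal \<bar>\<psi> x\<bar>"
      by (simp add: ennreal_mult[symmetric] power2_eq_square)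
    also have "\<dots> \<le> A a x * A b x" using maj that by (intro mult_mono) auto
    finally show ?thesis .
  qed
  have "DIM('a) = 1 \<or> DIM('a) = 2" using dim DIM_positive[where 'a = 'a] by linarith
  then show ?thesis
  proof
    assume "DIM('a) = 1"
    then obtain b where Bb: "(Basis :: 'a set) = {b}" by (auto simp: card_1_singleton_iff)
    have b: "b \<in> Basis" by (simp add: Bb)
    have const: "A b x = A b 0" for x
    proof -
      have "x = 0 + (x \<bullet> b) *\<^sub>R b" using euclidean_representation[of x] by (simp add: Bb)
      then show ?thesis using inv[OF b, of 0 "x \<bullet> b"] by simp
    qed
    \<comment> \<open>The slab has measure at least 1, so the constant majorant is at most its
      integral over the slab.\<close>
    have "A b 0 * 1 \<le> A b 0 * emeasure lborel (slab b)"
      using one_le_emeasure_unit_box[where 'a = 'a] by (intro mult_left_mono) (simp_all add: Bb)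
    also have "\<dots> = (\<integral>\<^sup>+x. indicator (slab b) x * A b x \<partial>lborel)"
    proof -
      have "(\<integral>\<^sup>+x. indicator (slab b) x * A b x \<partial>lborel) = (\<integral>\<^sup>+x. A b 0 * indicator (slab b) x \<partial>lborel)"
      proof (rule nn_integral_cong)
        show "indicator (slab b) x * A b x = A b 0 * indicator (slab b) x" for x
          unfolding const[of x] by (rule mult.commute)
      qed
      also have "\<dots> = A b 0 * emeasure lborel (slab b)" by (rule nn_integral_cmult_indicator) simp
      finally show ?thesis by (rule sym)
    qed
    also have "\<dots> \<le> J" by (rule int[OF b])
    finally have A0: "A b 0 \<le> J" by simp
    have "(\<integral>\<^sup>+x. indicator \<Omega> x * ennreal ((\<psi> x)\<^sup>2) \<partial>lborel) \<le> (\<integral>\<^sup>+x. J\<^sup>2 * indicator \<Omega> x \<partial>lborel)"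
    proof (rule nn_integral_mono)
      fix x
      have "A b x * A b x \<le> J\<^sup>2" using A0 by (simp add: const[of x] power2_eq_square mult_mono)
      then show "indicator \<Omega> x * ennreal ((\<psi> x)\<^sup>2) \<le> J\<^sup>2 * indicator \<Omega> x"
        using sq[OF _ b b, of x] by (auto simp: indicator_def intro: order_trans)
    qed
    also have "\<dots> = J\<^sup>2 * emeasure lborel \<Omega>" by (simp add: nn_integral_cmult_indicator)
    also have "\<dots> \<le> J\<^sup>2 * (1 + emeasure lborel \<Omega>)" by (intro mult_left_mono) auto
    finally show ?thesis by (simp add: mult.commute)
  next
    assume "DIM('a) = 2"
    then obtain a b where B: "(Basis :: 'a set) = {a, b}" "a \<noteq> b" by (auto simp: card_2_iff)
    have ab: "a \<in> Basis" "b \<in> Basis" "a \<bullet> b = 0" "b \<bullet> a = 0" using B inner_not_same_Basis[of a b]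
      by (auto simp: inner_commute)
    note [measurable] = Am[OF ab(1)] Am[OF ab(2)]
    define c where "c = (\<integral>\<^sup>+t. A b (t *\<^sub>R a) \<partial>lborel)"
    have c: "(\<integral>\<^sup>+t. A b (x + t *\<^sub>R a) \<partial>lborel) = c" for x
    proof -
      have x: "x = (x \<bullet> a) *\<^sub>R a + (x \<bullet> b) *\<^sub>R b"
      proof -
        have "x = (\<Sum>b\<in>Basis. (x \<bullet> b) *\<^sub>R b)" by (rule euclidean_representation[symmetric])
        also have "\<dots> = (x \<bullet> a) *\<^sub>R a + (x \<bullet> b) *\<^sub>R b" unfolding B(1) using B(2) by simp
        finally show ?thesis .
      qed
      have "A b (x + t *\<^sub>R a) = A b ((t + x \<bullet> a) *\<^sub>R a)" for t
      proof -
        have "x + t *\<^sub>R a = (t + x \<bullet> a) *\<^sub>R a + (x \<bullet> b) *\<^sub>R b"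
          by (subst x) (simp add: algebra_simps)
        then show ?thesis using inv[OF ab(2)] by simp
      qed
      then have "(\<integral>\<^sup>+t. A b (x + t *\<^sub>R a) \<partial>lborel) = (\<integral>\<^sup>+t. A b ((t + x \<bullet> a) *\<^sub>R a) \<partial>lborel)" by simp
      also have "\<dots> = c" unfolding c_def
        by (rule nn_integral_lborel_translate[of "\<lambda>t. A b (t *\<^sub>R a)" "x \<bullet> a"]) measurable
      finally show ?thesis .
    qed
    \<comment> \<open>The slab integral of \<open>A b\<close> is \<open>c\<close> times the measure
      of the unit square, since \<open>A b\<close> depends on the coordinate along \<open>a\<close>
      only.\<close>
    have "c * 1 \<le> c * emeasure lborel (slab a \<inter> slab b)"
      using one_le_emeasure_unit_box[where 'a = 'a] by (intro mult_left_mono) (simp_all add: B)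
    also have "\<dots> = (\<integral>\<^sup>+x. c * indicator (slab a \<inter> slab b) x \<partial>lborel)" by (simp add: nn_integral_cmult_indicator)
    also have "\<dots> = (\<integral>\<^sup>+x. indicator (slab a) x * (\<integral>\<^sup>+t. indicator (slab b) (x + t *\<^sub>R a) * A b (x + t *\<^sub>R a) \<partial>lborel) \<partial>lborel)"
    proof (rule nn_integral_cong)
      fix x
      have "indicator (slab b) (x + t *\<^sub>R a) = (indicator (slab b) x :: ennreal)" for t
        using ab by (simp add: slab_def indicator_def inner_add_left)
      then show "c * indicator (slab a \<inter> slab b) x
          = indicator (slab a) x * (\<integral>\<^sup>+t. indicator (slab b) (x + t *\<^sub>R a) * A b (x + t *\<^sub>R a) \<partial>lborel)"
        by (simp add: nn_integral_cmult c indicator_inter_arith mult_ac)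
    qed
    also have "\<dots> = (\<integral>\<^sup>+x. indicator (slab b) x * A b x \<partial>lborel)"
      by (rule nn_integral_slab[of "\<lambda>x. indicator (slab b) x * A b x"]) (use ab in measurable)
    also have "\<dots> \<le> J" by (rule int[OF ab(2)])
    finally have cJ: "c \<le> J" by simp
    have "(\<integral>\<^sup>+x. indicator \<Omega> x * ennreal ((\<psi> x)\<^sup>2) \<partial>lborel) \<le> (\<integral>\<^sup>+x. A a x * A b x \<partial>lborel)"
      using sq[OF _ ab(1,2)] by (intro nn_integral_mono) (auto simp: indicator_def)
    also have "\<dots> = (\<integral>\<^sup>+x. indicator (slab a) x * (\<integral>\<^sup>+t. A a (x + t *\<^sub>R a) * A b (x + t *\<^sub>R a) \<partial>lborel) \<partial>lborel)"
      by (rule nn_integral_slab[of "\<lambda>x. A a x * A b x", symmetric]) (use ab in measurable)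
    also have "\<dots> = (\<integral>\<^sup>+x. (indicator (slab a) x * A a x) * c \<partial>lborel)"
      by (simp add: inv[OF ab(1)] nn_integral_cmult c mult.assoc)
    also have "\<dots> = (\<integral>\<^sup>+x. indicator (slab a) x * A a x \<partial>lborel) * c" by (simp add: nn_integral_multc)
    also have "\<dots> \<le> J * J" by (intro mult_mono int ab cJ) auto
    also have "\<dots> = 1 * J\<^sup>2" by (simp add: power2_eq_square)
    also have "\<dots> \<le> (1 + emeasure lborel \<Omega>) * J\<^sup>2" by (intro mult_right_mono) auto
    finally show ?thesis .
  qed
qed

section \<open>Test functions and local integrability\<close>

lemma axis_Basis_real [simp]: "axis i (1::real) \<in> Basis"
  by (auto simp: Basis_vec_def)

lemma test_function_smooth: "test_function \<Omega> \<phi> \<Longrightarrow> smooth \<phi>"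
  by (simp add: test_function_def)

lemma test_function_partial:
  assumes \<phi>: "test_function \<Omega> \<phi>" and b: "b \<in> Basis"
  shows "test_function \<Omega> (partial b \<phi>)"
proof -
  let ?K = "closure {x. \<phi> x \<noteq> 0}"
  have "partial b \<phi> x = 0" if "x \<notin> ?K" for x
  proof -
    have "(\<phi> has_derivative (\<lambda>h. 0)) (at x)"
      by (rule has_derivative_transform_within_open[OF has_derivative_const[of 0], of "- ?K"])
        (use that closure_subset[of "{x. \<phi> x \<noteq> 0}"] in \<open>auto simp: open_Compl\<close>)
    then show ?thesis by (simp add: partial_eq)
  qed
  then have "{x. partial b \<phi> x \<noteq> 0} \<subseteq> ?K" by blast
  then have sub: "closure {x. partial b \<phi> x \<noteq> 0} \<subseteq> ?K" by (rule closure_minimal) simp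
  have K: "compact ?K" "?K \<subseteq> \<Omega>" "smooth \<phi>" using \<phi> unfolding test_function_def by blast+
  have c: "compact (closure {x. partial b \<phi> x \<noteq> 0})"
    unfolding compact_eq_bounded_closed
    by (rule conjI[OF bounded_subset[OF compact_imp_bounded[OF K(1)] sub] closed_closure])
  show ?thesis
    unfolding test_function_def
    by (intro conjI smooth_partial[OF K(3) b] c order_trans[OF sub K(2)])
qed

lemma test_function_zero: "test_function \<Omega> \<phi> \<Longrightarrow> x \<notin> \<Omega> \<Longrightarrow> \<phi> x = 0"
  using closure_subset[of "{x. \<phi> x \<noteq> 0}"] by (auto simp: test_function_def)

lemma locally_integrable_test_function:
  fixes f :: "'a::euclidean_space \<Rightarrow> real"
  assumes f: "locally_integrable \<Omega> f" and \<phi>: "test_function \<Omega> \<phi>" and \<Omega>: "\<Omega> \<in> sets lebesgue"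
  shows "integrable (lebesgue_on \<Omega>) (\<lambda>x. f x * \<phi> x)"
proof -
  let ?K = "closure {x. \<phi> x \<noteq> 0}"
  have K: "compact ?K" "?K \<subseteq> \<Omega>" and sm: "smooth \<phi>" using \<phi> by (auto simp: test_function_def)
  have fi: "integrable (lebesgue_on ?K) f" using f K by (simp add: locally_integrable_def)
  have "bounded (\<phi> ` ?K)" by (intro compact_imp_bounded compact_continuous_image smooth_continuous sm K)
  then obtain B where B: "\<And>x. x \<in> ?K \<Longrightarrow> \<bar>\<phi> x\<bar> \<le> B" by (auto simp: bounded_iff)
  have \<phi>m: "\<phi> \<in> borel_measurable (lebesgue_on ?K)"
    using smooth_measurable[OF sm] by (intro measurable_restrict_space1 measurable_completion) simp
  have "integrable (lebesgue_on ?K) (\<lambda>x. f x * \<phi> x)"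
  proof (rule Bochner_Integration.integrable_bound[OF integrable_mult_right[OF fi, of B]])
    show "AE x in lebesgue_on ?K. norm (f x * \<phi> x) \<le> norm (B * f x)"
    proof (rule AE_I2)
      fix x assume "x \<in> space (lebesgue_on ?K)"
      then have "\<bar>\<phi> x\<bar> \<le> \<bar>B\<bar>" using B[of x] by simp
      then show "norm (f x * \<phi> x) \<le> norm (B * f x)"
        by (simp add: abs_mult mult.commute mult_right_mono)
    qed
  qed (use \<phi>m borel_measurable_integrable[OF fi] in \<open>intro borel_measurable_times\<close>)
  then have "integrable lebesgue (\<lambda>x. indicator ?K x *\<^sub>R (f x * \<phi> x))"
    using K by (subst (asm) integrable_restrict_space) (auto simp: lmeasurable_compact fmeasurableD)
  moreover have "(\<lambda>x. indicator ?K x *\<^sub>R (f x * \<phi> x)) = (\<lambda>x. indicator \<Omega> x *\<^sub>R (f x * \<phi> x))"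
  proof
    show "indicator ?K x *\<^sub>R (f x * \<phi> x) = indicator \<Omega> x *\<^sub>R (f x * \<phi> x)" for x
      using K(2) closure_subset[of "{x. \<phi> x \<noteq> 0}"] by (cases "\<phi> x = 0") (auto simp: indicator_def)
  qed
  ultimately have "integrable lebesgue (\<lambda>x. indicator \<Omega> x *\<^sub>R (f x * \<phi> x))" by (simp only:)
  then show ?thesis using \<Omega> by (subst integrable_restrict_space) auto
qed

lemma locally_integrable_bounded_linear:
  assumes "bounded_linear A" "locally_integrable \<Omega> f"
  shows "locally_integrable \<Omega> (\<lambda>x. A (f x))"
  using assms unfolding locally_integrable_def by (blast intro: integrable_bounded_linear)

lemma locally_integrable_diff:
  "locally_integrable \<Omega> f \<Longrightarrow> locally_integrable \<Omega> g \<Longrightarrow> locally_integrable \<Omega> (\<lambda>x. f x - g x)"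
  unfolding locally_integrable_def by (blast intro: Bochner_Integration.integrable_diff)

section \<open>Weak derivatives and Sobolev spaces\<close>

locale bounded_open =
  fixes \<Omega> :: "(real^'n) set"
  assumes \<Omega>_open: "open \<Omega>" and \<Omega>_bounded: "bounded \<Omega>"
begin

lemma \<Omega>_lmeasurable: "\<Omega> \<in> lmeasurable"
  using \<Omega>_open \<Omega>_bounded by (rule lmeasurable_open[rotated])

lemma \<Omega>_sets: "\<Omega> \<in> sets lebesgue"
  using \<Omega>_lmeasurable by (rule fmeasurableD)

lemma smooth_bounded_on:
  assumes "smooth f"
  obtains B where "0 \<le> B" "\<And>x. x \<in> \<Omega> \<Longrightarrow> \<bar>f x\<bar> \<le> B"
proof -
  have "bounded (f ` closure \<Omega>)"
    using \<Omega>_bounded by (intro compact_imp_bounded compact_continuous_image smooth_continuous assms) (simp add: compact_closure)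
  then obtain B where "\<And>x. x \<in> closure \<Omega> \<Longrightarrow> \<bar>f x\<bar> \<le> B" by (auto simp: bounded_iff)
  then have "\<And>x. x \<in> \<Omega> \<Longrightarrow> \<bar>f x\<bar> \<le> max 0 B" using closure_subset[of \<Omega>] by (meson max.coboundedI2 subsetD)
  then show ?thesis by (intro that[of "max 0 B"]) simp_all
qed

lemma smooth_lebesgue_measurable: "smooth f \<Longrightarrow> f \<in> borel_measurable (lebesgue_on \<Omega>)"
  using smooth_measurable[of f] by (intro measurable_restrict_space1 measurable_completion) simp

lemma smooth_L2:
  assumes f: "smooth f"
  shows "f \<in> L2 \<Omega>"
proof -
  obtain B where "\<And>x. x \<in> \<Omega> \<Longrightarrow> \<bar>f x\<bar> \<le> B" by (rule smooth_bounded_on[OF f]) blast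
  then show ?thesis by (intro L2_bounded[OF \<Omega>_lmeasurable smooth_lebesgue_measurable[OF f], of B]) simp
qed

lemma test_L2: "test_function \<Omega> \<phi> \<Longrightarrow> \<phi> \<in> L2 \<Omega>"
  by (rule smooth_L2[OF test_function_smooth])

lemma L2_loc: "f \<in> L2 \<Omega> \<Longrightarrow> locally_integrable \<Omega> f"
  by (rule locally_integrable_L2[OF _ \<Omega>_sets])

text \<open>The product vanishes on the frontier, so its boundary integral is 0, and the divergence
  bound makes the integral of its derivative 0.\<close>

lemma smooth_integration_by_parts:
  assumes f: "smooth f" and \<phi>: "test_function \<Omega> \<phi>" and b: "b \<in> Basis"
  shows "(LINT x|lebesgue_on \<Omega>. f x * partial b \<phi> x) = - (LINT x|lebesgue_on \<Omega>. partial b f x * \<phi> x)"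
proof -
  have sm: "smooth \<phi>" using \<phi> by (rule test_function_smooth)
  have disj: "frontier \<Omega> \<inter> \<Omega> = {}" using \<Omega>_open by (auto simp: frontier_def interior_open)
  have "boundary_integral \<Omega> (\<lambda>x. \<bar>f x * \<phi> x\<bar>) = (\<integral>\<^sup>+x. 0 \<partial>(hausdorff_measure (DIM(real^'n) - 1) :: (real^'n) measure))"
    unfolding boundary_integral_def
  proof (rule nn_integral_cong)
    fix x
    show "ennreal \<bar>f x * \<phi> x\<bar> * indicator (frontier \<Omega>) x = 0"
      using test_function_zero[OF \<phi>, of x] disj by (cases "x \<in> frontier \<Omega>") auto
  qed
  then have z: "boundary_integral \<Omega> (\<lambda>x. \<bar>f x * \<phi> x\<bar>) = 0" by simp
  have "(LINT x|lebesgue_on \<Omega>. partial b (\<lambda>x. f x * \<phi> x) x) = 0"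
    using divergence_boundary_bound[OF \<Omega>_open \<Omega>_bounded b smooth_mult[OF f sm]] by (simp add: z)
  moreover have "partial b (\<lambda>x. f x * \<phi> x) = (\<lambda>x. f x * partial b \<phi> x + partial b f x * \<phi> x)"
    by (intro partial_mult smooth_differentiable f sm)
  moreover have "integrable (lebesgue_on \<Omega>) (\<lambda>x. f x * partial b \<phi> x)" "integrable (lebesgue_on \<Omega>) (\<lambda>x. partial b f x * \<phi> x)"
    by (intro integrable_L2[OF _ \<Omega>_lmeasurable] smooth_L2 smooth_mult f sm smooth_partial b)+
  ultimately show ?thesis by simp
qed

lemma weak_zero:
  fixes f :: "real^'n \<Rightarrow> real"
  assumes "locally_integrable \<Omega> f" "locally_integrable \<Omega> g"
    and "\<And>\<phi>. test_function \<Omega> \<phi> \<Longrightarrow> (LINT x|lebesgue_on \<Omega>. f x * \<phi> x) = (LINT x|lebesgue_on \<Omega>. g x * \<phi> x)"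
  shows "AE x in lebesgue_on \<Omega>. f x = g x"
proof -
  have "AE x in lebesgue_on \<Omega>. f x - g x = 0"
  proof (rule fundamental_lemma_variations[OF \<Omega>_open])
    show "locally_integrable \<Omega> (\<lambda>x. f x - g x)" by (intro locally_integrable_diff assms)
    fix \<phi> assume \<phi>: "test_function \<Omega> \<phi>"
    note i = locally_integrable_test_function[OF assms(1) \<phi> \<Omega>_sets] locally_integrable_test_function[OF assms(2) \<phi> \<Omega>_sets]
    show "(LINT x|lebesgue_on \<Omega>. (f x - g x) * \<phi> x) = 0"
      unfolding left_diff_distrib using assms(3)[OF \<phi>] by (simp add: Bochner_Integration.integral_diff[OF i])
  qed
  then show ?thesis by simp
qed

lemma weak_gradient_unique:
  assumes "has_weak_gradient \<Omega> u G" "has_weak_gradient \<Omega> u G'"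
  shows "AE x in lebesgue_on \<Omega>. G x = G' x"
proof -
  have "AE x in lebesgue_on \<Omega>. G x $ i = G' x $ i" for i
  proof (rule weak_zero)
    show "locally_integrable \<Omega> (\<lambda>x. G x $ i)" "locally_integrable \<Omega> (\<lambda>x. G' x $ i)"
      using assms by (auto simp: has_weak_gradient_def intro: locally_integrable_bounded_linear[OF bounded_linear_vec_nth])
    fix \<phi> assume \<phi>: "test_function \<Omega> \<phi>"
    have "(LINT x|lebesgue_on \<Omega>. u x * partial (axis i 1) \<phi> x) = - (LINT x|lebesgue_on \<Omega>. H x $ i * \<phi> x)"
      if "has_weak_gradient \<Omega> u H" for H
      using that \<phi> by (simp add: has_weak_gradient_def)
    from this[OF assms(1)] this[OF assms(2)]
    show "(LINT x|lebesgue_on \<Omega>. G x $ i * \<phi> x) = (LINT x|lebesgue_on \<Omega>. G' x $ i * \<phi> x)"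
      by simp
  qed
  then have "AE x in lebesgue_on \<Omega>. \<forall>i\<in>UNIV. G x $ i = G' x $ i"
    by (subst AE_finite_all) auto
  then show ?thesis by (simp add: vec_eq_iff)
qed

lemma weak_divergence_unique:
  assumes "has_weak_divergence \<Omega> F d" "has_weak_divergence \<Omega> F d'"
  shows "AE x in lebesgue_on \<Omega>. d x = d' x"
proof (rule weak_zero)
  fix \<phi> assume \<phi>: "test_function \<Omega> \<phi>"
  have "(LINT x|lebesgue_on \<Omega>. (\<Sum>i\<in>UNIV. F x $ i * partial (axis i 1) \<phi> x)) = - (LINT x|lebesgue_on \<Omega>. e x * \<phi> x)"
    if "has_weak_divergence \<Omega> F e" for e
    using that \<phi> by (simp add: has_weak_divergence_def)
  from this[OF assms(1)] this[OF assms(2)]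
  show "(LINT x|lebesgue_on \<Omega>. d x * \<phi> x) = (LINT x|lebesgue_on \<Omega>. d' x * \<phi> x)"
    by simp
qed (use assms in \<open>auto simp: has_weak_divergence_def\<close>)

abbreviation cls :: "(real^'n \<Rightarrow> 'b::euclidean_space) \<Rightarrow> (real^'n, 'b) l2" where
  "cls \<equiv> to_l2 \<Omega>"

lemmas cls_add = to_l2_add[OF \<Omega>_sets]
  and cls_diff = to_l2_diff[OF \<Omega>_sets]
  and cls_scaleR = to_l2_scaleR[OF \<Omega>_sets]
  and cls_inner = inner_to_l2[OF \<Omega>_sets]
  and cls_norm = norm_to_l2[OF \<Omega>_sets]
  and cls_eq_iff = to_l2_eq_iff[OF \<Omega>_sets]

lemma cls_cmult: "f \<in> L2 \<Omega> \<Longrightarrow> cls (\<lambda>x. c * f x) = c *\<^sub>R cls f" for f :: "real^'n \<Rightarrow> real"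
  using cls_scaleR[of f c] by simp

lemma L2_cmult: "f \<in> L2 \<Omega> \<Longrightarrow> (\<lambda>x. c * f x) \<in> L2 \<Omega>" for f :: "real^'n \<Rightarrow> real"
  using L2_scaleR[of f \<Omega> c] by simp

text \<open>The weak derivatives are characterised by inner products with fixed elements of \<open>L\<^sup>2\<close>, hence
  by conditions that are preserved under linear combinations and limits.\<close>

lemma test_field_L2: "test_function \<Omega> \<phi> \<Longrightarrow> (\<lambda>x. \<phi> x *\<^sub>R axis i 1) \<in> L2 \<Omega>"
  by (rule L2_bounded_linear[OF bounded_linear_scaleR_left test_L2])

lemma test_gradient_L2: "smooth \<phi> \<Longrightarrow> (\<lambda>x. (\<chi> i. partial (axis i 1) \<phi> x) :: real^'n) \<in> L2 \<Omega>"
proof -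
  assume \<phi>: "smooth \<phi>"
  have "(\<lambda>x. \<Sum>i\<in>A. partial (axis i 1) \<phi> x *\<^sub>R axis i 1 :: real^'n) \<in> L2 \<Omega>" if "finite A" for A
    using that
  proof (induction A rule: finite_induct)
    case empty
    show ?case using L2_zero by simp
  next
    case (insert i A)
    have "(\<lambda>x. partial (axis i 1) \<phi> x *\<^sub>R axis i 1 :: real^'n) \<in> L2 \<Omega>"
      by (rule L2_bounded_linear[OF bounded_linear_scaleR_left smooth_L2[OF smooth_partial[OF \<phi>]]]) simp
    from L2_add[OF this insert.IH] show ?case using insert.hyps by simp
  qed
  from this[of UNIV] have "(\<lambda>x. \<Sum>i\<in>UNIV. partial (axis i 1) \<phi> x *\<^sub>R axis i 1 :: real^'n) \<in> L2 \<Omega>" by simp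
  moreover have "(\<Sum>i\<in>UNIV. partial (axis i 1) \<phi> x *\<^sub>R axis i 1) = (\<chi> i. partial (axis i 1) \<phi> x)" for x
    by (simp add: vec_eq_iff axis_def if_distrib cong: if_cong)
  ultimately show ?thesis by simp
qed

lemma has_weak_gradient_L2_iff:
  assumes u: "u \<in> L2 \<Omega>" and G: "G \<in> L2 \<Omega>"
  shows "has_weak_gradient \<Omega> u G \<longleftrightarrow>
    (\<forall>\<phi>. test_function \<Omega> \<phi> \<longrightarrow> (\<forall>i. cls u \<bullet> cls (partial (axis i 1) \<phi>) = - (cls G \<bullet> cls (\<lambda>x. \<phi> x *\<^sub>R axis i 1))))"
proof -
  have "(LINT x|lebesgue_on \<Omega>. u x * partial (axis i 1) \<phi> x) = cls u \<bullet> cls (partial (axis i 1) \<phi>)"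
    "(LINT x|lebesgue_on \<Omega>. G x $ i * \<phi> x) = cls G \<bullet> cls (\<lambda>x. \<phi> x *\<^sub>R axis i 1)"
    if \<phi>: "test_function \<Omega> \<phi>" for \<phi> i
    using cls_inner[OF u test_L2[OF test_function_partial[OF \<phi>]], of "axis i 1"]
      cls_inner[OF G test_field_L2[OF \<phi>], of i]
    by (simp_all add: L2_inner_def inner_axis mult.commute)
  then show ?thesis using L2_loc[OF u] L2_loc[OF G] by (simp add: has_weak_gradient_def)
qed

lemma has_weak_divergence_L2_iff:
  assumes F: "F \<in> L2 \<Omega>" and d: "d \<in> L2 \<Omega>"
  shows "has_weak_divergence \<Omega> F d \<longleftrightarrow>
    (\<forall>\<phi>. test_function \<Omega> \<phi> \<longrightarrow> cls F \<bullet> cls (\<lambda>x. \<chi> i. partial (axis i 1) \<phi> x) = - (cls d \<bullet> cls \<phi>))"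
proof -
  have "(LINT x|lebesgue_on \<Omega>. (\<Sum>i\<in>UNIV. F x $ i * partial (axis i 1) \<phi> x)) = cls F \<bullet> cls (\<lambda>x. \<chi> i. partial (axis i 1) \<phi> x)"
    "(LINT x|lebesgue_on \<Omega>. d x * \<phi> x) = cls d \<bullet> cls \<phi>"
    if \<phi>: "test_function \<Omega> \<phi>" for \<phi>
    using cls_inner[OF F test_gradient_L2[OF test_function_smooth[OF \<phi>]]] cls_inner[OF d test_L2[OF \<phi>]]
    by (simp_all add: L2_inner_def inner_vec_def)
  then show ?thesis using L2_loc[OF F] L2_loc[OF d] by (simp add: has_weak_divergence_def)
qed

lemma has_weak_gradient_linear:
  assumes "u \<in> L2 \<Omega>" "G \<in> L2 \<Omega>" "v \<in> L2 \<Omega>" "H \<in> L2 \<Omega>" "has_weak_gradient \<Omega> u G" "has_weak_gradient \<Omega> v H"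
  shows "has_weak_gradient \<Omega> (\<lambda>x. c * u x + v x) (\<lambda>x. c *\<^sub>R G x + H x)"
  using assms(5,6)
  by (simp add: has_weak_gradient_L2_iff assms(1-4) L2_add L2_scaleR L2_cmult cls_add cls_scaleR cls_cmult inner_add_left)

lemma has_weak_divergence_linear:
  assumes "F \<in> L2 \<Omega>" "d \<in> L2 \<Omega>" "F' \<in> L2 \<Omega>" "d' \<in> L2 \<Omega>" "has_weak_divergence \<Omega> F d" "has_weak_divergence \<Omega> F' d'"
  shows "has_weak_divergence \<Omega> (\<lambda>x. c *\<^sub>R F x + F' x) (\<lambda>x. c * d x + d' x)"
  using assms(5,6)
  by (simp add: has_weak_divergence_L2_iff assms(1-4) L2_add L2_scaleR L2_cmult cls_add cls_scaleR cls_cmult inner_add_left)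

lemma has_weak_gradient_limit:
  assumes "\<And>k. u k \<in> L2 \<Omega>" "\<And>k. G k \<in> L2 \<Omega>" "v \<in> L2 \<Omega>" "H \<in> L2 \<Omega>" "\<And>k. has_weak_gradient \<Omega> (u k) (G k)"
    and "(\<lambda>k. cls (u k)) \<longlonglongrightarrow> cls v" "(\<lambda>k. cls (G k)) \<longlonglongrightarrow> cls H"
  shows "has_weak_gradient \<Omega> v H"
  unfolding has_weak_gradient_L2_iff[OF assms(3,4)]
proof (intro allI impI)
  fix \<phi> :: "real^'n \<Rightarrow> real" and i :: 'n assume \<phi>: "test_function \<Omega> \<phi>"
  have "cls (u k) \<bullet> cls (partial (axis i 1) \<phi>) = - (cls (G k) \<bullet> cls (\<lambda>x. \<phi> x *\<^sub>R axis i 1))" for k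
    using assms(5)[of k] \<phi> by (simp add: has_weak_gradient_L2_iff assms(1,2))
  moreover have "(\<lambda>k. cls (u k) \<bullet> cls (partial (axis i 1) \<phi>)) \<longlonglongrightarrow> cls v \<bullet> cls (partial (axis i 1) \<phi>)"
    by (intro tendsto_inner assms tendsto_const)
  moreover have "(\<lambda>k. - (cls (G k) \<bullet> cls (\<lambda>x. \<phi> x *\<^sub>R axis i 1))) \<longlonglongrightarrow> - (cls H \<bullet> cls (\<lambda>x. \<phi> x *\<^sub>R axis i 1))"
    by (intro tendsto_minus tendsto_inner assms tendsto_const)
  ultimately show "cls v \<bullet> cls (partial (axis i 1) \<phi>) = - (cls H \<bullet> cls (\<lambda>x. \<phi> x *\<^sub>R axis i 1))"
    using LIMSEQ_unique by simp
qed

lemma has_weak_divergence_limit: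
  assumes "\<And>k. F k \<in> L2 \<Omega>" "\<And>k. d k \<in> L2 \<Omega>" "H \<in> L2 \<Omega>" "e \<in> L2 \<Omega>" "\<And>k. has_weak_divergence \<Omega> (F k) (d k)"
    and "(\<lambda>k. cls (F k)) \<longlonglongrightarrow> cls H" "(\<lambda>k. cls (d k)) \<longlonglongrightarrow> cls e"
  shows "has_weak_divergence \<Omega> H e"
  unfolding has_weak_divergence_L2_iff[OF assms(3,4)]
proof (intro allI impI)
  fix \<phi> :: "real^'n \<Rightarrow> real" assume \<phi>: "test_function \<Omega> \<phi>"
  let ?D = "cls (\<lambda>x. \<chi> i. partial (axis i 1) \<phi> x)"
  have "cls (F k) \<bullet> ?D = - (cls (d k) \<bullet> cls \<phi>)" for k
    using assms(5)[of k] \<phi> by (simp add: has_weak_divergence_L2_iff assms(1,2))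
  moreover have "(\<lambda>k. cls (F k) \<bullet> ?D) \<longlonglongrightarrow> cls H \<bullet> ?D"
    by (intro tendsto_inner assms tendsto_const)
  moreover have "(\<lambda>k. - (cls (d k) \<bullet> cls \<phi>)) \<longlonglongrightarrow> - (cls e \<bullet> cls \<phi>)"
    by (intro tendsto_minus tendsto_inner assms tendsto_const)
  ultimately show "cls H \<bullet> ?D = - (cls e \<bullet> cls \<phi>)"
    using LIMSEQ_unique by simp
qed

lemma H1D:
  assumes "u \<in> H1 \<Omega>"
  shows "u \<in> L2 \<Omega>" "weak_gradient \<Omega> u \<in> L2 \<Omega>" "has_weak_gradient \<Omega> u (weak_gradient \<Omega> u)"
  using assms someI_ex[of "has_weak_gradient \<Omega> u"] by (auto simp: H1_def weak_gradient_def)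

lemma H1I:
  assumes "u \<in> L2 \<Omega>" "G \<in> L2 \<Omega>" "has_weak_gradient \<Omega> u G"
  shows "u \<in> H1 \<Omega>" "cls (weak_gradient \<Omega> u) = cls G"
proof -
  have w: "has_weak_gradient \<Omega> u (weak_gradient \<Omega> u)"
    unfolding weak_gradient_def by (rule someI[of _ G]) (rule assms(3))
  note ae = weak_gradient_unique[OF assms(3) w]
  have L: "weak_gradient \<Omega> u \<in> L2 \<Omega>" by (rule L2_cong_AE[OF assms(2) ae \<Omega>_sets])
  then show "u \<in> H1 \<Omega>" using assms(1,3) by (auto simp: H1_def)
  show "cls (weak_gradient \<Omega> u) = cls G" using cls_eq_iff[OF assms(2) L] ae by simp
qed

lemma H2D:
  assumes "u \<in> H2 \<Omega>"
  shows "u \<in> H1 \<Omega>" "weak_laplacian \<Omega> u \<in> L2 \<Omega>" "has_weak_divergence \<Omega> (weak_gradient \<Omega> u) (weak_laplacian \<Omega> u)"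
  using assms someI_ex[of "has_weak_divergence \<Omega> (weak_gradient \<Omega> u)"]
  by (auto simp: H2_def weak_laplacian_def weak_divergence_def)

lemma H2I:
  assumes "u \<in> L2 \<Omega>" "G \<in> L2 \<Omega>" "has_weak_gradient \<Omega> u G" "d \<in> L2 \<Omega>" "has_weak_divergence \<Omega> G d"
  shows "u \<in> H2 \<Omega>" "cls (weak_laplacian \<Omega> u) = cls d"
proof -
  note H1 = H1I[OF assms(1-3)]
  have "has_weak_divergence \<Omega> (weak_gradient \<Omega> u) d"
    using assms(5) by (simp add: has_weak_divergence_L2_iff assms(2,4) H1D[OF H1(1)] H1(2))
  then have w: "has_weak_divergence \<Omega> (weak_gradient \<Omega> u) (weak_laplacian \<Omega> u)" and ex: "\<exists>d. has_weak_divergence \<Omega> (weak_gradient \<Omega> u) d"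
    using someI[of "has_weak_divergence \<Omega> (weak_gradient \<Omega> u)" d]
    by (auto simp: weak_laplacian_def weak_divergence_def)
  note ae = weak_divergence_unique[OF \<open>has_weak_divergence \<Omega> (weak_gradient \<Omega> u) d\<close> w]
  have L: "weak_laplacian \<Omega> u \<in> L2 \<Omega>" by (rule L2_cong_AE[OF assms(4) ae \<Omega>_sets])
  then show "u \<in> H2 \<Omega>" using H1(1) ex by (simp add: H2_def)
  show "cls (weak_laplacian \<Omega> u) = cls d" using cls_eq_iff[OF assms(4) L] ae by simp
qed

section \<open>Classes of functions, gradients and Laplacians\<close>

definition grd :: "(real^'n \<Rightarrow> real) \<Rightarrow> (real^'n, real^'n) l2" where
  "grd u = cls (weak_gradient \<Omega> u)"

definition lap :: "(real^'n \<Rightarrow> real) \<Rightarrow> (real^'n, real) l2" where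
  "lap u = cls (weak_laplacian \<Omega> u)"

text \<open>Weak derivatives are only determined up to null sets, so that \<open>H\<^sup>2(\<Omega>)\<close> is mapped into the Hilbert
  space of classes \<open>(u, \<Delta>u)\<close>, whose inner product is the bilinear form \<open>(v, \<chi>) + (\<Delta>v, \<Delta>\<chi>)\<close> of the
  equation.\<close>

definition emb :: "(real^'n \<Rightarrow> real) \<Rightarrow> (real^'n, real \<times> real) l2" where
  "emb u = cls (\<lambda>x. (u x, weak_laplacian \<Omega> u x))"

lemma H1_linear:
  assumes u: "u \<in> H1 \<Omega>" and v: "v \<in> H1 \<Omega>"
  shows "(\<lambda>x. c * u x + v x) \<in> H1 \<Omega>" "grd (\<lambda>x. c * u x + v x) = c *\<^sub>R grd u + grd v"
    "cls (\<lambda>x. c * u x + v x) = c *\<^sub>R cls u + cls v"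
proof -
  note [simp] = H1D(1,2)[OF u] H1D(1,2)[OF v] L2_add L2_scaleR L2_cmult
  have g: "has_weak_gradient \<Omega> (\<lambda>x. c * u x + v x) (\<lambda>x. c *\<^sub>R weak_gradient \<Omega> u x + weak_gradient \<Omega> v x)"
    by (intro has_weak_gradient_linear H1D u v)
  show "(\<lambda>x. c * u x + v x) \<in> H1 \<Omega>" by (rule H1I(1)[OF _ _ g]) simp_all
  show "grd (\<lambda>x. c * u x + v x) = c *\<^sub>R grd u + grd v"
    unfolding grd_def by (subst H1I(2)[OF _ _ g]) (simp_all add: cls_add cls_scaleR)
  show "cls (\<lambda>x. c * u x + v x) = c *\<^sub>R cls u + cls v" by (simp add: cls_add cls_cmult)
qed

lemma H2_linear:
  assumes u: "u \<in> H2 \<Omega>" and v: "v \<in> H2 \<Omega>"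
  shows "(\<lambda>x. c * u x + v x) \<in> H2 \<Omega>" "lap (\<lambda>x. c * u x + v x) = c *\<^sub>R lap u + lap v"
proof -
  note [simp] = H1D(1,2)[OF H2D(1)[OF u]] H1D(1,2)[OF H2D(1)[OF v]] H2D(2)[OF u] H2D(2)[OF v] L2_add L2_scaleR L2_cmult
  have g: "has_weak_gradient \<Omega> (\<lambda>x. c * u x + v x) (\<lambda>x. c *\<^sub>R weak_gradient \<Omega> u x + weak_gradient \<Omega> v x)"
    by (intro has_weak_gradient_linear H1D H2D u v)
  have d: "has_weak_divergence \<Omega> (\<lambda>x. c *\<^sub>R weak_gradient \<Omega> u x + weak_gradient \<Omega> v x) (\<lambda>x. c * weak_laplacian \<Omega> u x + weak_laplacian \<Omega> v x)"
    by (intro has_weak_divergence_linear H1D H2D u v)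
  show "(\<lambda>x. c * u x + v x) \<in> H2 \<Omega>" by (rule H2I(1)[OF _ _ g _ d]) simp_all
  show "lap (\<lambda>x. c * u x + v x) = c *\<^sub>R lap u + lap v"
    unfolding lap_def by (subst H2I(2)[OF _ _ g _ d]) (simp_all add: cls_add cls_cmult)
qed

lemma H1_norm_sq: "u \<in> H1 \<Omega> \<Longrightarrow> H1_norm \<Omega> u = sqrt ((norm (cls u))\<^sup>2 + (norm (grd u))\<^sup>2)"
  by (simp add: H1_norm_def grd_def cls_norm H1D)

lemma H2_norm_sq: "u \<in> H2 \<Omega> \<Longrightarrow> H2_norm \<Omega> u = sqrt ((norm (cls u))\<^sup>2 + (norm (grd u))\<^sup>2 + (norm (lap u))\<^sup>2)"
  by (simp add: H2_norm_def grd_def lap_def cls_norm H1D H2D)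

lemma emb_inner:
  assumes u: "u \<in> H2 \<Omega>" and v: "v \<in> H2 \<Omega>"
  shows "emb u \<bullet> emb v = cls u \<bullet> cls v + lap u \<bullet> lap v"
  unfolding emb_def lap_def
  by (simp add: cls_inner L2_Pair L2_inner_Pair H1D H2D u v)

lemma emb_norm_sq: "u \<in> H2 \<Omega> \<Longrightarrow> (norm (emb u))\<^sup>2 = (norm (cls u))\<^sup>2 + (norm (lap u))\<^sup>2"
  by (simp add: power2_norm_eq_inner emb_inner)

text \<open>\<open>weak_laplacian\<close> is a choice and hence linear only up to null sets; the
  identity is proved for classes and read back almost everywhere.\<close>

lemma emb_linear:
  assumes u: "u \<in> H2 \<Omega>" and v: "v \<in> H2 \<Omega>"
  shows "emb (\<lambda>x. c * u x + v x) = c *\<^sub>R emb u + emb v"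
proof -
  let ?w = "\<lambda>x. c * u x + v x"
  note [simp] = H1D(1,2)[OF H2D(1)[OF u]] H1D(1,2)[OF H2D(1)[OF v]] H2D(2)[OF u] H2D(2)[OF v] L2_add L2_scaleR L2_cmult L2_Pair
  have w: "?w \<in> H2 \<Omega>" by (rule H2_linear[OF u v])
  have "lap ?w = cls (\<lambda>x. c * weak_laplacian \<Omega> u x + weak_laplacian \<Omega> v x)"
    unfolding H2_linear(2)[OF u v] lap_def by (simp add: cls_add cls_cmult)
  then have ae: "AE x in lebesgue_on \<Omega>. weak_laplacian \<Omega> ?w x = c * weak_laplacian \<Omega> u x + weak_laplacian \<Omega> v x"
    unfolding lap_def by (subst (asm) cls_eq_iff) (simp_all add: H2D[OF w])
  have "emb ?w = cls (\<lambda>x. c *\<^sub>R (u x, weak_laplacian \<Omega> u x) + (v x, weak_laplacian \<Omega> v x))"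
    unfolding emb_def using ae
    by (subst cls_eq_iff) (auto simp: H2D[OF w] elim: eventually_mono)
  also have "\<dots> = cls (\<lambda>x. c *\<^sub>R (u x, weak_laplacian \<Omega> u x)) + emb v"
    unfolding emb_def by (intro cls_add L2_scaleR) simp_all
  also have "cls (\<lambda>x. c *\<^sub>R (u x, weak_laplacian \<Omega> u x)) = c *\<^sub>R emb u"
    unfolding emb_def by (intro cls_scaleR) simp
  finally show ?thesis .
qed

lemma cls_le_emb: "u \<in> H2 \<Omega> \<Longrightarrow> norm (cls u) \<le> norm (emb u)"
  and lap_le_emb: "u \<in> H2 \<Omega> \<Longrightarrow> norm (lap u) \<le> norm (emb u)"
  by (rule power2_le_imp_le; simp add: emb_norm_sq)+

lemma emb_le_H2_norm: "u \<in> H2 \<Omega> \<Longrightarrow> norm (emb u) \<le> H2_norm \<Omega> u"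
  by (simp add: H2_norm_sq real_le_rsqrt emb_norm_sq)

lemma H1_diff:
  assumes "u \<in> H1 \<Omega>" "v \<in> H1 \<Omega>"
  shows "(\<lambda>x. u x - v x) \<in> H1 \<Omega>" "grd (\<lambda>x. u x - v x) = grd u - grd v" "cls (\<lambda>x. u x - v x) = cls u - cls v"
  using H1_linear[OF assms(2,1), of "-1"] by simp_all

lemma H2_diff:
  assumes "u \<in> H2 \<Omega>" "v \<in> H2 \<Omega>"
  shows "(\<lambda>x. u x - v x) \<in> H2 \<Omega>" "lap (\<lambda>x. u x - v x) = lap u - lap v" "emb (\<lambda>x. u x - v x) = emb u - emb v"
  using H2_linear[OF assms(2,1), of "-1"] emb_linear[OF assms(2,1), of "-1"] by simp_all

lemma smooth_H1:
  assumes "smooth \<phi>"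
  shows "\<phi> \<in> H1 \<Omega>" "grd \<phi> = cls (\<lambda>x. \<chi> i. partial (axis i 1) \<phi> x)"
proof -
  let ?G = "(\<lambda>x. \<chi> i. partial (axis i 1) \<phi> x) :: real^'n \<Rightarrow> real^'n"
  have G: "?G \<in> L2 \<Omega>" by (rule test_gradient_L2[OF assms])
  have w: "has_weak_gradient \<Omega> \<phi> ?G"
    using smooth_integration_by_parts[OF assms] L2_loc[OF G] L2_loc[OF smooth_L2[OF assms]]
    by (simp add: has_weak_gradient_def)
  show "\<phi> \<in> H1 \<Omega>" "grd \<phi> = cls ?G" using H1I[OF smooth_L2[OF assms] G w] by (simp_all add: grd_def)
qed

end

section \<open>Vanishing traces\<close>

lemma sets_hausdorff_measure: "sets (hausdorff_measure s :: 'a::metric_space measure) = sets borel"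
  by (simp add: hausdorff_measure_def sets.sigma_sets_eq[of borel, simplified])

lemma boundary_integral_surface:
  "(\<integral>\<^sup>+x. ennreal (f x) \<partial>surface_measure \<Omega>) = boundary_integral \<Omega> f" for f :: "real^'n \<Rightarrow> real"
  unfolding surface_measure_def boundary_integral_def
  by (subst nn_integral_restrict_space) (auto simp: sets_hausdorff_measure)

lemma measurable_hausdorff: "f \<in> borel_measurable borel \<Longrightarrow> f \<in> borel_measurable (hausdorff_measure s)"
  by (simp add: measurable_def sets_hausdorff_measure)

context
  fixes \<phi> \<psi> :: "'a::euclidean_space \<Rightarrow> real" and \<Omega> :: "'a set"
  assumes \<phi>: "smooth \<phi>" and \<psi>: "smooth \<psi>"
begin

lemma smooth_hausdorff_measurable [measurable]:
  "\<phi> \<in> borel_measurable (hausdorff_measure s)" "\<psi> \<in> borel_measurable (hausdorff_measure s)"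
  "frontier \<Omega> \<in> sets (hausdorff_measure s)"
  using smooth_measurable[OF \<phi>] smooth_measurable[OF \<psi>]
  by (auto simp: measurable_hausdorff sets_hausdorff_measure)

lemma boundary_integral_combine:
  assumes le: "\<And>x. x \<in> frontier \<Omega> \<Longrightarrow> f x \<le> a * (\<phi> x)\<^sup>2 + b * (\<psi> x)\<^sup>2" and ab: "0 \<le> a" "0 \<le> b"
  shows "boundary_integral \<Omega> f \<le> ennreal a * boundary_integral \<Omega> (\<lambda>x. (\<phi> x)\<^sup>2) + ennreal b * boundary_integral \<Omega> (\<lambda>x. (\<psi> x)\<^sup>2)"
proof -
  let ?s = "DIM('a) - 1"
  have "boundary_integral \<Omega> f \<le> (\<integral>\<^sup>+x. ennreal a * (ennreal ((\<phi> x)\<^sup>2) * indicator (frontier \<Omega>) x)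
      + ennreal b * (ennreal ((\<psi> x)\<^sup>2) * indicator (frontier \<Omega>) x) \<partial>hausdorff_measure ?s)"
    unfolding boundary_integral_def
  proof (rule nn_integral_mono)
    fix x
    show "ennreal (f x) * indicator (frontier \<Omega>) x \<le> ennreal a * (ennreal ((\<phi> x)\<^sup>2) * indicator (frontier \<Omega>) x)
      + ennreal b * (ennreal ((\<psi> x)\<^sup>2) * indicator (frontier \<Omega>) x)"
    proof (cases "x \<in> frontier \<Omega>")
      case True
      have "ennreal (f x) \<le> ennreal (a * (\<phi> x)\<^sup>2 + b * (\<psi> x)\<^sup>2)" by (intro ennreal_leI le True)
      also have "\<dots> = ennreal a * ennreal ((\<phi> x)\<^sup>2) + ennreal b * ennreal ((\<psi> x)\<^sup>2)"
        using ab by (simp add: ennreal_plus ennreal_mult)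
      finally show ?thesis using True by simp
    qed simp
  qed
  also have "\<dots> = ennreal a * boundary_integral \<Omega> (\<lambda>x. (\<phi> x)\<^sup>2) + ennreal b * boundary_integral \<Omega> (\<lambda>x. (\<psi> x)\<^sup>2)"
    unfolding boundary_integral_def
    by (subst nn_integral_add) (auto simp: nn_integral_cmult)
  finally show ?thesis .
qed

lemma boundary_integral_linear_sq:
  "boundary_integral \<Omega> (\<lambda>x. (c * \<phi> x + \<psi> x)\<^sup>2)
    \<le> ennreal (2 * c\<^sup>2) * boundary_integral \<Omega> (\<lambda>x. (\<phi> x)\<^sup>2) + ennreal 2 * boundary_integral \<Omega> (\<lambda>x. (\<psi> x)\<^sup>2)"
proof (rule boundary_integral_combine)
  fix x
  have "0 \<le> (c * \<phi> x - \<psi> x)\<^sup>2" by simp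
  then show "(c * \<phi> x + \<psi> x)\<^sup>2 \<le> 2 * c\<^sup>2 * (\<phi> x)\<^sup>2 + 2 * (\<psi> x)\<^sup>2"
    by (simp add: power2_eq_square algebra_simps)
qed auto

text \<open>Young's inequality with a weight. It is applied with \<open>e\<close> tending to 0, the
  first boundary integral being of order e^2 and the second merely finite, so that the right side is
  of order \<open>e\<close>.\<close>

lemma boundary_integral_mult:
  assumes "0 < e"
  shows "boundary_integral \<Omega> (\<lambda>x. \<bar>\<phi> x * \<psi> x\<bar>)
    \<le> ennreal (1 / e) * boundary_integral \<Omega> (\<lambda>x. (\<phi> x)\<^sup>2) + ennreal e * boundary_integral \<Omega> (\<lambda>x. (\<psi> x)\<^sup>2)"
proof (rule boundary_integral_combine)
  fix x
  have "0 \<le> (\<bar>\<phi> x\<bar> - e * \<bar>\<psi> x\<bar>)\<^sup>2 / e" using assms by simp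
  also have "\<dots> = 1 / e * (\<phi> x)\<^sup>2 + e * (\<psi> x)\<^sup>2 - 2 * \<bar>\<phi> x * \<psi> x\<bar>"
    using assms by (simp add: power2_diff power_mult_distrib abs_mult field_simps power2_eq_square)
  finally show "\<bar>\<phi> x * \<psi> x\<bar> \<le> 1 / e * (\<phi> x)\<^sup>2 + e * (\<psi> x)\<^sup>2" by linarith
qed (use assms in auto)

end

context bounded_open
begin

text \<open>Vanishing trace in terms of classes, with one tolerance in place of an approximating
  sequence. This form passes easily to linear combinations and limits.\<close>

definition zero_trace :: "(real^'n \<Rightarrow> real) \<Rightarrow> bool" where
  "zero_trace u \<longleftrightarrow> u \<in> H1 \<Omega> \<and> (\<forall>\<epsilon>>0. \<exists>\<phi>. smooth \<phi> \<and> norm (cls \<phi> - cls u) < \<epsilon> \<and> norm (grd \<phi> - grd u) < \<epsilon> \<and>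
     boundary_integral \<Omega> (\<lambda>x. (\<phi> x)\<^sup>2) < ennreal \<epsilon>)"

lemma H1_norm_diff:
  assumes "u \<in> H1 \<Omega>" "v \<in> H1 \<Omega>"
  shows "H1_norm \<Omega> (\<lambda>x. u x - v x) = sqrt ((norm (cls u - cls v))\<^sup>2 + (norm (grd u - grd v))\<^sup>2)"
  using H1_norm_sq[OF H1_diff(1)[OF assms]] by (simp add: H1_diff[OF assms])

lemma has_trace_zero_iff: "has_trace \<Omega> u (\<lambda>_. 0) \<longleftrightarrow> zero_trace u"
proof
  assume tr: "has_trace \<Omega> u (\<lambda>_. 0)"
  then have u: "u \<in> H1 \<Omega>" by (simp add: has_trace_def)
  obtain \<phi> where \<phi>: "\<And>k. smooth (\<phi> k)" "(\<lambda>k. H1_norm \<Omega> (\<lambda>x. u x - \<phi> k x)) \<longlonglongrightarrow> 0"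
    and b: "(\<lambda>k. boundary_integral \<Omega> (\<lambda>x. (\<phi> k x)\<^sup>2)) \<longlonglongrightarrow> 0"
    using tr unfolding has_trace_def boundary_integral_surface by auto
  show "zero_trace u"
    unfolding zero_trace_def
  proof (intro conjI allI impI u)
    fix \<epsilon> :: real assume \<epsilon>: "0 < \<epsilon>"
    have "\<forall>\<^sub>F k in sequentially. H1_norm \<Omega> (\<lambda>x. u x - \<phi> k x) < \<epsilon>" using order_tendstoD(2)[OF \<phi>(2) \<epsilon>] .
    moreover have "\<forall>\<^sub>F k in sequentially. boundary_integral \<Omega> (\<lambda>x. (\<phi> k x)\<^sup>2) < ennreal \<epsilon>"
      using order_tendstoD(2)[OF b, of "ennreal \<epsilon>"] \<epsilon> by simp
    ultimately have "\<forall>\<^sub>F k in sequentially. H1_norm \<Omega> (\<lambda>x. u x - \<phi> k x) < \<epsilon> \<and> boundary_integral \<Omega> (\<lambda>x. (\<phi> k x)\<^sup>2) < ennreal \<epsilon>"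
      by (rule eventually_conj)
    then obtain k where k: "H1_norm \<Omega> (\<lambda>x. u x - \<phi> k x) < \<epsilon>" "boundary_integral \<Omega> (\<lambda>x. (\<phi> k x)\<^sup>2) < ennreal \<epsilon>"
      by (auto simp: eventually_sequentially)
    have "norm (cls u - cls (\<phi> k)) \<le> H1_norm \<Omega> (\<lambda>x. u x - \<phi> k x)" "norm (grd u - grd (\<phi> k)) \<le> H1_norm \<Omega> (\<lambda>x. u x - \<phi> k x)"
      unfolding H1_norm_diff[OF u smooth_H1(1)[OF \<phi>(1)]] by (auto intro: real_le_rsqrt)
    then show "\<exists>\<phi>. smooth \<phi> \<and> norm (cls \<phi> - cls u) < \<epsilon> \<and> norm (grd \<phi> - grd u) < \<epsilon> \<and>
     boundary_integral \<Omega> (\<lambda>x. (\<phi> x)\<^sup>2) < ennreal \<epsilon>"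
      using k \<phi>(1) by (intro exI[of _ "\<phi> k"]) (auto simp: norm_minus_commute)
  qed
next
  assume tr: "zero_trace u"
  then have u: "u \<in> H1 \<Omega>" by (simp add: zero_trace_def)
  define Q where "Q k \<phi> \<longleftrightarrow> smooth \<phi> \<and> norm (cls \<phi> - cls u) < 1 / Suc k \<and> norm (grd \<phi> - grd u) < 1 / Suc k \<and>
     boundary_integral \<Omega> (\<lambda>x. (\<phi> x)\<^sup>2) < ennreal (1 / Suc k)" for k \<phi>
  have "\<exists>\<phi>. Q k \<phi>" for k using tr by (simp add: zero_trace_def Q_def)
  then obtain \<phi> where Q: "\<And>k. Q k (\<phi> k)" by metis
  have \<phi>: "smooth (\<phi> k)" "norm (cls (\<phi> k) - cls u) < 1 / Suc k" "norm (grd (\<phi> k) - grd u) < 1 / Suc k"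
    "boundary_integral \<Omega> (\<lambda>x. (\<phi> k x)\<^sup>2) < ennreal (1 / Suc k)" for k using Q[of k] by (simp_all add: Q_def)
  have inv: "(\<lambda>k. 1 / real (Suc k)) \<longlonglongrightarrow> 0" using LIMSEQ_inverse_real_of_nat by (simp add: inverse_eq_divide)
  have "(\<lambda>k. H1_norm \<Omega> (\<lambda>x. u x - \<phi> k x)) \<longlonglongrightarrow> 0"
  proof (rule Lim_null_comparison)
    have "norm (H1_norm \<Omega> (\<lambda>x. u x - \<phi> k x)) \<le> 2 * (1 / Suc k)" for k
    proof -
      have "H1_norm \<Omega> (\<lambda>x. u x - \<phi> k x) \<le> norm (cls u - cls (\<phi> k)) + norm (grd u - grd (\<phi> k))"
        unfolding H1_norm_diff[OF u smooth_H1(1)[OF \<phi>(1)]] by (rule sqrt_sum_squares_le_sum) auto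
      then show ?thesis using \<phi>(2,3)[of k]
        by (simp add: H1_norm_diff[OF u smooth_H1(1)[OF \<phi>(1)]] norm_minus_commute)
    qed
    then show "\<forall>\<^sub>F k in sequentially. norm (H1_norm \<Omega> (\<lambda>x. u x - \<phi> k x)) \<le> 2 * (1 / Suc k)" by simp
    show "(\<lambda>k. 2 * (1 / real (Suc k))) \<longlonglongrightarrow> 0" using tendsto_mult_left[OF inv, of 2] by simp
  qed
  moreover have "(\<lambda>k. boundary_integral \<Omega> (\<lambda>x. (\<phi> k x)\<^sup>2)) \<longlonglongrightarrow> 0"
  proof (rule tendsto_sandwich[OF _ _ tendsto_const])
    show "(\<lambda>k. ennreal (1 / Suc k)) \<longlonglongrightarrow> 0" using tendsto_ennrealI[OF inv] by simp
    show "\<forall>\<^sub>F k in sequentially. boundary_integral \<Omega> (\<lambda>x. (\<phi> k x)\<^sup>2) \<le> ennreal (1 / Suc k)"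
      using \<phi>(4) by (simp add: less_imp_le)
  qed simp
  ultimately show "has_trace \<Omega> u (\<lambda>_. 0)"
    unfolding has_trace_def boundary_integral_surface using u \<phi>(1) by auto
qed

lemma zero_trace_linear:
  assumes u: "zero_trace u" and v: "zero_trace v"
  shows "zero_trace (\<lambda>x. c * u x + v x)"
  unfolding zero_trace_def
proof (intro conjI allI impI)
  have uv: "u \<in> H1 \<Omega>" "v \<in> H1 \<Omega>" using u v by (simp_all add: zero_trace_def)
  then show "(\<lambda>x. c * u x + v x) \<in> H1 \<Omega>" by (rule H1_linear)
  fix \<epsilon> :: real assume \<epsilon>: "0 < \<epsilon>"
  \<comment> \<open>Large enough for both errors: 1 + |c| enters the norms, and 2 (1 + c^2) the
    boundary integral of the square.\<close>
  define m where "m = 1 + \<bar>c\<bar> + c\<^sup>2"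
  have m: "1 \<le> m" by (simp add: m_def)
  define \<delta> where "\<delta> = \<epsilon> / (4 * m)"
  have \<delta>: "0 < \<delta>" "m * \<delta> = \<epsilon> / 4" using \<epsilon> m by (simp_all add: \<delta>_def)
  obtain \<phi> where \<phi>: "smooth \<phi>" "norm (cls \<phi> - cls u) < \<delta>" "norm (grd \<phi> - grd u) < \<delta>"
     "boundary_integral \<Omega> (\<lambda>x. (\<phi> x)\<^sup>2) < ennreal \<delta>" using u \<delta>(1) by (auto simp: zero_trace_def)
  obtain \<psi> where \<psi>: "smooth \<psi>" "norm (cls \<psi> - cls v) < \<delta>" "norm (grd \<psi> - grd v) < \<delta>"
     "boundary_integral \<Omega> (\<lambda>x. (\<psi> x)\<^sup>2) < ennreal \<delta>" using v \<delta>(1) by (auto simp: zero_trace_def)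
  note lin = H1_linear[OF smooth_H1(1)[OF \<phi>(1)] smooth_H1(1)[OF \<psi>(1)], of c] H1_linear[OF uv, of c]
  have est: "norm (c *\<^sub>R a + b - (c *\<^sub>R a' + b')) < \<epsilon>" if "norm (a - a') < \<delta>" "norm (b - b') < \<delta>"
    for a a' b b' :: "'x::real_normed_vector"
  proof -
    have "norm (c *\<^sub>R a + b - (c *\<^sub>R a' + b')) = norm (c *\<^sub>R (a - a') + (b - b'))" by (simp add: algebra_simps)
    also have "\<dots> \<le> \<bar>c\<bar> * norm (a - a') + norm (b - b')"
      using norm_triangle_ineq[of "c *\<^sub>R (a - a')" "b - b'"] by simp
    also have "\<dots> \<le> \<bar>c\<bar> * \<delta> + \<delta>" using that by (intro add_mono mult_left_mono) auto
    also have "\<dots> \<le> m * \<delta>" using \<delta>(1) by (simp add: m_def algebra_simps)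
    finally show ?thesis using \<delta>(2) \<epsilon> by simp
  qed
  have "boundary_integral \<Omega> (\<lambda>x. (c * \<phi> x + \<psi> x)\<^sup>2) \<le> ennreal (2 * c\<^sup>2) * boundary_integral \<Omega> (\<lambda>x. (\<phi> x)\<^sup>2) + ennreal 2 * boundary_integral \<Omega> (\<lambda>x. (\<psi> x)\<^sup>2)"
    by (rule boundary_integral_linear_sq[OF \<phi>(1) \<psi>(1)])
  also have "\<dots> \<le> ennreal (2 * c\<^sup>2) * ennreal \<delta> + ennreal 2 * ennreal \<delta>"
    using \<phi>(4) \<psi>(4) by (intro add_mono mult_left_mono) auto
  also have "\<dots> = ennreal (2 * c\<^sup>2 * \<delta> + 2 * \<delta>)" using \<delta>(1) by (simp add: ennreal_mult ennreal_plus)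
  also have "\<dots> \<le> ennreal (2 * (m * \<delta>))" using \<delta>(1) by (intro ennreal_leI) (simp add: m_def algebra_simps)
  also have "\<dots> < ennreal \<epsilon>" using \<delta>(2) \<epsilon> by (simp add: ennreal_lessI)
  finally show "\<exists>\<phi>. smooth \<phi> \<and> norm (cls \<phi> - cls (\<lambda>x. c * u x + v x)) < \<epsilon> \<and> norm (grd \<phi> - grd (\<lambda>x. c * u x + v x)) < \<epsilon> \<and>
     boundary_integral \<Omega> (\<lambda>x. (\<phi> x)\<^sup>2) < ennreal \<epsilon>"
    using est[OF \<phi>(2) \<psi>(2)] est[OF \<phi>(3) \<psi>(3)] smooth_add[OF smooth_cmult[OF \<phi>(1)] \<psi>(1), of c]
    by (intro exI[of _ "\<lambda>x. c * \<phi> x + \<psi> x"]) (simp add: lin)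
qed

lemma zero_trace_closed:
  assumes v: "v \<in> H1 \<Omega>" and u: "\<And>k. zero_trace (u k)"
    and lim: "(\<lambda>k. cls (u k)) \<longlonglongrightarrow> cls v" "(\<lambda>k. grd (u k)) \<longlonglongrightarrow> grd v"
  shows "zero_trace v"
  unfolding zero_trace_def
proof (intro conjI allI impI v)
  fix \<epsilon> :: real assume \<epsilon>: "0 < \<epsilon>"
  have "\<forall>\<^sub>F k in sequentially. dist (cls (u k)) (cls v) < \<epsilon> / 2 \<and> dist (grd (u k)) (grd v) < \<epsilon> / 2"
    using \<epsilon> by (intro eventually_conj tendstoD lim) auto
  then obtain k where k: "norm (cls (u k) - cls v) < \<epsilon> / 2" "norm (grd (u k) - grd v) < \<epsilon> / 2"
    by (auto simp: eventually_sequentially dist_norm)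
  have "\<exists>\<phi>. smooth \<phi> \<and> norm (cls \<phi> - cls (u k)) < \<epsilon> / 2 \<and> norm (grd \<phi> - grd (u k)) < \<epsilon> / 2 \<and>
     boundary_integral \<Omega> (\<lambda>x. (\<phi> x)\<^sup>2) < ennreal (\<epsilon> / 2)"
    using u[of k] half_gt_zero[OF \<epsilon>] unfolding zero_trace_def by blast
  then obtain \<phi> where \<phi>: "smooth \<phi>" "norm (cls \<phi> - cls (u k)) < \<epsilon> / 2" "norm (grd \<phi> - grd (u k)) < \<epsilon> / 2"
     "boundary_integral \<Omega> (\<lambda>x. (\<phi> x)\<^sup>2) < ennreal (\<epsilon> / 2)" by blast
  have "boundary_integral \<Omega> (\<lambda>x. (\<phi> x)\<^sup>2) < ennreal \<epsilon>"
    by (rule order_less_le_trans[OF \<phi>(4)]) (use \<epsilon> in \<open>simp add: ennreal_leI\<close>)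
  moreover have "norm (cls \<phi> - cls v) < \<epsilon>" using norm_triangle_lt[of "cls \<phi> - cls (u k)" "cls (u k) - cls v" \<epsilon>] \<phi>(2) k(1) by simp
  moreover have "norm (grd \<phi> - grd v) < \<epsilon>" using norm_triangle_lt[of "grd \<phi> - grd (u k)" "grd (u k) - grd v" \<epsilon>] \<phi>(3) k(2) by simp
  ultimately show "\<exists>\<phi>. smooth \<phi> \<and> norm (cls \<phi> - cls v) < \<epsilon> \<and> norm (grd \<phi> - grd v) < \<epsilon> \<and>
     boundary_integral \<Omega> (\<lambda>x. (\<phi> x)\<^sup>2) < ennreal \<epsilon>" using \<phi>(1) by blast
qed

lemma H20_iff:
  "u \<in> H20 \<Omega> \<longleftrightarrow> u \<in> H2 \<Omega> \<and> zero_trace u \<and> (\<forall>v\<in>H1 \<Omega>. grd u \<bullet> grd v + lap u \<bullet> cls v = 0)"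
proof -
  have "normal_derivative \<Omega> u v = grd u \<bullet> grd v + lap u \<bullet> cls v" if "u \<in> H2 \<Omega>" "v \<in> H1 \<Omega>" for v
    using that by (simp add: normal_derivative_def grd_def lap_def cls_inner H1D H2D)
  then show ?thesis by (auto simp: H20_def has_trace_zero_iff)
qed

lemma H20_H2: "u \<in> H20 \<Omega> \<Longrightarrow> u \<in> H2 \<Omega>"
  and H20_H1: "u \<in> H20 \<Omega> \<Longrightarrow> u \<in> H1 \<Omega>"
  and H20_zero_trace: "u \<in> H20 \<Omega> \<Longrightarrow> zero_trace u"
  by (auto simp: H20_iff H2D)

lemma H20_H10: "u \<in> H20 \<Omega> \<Longrightarrow> u \<in> H10 \<Omega>"
  by (simp add: H10_def has_trace_zero_iff H20_zero_trace H20_H1)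

lemma H20_linear:
  assumes u: "u \<in> H20 \<Omega>" and v: "v \<in> H20 \<Omega>"
  shows "(\<lambda>x. c * u x + v x) \<in> H20 \<Omega>"
proof -
  note l = H2_linear[OF H20_H2[OF u] H20_H2[OF v]] H1_linear[OF H20_H1[OF u] H20_H1[OF v]]
  have "c * (grd u \<bullet> grd w + lap u \<bullet> cls w) + (grd v \<bullet> grd w + lap v \<bullet> cls w) = 0" if "w \<in> H1 \<Omega>" for w
    using u v that by (simp add: H20_iff)
  then have "grd (\<lambda>x. c * u x + v x) \<bullet> grd w + lap (\<lambda>x. c * u x + v x) \<bullet> cls w = 0" if "w \<in> H1 \<Omega>" for w
    unfolding l inner_add_left inner_scaleR_left using that by (simp add: algebra_simps)
  then show ?thesis
    unfolding H20_iff using l(1) zero_trace_linear[OF H20_zero_trace[OF u] H20_zero_trace[OF v], of c] by blast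
qed

text \<open>The zero function is written as 0 u + (- u + u); membership then follows from linearity,
  without computing weak derivatives.\<close>

lemma H20_zero: "(\<lambda>x. 0) \<in> H20 \<Omega>" if "u \<in> H20 \<Omega>"
  using H20_linear[OF that H20_linear[OF that that, of "-1"], of 0] by simp

lemma H20_diff: "u \<in> H20 \<Omega> \<Longrightarrow> v \<in> H20 \<Omega> \<Longrightarrow> (\<lambda>x. u x - v x) \<in> H20 \<Omega>"
  using H20_linear[of v u "-1"] by simp

lemma grd_le_emb:
  assumes "u \<in> H20 \<Omega>"
  shows "norm (grd u) \<le> norm (emb u)"
proof (rule power2_le_imp_le)
  have "(norm (grd u))\<^sup>2 = - (lap u \<bullet> cls u)"
    using assms H20_H1[OF assms] by (auto simp: H20_iff power2_norm_eq_inner add_eq_0_iff)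
  also have "\<dots> \<le> norm (lap u) * norm (cls u)" using Cauchy_Schwarz_ineq2[of "lap u" "cls u"] by linarith
  also have "\<dots> \<le> (norm (cls u))\<^sup>2 + (norm (lap u))\<^sup>2"
  proof -
    have "2 * (norm (lap u) * norm (cls u)) \<le> (norm (cls u))\<^sup>2 + (norm (lap u))\<^sup>2"
      using sum_squares_bound[of "norm (cls u)" "norm (lap u)"] by (simp add: mult_ac)
    moreover have "0 \<le> norm (lap u) * norm (cls u)" by simp
    ultimately show ?thesis by linarith
  qed
  finally show "(norm (grd u))\<^sup>2 \<le> (norm (emb u))\<^sup>2" by (simp add: emb_norm_sq H20_H2 assms)
qed simp

lemma H2_norm_le_emb:
  assumes "u \<in> H20 \<Omega>"
  shows "H2_norm \<Omega> u \<le> 2 * norm (emb u)"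
proof -
  have "(norm (grd u))\<^sup>2 \<le> (norm (emb u))\<^sup>2" by (intro power_mono grd_le_emb assms) simp
  then have "(norm (cls u))\<^sup>2 + (norm (grd u))\<^sup>2 + (norm (lap u))\<^sup>2 \<le> 4 * (norm (emb u))\<^sup>2"
    using emb_norm_sq[OF H20_H2[OF assms]] zero_le_power2[of "norm (cls u)"] zero_le_power2[of "norm (lap u)"]
    by linarith
  then have "H2_norm \<Omega> u \<le> sqrt ((2 * norm (emb u))\<^sup>2)"
    unfolding H2_norm_sq[OF H20_H2[OF assms]]
    by (intro real_sqrt_le_mono) (simp add: power_mult_distrib)
  then have "H2_norm \<Omega> u \<le> \<bar>2 * norm (emb u)\<bar>" by (simp only: real_sqrt_abs)
  then show ?thesis by simp
qed

lemma H1_norm_le_emb: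
  assumes "u \<in> H20 \<Omega>"
  shows "H1_norm \<Omega> u \<le> 2 * norm (emb u)"
proof -
  have "H1_norm \<Omega> u \<le> H2_norm \<Omega> u"
    unfolding H2_norm_sq[OF H20_H2[OF assms]] H1_norm_sq[OF H20_H1[OF assms]] by simp
  then show ?thesis using H2_norm_le_emb[OF assms] by linarith
qed

text \<open>On \<open>H\<^sub>0\<^sup>2(\<Omega>)\<close> the gradient is controlled by \<open>u\<close> and \<open>\<Delta>u\<close>, so that limits of \<open>emb\<close> are limits in
  the full norm.\<close>

lemma H20_closed:
  assumes u: "\<And>k. u k \<in> H20 \<Omega>" and lim: "(\<lambda>k. emb (u k)) \<longlonglongrightarrow> h"
  shows "\<exists>v\<in>H20 \<Omega>. emb v = h"
proof -
  note u2 = H20_H2[OF u] and u1 = H20_H1[OF u]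
  have C: "Cauchy (\<lambda>k. emb (u k))" using lim by (rule LIMSEQ_imp_Cauchy)
  \<comment> \<open>Stated for every Banach space, because values and gradients have classes in
    different types.\<close>
  have conv: "convergent Y" if "\<And>k l. norm (Y k - Y l) \<le> norm (emb (u k) - emb (u l))" for Y :: "nat \<Rightarrow> 'x::banach"
  proof -
    have "Cauchy Y"
    proof (rule metric_CauchyI)
      fix e :: real assume "0 < e"
      then have "\<exists>M. \<forall>m\<ge>M. \<forall>n\<ge>M. norm (emb (u m) - emb (u n)) < e"
        using C by (simp add: Cauchy_def dist_norm)
      then obtain M where M: "\<And>m n. M \<le> m \<Longrightarrow> M \<le> n \<Longrightarrow> norm (emb (u m) - emb (u n)) < e" by blast
      show "\<exists>M. \<forall>m\<ge>M. \<forall>n\<ge>M. dist (Y m) (Y n) < e"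
        unfolding dist_norm by (intro exI[of _ M] allI impI order_le_less_trans[OF that M])
    qed
    then show ?thesis by (rule Cauchy_convergent)
  qed
  have "convergent (\<lambda>k. cls (u k))" "convergent (\<lambda>k. grd (u k))" "convergent (\<lambda>k. lap (u k))"
  proof (rule_tac [!] conv)
    fix k l
    show "norm (cls (u k) - cls (u l)) \<le> norm (emb (u k) - emb (u l))"
      using cls_le_emb[OF H20_H2[OF H20_diff[OF u u]], of k l] by (simp add: H1_diff u1 H2_diff u2)
    show "norm (grd (u k) - grd (u l)) \<le> norm (emb (u k) - emb (u l))"
      using grd_le_emb[OF H20_diff[OF u u], of k l] by (simp add: H1_diff u1 H2_diff u2)
    show "norm (lap (u k) - lap (u l)) \<le> norm (emb (u k) - emb (u l))"
      using lap_le_emb[OF H20_H2[OF H20_diff[OF u u]], of k l] by (simp add: H1_diff u1 H2_diff u2)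
  qed
  then obtain a b c where abc: "(\<lambda>k. cls (u k)) \<longlonglongrightarrow> a" "(\<lambda>k. grd (u k)) \<longlonglongrightarrow> b" "(\<lambda>k. lap (u k)) \<longlonglongrightarrow> c"
    unfolding convergent_def by blast
  obtain v where v: "v \<in> L2 \<Omega>" "a = cls v"
    using to_l2_closed[OF \<Omega>_sets H1D(1)[OF u1] abc(1)] by blast
  obtain G where G: "G \<in> L2 \<Omega>" "b = cls G"
    using to_l2_closed[OF \<Omega>_sets H1D(2)[OF u1] abc(2)[unfolded grd_def]] by blast
  obtain d where d: "d \<in> L2 \<Omega>" "c = cls d"
    using to_l2_closed[OF \<Omega>_sets H2D(2)[OF u2] abc(3)[unfolded lap_def]] by blast
  have wg: "has_weak_gradient \<Omega> v G"
    using has_weak_gradient_limit[OF H1D(1)[OF u1] H1D(2)[OF u1] v(1) G(1) H1D(3)[OF u1]] abc(1,2) v(2) G(2)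
    by (simp add: grd_def)
  have wd: "has_weak_divergence \<Omega> G d"
    using has_weak_divergence_limit[OF H1D(2)[OF u1] H2D(2)[OF u2] G(1) d(1) H2D(3)[OF u2]] abc(2,3) d(2) G(2)
    by (simp add: grd_def lap_def)
  note H = H2I[OF v(1) G(1) wg d(1) wd] H1I[OF v(1) G(1) wg]
  have lims: "(\<lambda>k. cls (u k)) \<longlonglongrightarrow> cls v" "(\<lambda>k. grd (u k)) \<longlonglongrightarrow> grd v" "(\<lambda>k. lap (u k)) \<longlonglongrightarrow> lap v"
    using abc v(2) G(2) d(2) H by (simp_all add: grd_def lap_def)
  have "zero_trace v" by (rule zero_trace_closed[OF H(3) H20_zero_trace[OF u] lims(1,2)])
  moreover have "grd v \<bullet> grd w + lap v \<bullet> cls w = 0" if w: "w \<in> H1 \<Omega>" for w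
  proof (rule LIMSEQ_unique)
    show "(\<lambda>k. grd (u k) \<bullet> grd w + lap (u k) \<bullet> cls w) \<longlonglongrightarrow> grd v \<bullet> grd w + lap v \<bullet> cls w"
      by (intro tendsto_intros lims)
    show "(\<lambda>k. grd (u k) \<bullet> grd w + lap (u k) \<bullet> cls w) \<longlonglongrightarrow> 0"
      using u w by (simp add: H20_iff)
  qed
  ultimately have vH: "v \<in> H20 \<Omega>" using H(1) by (simp add: H20_iff)
  have "(\<lambda>k. emb (u k)) \<longlonglongrightarrow> emb v"
  proof -
    have e: "(norm (emb (u k) - emb v))\<^sup>2 = (norm (cls (u k) - cls v))\<^sup>2 + (norm (lap (u k) - lap v))\<^sup>2" for k
      using emb_norm_sq[OF H2_diff(1)[OF u2 H(1)]] by (simp add: H1_diff u1 H(3) H2_diff u2 H(1))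
    have "(\<lambda>k. (norm (cls (u k) - cls v))\<^sup>2 + (norm (lap (u k) - lap v))\<^sup>2) \<longlonglongrightarrow> (norm (cls v - cls v))\<^sup>2 + (norm (lap v - lap v))\<^sup>2"
      by (intro tendsto_intros lims)
    then have "(\<lambda>k. (norm (emb (u k) - emb v))\<^sup>2) \<longlonglongrightarrow> 0" unfolding e by simp
    then have "(\<lambda>k. sqrt ((norm (emb (u k) - emb v))\<^sup>2)) \<longlonglongrightarrow> sqrt 0" by (rule tendsto_real_sqrt)
    then show ?thesis by (simp add: tendsto_norm_zero_iff LIM_zero_iff)
  qed
  then show ?thesis using vH LIMSEQ_unique[OF lim] by blast
qed

end

section \<open>The L4 bound for functions with small boundary values\<close>

context bounded_open
begin

lemma nn_integral_smooth:
  assumes f: "smooth f" and nonneg: "\<And>x. 0 \<le> f x"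
  shows "(\<integral>\<^sup>+x. indicator \<Omega> x * ennreal (f x) \<partial>lborel) = ennreal (LINT x|lebesgue_on \<Omega>. f x)"
proof -
  have "(\<integral>\<^sup>+x. indicator \<Omega> x * ennreal (f x) \<partial>lborel) = (\<integral>\<^sup>+x. ennreal (indicator \<Omega> x *\<^sub>R f x) \<partial>lborel)"
    by (intro nn_integral_cong) (simp add: indicator_def)
  also have "\<dots> = ennreal (LINT x|lborel. indicator \<Omega> x *\<^sub>R f x)"
    using nonneg by (intro nn_integral_eq_integral smooth_integrable_bounded f \<Omega>_open \<Omega>_bounded) auto
  also have "(LINT x|lborel. indicator \<Omega> x *\<^sub>R f x) = (LINT x|lebesgue_on \<Omega>. f x)"
    using \<Omega>_open smooth_measurable[OF f] by (intro LINT_lebesgue_on_borel[symmetric]) auto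
  finally show ?thesis .
qed

lemma cls_norm_sq: "f \<in> L2 \<Omega> \<Longrightarrow> (norm (cls f))\<^sup>2 = (LINT x|lebesgue_on \<Omega>. (norm (f x))\<^sup>2)"
  unfolding power2_norm_eq_inner by (simp add: cls_inner L2_inner_def)

text \<open>The root of the factor in the Ladyzhenskaya inequality, which bounds a squared
  norm.\<close>

definition L4_const :: real where
  "L4_const = sqrt (1 + measure lebesgue \<Omega>)"

definition trace_const :: real where
  "trace_const = slice_const CARD('n)"

lemma L4_const_nonneg: "0 \<le> L4_const" and trace_const_nonneg: "0 \<le> trace_const"
  by (simp_all add: L4_const_def trace_const_def slice_const_nonneg)

text \<open>The Ladyzhenskaya inequality for \<psi> = \<phi>^2, whose partial derivatives 2 \<phi>
  \<partial>\<phi> are at most \<phi>^2 + |\<nabla>\<phi>|^2. Thus the squared H1 norm plus the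
  boundary term serves as \<open>J\<close> in every direction.\<close>

lemma smooth_L4:
  assumes dim: "CARD('n) \<le> 2" and \<phi>: "smooth \<phi>" and t: "0 \<le> t"
    and b: "boundary_integral \<Omega> (\<lambda>x. (\<phi> x)\<^sup>2) \<le> ennreal t"
  shows "norm (cls (\<lambda>x. (\<phi> x)\<^sup>2)) \<le> L4_const * ((norm (cls \<phi>))\<^sup>2 + (norm (grd \<phi>))\<^sup>2 + trace_const * t)"
proof -
  define \<psi> where "\<psi> x = (\<phi> x)\<^sup>2" for x
  have \<psi>: "smooth \<psi>" unfolding \<psi>_def[abs_def] by (rule smooth_power[OF \<phi>])
  let ?G = "(\<lambda>x. \<chi> i. partial (axis i 1) \<phi> x) :: real^'n \<Rightarrow> real^'n"
  have G: "?G \<in> L2 \<Omega>" by (rule test_gradient_L2[OF \<phi>])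
  define g where "g x = (\<phi> x)\<^sup>2 + (\<Sum>i\<in>UNIV. (partial (axis i 1) \<phi> x)\<^sup>2)" for x
  have sum_smooth: "smooth (\<lambda>x. \<Sum>i\<in>A. (partial (axis i 1) \<phi> x)\<^sup>2)" if "finite A" for A
    using that by (induction A rule: finite_induct)
      (auto intro!: smooth_const smooth_add smooth_power smooth_partial \<phi>)
  have gs: "smooth g" unfolding g_def[abs_def] by (intro smooth_add smooth_power \<phi> sum_smooth) simp
  have g0: "0 \<le> g x" for x by (simp add: g_def sum_nonneg)
  have gi: "(LINT x|lebesgue_on \<Omega>. g x) = (norm (cls \<phi>))\<^sup>2 + (norm (grd \<phi>))\<^sup>2"
  proof -
    have "g x = \<phi> x \<bullet> \<phi> x + ?G x \<bullet> ?G x" for x by (simp add: g_def inner_vec_def power2_eq_square)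
    then have "(LINT x|lebesgue_on \<Omega>. g x) = L2_inner \<Omega> \<phi> \<phi> + L2_inner \<Omega> ?G ?G"
      unfolding L2_inner_def by (simp only: Bochner_Integration.integral_add[OF integrable_inner_L2[OF smooth_L2[OF \<phi>] smooth_L2[OF \<phi>]] integrable_inner_L2[OF G G]])
    then show ?thesis unfolding smooth_H1(2)[OF \<phi>] power2_norm_eq_inner
      by (simp add: cls_inner smooth_L2[OF \<phi>] G)
  qed
  define R where "R = (norm (cls \<phi>))\<^sup>2 + (norm (grd \<phi>))\<^sup>2 + trace_const * t"
  have R: "0 \<le> R" using t trace_const_nonneg by (simp add: R_def)
  have abs: "(\<lambda>x. \<bar>\<psi> x\<bar>) = (\<lambda>x. (\<phi> x)\<^sup>2)" by (simp add: \<psi>_def)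
  have J: "(\<integral>\<^sup>+x. indicator \<Omega> x * ennreal \<bar>partial e \<psi> x\<bar> \<partial>lborel)
         + ennreal (slice_const DIM(real^'n)) * boundary_integral \<Omega> (\<lambda>x. \<bar>\<psi> x\<bar>) \<le> ennreal R" if e: "e \<in> Basis" for e
  proof -
    obtain i where i: "e = axis i 1" using e by (auto simp: Basis_vec_def)
    have "partial e \<psi> = (\<lambda>x. \<phi> x * partial e \<phi> x + partial e \<phi> x * \<phi> x)"
      unfolding \<psi>_def[abs_def] power2_eq_square by (intro partial_mult smooth_differentiable \<phi>)
    then have p: "partial e \<psi> x = 2 * \<phi> x * partial e \<phi> x" for x by simp
    have "\<bar>partial e \<psi> x\<bar> \<le> g x" for x
    proof -
      have "\<bar>partial e \<psi> x\<bar> \<le> (\<phi> x)\<^sup>2 + (partial e \<phi> x)\<^sup>2"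
        unfolding p using sum_squares_bound[of "\<bar>\<phi> x\<bar>" "\<bar>partial e \<phi> x\<bar>"] by (simp add: abs_mult)
      also have "(partial e \<phi> x)\<^sup>2 \<le> (\<Sum>i\<in>UNIV. (partial (axis i 1) \<phi> x)\<^sup>2)"
        unfolding i by (rule member_le_sum) auto
      finally show ?thesis by (simp add: g_def)
    qed
    then have "(\<integral>\<^sup>+x. indicator \<Omega> x * ennreal \<bar>partial e \<psi> x\<bar> \<partial>lborel) \<le> (\<integral>\<^sup>+x. indicator \<Omega> x * ennreal (g x) \<partial>lborel)"
      by (intro nn_integral_mono mult_left_mono ennreal_leI) auto
    also have "\<dots> = ennreal ((norm (cls \<phi>))\<^sup>2 + (norm (grd \<phi>))\<^sup>2)" unfolding nn_integral_smooth[OF gs g0] gi ..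
    finally have "(\<integral>\<^sup>+x. indicator \<Omega> x * ennreal \<bar>partial e \<psi> x\<bar> \<partial>lborel) \<le> ennreal ((norm (cls \<phi>))\<^sup>2 + (norm (grd \<phi>))\<^sup>2)" .
    moreover have "ennreal (slice_const DIM(real^'n)) * boundary_integral \<Omega> (\<lambda>x. \<bar>\<psi> x\<bar>) \<le> ennreal trace_const * ennreal t"
      unfolding abs trace_const_def using b by (intro mult_mono) auto
    ultimately have "(\<integral>\<^sup>+x. indicator \<Omega> x * ennreal \<bar>partial e \<psi> x\<bar> \<partial>lborel)
         + ennreal (slice_const DIM(real^'n)) * boundary_integral \<Omega> (\<lambda>x. \<bar>\<psi> x\<bar>)
         \<le> ennreal ((norm (cls \<phi>))\<^sup>2 + (norm (grd \<phi>))\<^sup>2) + ennreal trace_const * ennreal t" by (rule add_mono)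
    also have "\<dots> = ennreal R" unfolding R_def using t trace_const_nonneg by (simp add: ennreal_mult ennreal_plus)
    finally show ?thesis .
  qed
  have "boundary_integral \<Omega> (\<lambda>x. \<bar>\<psi> x\<bar>) < \<infinity>" unfolding abs using b by (rule order_le_less_trans) simp
  from ladyzhenskaya_boundary[OF _ \<Omega>_open \<Omega>_bounded \<psi> this J] dim
  have "(\<integral>\<^sup>+x. indicator \<Omega> x * ennreal ((\<psi> x)\<^sup>2) \<partial>lborel) \<le> (1 + emeasure lborel \<Omega>) * (ennreal R)\<^sup>2" by simp
  moreover have "(\<integral>\<^sup>+x. indicator \<Omega> x * ennreal ((\<psi> x)\<^sup>2) \<partial>lborel) = ennreal ((norm (cls \<psi>))\<^sup>2)"
    unfolding cls_norm_sq[OF smooth_L2[OF \<psi>]] real_norm_def power2_abs by (intro nn_integral_smooth smooth_power \<psi>) simp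
  moreover have "emeasure lborel \<Omega> = ennreal (measure lebesgue \<Omega>)"
    using \<Omega>_open emeasure_eq_measure2[OF \<Omega>_lmeasurable] by (simp add: emeasure_completion borel_open)
  ultimately have le: "ennreal ((norm (cls \<psi>))\<^sup>2) \<le> (1 + ennreal (measure lebesgue \<Omega>)) * (ennreal R)\<^sup>2" by (simp only:)
  have "ennreal ((norm (cls \<psi>))\<^sup>2) \<le> ennreal ((1 + measure lebesgue \<Omega>) * R\<^sup>2)"
  proof -
    have "ennreal ((1 + measure lebesgue \<Omega>) * R\<^sup>2) = (1 + ennreal (measure lebesgue \<Omega>)) * (ennreal R)\<^sup>2"
      using R by (simp add: ennreal_mult ennreal_plus ennreal_power)
    then show ?thesis using le by (simp only:)
  qed
  then have "(norm (cls \<psi>))\<^sup>2 \<le> (1 + measure lebesgue \<Omega>) * R\<^sup>2" by (subst (asm) ennreal_le_iff) auto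
  also have "\<dots> = (L4_const * R)\<^sup>2" by (simp add: L4_const_def power_mult_distrib)
  finally have "norm (cls \<psi>) \<le> L4_const * R"
    by (rule power2_le_imp_le) (intro mult_nonneg_nonneg L4_const_nonneg R)
  moreover have "\<psi> = (\<lambda>x. (\<phi> x)\<^sup>2)" by (rule ext) (rule \<psi>_def)
  ultimately show ?thesis by (simp only: R_def)
qed

text \<open>Fatou's lemma along a subsequence of approximants that converges almost everywhere. The
  allowance \<open>t\<close> for their boundary integrals makes the bound available also for
  differences \<open>\<phi> k - u\<close>, whose approximants have small but possibly nonzero
  boundary integrals.\<close>

lemma H1_L4:
  assumes dim: "CARD('n) \<le> 2" and v: "v \<in> H1 \<Omega>" and t: "0 \<le> t"
    and approx: "\<And>\<epsilon>. 0 < \<epsilon> \<Longrightarrow> \<exists>\<phi>. smooth \<phi> \<and> norm (cls \<phi> - cls v) < \<epsilon> \<and> norm (grd \<phi> - grd v) < \<epsilon> \<and>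
       boundary_integral \<Omega> (\<lambda>x. (\<phi> x)\<^sup>2) \<le> ennreal t"
  shows "(\<lambda>x. (v x)\<^sup>2) \<in> L2 \<Omega>"
    and "norm (cls (\<lambda>x. (v x)\<^sup>2)) \<le> L4_const * ((norm (cls v))\<^sup>2 + (norm (grd v))\<^sup>2 + trace_const * t)"
proof -
  define Q where "Q k \<phi> \<longleftrightarrow> smooth \<phi> \<and> norm (cls \<phi> - cls v) < 1 / Suc k \<and> norm (grd \<phi> - grd v) < 1 / Suc k \<and>
     boundary_integral \<Omega> (\<lambda>x. (\<phi> x)\<^sup>2) \<le> ennreal t" for k \<phi>
  have "\<exists>\<phi>. Q k \<phi>" for k unfolding Q_def by (rule approx) simp
  then obtain \<phi> where Q: "\<And>k. Q k (\<phi> k)" by metis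
  have \<phi>: "smooth (\<phi> k)" "norm (cls (\<phi> k) - cls v) < 1 / Suc k" "norm (grd (\<phi> k) - grd v) < 1 / Suc k"
    "boundary_integral \<Omega> (\<lambda>x. (\<phi> k x)\<^sup>2) \<le> ennreal t" for k using Q[of k] by (simp_all add: Q_def)
  have inv: "(\<lambda>k. 1 / real (Suc k)) \<longlonglongrightarrow> 0" using LIMSEQ_inverse_real_of_nat by (simp add: inverse_eq_divide)
  have lim: "(\<lambda>k. cls (\<phi> k)) \<longlonglongrightarrow> cls v" "(\<lambda>k. grd (\<phi> k)) \<longlonglongrightarrow> grd v"
    using \<phi>(2,3) by (auto intro!: LIM_zero_cancel[OF Lim_null_comparison[OF _ inv]] always_eventually less_imp_le)
  have v2: "v \<in> L2 \<Omega>" by (rule H1D[OF v])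
  obtain r where r: "strict_mono r" "AE x in lebesgue_on \<Omega>. (\<lambda>k. \<phi> (r k) x) \<longlonglongrightarrow> v x"
    using to_l2_tendsto_AE_subseq[OF \<Omega>_sets smooth_L2[OF \<phi>(1)] v2 lim(1)] by blast
  define B where "B k = L4_const * ((norm (cls (\<phi> k)))\<^sup>2 + (norm (grd (\<phi> k)))\<^sup>2 + trace_const * t)" for k
  define B' where "B' = L4_const * ((norm (cls v))\<^sup>2 + (norm (grd v))\<^sup>2 + trace_const * t)"
  have B: "B \<longlonglongrightarrow> B'" unfolding B_def[abs_def] B'_def by (intro tendsto_intros lim)
  have B'0: "0 \<le> B'" using t trace_const_nonneg L4_const_nonneg by (simp add: B'_def)
  have vm: "v \<in> borel_measurable (lebesgue_on \<Omega>)" by (rule L2_measurable[OF v2])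
  have "(\<integral>\<^sup>+x. ennreal (((v x)\<^sup>2)\<^sup>2) \<partial>lebesgue_on \<Omega>) = (\<integral>\<^sup>+x. liminf (\<lambda>k. ennreal (((\<phi> (r k) x)\<^sup>2)\<^sup>2)) \<partial>lebesgue_on \<Omega>)"
  proof (rule nn_integral_cong_AE, rule AE_mp[OF r(2)], intro AE_I2 impI)
    fix x assume "(\<lambda>k. \<phi> (r k) x) \<longlonglongrightarrow> v x"
    then have "(\<lambda>k. ennreal (((\<phi> (r k) x)\<^sup>2)\<^sup>2)) \<longlonglongrightarrow> ennreal (((v x)\<^sup>2)\<^sup>2)"
      by (intro tendsto_ennrealI tendsto_power)
    from lim_imp_Liminf[OF _ this] show "ennreal (((v x)\<^sup>2)\<^sup>2) = liminf (\<lambda>k. ennreal (((\<phi> (r k) x)\<^sup>2)\<^sup>2))" by simp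
  qed
  also have "\<dots> \<le> liminf (\<lambda>k. \<integral>\<^sup>+x. ennreal (((\<phi> (r k) x)\<^sup>2)\<^sup>2) \<partial>lebesgue_on \<Omega>)"
    using smooth_lebesgue_measurable[OF \<phi>(1)] by (intro nn_integral_liminf) simp
  also have "\<dots> \<le> liminf (\<lambda>k. ennreal ((B (r k))\<^sup>2))"
  proof (intro Liminf_mono always_eventually allI)
    fix k
    note sm = smooth_power[OF \<phi>(1), of "r k" 2]
    have "(\<integral>\<^sup>+x. ennreal (((\<phi> (r k) x)\<^sup>2)\<^sup>2) \<partial>lebesgue_on \<Omega>) = ennreal ((norm (cls (\<lambda>x. (\<phi> (r k) x)\<^sup>2)))\<^sup>2)"
      unfolding cls_norm_sq[OF smooth_L2[OF sm]] real_norm_def power2_abs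
      using L2_integrable[OF smooth_L2[OF sm]] by (intro nn_integral_eq_integral) auto
    also have "\<dots> \<le> ennreal ((B (r k))\<^sup>2)"
      unfolding B_def by (intro ennreal_leI power_mono smooth_L4 dim \<phi> t) simp
    finally show "(\<integral>\<^sup>+x. ennreal (((\<phi> (r k) x)\<^sup>2)\<^sup>2) \<partial>lebesgue_on \<Omega>) \<le> ennreal ((B (r k))\<^sup>2)" .
  qed
  also have "\<dots> = ennreal (B'\<^sup>2)"
  proof (rule lim_imp_Liminf)
    have "(\<lambda>k. B (r k)) \<longlonglongrightarrow> B'" using LIMSEQ_subseq_LIMSEQ[OF B r(1)] by (simp add: o_def)
    then show "(\<lambda>k. ennreal ((B (r k))\<^sup>2)) \<longlonglongrightarrow> ennreal (B'\<^sup>2)" by (intro tendsto_ennrealI tendsto_power)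
  qed simp
  finally have bound: "(\<integral>\<^sup>+x. ennreal (((v x)\<^sup>2)\<^sup>2) \<partial>lebesgue_on \<Omega>) \<le> ennreal (B'\<^sup>2)" .
  have int: "integrable (lebesgue_on \<Omega>) (\<lambda>x. ((v x)\<^sup>2)\<^sup>2)"
    using order_le_less_trans[OF bound ennreal_less_top] vm by (intro integrableI_bounded) auto
  then show L: "(\<lambda>x. (v x)\<^sup>2) \<in> L2 \<Omega>" using vm by (simp add: L2_def)
  have "ennreal ((norm (cls (\<lambda>x. (v x)\<^sup>2)))\<^sup>2) \<le> ennreal (B'\<^sup>2)"
    unfolding cls_norm_sq[OF L] real_norm_def power2_abs using bound int by (subst nn_integral_eq_integral[symmetric]) auto
  then have "(norm (cls (\<lambda>x. (v x)\<^sup>2)))\<^sup>2 \<le> B'\<^sup>2" by simp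
  then show "norm (cls (\<lambda>x. (v x)\<^sup>2)) \<le> L4_const * ((norm (cls v))\<^sup>2 + (norm (grd v))\<^sup>2 + trace_const * t)"
    unfolding B'_def[symmetric] using B'0 by (rule power2_le_imp_le)
qed

text \<open>Every positive \<open>t\<close> is admissible in the previous bound, and
  \<open>t\<close> tends to 0.\<close>

lemma zero_trace_L4:
  assumes dim: "CARD('n) \<le> 2" and u: "zero_trace u"
  shows "(\<lambda>x. (u x)\<^sup>2) \<in> L2 \<Omega>"
    and "norm (cls (\<lambda>x. (u x)\<^sup>2)) \<le> L4_const * ((norm (cls u))\<^sup>2 + (norm (grd u))\<^sup>2)"
proof -
  have u1: "u \<in> H1 \<Omega>" using u by (simp add: zero_trace_def)
  have approx: "\<exists>\<phi>. smooth \<phi> \<and> norm (cls \<phi> - cls u) < \<epsilon> \<and> norm (grd \<phi> - grd u) < \<epsilon> \<and>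
       boundary_integral \<Omega> (\<lambda>x. (\<phi> x)\<^sup>2) \<le> ennreal t" if "0 < \<epsilon>" "0 < t" for \<epsilon> t
  proof -
    have "0 < min \<epsilon> t" using that by simp
    then have "\<exists>\<phi>. smooth \<phi> \<and> norm (cls \<phi> - cls u) < min \<epsilon> t \<and> norm (grd \<phi> - grd u) < min \<epsilon> t \<and>
       boundary_integral \<Omega> (\<lambda>x. (\<phi> x)\<^sup>2) < ennreal (min \<epsilon> t)"
      using u unfolding zero_trace_def by blast
    then obtain \<phi> where \<phi>: "smooth \<phi>" "norm (cls \<phi> - cls u) < min \<epsilon> t" "norm (grd \<phi> - grd u) < min \<epsilon> t"
       "boundary_integral \<Omega> (\<lambda>x. (\<phi> x)\<^sup>2) < ennreal (min \<epsilon> t)" by (elim exE conjE) (rule that)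
    have "boundary_integral \<Omega> (\<lambda>x. (\<phi> x)\<^sup>2) \<le> ennreal t"
      using \<phi>(4) by (rule order_trans[OF less_imp_le]) (simp add: ennreal_leI)
    then show ?thesis using \<phi> by auto
  qed
  note L4 = H1_L4[OF dim u1 less_imp_le approx]
  show "(\<lambda>x. (u x)\<^sup>2) \<in> L2 \<Omega>" by (rule L4(1)[of 1]) auto
  show "norm (cls (\<lambda>x. (u x)\<^sup>2)) \<le> L4_const * ((norm (cls u))\<^sup>2 + (norm (grd u))\<^sup>2)" (is "?l \<le> L4_const * ?r")
  proof (rule LIMSEQ_le_const)
    have "(\<lambda>k. L4_const * (?r + trace_const * (1 / Suc k))) \<longlonglongrightarrow> L4_const * (?r + trace_const * 0)"
      using LIMSEQ_inverse_real_of_nat by (intro tendsto_intros) (simp add: inverse_eq_divide)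
    then show "(\<lambda>k. L4_const * (?r + trace_const * (1 / Suc k))) \<longlonglongrightarrow> L4_const * ?r" by simp
    show "\<exists>N. \<forall>k\<ge>N. ?l \<le> L4_const * (?r + trace_const * (1 / Suc k))"
      using L4(2)[of "1 / Suc k" for k] by simp
  qed
qed

text \<open>Approximants that converge in H1 also converge in L4: the L4 bound is applied to the
  difference \<open>\<phi> k - u\<close>.\<close>

lemma zero_trace_seq:
  assumes dim: "CARD('n) \<le> 2" and u: "zero_trace u"
  shows "\<exists>\<phi>. (\<forall>k::nat. smooth (\<phi> k)) \<and> (\<lambda>k. cls (\<phi> k)) \<longlonglongrightarrow> cls u \<and> (\<lambda>k. grd (\<phi> k)) \<longlonglongrightarrow> grd u \<and>
     (\<forall>k. boundary_integral \<Omega> (\<lambda>x. (\<phi> k x)\<^sup>2) \<le> ennreal ((1 / Suc k)\<^sup>2)) \<and>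
     (\<forall>k. (\<lambda>x. (\<phi> k x - u x)\<^sup>2) \<in> L2 \<Omega>) \<and> (\<lambda>k. norm (cls (\<lambda>x. (\<phi> k x - u x)\<^sup>2))) \<longlonglongrightarrow> 0"
proof -
  have u1: "u \<in> H1 \<Omega>" using u by (simp add: zero_trace_def)
  \<comment> \<open>The square leaves boundary integrals that are still small after division by 1 /
    (k + 1), as the weighted Young inequality requires.\<close>
  define \<delta> where "\<delta> k = (1 / real (Suc k))\<^sup>2" for k
  have \<delta>: "0 < \<delta> k" for k by (simp add: \<delta>_def)
  have inv: "(\<lambda>k. 1 / real (Suc k)) \<longlonglongrightarrow> 0" using LIMSEQ_inverse_real_of_nat by (simp add: inverse_eq_divide)
  have \<delta>0: "\<delta> \<longlonglongrightarrow> 0" unfolding \<delta>_def[abs_def] using tendsto_power[OF inv, of 2] by simp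
  define Q where "Q k \<phi> \<longleftrightarrow> smooth \<phi> \<and> norm (cls \<phi> - cls u) < \<delta> k \<and> norm (grd \<phi> - grd u) < \<delta> k \<and>
     boundary_integral \<Omega> (\<lambda>x. (\<phi> x)\<^sup>2) < ennreal (\<delta> k)" for k \<phi>
  have "\<exists>\<phi>. Q k \<phi>" for k using u \<delta> by (simp add: zero_trace_def Q_def)
  then obtain \<phi> where Q: "\<And>k. Q k (\<phi> k)" by metis
  have \<phi>: "smooth (\<phi> k)" "norm (cls (\<phi> k) - cls u) < \<delta> k" "norm (grd (\<phi> k) - grd u) < \<delta> k"
    "boundary_integral \<Omega> (\<lambda>x. (\<phi> k x)\<^sup>2) < ennreal (\<delta> k)" for k using Q[of k] by (simp_all add: Q_def)
  note \<phi>1 = smooth_H1(1)[OF \<phi>(1)]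
  have lim: "(\<lambda>k. cls (\<phi> k)) \<longlonglongrightarrow> cls u" "(\<lambda>k. grd (\<phi> k)) \<longlonglongrightarrow> grd u"
    using \<phi>(2,3) by (auto intro!: LIM_zero_cancel[OF Lim_null_comparison[OF _ \<delta>0]] always_eventually less_imp_le)
  \<comment> \<open>The difference is approximated by \<open>\<phi> k - \<eta>\<close> with \<eta>
    close to \<open>u\<close>; the square of a difference is at most twice the sum of the squares,
    so its boundary integral is at most 2 \<delta> + 2 \<delta>.\<close>
  have approx: "\<exists>\<psi>. smooth \<psi> \<and> norm (cls \<psi> - cls (\<lambda>x. \<phi> k x - u x)) < \<epsilon> \<and> norm (grd \<psi> - grd (\<lambda>x. \<phi> k x - u x)) < \<epsilon> \<and>
       boundary_integral \<Omega> (\<lambda>x. (\<psi> x)\<^sup>2) \<le> ennreal (4 * \<delta> k)" if \<epsilon>: "0 < \<epsilon>" for k \<epsilon>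
  proof -
    have m: "0 < min \<epsilon> (\<delta> k)" using \<epsilon> \<delta> by simp
    have "\<exists>\<eta>. smooth \<eta> \<and> norm (cls \<eta> - cls u) < min \<epsilon> (\<delta> k) \<and> norm (grd \<eta> - grd u) < min \<epsilon> (\<delta> k) \<and>
       boundary_integral \<Omega> (\<lambda>x. (\<eta> x)\<^sup>2) < ennreal (min \<epsilon> (\<delta> k))"
      using u m unfolding zero_trace_def by blast
    then obtain \<eta> where \<eta>: "smooth \<eta>" "norm (cls \<eta> - cls u) < min \<epsilon> (\<delta> k)" "norm (grd \<eta> - grd u) < min \<epsilon> (\<delta> k)"
       "boundary_integral \<Omega> (\<lambda>x. (\<eta> x)\<^sup>2) < ennreal (min \<epsilon> (\<delta> k))" by (elim exE conjE) (rule that)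
    have b: "boundary_integral \<Omega> (\<lambda>x. (\<eta> x)\<^sup>2) \<le> ennreal (\<delta> k)"
      using \<eta>(4) by (rule order_trans[OF less_imp_le]) (simp add: ennreal_leI)
    have "boundary_integral \<Omega> (\<lambda>x. (- 1 * \<eta> x + \<phi> k x)\<^sup>2)
        \<le> ennreal (2 * (- 1)\<^sup>2) * boundary_integral \<Omega> (\<lambda>x. (\<eta> x)\<^sup>2) + ennreal 2 * boundary_integral \<Omega> (\<lambda>x. (\<phi> k x)\<^sup>2)"
      by (rule boundary_integral_linear_sq[OF \<eta>(1) \<phi>(1)])
    also have "\<dots> \<le> ennreal 2 * ennreal (\<delta> k) + ennreal 2 * ennreal (\<delta> k)"
      using b less_imp_le[OF \<phi>(4)[of k]] by (intro add_mono mult_mono) auto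
    also have "\<dots> = ennreal (4 * \<delta> k)" using \<delta>[of k] by (simp add: ennreal_mult distrib_right[symmetric])
    finally have bi: "boundary_integral \<Omega> (\<lambda>x. (\<phi> k x - \<eta> x)\<^sup>2) \<le> ennreal (4 * \<delta> k)" by simp
    have "norm (cls (\<lambda>x. \<phi> k x - \<eta> x) - cls (\<lambda>x. \<phi> k x - u x)) < \<epsilon>" "norm (grd (\<lambda>x. \<phi> k x - \<eta> x) - grd (\<lambda>x. \<phi> k x - u x)) < \<epsilon>"
      using \<eta>(2,3) by (simp_all add: H1_diff \<phi>1 u1 smooth_H1(1)[OF \<eta>(1)] norm_minus_commute)
    then show ?thesis using bi smooth_diff[OF \<phi>(1) \<eta>(1), of k] by (intro exI[of _ "\<lambda>x. \<phi> k x - \<eta> x"]) simp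
  qed
  note L4 = H1_L4[OF dim H1_diff(1)[OF \<phi>1 u1] _ approx]
  have "(\<lambda>k. norm (cls (\<lambda>x. (\<phi> k x - u x)\<^sup>2))) \<longlonglongrightarrow> 0"
  proof (rule Lim_null_comparison)
    let ?B = "\<lambda>k. L4_const * ((norm (cls (\<phi> k) - cls u))\<^sup>2 + (norm (grd (\<phi> k) - grd u))\<^sup>2 + trace_const * (4 * \<delta> k))"
    have "norm (cls (\<lambda>x. (\<phi> k x - u x)\<^sup>2)) \<le> ?B k" for k
      using L4(2)[of k] \<delta>[of k] by (simp add: H1_diff \<phi>1 u1)
    then show "\<forall>\<^sub>F k in sequentially. norm (norm (cls (\<lambda>x. (\<phi> k x - u x)\<^sup>2))) \<le> ?B k" by simp
    have "?B \<longlonglongrightarrow> L4_const * ((norm (cls u - cls u))\<^sup>2 + (norm (grd u - grd u))\<^sup>2 + trace_const * (4 * 0))"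
      by (intro tendsto_intros lim \<delta>0)
    then show "?B \<longlonglongrightarrow> 0" by simp
  qed
  moreover have "(\<lambda>x. (\<phi> k x - u x)\<^sup>2) \<in> L2 \<Omega>" for k
    by (rule L4(1)[of k]) (use \<delta>[of k] in simp_all)
  moreover have "boundary_integral \<Omega> (\<lambda>x. (\<phi> k x)\<^sup>2) \<le> ennreal ((1 / Suc k)\<^sup>2)" for k
    using less_imp_le[OF \<phi>(4)[of k]] unfolding \<delta>_def .
  ultimately show ?thesis by (intro exI[of _ \<phi>] conjI allI \<phi>(1) lim)
qed

end

section \<open>Partial derivatives, L4 products and integration by parts\<close>

context bounded_open
begin

text \<open>Pointwise linear maps act on classes with the same Lipschitz constant. In particular
  equal classes have equal images, although the functions are equal only almost everywhere.\<close>

lemma cls_bounded_linear: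
  fixes A :: "'b::euclidean_space \<Rightarrow> 'c::euclidean_space"
  assumes A: "bounded_linear A" "\<And>y. norm (A y) \<le> K * norm y" and K: "0 \<le> K"
    and F: "F \<in> L2 \<Omega>" and G: "G \<in> L2 \<Omega>"
  shows "norm (cls (\<lambda>x. A (F x)) - cls (\<lambda>x. A (G x))) \<le> K * norm (cls F - cls G)"
proof (rule power2_le_imp_le)
  note FG = L2_diff[OF F G]
  note AFG = L2_bounded_linear[OF A(1) FG]
  have "cls (\<lambda>x. A (F x)) - cls (\<lambda>x. A (G x)) = cls (\<lambda>x. A (F x - G x))"
    using cls_diff[OF L2_bounded_linear[OF A(1) F] L2_bounded_linear[OF A(1) G]]
    by (simp add: linear_diff[OF bounded_linear.linear[OF A(1)]])
  then have "(norm (cls (\<lambda>x. A (F x)) - cls (\<lambda>x. A (G x))))\<^sup>2 = (LINT x|lebesgue_on \<Omega>. (norm (A (F x - G x)))\<^sup>2)"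
    by (simp add: cls_norm_sq AFG)
  also have "\<dots> \<le> (LINT x|lebesgue_on \<Omega>. K\<^sup>2 * (norm (F x - G x))\<^sup>2)"
  proof (rule integral_mono[OF L2_integrable[OF AFG] integrable_mult_right[OF L2_integrable[OF FG]]])
    fix x
    show "(norm (A (F x - G x)))\<^sup>2 \<le> K\<^sup>2 * (norm (F x - G x))\<^sup>2"
      using power_mono[OF A(2)[of "F x - G x"], of 2] by (simp add: power_mult_distrib)
  qed
  also have "\<dots> = (K * norm (cls F - cls G))\<^sup>2"
    by (simp add: cls_diff[OF F G, symmetric] cls_norm_sq FG power_mult_distrib)
  finally show "(norm (cls (\<lambda>x. A (F x)) - cls (\<lambda>x. A (G x))))\<^sup>2 \<le> (K * norm (cls F - cls G))\<^sup>2" .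
qed (use K in simp)

definition pd :: "'n \<Rightarrow> (real^'n \<Rightarrow> real) \<Rightarrow> (real^'n, real) l2" where
  "pd i u = cls (\<lambda>x. weak_gradient \<Omega> u x $ i)"

text \<open>All components of the flux agree, so its divergence involves the gradient only through
  this sum.\<close>

definition sum_partials :: "(real^'n \<Rightarrow> real) \<Rightarrow> real^'n \<Rightarrow> real" where
  "sum_partials u x = (\<Sum>i\<in>UNIV. weak_gradient \<Omega> u x $ i)"

definition sp :: "(real^'n \<Rightarrow> real) \<Rightarrow> (real^'n, real) l2" where
  "sp u = cls (sum_partials u)"

lemma component_L2: "u \<in> H1 \<Omega> \<Longrightarrow> (\<lambda>x. weak_gradient \<Omega> u x $ i) \<in> L2 \<Omega>"
  by (rule L2_bounded_linear[OF bounded_linear_vec_nth H1D(2)])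

lemma pd_lipschitz: "u \<in> H1 \<Omega> \<Longrightarrow> v \<in> H1 \<Omega> \<Longrightarrow> norm (pd i u - pd i v) \<le> norm (grd u - grd v)"
  using cls_bounded_linear[OF bounded_linear_vec_nth[of i], where K = 1 and F = "weak_gradient \<Omega> u" and G = "weak_gradient \<Omega> v"]
  by (simp add: pd_def grd_def H1D component_le_norm_cart)

lemma pd_limit:
  assumes "u \<in> H1 \<Omega>" "\<And>k. v k \<in> H1 \<Omega>" and lim: "(\<lambda>k. grd (v k)) \<longlonglongrightarrow> grd u"
  shows "(\<lambda>k. pd i (v k)) \<longlonglongrightarrow> pd i u"
proof (rule LIM_zero_cancel, rule Lim_null_comparison)
  show "\<forall>\<^sub>F k in sequentially. norm (pd i (v k) - pd i u) \<le> norm (grd (v k) - grd u)"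
    using pd_lipschitz[OF assms(2,1)] by simp
  show "(\<lambda>k. norm (grd (v k) - grd u)) \<longlonglongrightarrow> 0" using lim by (simp add: LIM_zero tendsto_norm_zero)
qed

lemma pd_smooth:
  assumes \<phi>: "smooth \<phi>"
  shows "pd i \<phi> = cls (partial (axis i 1) \<phi>)"
proof -
  have "norm (pd i \<phi> - cls (\<lambda>x. (\<chi> i. partial (axis i 1) \<phi> x) $ i)) \<le> 1 * norm (grd \<phi> - cls (\<lambda>x. \<chi> i. partial (axis i 1) \<phi> x))"
    unfolding pd_def grd_def
    by (rule cls_bounded_linear[OF bounded_linear_vec_nth])
      (simp_all add: component_le_norm_cart H1D smooth_H1[OF \<phi>] test_gradient_L2[OF \<phi>])
  then show ?thesis by (simp add: smooth_H1(2)[OF \<phi>])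
qed

lemma sum_components: "bounded_linear (\<lambda>y :: real^'n. \<Sum>i\<in>UNIV. y $ i)"
  "norm (\<Sum>i\<in>UNIV. (y :: real^'n) $ i) \<le> CARD('n) * norm y"
proof -
  show "bounded_linear (\<lambda>y :: real^'n. \<Sum>i\<in>UNIV. y $ i)"
    by (intro bounded_linear_sum bounded_linear_vec_nth)
  have "norm (\<Sum>i\<in>UNIV. y $ i) \<le> (\<Sum>i\<in>(UNIV :: 'n set). norm y)"
    by (rule order_trans[OF norm_sum sum_mono]) (simp add: component_le_norm_cart)
  then show "norm (\<Sum>i\<in>UNIV. y $ i) \<le> CARD('n) * norm y" by simp
qed

lemma sum_partials_L2: "u \<in> H1 \<Omega> \<Longrightarrow> sum_partials u \<in> L2 \<Omega>"
  unfolding sum_partials_def[abs_def] by (rule L2_bounded_linear[OF sum_components(1) H1D(2)])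

text \<open>The chosen gradient of a difference is the difference of the chosen gradients only as a
  class; the Lipschitz estimate with right side 0 carries this over to the sum of the
  components.\<close>

lemma sp_diff:
  assumes u: "u \<in> H1 \<Omega>" and v: "v \<in> H1 \<Omega>"
  shows "sp (\<lambda>x. u x - v x) = sp u - sp v"
proof -
  let ?A = "\<lambda>y :: real^'n. \<Sum>i\<in>UNIV. y $ i"
  note w = H1_diff[OF u v]
  have "norm (cls (\<lambda>x. ?A (weak_gradient \<Omega> (\<lambda>x. u x - v x) x)) - cls (\<lambda>x. ?A (weak_gradient \<Omega> u x - weak_gradient \<Omega> v x)))
      \<le> CARD('n) * norm (cls (weak_gradient \<Omega> (\<lambda>x. u x - v x)) - cls (\<lambda>x. weak_gradient \<Omega> u x - weak_gradient \<Omega> v x))"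
    by (intro cls_bounded_linear[OF sum_components] L2_diff H1D u v w) simp
  also have "\<dots> = 0" using w(2) by (simp add: cls_diff[OF H1D(2)[OF u] H1D(2)[OF v]] grd_def)
  finally have "sp (\<lambda>x. u x - v x) = cls (\<lambda>x. ?A (weak_gradient \<Omega> u x - weak_gradient \<Omega> v x))"
    by (simp add: sp_def sum_partials_def[abs_def])
  also have "\<dots> = cls (\<lambda>x. sum_partials u x - sum_partials v x)" by (simp add: sum_partials_def sum_subtractf)
  also have "\<dots> = sp u - sp v" unfolding sp_def by (intro cls_diff sum_partials_L2 u v)
  finally show ?thesis .
qed

lemma cls_zero [simp]: "cls (\<lambda>x. 0) = 0"
  using cls_diff[OF L2_zero L2_zero] by simp

lemma norm_sp_le: "u \<in> H1 \<Omega> \<Longrightarrow> norm (sp u) \<le> CARD('n) * norm (grd u)"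
  using cls_bounded_linear[OF sum_components, of "weak_gradient \<Omega> u" "\<lambda>x. 0"]
  by (simp add: sp_def sum_partials_def[abs_def] grd_def H1D L2_zero)

lemma cls_sum:
  assumes "finite A" "\<And>i. i \<in> A \<Longrightarrow> f i \<in> L2 \<Omega>"
  shows "(\<lambda>x. \<Sum>i\<in>A. f i x) \<in> L2 \<Omega> \<and> cls (\<lambda>x. \<Sum>i\<in>A. f i x) = (\<Sum>i\<in>A. cls (f i))"
  using assms
proof (induction A rule: finite_induct)
  case empty
  show ?case using cls_diff[OF L2_zero L2_zero] by (simp add: L2_zero)
next
  case (insert i A)
  then show ?case by (simp add: L2_add cls_add)
qed

lemma sp_eq_sum: "u \<in> H1 \<Omega> \<Longrightarrow> sp u = (\<Sum>i\<in>UNIV. pd i u)"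
  using cls_sum[of UNIV "\<lambda>i x. weak_gradient \<Omega> u x $ i"] component_L2[of u]
  by (simp add: sp_def sum_partials_def[abs_def] pd_def)

definition L4 :: "(real^'n \<Rightarrow> real) set" where
  "L4 = {f. f \<in> borel_measurable (lebesgue_on \<Omega>) \<and> (\<lambda>x. (f x)\<^sup>2) \<in> L2 \<Omega>}"

text \<open>The square of the L4 norm.\<close>

definition n4 :: "(real^'n \<Rightarrow> real) \<Rightarrow> real" where
  "n4 f = norm (cls (\<lambda>x. (f x)\<^sup>2))"

lemma L4_mult:
  assumes "f \<in> L4" "g \<in> L4"
  shows "(\<lambda>x. f x * g x) \<in> L2 \<Omega>" "norm (cls (\<lambda>x. f x * g x)) \<le> sqrt (n4 f * n4 g)"
proof -
  have fg: "f \<in> borel_measurable (lebesgue_on \<Omega>)" "g \<in> borel_measurable (lebesgue_on \<Omega>)"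
    "(\<lambda>x. (f x)\<^sup>2) \<in> L2 \<Omega>" "(\<lambda>x. (g x)\<^sup>2) \<in> L2 \<Omega>" using assms by (auto simp: L4_def)
  note m = L2_mult_L4[OF \<Omega>_sets fg]
  show "(\<lambda>x. f x * g x) \<in> L2 \<Omega>" by (rule m(1))
  show "norm (cls (\<lambda>x. f x * g x)) \<le> sqrt (n4 f * n4 g)"
    using m(2) by (intro real_le_rsqrt) (simp add: n4_def cls_norm m(1) fg(3,4))
qed

lemma smooth_in_L4: "smooth f \<Longrightarrow> f \<in> L4"
  by (simp add: L4_def smooth_lebesgue_measurable smooth_L2 smooth_power)

lemma L4_product_limit:
  assumes f: "\<And>k. f k \<in> L4" "h \<in> L4" and d: "\<And>k. (\<lambda>x. f k x - h x) \<in> L4" "(\<lambda>k. n4 (\<lambda>x. f k x - h x)) \<longlonglongrightarrow> 0"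
    and g: "g \<in> L4"
  shows "(\<lambda>k. cls (\<lambda>x. f k x * g x)) \<longlonglongrightarrow> cls (\<lambda>x. h x * g x)"
proof (rule LIM_zero_cancel, rule Lim_null_comparison)
  have "norm (cls (\<lambda>x. f k x * g x) - cls (\<lambda>x. h x * g x)) \<le> sqrt (n4 (\<lambda>x. f k x - h x) * n4 g)" for k
  proof -
    have "cls (\<lambda>x. f k x * g x) - cls (\<lambda>x. h x * g x) = cls (\<lambda>x. (f k x - h x) * g x)"
      using cls_diff[OF L4_mult(1)[OF f(1) g] L4_mult(1)[OF f(2) g], of k] by (simp add: left_diff_distrib)
    then show ?thesis using L4_mult(2)[OF d(1) g, of k] by simp
  qed
  then show "\<forall>\<^sub>F k in sequentially. norm (cls (\<lambda>x. f k x * g x) - cls (\<lambda>x. h x * g x)) \<le> sqrt (n4 (\<lambda>x. f k x - h x) * n4 g)"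
    by simp
  have "(\<lambda>k. sqrt (n4 (\<lambda>x. f k x - h x) * n4 g)) \<longlonglongrightarrow> sqrt (0 * n4 g)"
    by (intro tendsto_intros d)
  then show "(\<lambda>k. sqrt (n4 (\<lambda>x. f k x - h x) * n4 g)) \<longlonglongrightarrow> 0" by simp
qed

text \<open>For the approximants the divergence bound controls the sum of both pairings by the
  boundary integral of \<open>\<phi> k * \<psi>\<close>, which tends to 0; the pairings themselves
  converge.\<close>

lemma zero_trace_integration_by_parts:
  assumes u: "u \<in> H1 \<Omega>" and \<phi>: "\<And>k::nat. smooth (\<phi> k)" "(\<lambda>k. cls (\<phi> k)) \<longlonglongrightarrow> cls u" "(\<lambda>k. grd (\<phi> k)) \<longlonglongrightarrow> grd u"
    "\<And>k. boundary_integral \<Omega> (\<lambda>x. (\<phi> k x)\<^sup>2) \<le> ennreal ((1 / Suc k)\<^sup>2)"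
    and \<psi>: "smooth \<psi>" "boundary_integral \<Omega> (\<lambda>x. (\<psi> x)\<^sup>2) < \<infinity>"
  shows "cls u \<bullet> pd i \<psi> = - (pd i u \<bullet> cls \<psi>)"
proof -
  let ?b = "axis i 1 :: real^'n"
  obtain B where B: "boundary_integral \<Omega> (\<lambda>x. (\<psi> x)\<^sup>2) = ennreal B" "0 \<le> B"
    using \<psi>(2) by (cases "boundary_integral \<Omega> (\<lambda>x. (\<psi> x)\<^sup>2)") auto
  have "norm (cls (\<phi> k) \<bullet> pd i \<psi> + pd i (\<phi> k) \<bullet> cls \<psi>) \<le> 2 * trace_const * (1 + B) * (1 / Suc k)" for k
  proof -
    \<comment> \<open>With this weight in Young's inequality both terms are of order
      \<open>e\<close>: e^2 / e from the approximant and e \<open>B\<close> from \<psi>.\<close>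
    define e where "e = 1 / real (Suc k)"
    have e: "0 < e" by (simp add: e_def)
    have "boundary_integral \<Omega> (\<lambda>x. \<bar>\<phi> k x * \<psi> x\<bar>)
        \<le> ennreal (1 / e) * boundary_integral \<Omega> (\<lambda>x. (\<phi> k x)\<^sup>2) + ennreal e * boundary_integral \<Omega> (\<lambda>x. (\<psi> x)\<^sup>2)"
      by (rule boundary_integral_mult[OF \<phi>(1) \<psi>(1) e])
    also have "\<dots> \<le> ennreal (1 / e) * ennreal (e\<^sup>2) + ennreal e * ennreal B"
      unfolding B(1) using \<phi>(4)[of k] by (intro add_mono mult_left_mono) (auto simp: e_def)
    also have "\<dots> = ennreal (1 / e * e\<^sup>2 + e * B)"
      using e B(2) by (simp only: ennreal_mult[symmetric] ennreal_plus[symmetric] zero_le_power2 zero_le_divide_1_iff less_imp_le mult_nonneg_nonneg)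
    also have "1 / e * e\<^sup>2 + e * B = (1 + B) * e" using e by (simp add: power2_eq_square algebra_simps)
    finally have bi: "boundary_integral \<Omega> (\<lambda>x. \<bar>\<phi> k x * \<psi> x\<bar>) \<le> ennreal ((1 + B) * e)" .
    then have fin: "boundary_integral \<Omega> (\<lambda>x. \<bar>\<phi> k x * \<psi> x\<bar>) < \<infinity>" by (rule order_le_less_trans) simp
    have "enn2real (boundary_integral \<Omega> (\<lambda>x. \<bar>\<phi> k x * \<psi> x\<bar>)) \<le> (1 + B) * e"
      using bi e B(2) by (intro enn2real_leI) auto
    then have le: "2 * trace_const * enn2real (boundary_integral \<Omega> (\<lambda>x. \<bar>\<phi> k x * \<psi> x\<bar>)) \<le> 2 * trace_const * ((1 + B) * e)"
      by (intro mult_left_mono) (auto simp: trace_const_nonneg)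
    have "\<bar>LINT x|lebesgue_on \<Omega>. partial ?b (\<lambda>x. \<phi> k x * \<psi> x) x\<bar> \<le> 2 * trace_const * ((1 + B) * e)"
      using divergence_boundary_bound[OF \<Omega>_open \<Omega>_bounded axis_Basis_real smooth_mult[OF \<phi>(1) \<psi>(1)] fin, of i] le
      by (simp add: trace_const_def)
    moreover have "(LINT x|lebesgue_on \<Omega>. partial ?b (\<lambda>x. \<phi> k x * \<psi> x) x) = cls (\<phi> k) \<bullet> pd i \<psi> + pd i (\<phi> k) \<bullet> cls \<psi>"
    proof -
      have L: "\<phi> k \<in> L2 \<Omega>" "\<psi> \<in> L2 \<Omega>" "partial ?b (\<phi> k) \<in> L2 \<Omega>" "partial ?b \<psi> \<in> L2 \<Omega>"
        by (intro smooth_L2 smooth_partial \<phi> \<psi> axis_Basis_real)+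
      have "partial ?b (\<lambda>x. \<phi> k x * \<psi> x) = (\<lambda>x. \<phi> k x \<bullet> partial ?b \<psi> x + partial ?b (\<phi> k) x \<bullet> \<psi> x)"
        using partial_mult[OF smooth_differentiable[OF \<phi>(1)] smooth_differentiable[OF \<psi>(1)]] by simp
      then show ?thesis
        unfolding pd_smooth[OF \<psi>(1)] pd_smooth[OF \<phi>(1)] cls_inner[OF L(1,4)] cls_inner[OF L(3,2)] L2_inner_def
        by (simp only: Bochner_Integration.integral_add[OF integrable_inner_L2[OF L(1,4)] integrable_inner_L2[OF L(3,2)]])
    qed
    ultimately show ?thesis by (simp add: e_def mult.assoc)
  qed
  then have ev: "\<forall>\<^sub>F k in sequentially. norm (cls (\<phi> k) \<bullet> pd i \<psi> + pd i (\<phi> k) \<bullet> cls \<psi>) \<le> 2 * trace_const * (1 + B) * (1 / Suc k)"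
    by simp
  have "(\<lambda>k. 2 * trace_const * (1 + B) * (1 / real (Suc k))) \<longlonglongrightarrow> 2 * trace_const * (1 + B) * 0"
    using LIMSEQ_inverse_real_of_nat by (intro tendsto_mult tendsto_const) (simp add: inverse_eq_divide)
  then have "(\<lambda>k. 2 * trace_const * (1 + B) * (1 / real (Suc k))) \<longlonglongrightarrow> 0" by simp
  from Lim_null_comparison[OF ev this]
  have "(\<lambda>k. cls (\<phi> k) \<bullet> pd i \<psi> + pd i (\<phi> k) \<bullet> cls \<psi>) \<longlonglongrightarrow> 0" .
  moreover have "(\<lambda>k. cls (\<phi> k) \<bullet> pd i \<psi> + pd i (\<phi> k) \<bullet> cls \<psi>) \<longlonglongrightarrow> cls u \<bullet> pd i \<psi> + pd i u \<bullet> cls \<psi>"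
    by (intro tendsto_intros \<phi>(2) pd_limit[OF u smooth_H1(1)[OF \<phi>(1)] \<phi>(3)])
  ultimately have "cls u \<bullet> pd i \<psi> + pd i u \<bullet> cls \<psi> = 0" using LIMSEQ_unique by blast
  then show ?thesis by linarith
qed


lemma square_limit:
  assumes f: "\<And>k. f k \<in> L4" "h \<in> L4" and d: "\<And>k. (\<lambda>x. f k x - h x) \<in> L4" "(\<lambda>k. n4 (\<lambda>x. f k x - h x)) \<longlonglongrightarrow> 0"
  shows "(\<lambda>k. cls (\<lambda>x. f k x * f k x)) \<longlonglongrightarrow> cls (\<lambda>x. h x * h x)"
proof -
  have L: "(\<lambda>x. (f k x - h x) * (f k x - h x)) \<in> L2 \<Omega>" "(\<lambda>x. f k x * h x) \<in> L2 \<Omega>" "(\<lambda>x. h x * h x) \<in> L2 \<Omega>" for k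
    by (intro L4_mult(1) d(1) f)+
  \<comment> \<open>f^2 = (f - h)^2 + 2 f h - h^2: the first term tends to 0 in L2, and the second
    is a product with a fixed factor in L4.\<close>
  have eq: "cls (\<lambda>x. f k x * f k x) = cls (\<lambda>x. (f k x - h x) * (f k x - h x)) + 2 *\<^sub>R cls (\<lambda>x. f k x * h x) - cls (\<lambda>x. h x * h x)" for k
  proof -
    have "cls (\<lambda>x. f k x * f k x) = cls (\<lambda>x. (f k x - h x) * (f k x - h x) + 2 * (f k x * h x) - h x * h x)"
      by (simp add: algebra_simps)
    then show ?thesis by (simp only: cls_diff cls_add cls_cmult L2_add L2_cmult L)
  qed
  have "(\<lambda>k. cls (\<lambda>x. (f k x - h x) * (f k x - h x))) \<longlonglongrightarrow> 0"
    using d(2) by (simp add: n4_def power2_eq_square tendsto_norm_zero_iff)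
  moreover have "(\<lambda>k. cls (\<lambda>x. f k x * h x)) \<longlonglongrightarrow> cls (\<lambda>x. h x * h x)"
    by (rule L4_product_limit[OF f d f(2)])
  ultimately have "(\<lambda>k. cls (\<lambda>x. (f k x - h x) * (f k x - h x)) + 2 *\<^sub>R cls (\<lambda>x. f k x * h x) - cls (\<lambda>x. h x * h x))
      \<longlonglongrightarrow> 0 + 2 *\<^sub>R cls (\<lambda>x. h x * h x) - cls (\<lambda>x. h x * h x)"
    by (intro tendsto_intros)
  moreover have "0 + 2 *\<^sub>R cls (\<lambda>x. h x * h x) - cls (\<lambda>x. h x * h x) = cls (\<lambda>x. h x * h x)"
    by (simp add: scaleR_2)
  ultimately show ?thesis unfolding eq by simp
qed

lemma partial_square: "smooth \<phi> \<Longrightarrow> partial b (\<lambda>x. \<phi> x * \<phi> x) = (\<lambda>x. 2 * (partial b \<phi> x * \<phi> x))"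
  by (subst partial_mult) (auto intro: smooth_differentiable)

lemma inner_square_rule:
  assumes \<phi>: "smooth \<phi>" and g: "g \<in> L4" "g \<in> L2 \<Omega>"
  shows "cls g \<bullet> pd i (\<lambda>x. \<phi> x * \<phi> x) = 2 * (pd i \<phi> \<bullet> cls (\<lambda>x. \<phi> x * g x))"
proof -
  note p = smooth_L2[OF smooth_partial[OF \<phi> axis_Basis_real], of i] smooth_L2[OF smooth_partial[OF smooth_mult[OF \<phi> \<phi>] axis_Basis_real], of i]
  show ?thesis
    unfolding pd_smooth[OF \<phi>] pd_smooth[OF smooth_mult[OF \<phi> \<phi>]] cls_inner[OF g(2) p(2)]
      cls_inner[OF p(1) L4_mult(1)[OF smooth_in_L4[OF \<phi>] g(1)]] L2_inner_def
    unfolding partial_square[OF \<phi>] Bochner_Integration.integral_mult_right_zero[symmetric]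
    by (intro Bochner_Integration.integral_cong) auto
qed

end

section \<open>The nonlinear form\<close>

locale planar_domain = bounded_open \<Omega> for \<Omega> :: "(real^'n) set" +
  assumes dim: "CARD('n) \<le> 2"
begin

lemma zero_trace_in_L4:
  assumes "zero_trace u"
  shows "u \<in> L4" "n4 u \<le> L4_const * ((norm (cls u))\<^sup>2 + (norm (grd u))\<^sup>2)"
  using zero_trace_L4[OF dim assms] assms by (auto simp: L4_def n4_def zero_trace_def intro: L2_measurable H1D)

lemma zero_trace_approx:
  assumes u: "zero_trace u"
  shows "\<exists>\<phi> :: nat \<Rightarrow> real^'n \<Rightarrow> real. (\<forall>k. smooth (\<phi> k)) \<and> (\<lambda>k. cls (\<phi> k)) \<longlonglongrightarrow> cls u \<and> (\<lambda>k. grd (\<phi> k)) \<longlonglongrightarrow> grd u \<and>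
     (\<forall>k. boundary_integral \<Omega> (\<lambda>x. (\<phi> k x)\<^sup>2) \<le> ennreal ((1 / Suc k)\<^sup>2)) \<and>
     (\<forall>k. (\<lambda>x. \<phi> k x - u x) \<in> L4) \<and> (\<lambda>k. n4 (\<lambda>x. \<phi> k x - u x)) \<longlonglongrightarrow> 0"
proof -
  obtain \<phi> where \<phi>: "\<forall>k::nat. smooth (\<phi> k)" "(\<lambda>k. cls (\<phi> k)) \<longlonglongrightarrow> cls u" "(\<lambda>k. grd (\<phi> k)) \<longlonglongrightarrow> grd u"
     "\<forall>k. boundary_integral \<Omega> (\<lambda>x. (\<phi> k x)\<^sup>2) \<le> ennreal ((1 / Suc k)\<^sup>2)"
     "\<forall>k. (\<lambda>x. (\<phi> k x - u x)\<^sup>2) \<in> L2 \<Omega>" "(\<lambda>k. norm (cls (\<lambda>x. (\<phi> k x - u x)\<^sup>2))) \<longlonglongrightarrow> 0"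
    using zero_trace_seq[OF dim u] by (elim exE conjE) (rule that)
  have "(\<lambda>x. \<phi> k x - u x) \<in> borel_measurable (lebesgue_on \<Omega>)" for k
    using smooth_lebesgue_measurable[of "\<phi> k"] \<phi>(1) zero_trace_in_L4(1)[OF u]
    by (intro borel_measurable_diff) (auto simp: L4_def)
  then show ?thesis using \<phi> by (intro exI[of _ \<phi>]) (simp add: L4_def n4_def)
qed

text \<open>\<open>\<integral> u \<partial>\<^sub>i u\<close> and \<open>\<integral> u\<^sup>2 \<partial>\<^sub>i u\<close> are integrals of derivatives of functions vanishing on the
  boundary: this makes the nonlinearity neutral in the energy balance.\<close>

lemma energy_identities:
  assumes u: "zero_trace u"
  shows "pd i u \<bullet> cls u = 0" "pd i u \<bullet> cls (\<lambda>x. u x * u x) = 0"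
proof -
  have u1: "u \<in> H1 \<Omega>" using u by (simp add: zero_trace_def)
  obtain \<phi> :: "nat \<Rightarrow> real^'n \<Rightarrow> real" where \<phi>0: "\<forall>k. smooth (\<phi> k)" and lim: "(\<lambda>k. cls (\<phi> k)) \<longlonglongrightarrow> cls u" "(\<lambda>k. grd (\<phi> k)) \<longlonglongrightarrow> grd u"
    and bi0: "\<forall>k. boundary_integral \<Omega> (\<lambda>x. (\<phi> k x)\<^sup>2) \<le> ennreal ((1 / Suc k)\<^sup>2)"
    and d0: "\<forall>k. (\<lambda>x. \<phi> k x - u x) \<in> L4" "(\<lambda>k. n4 (\<lambda>x. \<phi> k x - u x)) \<longlonglongrightarrow> 0"
    using zero_trace_approx[OF u] by (elim exE conjE) (rule that)
  note \<phi> = \<phi>0[rule_format] and bi = bi0[rule_format] and d = d0(1)[rule_format] d0(2)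
  note ibp = zero_trace_integration_by_parts[OF u1 \<phi> lim bi]
  note uL4 = zero_trace_in_L4(1)[OF u]
  have pdl: "(\<lambda>k. pd i (\<phi> k)) \<longlonglongrightarrow> pd i u" by (rule pd_limit[OF u1 smooth_H1(1)[OF \<phi>] lim(2)])
  have fin: "boundary_integral \<Omega> (\<lambda>x. (\<phi> k x)\<^sup>2) < \<infinity>" for k by (rule order_le_less_trans[OF bi]) simp
  have "cls u \<bullet> pd i u = - (pd i u \<bullet> cls u)"
  proof (rule LIMSEQ_unique)
    show "(\<lambda>k. cls u \<bullet> pd i (\<phi> k)) \<longlonglongrightarrow> cls u \<bullet> pd i u" by (intro tendsto_intros pdl)
    show "(\<lambda>k. cls u \<bullet> pd i (\<phi> k)) \<longlonglongrightarrow> - (pd i u \<bullet> cls u)"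
      unfolding ibp[OF \<phi> fin] by (intro tendsto_intros lim)
  qed
  then show "pd i u \<bullet> cls u = 0" by (simp add: inner_commute)
  \<comment> \<open>The approximant is bounded on the compact frontier, so finiteness for its square
    gives finiteness for its fourth power.\<close>
  have fin2: "boundary_integral \<Omega> (\<lambda>x. (\<phi> k x * \<phi> k x)\<^sup>2) < \<infinity>" for k
  proof -
    have "compact (frontier \<Omega>)" using \<Omega>_bounded by (rule compact_frontier_bounded)
    then have "bounded (\<phi> k ` frontier \<Omega>)" by (intro compact_imp_bounded compact_continuous_image smooth_continuous \<phi>)
    then obtain M where M: "\<And>x. x \<in> frontier \<Omega> \<Longrightarrow> \<bar>\<phi> k x\<bar> \<le> M" by (auto simp: bounded_iff)
    have "boundary_integral \<Omega> (\<lambda>x. (\<phi> k x * \<phi> k x)\<^sup>2)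
        \<le> ennreal (M\<^sup>2) * boundary_integral \<Omega> (\<lambda>x. (\<phi> k x)\<^sup>2) + ennreal 0 * boundary_integral \<Omega> (\<lambda>x. (\<phi> k x)\<^sup>2)"
    proof (rule boundary_integral_combine[OF \<phi> \<phi>])
      fix x assume "x \<in> frontier \<Omega>"
      then have "(\<phi> k x)\<^sup>2 \<le> M\<^sup>2" using M by (metis abs_ge_zero power2_abs power_mono)
      from mult_right_mono[OF this zero_le_power2[of "\<phi> k x"]]
      show "(\<phi> k x * \<phi> k x)\<^sup>2 \<le> M\<^sup>2 * (\<phi> k x)\<^sup>2 + 0 * (\<phi> k x)\<^sup>2" by (simp add: power_mult_distrib)
    qed auto
    also have "\<dots> < \<infinity>" using fin[of k] by (simp add: ennreal_mult_less_top)
    finally show ?thesis .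
  qed
  \<comment> \<open>Both sides are limits of one sequence: 2 (\<partial>\<phi>, \<phi> u) equals (u,
    \<partial>(\<phi>^2)) by the product rule, and -(\<partial>u, \<phi>^2) by parts. A number that
    satisfies 2 X = -X is 0.\<close>
  have "2 * (pd i u \<bullet> cls (\<lambda>x. u x * u x)) = - (pd i u \<bullet> cls (\<lambda>x. u x * u x))"
  proof (rule LIMSEQ_unique)
    show "(\<lambda>k. 2 * (pd i (\<phi> k) \<bullet> cls (\<lambda>x. \<phi> k x * u x))) \<longlonglongrightarrow> 2 * (pd i u \<bullet> cls (\<lambda>x. u x * u x))"
      by (intro tendsto_intros pdl L4_product_limit smooth_in_L4 \<phi> uL4 d)
    show "(\<lambda>k. 2 * (pd i (\<phi> k) \<bullet> cls (\<lambda>x. \<phi> k x * u x))) \<longlonglongrightarrow> - (pd i u \<bullet> cls (\<lambda>x. u x * u x))"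
      unfolding inner_square_rule[OF \<phi> uL4 H1D(1)[OF u1], symmetric] ibp[OF smooth_mult[OF \<phi> \<phi>] fin2]
      by (intro tendsto_intros square_limit smooth_in_L4 \<phi> uL4 d)
  qed
  then show "pd i u \<bullet> cls (\<lambda>x. u x * u x) = 0" by simp
qed

text \<open>The flux is -(u + u^2 / 2) times the vector of ones. The linear part is the definition
  of the weak gradient, and the product rule for u^2 is inherited from the smooth approximants by L4
  convergence.\<close>

lemma weak_divergence_flux:
  assumes u: "zero_trace u"
  shows "has_weak_divergence \<Omega> (\<lambda>x. flux (u x)) (\<lambda>x. - (sum_partials u x + sum_partials u x * u x))"
proof -
  have u1: "u \<in> H1 \<Omega>" using u by (simp add: zero_trace_def)
  note u2 = H1D(1)[OF u1]
  obtain \<phi> :: "nat \<Rightarrow> real^'n \<Rightarrow> real" where \<phi>0: "\<forall>k. smooth (\<phi> k)" and lim: "(\<lambda>k. cls (\<phi> k)) \<longlonglongrightarrow> cls u" "(\<lambda>k. grd (\<phi> k)) \<longlonglongrightarrow> grd u"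
    and bi0: "\<forall>k. boundary_integral \<Omega> (\<lambda>x. (\<phi> k x)\<^sup>2) \<le> ennreal ((1 / Suc k)\<^sup>2)"
    and d0: "\<forall>k. (\<lambda>x. \<phi> k x - u x) \<in> L4" "(\<lambda>k. n4 (\<lambda>x. \<phi> k x - u x)) \<longlonglongrightarrow> 0"
    using zero_trace_approx[OF u] by (elim exE conjE) (rule that)
  note \<phi> = \<phi>0[rule_format] and bi = bi0[rule_format] and d = d0(1)[rule_format] d0(2)
  note uL4 = zero_trace_in_L4(1)[OF u]
  have pdl: "(\<lambda>k. pd i (\<phi> k)) \<longlonglongrightarrow> pd i u" for i by (rule pd_limit[OF u1 smooth_H1(1)[OF \<phi>] lim(2)])
  have uu: "(\<lambda>x. u x * u x) \<in> L2 \<Omega>" by (rule L4_mult(1)[OF uL4 uL4])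
  define h where "h x = u x + (1/2) * (u x * u x)" for x
  have h: "h \<in> L2 \<Omega>" "cls h = cls u + (1/2) *\<^sub>R cls (\<lambda>x. u x * u x)"
    unfolding h_def by (intro L2_add L2_cmult u2 uu) (simp only: cls_add cls_cmult L2_cmult u2 uu)
  have flux: "flux (u x) = (- h x) *\<^sub>R ((\<chi> i. 1) :: real^'n)" for x
    by (simp add: flux_def h_def vec_eq_iff power2_eq_square)
  have F: "(\<lambda>x. flux (u x) :: real^'n) \<in> L2 \<Omega>"
    unfolding flux by (intro L2_bounded_linear[OF bounded_linear_scaleR_left] L2_uminus h)
  have s: "sum_partials u \<in> L2 \<Omega>" by (rule sum_partials_L2[OF u1])
  \<comment> \<open>A product of two L2 functions: integrable, but not known to be in L2, which is
    why divergences are only required to be locally integrable.\<close>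
  have su: "locally_integrable \<Omega> (\<lambda>x. sum_partials u x * u x)"
    unfolding locally_integrable_def
  proof (intro allI impI)
    fix K assume K: "compact K" "K \<subseteq> \<Omega>"
    then have "K \<in> sets lebesgue" by (simp add: lmeasurable_compact fmeasurableD)
    then show "integrable (lebesgue_on K) (\<lambda>x. sum_partials u x * u x)"
      using integrable_inner_L2[OF L2_subset[OF s \<Omega>_sets _ K(2)] L2_subset[OF u2 \<Omega>_sets _ K(2)]] by simp
  qed
  have "locally_integrable \<Omega> (\<lambda>x. (- 1) *\<^sub>R sum_partials u x - sum_partials u x * u x)"
    by (intro locally_integrable_diff su locally_integrable_bounded_linear[OF bounded_linear_scaleR_right] L2_loc s)
  then have loc: "locally_integrable \<Omega> (\<lambda>x. - (sum_partials u x + sum_partials u x * u x))" by simp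
  have "(LINT x|lebesgue_on \<Omega>. (\<Sum>i\<in>UNIV. (flux (u x) :: real^'n) $ i * partial (axis i 1) \<eta> x))
      = - (LINT x|lebesgue_on \<Omega>. - (sum_partials u x + sum_partials u x * u x) * \<eta> x)" if \<eta>: "test_function \<Omega> \<eta>" for \<eta>
  proof -
    note \<eta>s = test_function_smooth[OF \<eta>] and \<eta>2 = test_L2[OF \<eta>]
    have \<eta>p: "partial (axis i 1) \<eta> \<in> L2 \<Omega>" for i by (rule test_L2[OF test_function_partial[OF \<eta> axis_Basis_real]])
    have u\<eta>: "(\<lambda>x. u x * \<eta> x) \<in> L2 \<Omega>" by (rule L4_mult(1)[OF uL4 smooth_in_L4[OF \<eta>s]])
    have a: "cls u \<bullet> cls (partial (axis i 1) \<eta>) = - (pd i u \<bullet> cls \<eta>)" for i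
      using H1D(3)[OF u1] \<eta> unfolding has_weak_gradient_def pd_def cls_inner[OF u2 \<eta>p] cls_inner[OF component_L2[OF u1] \<eta>2]
      by (simp add: L2_inner_def)
    \<comment> \<open>The weak derivative of u^2 is 2 u \<partial>u: true for each approximant after
      integration by parts against \<eta>, and both sides converge.\<close>
    have b: "cls (\<lambda>x. u x * u x) \<bullet> cls (partial (axis i 1) \<eta>) = - (2 * (pd i u \<bullet> cls (\<lambda>x. u x * \<eta> x)))" for i
    proof (rule LIMSEQ_unique)
      have "cls (\<lambda>x. \<phi> k x * \<phi> k x) \<bullet> cls (partial (axis i 1) \<eta>) = - (2 * (pd i (\<phi> k) \<bullet> cls (\<lambda>x. \<phi> k x * \<eta> x)))" for k
      proof -
        note sq = smooth_mult[OF \<phi> \<phi>, of k k]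
        have "cls (\<lambda>x. \<phi> k x * \<phi> k x) \<bullet> cls (partial (axis i 1) \<eta>) = - (cls \<eta> \<bullet> pd i (\<lambda>x. \<phi> k x * \<phi> k x))"
          unfolding pd_smooth[OF sq] cls_inner[OF smooth_L2[OF sq] \<eta>p] cls_inner[OF \<eta>2 smooth_L2[OF smooth_partial[OF sq axis_Basis_real]]] L2_inner_def
          using smooth_integration_by_parts[OF sq \<eta> axis_Basis_real, of i] by (simp add: mult.commute)
        then show ?thesis unfolding inner_square_rule[OF \<phi> smooth_in_L4[OF \<eta>s] \<eta>2] .
      qed
      moreover have "(\<lambda>k. - (2 * (pd i (\<phi> k) \<bullet> cls (\<lambda>x. \<phi> k x * \<eta> x)))) \<longlonglongrightarrow> - (2 * (pd i u \<bullet> cls (\<lambda>x. u x * \<eta> x)))"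
        by (intro tendsto_intros pdl L4_product_limit smooth_in_L4 \<phi> uL4 d \<eta>s)
      ultimately show "(\<lambda>k. cls (\<lambda>x. \<phi> k x * \<phi> k x) \<bullet> cls (partial (axis i 1) \<eta>)) \<longlonglongrightarrow> - (2 * (pd i u \<bullet> cls (\<lambda>x. u x * \<eta> x)))"
        by simp
      show "(\<lambda>k. cls (\<lambda>x. \<phi> k x * \<phi> k x) \<bullet> cls (partial (axis i 1) \<eta>)) \<longlonglongrightarrow> cls (\<lambda>x. u x * u x) \<bullet> cls (partial (axis i 1) \<eta>)"
        by (intro tendsto_intros square_limit smooth_in_L4 \<phi> uL4 d)
    qed
    have "(LINT x|lebesgue_on \<Omega>. (\<Sum>i\<in>UNIV. (flux (u x) :: real^'n) $ i * partial (axis i 1) \<eta> x))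
        = (\<Sum>i\<in>UNIV. - (LINT x|lebesgue_on \<Omega>. h x \<bullet> partial (axis i 1) \<eta> x))"
      unfolding flux by (simp add: integral_sum integrable_inner_L2[OF h(1) \<eta>p, simplified])
    also have "\<dots> = (\<Sum>i\<in>UNIV. - (cls h \<bullet> cls (partial (axis i 1) \<eta>)))"
      by (simp only: cls_inner[OF h(1) \<eta>p] L2_inner_def)
    also have "\<dots> = (\<Sum>i\<in>UNIV. pd i u \<bullet> cls \<eta> + pd i u \<bullet> cls (\<lambda>x. u x * \<eta> x))"
      unfolding h(2) by (simp add: inner_add_left a b add.commute)
    also have "\<dots> = sp u \<bullet> cls \<eta> + sp u \<bullet> cls (\<lambda>x. u x * \<eta> x)"
      unfolding sp_eq_sum[OF u1] by (simp add: inner_sum_left sum.distrib)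
    also have "\<dots> = (LINT x|lebesgue_on \<Omega>. sum_partials u x \<bullet> \<eta> x + sum_partials u x \<bullet> (u x * \<eta> x))"
      unfolding sp_def cls_inner[OF s \<eta>2] cls_inner[OF s u\<eta>] L2_inner_def
      by (rule Bochner_Integration.integral_add[symmetric]) (intro integrable_inner_L2 s \<eta>2 u\<eta>)+
    also have "\<dots> = - (LINT x|lebesgue_on \<Omega>. - (sum_partials u x + sum_partials u x * u x) * \<eta> x)"
      unfolding Bochner_Integration.integral_minus[symmetric]
      by (intro Bochner_Integration.integral_cong) (auto simp: algebra_simps)
    finally show ?thesis .
  qed
  then show ?thesis using L2_loc[OF F] loc by (simp add: has_weak_divergence_def)
qed

text \<open>The part of the equation without time derivative, after \<open>\<nabla> \<bullet> g(u) = - (1 + u) (\<Sum>i. \<partial>\<^sub>i u)\<close>;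
  \<open>sp u\<close> is the class of \<open>\<Sum>i. \<partial>\<^sub>i u\<close>.\<close>

definition form :: "real \<Rightarrow> (real^'n \<Rightarrow> real) \<Rightarrow> (real^'n \<Rightarrow> real) \<Rightarrow> real" where
  "form \<alpha> u w = - \<alpha> * (grd u \<bullet> grd w) - sp u \<bullet> cls w - sp u \<bullet> cls (\<lambda>x. u x * w x)"

lemma H20_L4:
  assumes "u \<in> H20 \<Omega>"
  shows "u \<in> L4" "n4 u \<le> 2 * L4_const * (norm (emb u))\<^sup>2"
proof -
  note z = zero_trace_in_L4[OF H20_zero_trace[OF assms]]
  show "u \<in> L4" by (rule z)
  have "(norm (cls u))\<^sup>2 + (norm (grd u))\<^sup>2 \<le> (norm (emb u))\<^sup>2 + (norm (emb u))\<^sup>2"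
    by (intro add_mono power_mono cls_le_emb H20_H2 grd_le_emb assms) auto
  then have "L4_const * ((norm (cls u))\<^sup>2 + (norm (grd u))\<^sup>2) \<le> L4_const * (2 * (norm (emb u))\<^sup>2)"
    by (intro mult_left_mono L4_const_nonneg) simp
  then show "n4 u \<le> 2 * L4_const * (norm (emb u))\<^sup>2" using z(2) by simp
qed

lemma H20_product:
  assumes u: "u \<in> H20 \<Omega>" and w: "w \<in> H20 \<Omega>"
  shows "(\<lambda>x. u x * w x) \<in> L2 \<Omega>" "norm (cls (\<lambda>x. u x * w x)) \<le> 2 * L4_const * norm (emb u) * norm (emb w)"
proof -
  note m = L4_mult[OF H20_L4(1)[OF u] H20_L4(1)[OF w]]
  show "(\<lambda>x. u x * w x) \<in> L2 \<Omega>" by (rule m)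
  have "n4 u * n4 w \<le> (2 * L4_const * (norm (emb u))\<^sup>2) * (2 * L4_const * (norm (emb w))\<^sup>2)"
    by (intro mult_mono H20_L4 u w) (auto simp: n4_def L4_const_nonneg)
  also have "\<dots> = (2 * L4_const * norm (emb u) * norm (emb w))\<^sup>2" by (simp add: power2_eq_square)
  finally have "sqrt (n4 u * n4 w) \<le> \<bar>2 * L4_const * norm (emb u) * norm (emb w)\<bar>"
    using real_sqrt_le_mono by (metis real_sqrt_abs)
  then show "norm (cls (\<lambda>x. u x * w x)) \<le> 2 * L4_const * norm (emb u) * norm (emb w)"
    using m(2) L4_const_nonneg by (simp add: abs_of_nonneg)
qed

lemma form_linear:
  assumes u: "u \<in> H20 \<Omega>" and v: "v \<in> H20 \<Omega>" and w: "w \<in> H20 \<Omega>"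
  shows "form \<alpha> u (\<lambda>x. c * v x + w x) = c * form \<alpha> u v + form \<alpha> u w"
proof -
  have "cls (\<lambda>x. u x * (c * v x + w x)) = cls (\<lambda>x. c * (u x * v x) + u x * w x)" by (simp add: algebra_simps)
  also have "\<dots> = c *\<^sub>R cls (\<lambda>x. u x * v x) + cls (\<lambda>x. u x * w x)"
    by (simp add: cls_add cls_cmult L2_cmult H20_product u v w)
  finally show ?thesis
    unfolding form_def H1_linear[OF H20_H1[OF v] H20_H1[OF w]] by (simp add: inner_add_right algebra_simps)
qed

text \<open>The summands bound the diffusion term, the linear and the quadratic part of the flux:
  the number of dimensions comes from the sum of partials, and 2 \<open>L4_const\<close> from the L2
  norm of a product.\<close>

definition form_const :: "real \<Rightarrow> real" where
  "form_const \<alpha> = \<bar>\<alpha>\<bar> + real CARD('n) + 2 * real CARD('n) * L4_const"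

lemma form_lipschitz:
  assumes u: "u \<in> H20 \<Omega>" and v: "v \<in> H20 \<Omega>" and w: "w \<in> H20 \<Omega>"
  shows "\<bar>form \<alpha> u w - form \<alpha> v w\<bar>
    \<le> form_const \<alpha> * (1 + norm (emb u) + norm (emb v)) * norm (emb u - emb v) * norm (emb w)"
proof -
  let ?N = "real CARD('n)"
  define d where "d x = u x - v x" for x
  have d: "d \<in> H20 \<Omega>" unfolding d_def[abs_def] by (rule H20_diff[OF u v])
  have ed: "emb d = emb u - emb v" "grd d = grd u - grd v" "sp d = sp u - sp v"
    unfolding d_def[abs_def] by (intro H2_diff H1_diff sp_diff H20_H2 H20_H1 u v)+
  have cd: "cls (\<lambda>x. d x * w x) = cls (\<lambda>x. u x * w x) - cls (\<lambda>x. v x * w x)"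
    unfolding d_def left_diff_distrib by (intro cls_diff H20_product u v w)
  have spn: "norm (sp x) \<le> ?N * norm (emb x)" if "x \<in> H20 \<Omega>" for x
    by (rule order_trans[OF norm_sp_le[OF H20_H1[OF that]] mult_left_mono[OF grd_le_emb[OF that]]]) simp
  \<comment> \<open>The quadratic term is split as B(u, u) - B(v, v) = B(d, u) + B(v, d), so that
    each piece contains the difference once.\<close>
  have eq: "form \<alpha> u w - form \<alpha> v w = - \<alpha> * (grd d \<bullet> grd w) - sp d \<bullet> cls w - (sp d \<bullet> cls (\<lambda>x. u x * w x) + sp v \<bullet> cls (\<lambda>x. d x * w x))"
    unfolding form_def ed cd by (simp add: inner_diff_left inner_diff_right algebra_simps)
  let ?D = "norm (emb d)" and ?W = "norm (emb w)" and ?U = "norm (emb u)" and ?V = "norm (emb v)"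
  have 1: "\<bar>- \<alpha> * (grd d \<bullet> grd w)\<bar> \<le> \<bar>\<alpha>\<bar> * (?D * ?W)"
  proof -
    have "\<bar>grd d \<bullet> grd w\<bar> \<le> ?D * ?W"
      by (rule order_trans[OF Cauchy_Schwarz_ineq2 mult_mono]) (auto intro: grd_le_emb d w)
    then show ?thesis by (simp add: abs_mult mult_left_mono)
  qed
  have 2: "\<bar>sp d \<bullet> cls w\<bar> \<le> ?N * ?D * ?W"
    by (rule order_trans[OF Cauchy_Schwarz_ineq2 mult_mono]) (auto intro: spn d cls_le_emb H20_H2 w)
  have 3: "\<bar>sp d \<bullet> cls (\<lambda>x. u x * w x)\<bar> \<le> ?N * ?D * (2 * L4_const * ?U * ?W)"
    by (rule order_trans[OF Cauchy_Schwarz_ineq2 mult_mono]) (auto intro: spn d H20_product u w)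
  have 4: "\<bar>sp v \<bullet> cls (\<lambda>x. d x * w x)\<bar> \<le> ?N * ?V * (2 * L4_const * ?D * ?W)"
    by (rule order_trans[OF Cauchy_Schwarz_ineq2 mult_mono]) (auto intro: spn v H20_product d w)
  have "\<bar>form \<alpha> u w - form \<alpha> v w\<bar>
      \<le> \<bar>\<alpha>\<bar> * (?D * ?W) + ?N * ?D * ?W + (?N * ?D * (2 * L4_const * ?U * ?W) + ?N * ?V * (2 * L4_const * ?D * ?W))"
    unfolding eq using 1 2 3 4 by linarith
  also have "\<dots> = (\<bar>\<alpha>\<bar> + ?N) * (?D * ?W) + 2 * ?N * L4_const * (?U + ?V) * (?D * ?W)" by (simp add: algebra_simps)
  also have "\<dots> \<le> (\<bar>\<alpha>\<bar> + ?N) * (1 + ?U + ?V) * (?D * ?W) + 2 * ?N * L4_const * (1 + ?U + ?V) * (?D * ?W)"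
  proof (intro add_mono mult_right_mono mult_left_mono)
    show "\<bar>\<alpha>\<bar> + ?N \<le> (\<bar>\<alpha>\<bar> + ?N) * (1 + ?U + ?V)"
      using mult_left_mono[of 1 "1 + ?U + ?V" "\<bar>\<alpha>\<bar> + ?N"] by simp
  qed (auto simp: L4_const_nonneg)
  also have "\<dots> = form_const \<alpha> * (1 + ?U + ?V) * norm (emb u - emb v) * ?W"
    unfolding ed(1)[symmetric] by (simp add: form_const_def algebra_simps)
  finally show ?thesis .
qed

lemma form_dissipative:
  assumes u: "u \<in> H20 \<Omega>" and "0 \<le> \<alpha>"
  shows "form \<alpha> u u \<le> 0"
proof -
  have "sp u \<bullet> cls u = 0" "sp u \<bullet> cls (\<lambda>x. u x * u x) = 0"
    unfolding sp_eq_sum[OF H20_H1[OF u]]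
    by (simp_all add: inner_sum_left energy_identities[OF H20_zero_trace[OF u]])
  then show ?thesis using assms(2) by (simp add: form_def)
qed

text \<open>The chosen weak divergence agrees almost everywhere with the explicit one. The quadratic
  factor \<open>u\<close> is moved to the test function, so that both pairings are inner products in
  L2.\<close>

lemma form_divergence:
  assumes u: "u \<in> H20 \<Omega>" and w: "w \<in> H20 \<Omega>"
  shows "L2_inner \<Omega> (weak_divergence \<Omega> (\<lambda>x. flux (u x))) w = - (sp u \<bullet> cls w) - sp u \<bullet> cls (\<lambda>x. u x * w x)"
proof -
  let ?d = "\<lambda>x. - (sum_partials u x + sum_partials u x * u x)"
  note wd = weak_divergence_flux[OF H20_zero_trace[OF u]]
  have "has_weak_divergence \<Omega> (\<lambda>x. flux (u x)) (weak_divergence \<Omega> (\<lambda>x. flux (u x)))"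
    unfolding weak_divergence_def by (rule someI[of _ ?d]) (rule wd)
  from weak_divergence_unique[OF wd this]
  have ae: "AE x in lebesgue_on \<Omega>. ?d x = weak_divergence \<Omega> (\<lambda>x. flux (u x)) x" .
  have s: "sum_partials u \<in> L2 \<Omega>" by (rule sum_partials_L2[OF H20_H1[OF u]])
  have w2: "w \<in> L2 \<Omega>" by (rule H1D[OF H20_H1[OF w]])
  have u2: "u \<in> L2 \<Omega>" by (rule H1D[OF H20_H1[OF u]])
  note uw = H20_product(1)[OF u w]
  have dm: "?d \<in> borel_measurable (lebesgue_on \<Omega>)"
    using L2_measurable[OF s] L2_measurable[OF u2] by auto
  have "L2_inner \<Omega> (weak_divergence \<Omega> (\<lambda>x. flux (u x))) w = (LINT x|lebesgue_on \<Omega>. ?d x * w x)"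
    unfolding L2_inner_def
  proof (rule integral_cong_AE)
    show "AE x in lebesgue_on \<Omega>. weak_divergence \<Omega> (\<lambda>x. flux (u x)) x \<bullet> w x = ?d x * w x"
      using ae by eventually_elim simp
    show "(\<lambda>x. ?d x * w x) \<in> borel_measurable (lebesgue_on \<Omega>)"
      using dm L2_measurable[OF w2] by (rule borel_measurable_times)
    show "(\<lambda>x. weak_divergence \<Omega> (\<lambda>x. flux (u x)) x \<bullet> w x) \<in> borel_measurable (lebesgue_on \<Omega>)"
      using measurable_lebesgue_on_AE[OF dm ae \<Omega>_sets] L2_measurable[OF w2] by (rule borel_measurable_inner)
  qed
  also have "\<dots> = - (LINT x|lebesgue_on \<Omega>. sum_partials u x \<bullet> w x + sum_partials u x \<bullet> (u x * w x))"
    unfolding Bochner_Integration.integral_minus[symmetric]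
    by (intro Bochner_Integration.integral_cong) (auto simp: algebra_simps)
  also have "(LINT x|lebesgue_on \<Omega>. sum_partials u x \<bullet> w x + sum_partials u x \<bullet> (u x * w x)) = sp u \<bullet> cls w + sp u \<bullet> cls (\<lambda>x. u x * w x)"
    unfolding sp_def cls_inner[OF s w2] cls_inner[OF s uw] L2_inner_def
    by (rule Bochner_Integration.integral_add) (intro integrable_inner_L2 s w2 uw)+
  finally show ?thesis by simp
qed

end

section \<open>Bochner integrals\<close>

text \<open>One error bound for all pairs of times at distance at most T / (k + 1); it makes the
  step function approximation uniform in time.\<close>

lemma modulus_of_continuity:
  fixes F :: "real \<Rightarrow> 'h::real_normed_vector"
  assumes F: "continuous_on {0..T} F" and T: "0 < T"
  shows "\<exists>\<omega>. \<omega> \<longlonglongrightarrow> 0 \<and> (\<forall>k. \<forall>s\<in>{0..T}. \<forall>t\<in>{0..T}. \<bar>s - t\<bar> \<le> T / Suc k \<longrightarrow> norm (F s - F t) \<le> \<omega> k)"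
proof -
  define D where "D k = {(s, t). s \<in> {0..T} \<and> t \<in> {0..T} \<and> \<bar>s - t\<bar> \<le> T / Suc k}" for k :: nat
  define \<omega> where "\<omega> k = (SUP (s, t)\<in>D k. norm (F s - F t))" for k
  have "compact (F ` {0..T})" by (intro compact_continuous_image F) simp
  then have "bounded (F ` {0..T})" by (rule compact_imp_bounded)
  then obtain M where M: "\<forall>t\<in>{0..T}. norm (F t) \<le> M" unfolding bounded_iff by (auto simp: ball_simps)
  have bdd: "bdd_above ((\<lambda>(s, t). norm (F s - F t)) ` D k)" for k
  proof (rule bdd_aboveI2)
    fix p assume "p \<in> D k"
    then have "norm (F (fst p)) \<le> M" "norm (F (snd p)) \<le> M" using M by (auto simp: D_def)
    then show "(case p of (s, t) \<Rightarrow> norm (F s - F t)) \<le> M + M"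
      using norm_triangle_ineq4[of "F (fst p)" "F (snd p)"] by (simp add: case_prod_unfold)
  qed
  have up: "norm (F s - F t) \<le> \<omega> k" if "(s, t) \<in> D k" for s t k
    unfolding \<omega>_def using cSUP_upper[OF that bdd] by simp
  have z: "(0, 0) \<in> D k" for k using T by (simp add: D_def)
  have "\<omega> \<longlonglongrightarrow> 0"
  proof (rule tendstoI)
    fix e :: real assume e: "0 < e"
    have "uniformly_continuous_on {0..T} F" by (rule compact_uniformly_continuous[OF F]) simp
    then obtain d where d: "d > 0" "\<forall>s\<in>{0..T}. \<forall>t\<in>{0..T}. dist t s < d \<longrightarrow> dist (F t) (F s) < e / 2"
      using half_gt_zero[OF e] unfolding uniformly_continuous_on_def by meson
    have "(\<lambda>k. T * inverse (real (Suc k))) \<longlonglongrightarrow> T * 0" by (intro tendsto_intros LIMSEQ_inverse_real_of_nat)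
    then have "\<forall>\<^sub>F k in sequentially. T * inverse (real (Suc k)) < d" using d(1) by (intro order_tendstoD(2)) auto
    then show "\<forall>\<^sub>F k in sequentially. dist (\<omega> k) 0 < e"
    proof eventually_elim
      case (elim k)
      have "\<omega> k \<le> e / 2"
        unfolding \<omega>_def
      proof (rule cSUP_least)
        show "D k \<noteq> {}" using z by auto
        fix p assume "p \<in> D k"
        then have p: "fst p \<in> {0..T}" "snd p \<in> {0..T}" "dist (fst p) (snd p) < d"
          using elim by (auto simp: D_def dist_real_def divide_inverse)
        have "dist (F (fst p)) (F (snd p)) < e / 2"
          by (rule d(2)[rule_format, OF p(2) p(1) p(3)])
        then show "(case p of (s, t) \<Rightarrow> norm (F s - F t)) \<le> e / 2"
          by (simp add: dist_norm case_prod_unfold)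
      qed
      moreover have "0 \<le> \<omega> k" using up[OF z, of k] by simp
      ultimately show ?case using e by simp
    qed
  qed
  then show ?thesis using up by (intro exI[of _ \<omega>]) (auto simp: D_def)
qed

definition node :: "real \<Rightarrow> nat \<Rightarrow> nat \<Rightarrow> real" where
  "node T k j = T * real j / real (Suc k)"

lemma node_0: "node T k 0 = 0"
  and node_Suc: "node T k (Suc j) = node T k j + T / real (Suc k)"
  and node_nonneg: "0 < T \<Longrightarrow> 0 \<le> node T k j"
  by (simp_all add: node_def add_divide_distrib algebra_simps)

lemma node_last: "node T k (Suc k) = T"
  by (simp add: node_def del: of_nat_Suc)

lemma node_step: "0 < T \<Longrightarrow> node T k j < node T k (Suc j)"
  by (simp add: node_Suc)

lemma node_le: "0 < T \<Longrightarrow> j \<le> Suc k \<Longrightarrow> node T k j \<le> T"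
  using node_last[of T k] lift_Suc_mono_le[of "node T k" j "Suc k"] node_step[of T k]
  by (metis less_imp_le)

text \<open>Induction over the pieces: each one of length h = T / (k + 1) adds an error of at most h
  \<omega>.\<close>

lemma left_riemann_sum:
  fixes F :: "real \<Rightarrow> 'h::banach"
  assumes F: "continuous_on {0..T} F" and T: "0 < T"
    and \<omega>: "\<And>s t. s \<in> {0..T} \<Longrightarrow> t \<in> {0..T} \<Longrightarrow> \<bar>s - t\<bar> \<le> T / real (Suc k) \<Longrightarrow> norm (F s - F t) \<le> \<omega>"
  shows "norm (integral {0..T} F - (\<Sum>j<Suc k. (T / real (Suc k)) *\<^sub>R F (node T k j))) \<le> T * \<omega>"
proof -
  let ?p = "node T k"
  define h where "h = T / real (Suc k)"
  note p = less_imp_le[OF node_step[OF T], of k] node_nonneg[OF T, of k]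
  have pS: "?p (Suc j) = ?p j + h" for j by (simp add: node_Suc h_def)
  have "norm (integral {0..?p m} F - (\<Sum>j<m. h *\<^sub>R F (?p j))) \<le> real m * (h * \<omega>)" if "m \<le> Suc k" for m
    using that
  proof (induction m)
    case (Suc m)
    note pT = node_le[OF T Suc.prems]
    have "{?p m..?p (Suc m)} \<subseteq> {0..T}" "{0..?p (Suc m)} \<subseteq> {0..T}" using p(2)[of m] pT by auto
    note c = this[THEN continuous_on_subset[OF F]]
    have split: "integral {0..?p (Suc m)} F = integral {0..?p m} F + integral {?p m..?p (Suc m)} F"
      by (rule Henstock_Kurzweil_Integration.integral_combine[symmetric]) (intro p integrable_continuous_interval c)+
    have "integral {?p m..?p (Suc m)} F - h *\<^sub>R F (?p m) = integral {?p m..?p (Suc m)} (\<lambda>t. F t - F (?p m))"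
      unfolding Henstock_Kurzweil_Integration.integral_diff[OF integrable_continuous_interval[OF c(1)] integrable_const_ivl]
      using p(1)[of m] pS[of m] by simp
    also have "norm \<dots> \<le> \<omega> * (?p (Suc m) - ?p m)"
    proof (rule integral_bound[OF p(1)])
      show "continuous_on {?p m..?p (Suc m)} (\<lambda>t. F t - F (?p m))" by (intro continuous_intros c)
      fix t assume "t \<in> {?p m..?p (Suc m)}"
      then show "norm (F t - F (?p m)) \<le> \<omega>"
        using p(2)[of m] p(1)[of m] pT pS[of m] by (intro \<omega>) (auto simp flip: h_def simp del: of_nat_Suc)
    qed
    also have "\<dots> = h * \<omega>" using pS[of m] by simp
    finally have 1: "norm (integral {?p m..?p (Suc m)} F - h *\<^sub>R F (?p m)) \<le> h * \<omega>" .
    have 2: "norm (integral {0..?p m} F - (\<Sum>j<m. h *\<^sub>R F (?p j))) \<le> real m * (h * \<omega>)" using Suc by simp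
    have e1: "integral {0..?p (Suc m)} F - (\<Sum>j<Suc m. h *\<^sub>R F (?p j))
        = (integral {0..?p m} F - (\<Sum>j<m. h *\<^sub>R F (?p j))) + (integral {?p m..?p (Suc m)} F - h *\<^sub>R F (?p m))"
      unfolding split by simp
    have e2: "real (Suc m) * (h * \<omega>) = real m * (h * \<omega>) + h * \<omega>" by (simp add: algebra_simps)
    show ?case unfolding e1 e2 by (rule norm_triangle_le[OF add_mono[OF 2 1]])
  qed (simp add: node_0)
  from this[of "Suc k"] show ?thesis by (simp add: node_last h_def)
qed

text \<open>The equation is integrated in time and so asks for no derivative of \<open>U\<close> and
  \<open>W\<close>. At each \<open>t\<close> the difference itself is the test element, and
  Gronwall's lemma applies to its norm.\<close>

lemma integral_form_unique:
  fixes V :: "'h::{real_inner,banach} set" and l :: "'h \<Rightarrow> 'h \<Rightarrow> real" and T :: real and U W :: "real \<Rightarrow> 'h"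
  assumes V: "subspace V"
    and lip: "\<And>u v w. u \<in> V \<Longrightarrow> v \<in> V \<Longrightarrow> w \<in> V \<Longrightarrow>
       \<bar>l u w - l v w\<bar> \<le> C * (1 + norm u + norm v) * norm (u - v) * norm w"
    and C: "0 \<le> C" and T: "0 < T"
    and U: "continuous_on {0..T} U" "\<And>t. t \<in> {0..T} \<Longrightarrow> U t \<in> V"
    and W: "continuous_on {0..T} W" "\<And>t. t \<in> {0..T} \<Longrightarrow> W t \<in> V"
    and int: "\<And>t w. t \<in> {0..T} \<Longrightarrow> w \<in> V \<Longrightarrow> ((\<lambda>s. l (U s) w) has_integral U t \<bullet> w - U 0 \<bullet> w) {0..t}"
      "\<And>t w. t \<in> {0..T} \<Longrightarrow> w \<in> V \<Longrightarrow> ((\<lambda>s. l (W s) w) has_integral W t \<bullet> w - W 0 \<bullet> w) {0..t}"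
    and init: "U 0 = W 0" and t: "t \<in> {0..T}"
  shows "U t = W t"
proof -
  have "bounded (U ` {0..T})" "bounded (W ` {0..T})"
    by (rule compact_imp_bounded[OF compact_continuous_image[OF U(1) compact_Icc]]
        compact_imp_bounded[OF compact_continuous_image[OF W(1) compact_Icc]])+
  then obtain M N where MN: "\<forall>t\<in>{0..T}. norm (U t) \<le> M" "\<forall>t\<in>{0..T}. norm (W t) \<le> N"
    unfolding bounded_iff by (auto simp: ball_simps)
  have "norm (U 0) \<le> M" "norm (W 0) \<le> N" using MN T by auto
  then have MN0: "0 \<le> M" "0 \<le> N" using order_trans[OF norm_ge_zero] by blast+
  define K where "K = C * (1 + M + N)"
  define D where "D t = U t - W t" for t
  have K: "0 \<le> K" using C MN0 by (simp add: K_def)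
  have "norm (D t) = 0"
  proof (rule gronwall_zero[where T = T and \<phi> = "\<lambda>t. norm (D t)"])
    show c: "continuous_on {0..T} (\<lambda>t. norm (D t))" unfolding D_def by (intro continuous_intros U W)
    fix t assume t: "t \<in> {0..T}"
    \<comment> \<open>The test element depends on \<open>t\<close> but is constant in the
      integration variable. It gives norm(D t)^2 on the left, and one factor norm(D t) is divided
      out afterwards.\<close>
    have DV: "D t \<in> V" unfolding D_def by (intro subspace_diff V U W t)
    have i: "(\<lambda>s. norm (D s)) integrable_on {0..t}"
      using t by (intro integrable_continuous_interval continuous_on_subset[OF c]) auto
    have "((\<lambda>s. l (U s) (D t) - l (W s) (D t)) has_integral (U t \<bullet> D t - U 0 \<bullet> D t) - (W t \<bullet> D t - W 0 \<bullet> D t)) {0..t}"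
      by (intro has_integral_diff int t DV)
    moreover have "(U t \<bullet> D t - U 0 \<bullet> D t) - (W t \<bullet> D t - W 0 \<bullet> D t) = norm (D t) * norm (D t)"
      by (simp add: init flip: power2_eq_square power2_norm_eq_inner) (simp add: D_def inner_diff_left power2_norm_eq_inner)
    ultimately have h: "((\<lambda>s. l (U s) (D t) - l (W s) (D t)) has_integral norm (D t) * norm (D t)) {0..t}" by simp
    have "((\<lambda>s. (K * norm (D t)) * norm (D s)) has_integral (K * norm (D t)) * integral {0..t} (\<lambda>s. norm (D s))) {0..t}"
      by (intro has_integral_mult_right integrable_integral i)
    from h this have le: "norm (D t) * norm (D t) \<le> (K * norm (D t)) * integral {0..t} (\<lambda>s. norm (D s))"
    proof (rule has_integral_le)
      fix s assume "s \<in> {0..t}"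
      then have s: "s \<in> {0..T}" using t by auto
      have "l (U s) (D t) - l (W s) (D t) \<le> C * (1 + norm (U s) + norm (W s)) * norm (U s - W s) * norm (D t)"
        using lip[OF U(2)[OF s] W(2)[OF s] DV] by simp
      also have "\<dots> \<le> K * norm (U s - W s) * norm (D t)"
        unfolding K_def using MN s C by (intro mult_right_mono mult_left_mono add_mono) auto
      finally show "l (U s) (D t) - l (W s) (D t) \<le> (K * norm (D t)) * norm (D s)"
        by (simp add: D_def mult_ac)
    qed
    show "norm (D t) \<le> K * integral {0..t} (\<lambda>s. norm (D s))"
    proof (cases "norm (D t) = 0")
      case True
      then show ?thesis using K by (simp add: Henstock_Kurzweil_Integration.integral_nonneg[OF i])
    next
      case False
      then have "0 < norm (D t)" by simp
      with le show ?thesis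
        by (metis mult.assoc mult.commute mult_le_cancel_left_pos)
    qed
  qed (use t K in auto)
  then show ?thesis by (simp add: D_def)
qed

text \<open>The values at the left nodes on half-open pieces, as a simple function. The point
  \<open>T\<close> is removed because the pieces must lie in the open interval; their lengths do not
  change.\<close>

definition steps :: "real \<Rightarrow> nat \<Rightarrow> (real \<Rightarrow> 'a \<Rightarrow> real) \<Rightarrow> 'a simple" where
  "steps T k f = map (\<lambda>j. ({node T k j<..node T k (Suc j)} - {T}, f (node T k j))) [0..<Suc k]"

lemma steps_pieces:
  assumes T: "0 < T" and j: "j < Suc k"
  shows "{node T k j<..node T k (Suc j)} - {T} \<subseteq> {0<..<T}"
    and "{node T k j<..node T k (Suc j)} - {T} \<in> sets lebesgue"
    and "measure lebesgue ({node T k j<..node T k (Suc j)} - {T}) = T / real (Suc k)"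
    and "node T k j \<in> {0..T}"
proof -
  have 2: "node T k (Suc j) \<le> T" using T j by (intro node_le) auto
  note 3 = node_nonneg[OF T, of k j] and 4 = node_step[OF T, of k j]
  show "{node T k j<..node T k (Suc j)} - {T} \<subseteq> {0<..<T}"
    using 2 3 by (intro subsetI) (simp add: order_less_le)
  show "{node T k j<..node T k (Suc j)} - {T} \<in> sets lebesgue" by (intro sets.Diff) auto
  have "measure lebesgue ({node T k j<..node T k (Suc j)} - {T}) = measure lebesgue {node T k j<..node T k (Suc j)}"
    by (rule measure_Diff_null_set) auto
  also have "\<dots> = node T k (Suc j) - node T k j" using 4 by simp
  finally show "measure lebesgue ({node T k j<..node T k (Suc j)} - {T}) = T / real (Suc k)" by (simp add: node_Suc)
  show "node T k j \<in> {0..T}" using 2 3 4 by simp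
qed

lemma steps_simples:
  assumes T: "0 < T" and f: "\<And>t. t \<in> {0..T} \<Longrightarrow> f t \<in> Z"
  shows "steps T k f \<in> simples {0<..<T} Z"
proof -
  have "fst p \<in> sets lebesgue \<and> fst p \<subseteq> {0<..<T} \<and> snd p \<in> Z" if "p \<in> set (steps T k f)" for p
  proof -
    have "p \<in> (\<lambda>j. ({node T k j<..node T k (Suc j)} - {T}, f (node T k j))) ` {0..<Suc k}"
      using that by (simp add: steps_def del: upt_Suc)
    then obtain j where "j < Suc k" "p = ({node T k j<..node T k (Suc j)} - {T}, f (node T k j))" by fastforce
    then show ?thesis using steps_pieces[OF T, of j k] f by simp
  qed
  then show ?thesis unfolding simples_def by (simp add: case_prod_unfold)
qed

lemma steps_integral:
  assumes T: "0 < T"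
  shows "simple_integral (steps T k f) x = (\<Sum>j<Suc k. T / real (Suc k) * f (node T k j) x)"
proof -
  have "simple_integral (steps T k f) x
      = (\<Sum>j\<leftarrow>[0..<Suc k]. measure lebesgue ({node T k j<..node T k (Suc j)} - {T}) * f (node T k j) x)"
    by (simp add: simple_integral_def steps_def o_def del: upt_Suc)
  also have "\<dots> = (\<Sum>j<Suc k. measure lebesgue ({node T k j<..node T k (Suc j)} - {T}) * f (node T k j) x)"
    unfolding interv_sum_list_conv_sum_set_nat set_upt by (simp only: lessThan_atLeast0)
  also have "\<dots> = (\<Sum>j<Suc k. T / real (Suc k) * f (node T k j) x)"
    by (rule sum.cong) (simp_all only: steps_pieces(3)[OF T] lessThan_iff)
  finally show ?thesis .
qed

lemma steps_value:
  assumes t: "t \<in> {0<..<T}"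
  shows "\<exists>s\<in>{0..T}. \<bar>t - s\<bar> \<le> T / real (Suc k) \<and> simple_value (steps T k f) t = f s"
proof -
  have T: "0 < T" using t by auto
  let ?N = "real (Suc k)"
  define y where "y = t * ?N / T"
  have N: "0 < ?N" by simp
  have y: "0 < y" "y < ?N" using t T N unfolding y_def by (auto simp: pos_divide_less_eq simp del: of_nat_Suc)
  have ty: "t = T * y / ?N" using T unfolding y_def by (simp del: of_nat_Suc)
  \<comment> \<open>The pieces are open on the left and closed on the right, so the index of the
    piece that contains \<open>t\<close> is one below the ceiling.\<close>
  define j where "j = nat (\<lceil>y\<rceil> - 1)"
  have "\<lceil>y\<rceil> \<ge> 1" using y by linarith
  then have j: "real j < y" "y \<le> real j + 1" unfolding j_def by linarith+
  then have jk: "j < Suc k" using y by linarith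
  have iff: "t \<in> {node T k i<..node T k (Suc i)} - {T} \<longleftrightarrow> i = j" for i :: nat
  proof -
    have "t \<in> {node T k i<..node T k (Suc i)} - {T} \<longleftrightarrow> real i < y \<and> y \<le> real (Suc i)"
      using t T N unfolding ty node_def by (simp add: divide_less_cancel divide_le_cancel del: of_nat_Suc)
    also have "\<dots> \<longleftrightarrow> i = j" using j by auto
    finally show ?thesis .
  qed
  have "simple_value (steps T k f) t x = f (node T k j) x" for x
  proof -
    have "simple_value (steps T k f) t x
        = (\<Sum>i\<leftarrow>[0..<Suc k]. indicator ({node T k i<..node T k (Suc i)} - {T}) t * f (node T k i) x)"
      by (simp add: simple_value_def steps_def o_def del: upt_Suc)
    also have "\<dots> = (\<Sum>i\<in>{0..<Suc k}. if i = j then f (node T k i) x else 0)"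
      unfolding interv_sum_list_conv_sum_set_nat set_upt indicator_def iff by (intro sum.cong) auto
    also have "\<dots> = f (node T k j) x" using jk by simp
    finally show ?thesis .
  qed
  moreover have "node T k j \<in> {0..T}" by (rule steps_pieces[OF T jk])
  moreover have "\<bar>t - node T k j\<bar> \<le> T / ?N"
  proof -
    have "T * y \<le> T * (real j + 1)" "T * real j \<le> T * y" using j T by (auto intro: mult_left_mono)
    then have "t \<le> T * (real j + 1) / ?N" "node T k j \<le> t"
      unfolding ty node_def using N by (auto intro: divide_right_mono simp del: of_nat_Suc)
    moreover have "T * (real j + 1) / ?N = node T k j + T / ?N"
      unfolding node_def by (simp only: distrib_left mult_1_right add_divide_distrib)
    ultimately show ?thesis by linarith
  qed
  ultimately show ?thesis by (intro bexI[of _ "node T k j"]) (auto simp: fun_eq_iff)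
qed

context bounded_open
begin

text \<open>A function determines its weak gradient and Laplacian, so the first component of a class
  determines the second.\<close>

lemma emb_cong:
  assumes u: "u \<in> H2 \<Omega>" and v: "v \<in> H2 \<Omega>" and eq: "cls u = cls v"
  shows "emb u = emb v"
proof -
  note u1 = H1D[OF H2D(1)[OF u]] and v1 = H1D[OF H2D(1)[OF v]]
  have "has_weak_gradient \<Omega> v (weak_gradient \<Omega> u)"
    using u1(3) unfolding has_weak_gradient_L2_iff[OF u1(1,2)] has_weak_gradient_L2_iff[OF v1(1) u1(2)] eq .
  from H2I(2)[OF v1(1) u1(2) this H2D(2,3)[OF u]] have l: "lap v = lap u" by (simp add: lap_def)
  have "(norm (emb (\<lambda>x. u x - v x)))\<^sup>2 = (norm (cls u - cls v))\<^sup>2 + (norm (lap u - lap v))\<^sup>2"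
    unfolding emb_norm_sq[OF H2_diff(1)[OF u v]] H2_diff(2)[OF u v] H1_diff(3)[OF H2D(1)[OF u] H2D(1)[OF v]] ..
  then show ?thesis unfolding H2_diff(3)[OF u v] using eq l by simp
qed

lemma cls_cong_emb:
  assumes u: "u \<in> H2 \<Omega>" and v: "v \<in> H2 \<Omega>" and eq: "emb u = emb v"
  shows "cls u = cls v"
proof -
  have "norm (cls (\<lambda>x. u x - v x)) \<le> norm (emb (\<lambda>x. u x - v x))" by (rule cls_le_emb[OF H2_diff(1)[OF u v]])
  then show ?thesis
    unfolding H2_diff(3)[OF u v] H1_diff(3)[OF H2D(1)[OF u] H2D(1)[OF v]] using eq by simp
qed

lemma H20_scale:
  assumes "u \<in> H20 \<Omega>"
  shows "(\<lambda>x. c * u x) \<in> H20 \<Omega>" "emb (\<lambda>x. c * u x) = c *\<^sub>R emb u"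
proof -
  note z = H20_zero[OF assms]
  show "(\<lambda>x. c * u x) \<in> H20 \<Omega>" using H20_linear[OF assms z, of c] by simp
  have "emb (\<lambda>x. 0) = 0" using H2_diff(3)[OF H20_H2[OF z] H20_H2[OF z]] by simp
  then show "emb (\<lambda>x. c * u x) = c *\<^sub>R emb u"
    using emb_linear[OF H20_H2[OF assms] H20_H2[OF z], of c] by simp
qed

lemma H2_zero:
  assumes "u \<in> H2 \<Omega>"
  shows "(\<lambda>x. 0) \<in> H2 \<Omega>" "emb (\<lambda>x. 0) = 0"
  using H2_diff(1,3)[OF assms assms] by simp_all

lemma H20_sum:
  fixes f :: "nat \<Rightarrow> real^'n \<Rightarrow> real"
  assumes u: "u \<in> H20 \<Omega>" and f: "\<And>j. j < m \<Longrightarrow> f j \<in> H20 \<Omega>"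
  shows "(\<lambda>x. \<Sum>j<m. c * f j x) \<in> H20 \<Omega> \<and> emb (\<lambda>x. \<Sum>j<m. c * f j x) = (\<Sum>j<m. c *\<^sub>R emb (f j))"
  using f
proof (induction m)
  case 0
  then show ?case using H20_zero[OF u] H2_zero[OF H20_H2[OF u]] by simp
next
  case (Suc m)
  then have fm: "f m \<in> H20 \<Omega>" and IH: "(\<lambda>x. \<Sum>j<m. c * f j x) \<in> H20 \<Omega>" "emb (\<lambda>x. \<Sum>j<m. c * f j x) = (\<Sum>j<m. c *\<^sub>R emb (f j))"
    by simp_all
  show ?case
    using H20_linear[OF fm IH(1), of c] emb_linear[OF H20_H2[OF fm] H20_H2[OF IH(1)], of c] IH(2)
    by (simp add: add.commute)
qed

lemma H20_subspace:
  assumes "u \<in> H20 \<Omega>"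
  shows "subspace (emb ` H20 \<Omega>)"
proof (rule subspaceI)
  show "0 \<in> emb ` H20 \<Omega>" using H20_zero[OF assms] H2_zero[OF H20_H2[OF assms]] by force
next
  fix h k assume "h \<in> emb ` H20 \<Omega>" "k \<in> emb ` H20 \<Omega>"
  then obtain u v where "u \<in> H20 \<Omega>" "h = emb u" "v \<in> H20 \<Omega>" "k = emb v" by blast
  then show "h + k \<in> emb ` H20 \<Omega>"
    using H20_linear[of u v 1] emb_linear[OF H20_H2 H20_H2, of u v 1] by force
next
  fix c h assume "h \<in> emb ` H20 \<Omega>"
  then obtain u where "u \<in> H20 \<Omega>" "h = emb u" by blast
  then show "c *\<^sub>R h \<in> emb ` H20 \<Omega>" using H20_scale[of u c] by (metis image_eqI)
qed

lemma H20_image_closed: "closed (emb ` H20 \<Omega>)"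
  unfolding closed_sequential_limits
proof (intro allI impI, elim conjE)
  fix h l assume h: "\<forall>k. h k \<in> emb ` H20 \<Omega>" and lim: "h \<longlonglongrightarrow> l"
  have "\<exists>v. v \<in> H20 \<Omega> \<and> emb v = h k" for k
  proof -
    have "h k \<in> emb ` H20 \<Omega>" using h by blast
    then show ?thesis by (elim imageE) (rule exI, erule conjI, erule sym)
  qed
  from choice[OF allI[OF this]] obtain u where u: "\<forall>k. u k \<in> H20 \<Omega> \<and> emb (u k) = h k" by (rule exE)
  have "(\<lambda>k. emb (u k)) \<longlonglongrightarrow> l" using u lim by simp
  from H20_closed[OF _ this] u show "l \<in> emb ` H20 \<Omega>" by blast
qed

lemma H2_norm_nonneg: "0 \<le> H2_norm \<Omega> u" and H1_norm_nonneg: "0 \<le> H1_norm \<Omega> u"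
  by (simp_all add: H2_norm_def H1_norm_def)

section \<open>Continuous functions with values in H20 as Bochner functions\<close>

context
  fixes T :: real and f :: "real \<Rightarrow> real^'n \<Rightarrow> real" and Z and N :: "(real^'n \<Rightarrow> real) \<Rightarrow> real"
  assumes T: "0 < T" and f: "\<And>t. t \<in> {0..T} \<Longrightarrow> f t \<in> H20 \<Omega>"
    and cont: "continuous_on {0..T} (\<lambda>t. emb (f t))"
    and Z: "H20 \<Omega> \<subseteq> Z" and N: "\<And>a. a \<in> H20 \<Omega> \<Longrightarrow> N a \<le> 2 * norm (emb a)" "\<And>a. 0 \<le> N a"
begin

text \<open>\<open>Z\<close> and \<open>N\<close> stand for H20 or H2 with the H2 norm and for H10
  with the H1 norm; the factor 2 is the bound of both norms by the norm of \<open>emb\<close> on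
  H20. One sequence of step functions approximates the function uniformly and its integral by
  Riemann sums.\<close>

lemma steps_approx:
  "\<exists>\<omega>. \<omega> \<longlonglongrightarrow> 0 \<and> (\<forall>k. \<forall>t\<in>{0<..<T}. N (\<lambda>x. f t x - simple_value (steps T k f) t x) \<le> 2 * \<omega> k) \<and>
    (\<forall>k. norm (integral {0..T} (\<lambda>t. emb (f t)) - emb (simple_integral (steps T k f))) \<le> T * \<omega> k \<and>
         simple_integral (steps T k f) \<in> H20 \<Omega>)"
proof -
  obtain \<omega> where \<omega>: "\<omega> \<longlonglongrightarrow> 0" and
    \<omega>': "\<forall>k. \<forall>s\<in>{0..T}. \<forall>t\<in>{0..T}. \<bar>s - t\<bar> \<le> T / Suc k \<longrightarrow> norm (emb (f s) - emb (f t)) \<le> \<omega> k"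
    using modulus_of_continuity[OF cont T] by blast
  have 1: "N (\<lambda>x. f t x - simple_value (steps T k f) t x) \<le> 2 * \<omega> k" if t: "t \<in> {0<..<T}" for k t
  proof -
    have t': "t \<in> {0..T}" using t by simp
    obtain s where s: "s \<in> {0..T}" "\<bar>t - s\<bar> \<le> T / real (Suc k)" "simple_value (steps T k f) t = f s"
      using steps_value[OF t] by blast
    have "N (\<lambda>x. f t x - f s x) \<le> 2 * norm (emb (\<lambda>x. f t x - f s x))" by (intro N H20_diff f t' s)
    also have "\<dots> \<le> 2 * \<omega> k"
      unfolding H2_diff(3)[OF H20_H2[OF f[OF t']] H20_H2[OF f[OF s(1)]]]
      using \<omega>'[rule_format, OF t' s(1,2)] by simp
    finally show ?thesis unfolding s(3) .
  qed
  have nd: "f (node T k j) \<in> H20 \<Omega>" if "j < Suc k" for j k by (rule f[OF steps_pieces(4)[OF T that]])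
  have i: "simple_integral (steps T k f) = (\<lambda>x. \<Sum>j<Suc k. T / real (Suc k) * f (node T k j) x)" for k
    by (rule ext) (rule steps_integral[OF T])
  have 2: "norm (integral {0..T} (\<lambda>t. emb (f t)) - emb (simple_integral (steps T k f))) \<le> T * \<omega> k" for k
  proof -
    have e: "emb (simple_integral (steps T k f)) = (\<Sum>j<Suc k. (T / real (Suc k)) *\<^sub>R emb (f (node T k j)))"
      unfolding i by (rule H20_sum[OF nd[of 0 0] nd, THEN conjunct2]) simp
    show ?thesis unfolding e by (rule left_riemann_sum[OF cont T]) (rule \<omega>'[rule_format])
  qed
  have 3: "simple_integral (steps T k f) \<in> H20 \<Omega>" for k
    unfolding i by (rule H20_sum[OF nd[of 0 0] nd, THEN conjunct1]) simp
  show ?thesis using \<omega> 1 2 3 by blast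
qed

lemma strongly_measurable_continuous: "strongly_measurable {0<..<T} Z N f"
proof -
  obtain \<omega> where \<omega>: "\<omega> \<longlonglongrightarrow> 0" and b: "\<forall>k. \<forall>t\<in>{0<..<T}. N (\<lambda>x. f t x - simple_value (steps T k f) t x) \<le> 2 * \<omega> k"
    using steps_approx by blast
  have "(\<lambda>k. N (\<lambda>x. f t x - simple_value (steps T k f) t x)) \<longlonglongrightarrow> 0" if t: "t \<in> {0<..<T}" for t
  proof (rule Lim_null_comparison)
    show "\<forall>\<^sub>F k in sequentially. norm (N (\<lambda>x. f t x - simple_value (steps T k f) t x)) \<le> 2 * \<omega> k"
      using b t N(2) by (intro always_eventually) simp
    show "(\<lambda>k. 2 * \<omega> k) \<longlonglongrightarrow> 0" using tendsto_mult_left[OF \<omega>, of 2] by simp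
  qed
  moreover have "steps T k f \<in> simples {0<..<T} Z" for k using f Z by (intro steps_simples T) blast
  moreover have "f t \<in> Z" if "t \<in> {0<..<T}" for t using f[of t] Z that by auto
  ultimately show ?thesis
    unfolding strongly_measurable_def by (intro conjI exI[of _ "\<lambda>k. steps T k f"] allI AE_I2) auto
qed

lemma bounded_continuous: "\<exists>C. \<forall>t\<in>{0<..<T}. N (f t) \<le> C"
proof -
  have "bounded ((\<lambda>t. emb (f t)) ` {0..T})" by (rule compact_imp_bounded[OF compact_continuous_image[OF cont compact_Icc]])
  then obtain M where M: "\<forall>t\<in>{0..T}. norm (emb (f t)) \<le> M" unfolding bounded_iff by (auto simp: ball_simps)
  have "N (f t) \<le> 2 * M" if "t \<in> {0<..<T}" for t
    using N(1)[OF f, of t] M that by (auto dest: bspec[of _ _ t])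
  then show ?thesis by blast
qed

lemma bochner_Linf_continuous: "f \<in> bochner_Linf {0<..<T} Z N"
proof -
  obtain C where "\<forall>t\<in>{0<..<T}. N (f t) \<le> C" using bounded_continuous by blast
  then have "AE t in lebesgue_on {0<..<T}. N (f t) \<le> C" by (intro AE_I2) simp
  then show ?thesis using strongly_measurable_continuous unfolding bochner_Linf_def by blast
qed

lemma bochner_Lp_continuous: "f \<in> bochner_Lp 2 {0<..<T} Z N"
proof -
  obtain C where C: "\<forall>t\<in>{0<..<T}. N (f t) \<le> C" using bounded_continuous by blast
  have "(\<integral>\<^sup>+t. ennreal (N (f t) powr 2) \<partial>lebesgue_on {0<..<T}) \<le> (\<integral>\<^sup>+t. ennreal (C powr 2) \<partial>lebesgue_on {0<..<T})"
    using C N(2) by (intro nn_integral_mono ennreal_leI powr_mono2) auto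
  also have "\<dots> < \<infinity>" using T by (simp add: emeasure_restrict_space ennreal_mult_less_top)
  finally show ?thesis using strongly_measurable_continuous by (simp add: bochner_Lp_def)
qed

lemma has_integral_in_continuous:
  assumes J: "J \<in> H20 \<Omega>" "emb J = integral {0..T} (\<lambda>t. emb (f t))"
  shows "has_integral_in {0<..<T} Z N f J"
proof -
  obtain \<omega> where \<omega>: "\<omega> \<longlonglongrightarrow> 0" and b: "\<forall>k. \<forall>t\<in>{0<..<T}. N (\<lambda>x. f t x - simple_value (steps T k f) t x) \<le> 2 * \<omega> k"
    and i: "\<forall>k. norm (integral {0..T} (\<lambda>t. emb (f t)) - emb (simple_integral (steps T k f))) \<le> T * \<omega> k \<and>
         simple_integral (steps T k f) \<in> H20 \<Omega>"
    using steps_approx by blast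
  have "steps T k f \<in> simples {0<..<T} Z" for k using f Z by (intro steps_simples T) blast
  moreover have "(\<lambda>k. \<integral>\<^sup>+t. ennreal (N (\<lambda>x. f t x - simple_value (steps T k f) t x)) \<partial>lebesgue_on {0<..<T}) \<longlonglongrightarrow> 0"
  proof (rule tendsto_sandwich[OF _ _ tendsto_const])
    show "\<forall>\<^sub>F k in sequentially. (\<integral>\<^sup>+t. ennreal (N (\<lambda>x. f t x - simple_value (steps T k f) t x)) \<partial>lebesgue_on {0<..<T})
        \<le> ennreal (2 * \<omega> k * T)"
    proof (rule always_eventually, rule allI)
      fix k
      have "0 \<le> 2 * \<omega> k" using order_trans[OF N(2) b[rule_format, of "T/2" k]] T by simp
      moreover have "(\<integral>\<^sup>+t. ennreal (N (\<lambda>x. f t x - simple_value (steps T k f) t x)) \<partial>lebesgue_on {0<..<T})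
          \<le> (\<integral>\<^sup>+t. ennreal (2 * \<omega> k) \<partial>lebesgue_on {0<..<T})"
        using b by (intro nn_integral_mono ennreal_leI) simp
      ultimately show "(\<integral>\<^sup>+t. ennreal (N (\<lambda>x. f t x - simple_value (steps T k f) t x)) \<partial>lebesgue_on {0<..<T})
        \<le> ennreal (2 * \<omega> k * T)" using T by (simp add: emeasure_restrict_space ennreal_mult)
    qed
    have "(\<lambda>k. 2 * \<omega> k * T) \<longlonglongrightarrow> 2 * 0 * T" by (intro tendsto_intros \<omega>)
    from tendsto_ennrealI[OF this] show "(\<lambda>k. ennreal (2 * \<omega> k * T)) \<longlonglongrightarrow> 0" by simp
  qed simp
  moreover have "(\<lambda>k. N (\<lambda>x. J x - simple_integral (steps T k f) x)) \<longlonglongrightarrow> 0"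
  proof (rule Lim_null_comparison)
    have "norm (N (\<lambda>x. J x - simple_integral (steps T k f) x)) \<le> 2 * (T * \<omega> k)" for k
    proof -
      have s: "simple_integral (steps T k f) \<in> H20 \<Omega>" using i by blast
      have "N (\<lambda>x. J x - simple_integral (steps T k f) x) \<le> 2 * norm (emb (\<lambda>x. J x - simple_integral (steps T k f) x))"
        by (intro N H20_diff J s)
      also have "\<dots> \<le> 2 * (T * \<omega> k)" unfolding H2_diff(3)[OF H20_H2[OF J(1)] H20_H2[OF s]] J(2) using i by simp
      finally show ?thesis using N(2) by simp
    qed
    then show "\<forall>\<^sub>F k in sequentially. norm (N (\<lambda>x. J x - simple_integral (steps T k f) x)) \<le> 2 * (T * \<omega> k)"
      by (intro always_eventually allI)
    have "(\<lambda>k. 2 * (T * \<omega> k)) \<longlonglongrightarrow> 2 * (T * 0)" by (intro tendsto_intros \<omega>)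
    then show "(\<lambda>k. 2 * (T * \<omega> k)) \<longlonglongrightarrow> 0" by simp
  qed
  ultimately show ?thesis
    unfolding has_integral_in_def using strongly_measurable_continuous J(1) Z
    by (intro conjI exI[of _ "\<lambda>k. steps T k f"] allI) blast+
qed

end

lemma simple_value_emb:
  assumes Z: "z0 \<in> H2 \<Omega>" and s: "s \<in> simples I (H2 \<Omega>)"
  shows "simple_value s t \<in> H2 \<Omega> \<and> emb (simple_value s t) = (\<Sum>(A, z)\<leftarrow>s. indicator A t *\<^sub>R emb z)"
  using s
proof (induction s)
  case Nil
  then show ?case using H2_zero[OF Z] by (simp add: simple_value_def[abs_def])
next
  case (Cons p s)
  obtain A z where p: "p = (A, z)" by (cases p)
  have z: "z \<in> H2 \<Omega>" and s: "simple_value s t \<in> H2 \<Omega>" "emb (simple_value s t) = (\<Sum>(A, z)\<leftarrow>s. indicator A t *\<^sub>R emb z)"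
    using Cons by (auto simp: p simples_def)
  have "simple_value (p # s) t = (\<lambda>x. indicator A t * z x + simple_value s t x)"
    by (simp add: simple_value_def fun_eq_iff p)
  then show ?case using H2_linear(1)[OF z s(1)] emb_linear[OF z s(1)] s(2) by (simp add: p)
qed

lemma simple_integral_emb:
  assumes Z: "z0 \<in> H2 \<Omega>" and s: "s \<in> simples I (H2 \<Omega>)"
  shows "simple_integral s \<in> H2 \<Omega> \<and> emb (simple_integral s) = (\<Sum>(A, z)\<leftarrow>s. measure lebesgue A *\<^sub>R emb z)"
  using s
proof (induction s)
  case Nil
  then show ?case using H2_zero[OF Z] by (simp add: simple_integral_def[abs_def])
next
  case (Cons p s)
  obtain A z where p: "p = (A, z)" by (cases p)
  have z: "z \<in> H2 \<Omega>" and s: "simple_integral s \<in> H2 \<Omega>" "emb (simple_integral s) = (\<Sum>(A, z)\<leftarrow>s. measure lebesgue A *\<^sub>R emb z)"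
    using Cons by (auto simp: p simples_def)
  have "simple_integral (p # s) = (\<lambda>x. measure lebesgue A * z x + simple_integral s x)"
    by (simp add: simple_integral_def fun_eq_iff p)
  then show ?case using H2_linear(1)[OF z s(1)] emb_linear[OF z s(1)] s(2) by (simp add: p)
qed

lemma simple_functional_integral:
  assumes I: "I \<in> lmeasurable" and s: "s \<in> simples I Z"
  shows "has_bochner_integral (lebesgue_on I) (\<lambda>t. \<Sum>(A, z)\<leftarrow>s. indicator A t * c z) (\<Sum>(A, z)\<leftarrow>s. measure lebesgue A * c z)"
  using s
proof (induction s)
  case (Cons p s)
  obtain A z where p: "p = (A, z)" by (cases p)
  have A: "A \<in> sets lebesgue" "A \<subseteq> I" and s: "s \<in> simples I Z" using Cons.prems by (auto simp: p simples_def)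
  have Is: "I \<in> sets lebesgue" using I by (rule fmeasurableD)
  have "emeasure (lebesgue_on I) A = emeasure lebesgue A"
    by (rule emeasure_restrict_space) (use A Is in auto)
  also have "\<dots> \<le> emeasure lebesgue I" by (rule emeasure_mono[OF A(2) Is])
  also have "\<dots> < \<infinity>" using fmeasurableD2[OF I] by (simp only: less_top infinity_ennreal_def)
  finally have "has_bochner_integral (lebesgue_on I) (\<lambda>t. indicator A t *\<^sub>R c z) (measure (lebesgue_on I) A *\<^sub>R c z)"
    using A Is by (intro has_bochner_integral_indicator) (auto simp: sets_restrict_space_iff)
  moreover have "measure (lebesgue_on I) A = measure lebesgue A"
    using A Is by (simp add: measure_restrict_space)
  ultimately have "has_bochner_integral (lebesgue_on I) (\<lambda>t. indicator A t * c z) (measure lebesgue A * c z)" by simp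
  from has_bochner_integral_add[OF this Cons.IH[OF s]] show ?case by (simp add: p)
qed (simp add: has_bochner_integral_zero)

text \<open>A Bochner integral in H2, paired with a fixed element, becomes a scalar Lebesgue
  integral. Both the pairing and the integral are limits of those of simple functions, because
  \<open>emb\<close> is a contraction from the H2 norm.\<close>

lemma has_integral_in_inner:
  assumes I: "I \<in> lmeasurable" and f: "has_integral_in I (H2 \<Omega>) (H2_norm \<Omega>) f J"
  shows "has_bochner_integral (lebesgue_on I) (\<lambda>t. h \<bullet> emb (f t)) (h \<bullet> emb J)"
proof -
  let ?M = "lebesgue_on I"
  have Is: "I \<in> sets lebesgue" using I by (rule fmeasurableD)
  have sm: "strongly_measurable I (H2 \<Omega>) (H2_norm \<Omega>) f" and J: "J \<in> H2 \<Omega>"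
    using f by (auto simp: has_integral_in_def)
  have fZ: "AE t in ?M. f t \<in> H2 \<Omega>" using sm by (simp add: strongly_measurable_def)
  have diff: "norm (h \<bullet> emb b - h \<bullet> emb a) \<le> norm h * H2_norm \<Omega> (\<lambda>x. a x - b x)" if "a \<in> H2 \<Omega>" "b \<in> H2 \<Omega>" for a b
  proof -
    have "norm (h \<bullet> emb b - h \<bullet> emb a) \<le> norm h * norm (emb (\<lambda>x. a x - b x))"
      unfolding norm_minus_commute[of "h \<bullet> emb b"] H2_diff(3)[OF that]
      unfolding inner_diff_right[symmetric] norm_minus_commute[of "emb b"] real_norm_def
      by (rule Cauchy_Schwarz_ineq2)
    also have "\<dots> \<le> norm h * H2_norm \<Omega> (\<lambda>x. a x - b x)"
      by (intro mult_left_mono emb_le_H2_norm H2_diff that) simp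
    finally show ?thesis .
  qed
  have sint: "has_bochner_integral ?M (\<lambda>t. h \<bullet> emb (simple_value s t)) (h \<bullet> emb (simple_integral s))"
    if s: "s \<in> simples I (H2 \<Omega>)" for s
  proof -
    have r: "(\<Sum>(A, z)\<leftarrow>s. g A * (h \<bullet> emb z)) = h \<bullet> (\<Sum>(A, z)\<leftarrow>s. g A *\<^sub>R emb z)" for g :: "real set \<Rightarrow> real"
      by (induction s) (auto simp: inner_add_right)
    show ?thesis
      using simple_functional_integral[OF I s, of "\<lambda>z. h \<bullet> emb z"] unfolding r
      by (simp add: simple_value_emb[OF J s] simple_integral_emb[OF J s])
  qed
  \<comment> \<open>Almost everywhere a limit of scalar simple functions, with the approximants that
    strong measurability provides.\<close>
  have meas: "(\<lambda>t. h \<bullet> emb (f t)) \<in> borel_measurable ?M"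
  proof -
    obtain s where s: "\<forall>k. s k \<in> simples I (H2 \<Omega>)"
      and lim: "AE t in ?M. (\<lambda>k::nat. H2_norm \<Omega> (\<lambda>x. f t x - simple_value (s k) t x)) \<longlonglongrightarrow> 0"
      using sm unfolding strongly_measurable_def by blast
    have ae: "AE t in ?M. lim (\<lambda>k. h \<bullet> emb (simple_value (s k) t)) = h \<bullet> emb (f t)"
      using lim fZ
    proof eventually_elim
      case (elim t)
      have "(\<lambda>k. h \<bullet> emb (simple_value (s k) t)) \<longlonglongrightarrow> h \<bullet> emb (f t)"
      proof (rule LIM_zero_cancel, rule Lim_null_comparison)
        have "norm (h \<bullet> emb (simple_value (s k) t) - h \<bullet> emb (f t)) \<le> norm h * H2_norm \<Omega> (\<lambda>x. f t x - simple_value (s k) t x)" for k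
          by (rule diff[OF elim(2) simple_value_emb[OF J s[rule_format], THEN conjunct1]])
        then show "\<forall>\<^sub>F k in sequentially. norm (h \<bullet> emb (simple_value (s k) t) - h \<bullet> emb (f t))
            \<le> norm h * H2_norm \<Omega> (\<lambda>x. f t x - simple_value (s k) t x)"
          by (intro always_eventually allI)
        show "(\<lambda>k. norm h * H2_norm \<Omega> (\<lambda>x. f t x - simple_value (s k) t x)) \<longlonglongrightarrow> 0"
          using tendsto_mult_left[OF elim(1), of "norm h"] by simp
      qed
      then show ?case by (rule limI)
    qed
    have me: "(\<lambda>t. lim (\<lambda>k. h \<bullet> emb (simple_value (s k) t))) \<in> borel_measurable ?M"
      by (rule borel_measurable_lim_metric)
        (rule borel_measurable_integrable, rule integrable.intros, rule sint, rule s[rule_format])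
    show ?thesis by (rule measurable_lebesgue_on_AE[OF me ae Is])
  qed
  obtain s where s: "\<forall>k. s k \<in> simples I (H2 \<Omega>)"
    and l1: "(\<lambda>k::nat. \<integral>\<^sup>+t. ennreal (H2_norm \<Omega> (\<lambda>x. f t x - simple_value (s k) t x)) \<partial>?M) \<longlonglongrightarrow> 0"
    and l2: "(\<lambda>k. H2_norm \<Omega> (\<lambda>x. J x - simple_integral (s k) x)) \<longlonglongrightarrow> 0"
    using f unfolding has_integral_in_def by blast
  note S = sint[OF s[rule_format]]
  \<comment> \<open>The added 1 makes \<open>c\<close> positive, so that it can be divided by, also
    for h = 0.\<close>
  define c where "c = norm h + 1"
  have c: "0 < c" by (simp add: c_def add_nonneg_pos)
  define L where "L k = (\<integral>\<^sup>+t. ennreal (norm (h \<bullet> emb (simple_value (s k) t) - h \<bullet> emb (f t))) \<partial>?M)" for k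
  define B where "B k = (\<integral>\<^sup>+t. ennreal (H2_norm \<Omega> (\<lambda>x. f t x - simple_value (s k) t x)) \<partial>?M)" for k
  have m: "(\<lambda>t. h \<bullet> emb (simple_value (s k) t)) \<in> borel_measurable ?M" for k
    by (rule borel_measurable_integrable, rule integrable.intros, rule S)
  have LB: "L k \<le> ennreal c * B k" for k
  proof -
    let ?g = "\<lambda>t. norm (h \<bullet> emb (simple_value (s k) t) - h \<bullet> emb (f t))"
    have gm: "(\<lambda>t. ennreal (?g t / c)) \<in> borel_measurable ?M"
      using m[of k] meas by measurable
    have "L k = (\<integral>\<^sup>+t. ennreal c * ennreal (?g t / c) \<partial>?M)"
      unfolding L_def using c by (intro nn_integral_cong) (simp flip: ennreal_mult)
    also have "\<dots> = ennreal c * (\<integral>\<^sup>+t. ennreal (?g t / c) \<partial>?M)" by (rule nn_integral_cmult[OF gm])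
    also have "\<dots> \<le> ennreal c * B k"
      unfolding B_def
    proof (intro mult_left_mono nn_integral_mono_AE)
      show "AE t in ?M. ennreal (?g t / c) \<le> ennreal (H2_norm \<Omega> (\<lambda>x. f t x - simple_value (s k) t x))"
        using fZ
      proof eventually_elim
        case (elim t)
        have "?g t \<le> norm h * H2_norm \<Omega> (\<lambda>x. f t x - simple_value (s k) t x)"
          by (rule diff[OF elim simple_value_emb[OF J s[rule_format], THEN conjunct1]])
        also have "\<dots> \<le> c * H2_norm \<Omega> (\<lambda>x. f t x - simple_value (s k) t x)"
          by (intro mult_right_mono H2_norm_nonneg) (simp add: c_def)
        finally show ?case using c by (intro ennreal_leI) (simp add: pos_divide_le_eq mult.commute)
      qed
    qed simp
    finally show ?thesis .
  qed
  have "(\<lambda>k. ennreal c * B k) \<longlonglongrightarrow> ennreal c * 0"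
    using l1 by (intro ennreal_tendsto_cmult) (simp_all add: B_def)
  then have cB: "(\<lambda>k. ennreal c * B k) \<longlonglongrightarrow> 0" by simp
  have L0: "L \<longlonglongrightarrow> 0"
    by (rule tendsto_sandwich[OF _ _ tendsto_const cB]) (simp_all add: LB)
  have int: "integrable ?M (\<lambda>t. h \<bullet> emb (f t))"
  proof -
    have "\<forall>\<^sub>F k in sequentially. L k < 1" using L0 by (rule order_tendstoD(2)) simp
    then obtain k where k: "L k < 1" by (auto simp: eventually_sequentially)
    have "integrable ?M (\<lambda>t. h \<bullet> emb (simple_value (s k) t) - h \<bullet> emb (f t))"
    proof (rule integrableI_bounded)
      show "(\<lambda>t. h \<bullet> emb (simple_value (s k) t) - h \<bullet> emb (f t)) \<in> borel_measurable ?M"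
        by (intro borel_measurable_diff m meas)
      show "(\<integral>\<^sup>+t. ennreal (norm (h \<bullet> emb (simple_value (s k) t) - h \<bullet> emb (f t))) \<partial>?M) < \<infinity>"
        using k order_less_trans[OF k] by (simp add: L_def)
    qed
    with integrable.intros[OF S[of k]]
    have "integrable ?M (\<lambda>t. h \<bullet> emb (simple_value (s k) t) - (h \<bullet> emb (simple_value (s k) t) - h \<bullet> emb (f t)))"
      by (rule Bochner_Integration.integrable_diff)
    then show ?thesis by simp
  qed
  have "(\<lambda>k. LINT t|?M. h \<bullet> emb (simple_value (s k) t)) \<longlonglongrightarrow> (LINT t|?M. h \<bullet> emb (f t))"
    by (rule tendsto_L1_int[OF integrable.intros[OF S] int]) (use L0 in \<open>simp add: L_def[abs_def]\<close>)
  then have "(\<lambda>k. h \<bullet> emb (simple_integral (s k))) \<longlonglongrightarrow> (LINT t|?M. h \<bullet> emb (f t))"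
    unfolding has_bochner_integral_integral_eq[OF S] .
  moreover have "(\<lambda>k. h \<bullet> emb (simple_integral (s k))) \<longlonglongrightarrow> h \<bullet> emb J"
  proof (rule LIM_zero_cancel, rule Lim_null_comparison)
    have "norm (h \<bullet> emb (simple_integral (s k)) - h \<bullet> emb J) \<le> norm h * H2_norm \<Omega> (\<lambda>x. J x - simple_integral (s k) x)" for k
      by (rule diff[OF J simple_integral_emb[OF J s[rule_format], THEN conjunct1]])
    then show "\<forall>\<^sub>F k in sequentially. norm (h \<bullet> emb (simple_integral (s k)) - h \<bullet> emb J)
        \<le> norm h * H2_norm \<Omega> (\<lambda>x. J x - simple_integral (s k) x)"
      by (intro always_eventually allI)
    show "(\<lambda>k. norm h * H2_norm \<Omega> (\<lambda>x. J x - simple_integral (s k) x)) \<longlonglongrightarrow> 0"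
      using tendsto_mult_left[OF l2, of "norm h"] by simp
  qed
  ultimately have "(LINT t|?M. h \<bullet> emb (f t)) = h \<bullet> emb J" by (rule LIMSEQ_unique)
  with int show ?thesis by (simp add: has_bochner_integral_iff)
qed

end

text \<open>A nonempty open interval has positive measure, so it is not contained in the exceptional
  null set.\<close>

lemma AE_lebesgue_on_interval_ex:
  fixes a b :: real
  assumes ae: "AE t in lebesgue_on I. P t" and I: "I \<in> sets lebesgue" and ab: "a < b" "{a<..<b} \<subseteq> I"
  shows "\<exists>t\<in>{a<..<b}. P t"
proof (rule ccontr)
  assume "\<not> ?thesis"
  then have no: "\<And>t. t \<in> {a<..<b} \<Longrightarrow> \<not> P t" by blast
  have "AE t in lebesgue. t \<in> I \<longrightarrow> P t" using ae I by (simp add: AE_restrict_space_iff)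
  then have "AE t in lebesgue. t \<notin> {a<..<b}" by eventually_elim (use no ab in auto)
  then have "emeasure lebesgue {a<..<b} = 0" by (subst (asm) AE_iff_measurable[of "{a<..<b}"]) auto
  then show False using ab by simp
qed

section \<open>The equation on the Hilbert space of classes\<close>

context planar_domain
begin

definition V :: "(real^'n, real \<times> real) l2 set" where "V = emb ` H20 \<Omega>"

text \<open>The Hilbert space theory speaks of classes and \<open>form\<close> of functions; this
  picks a function of a given class in \<open>V\<close>. By \<open>form_cong\<close> below, the
  choice has no influence on the value of the form.\<close>

definition rep :: "(real^'n, real \<times> real) l2 \<Rightarrow> real^'n \<Rightarrow> real" where
  "rep h = (SOME u. u \<in> H20 \<Omega> \<and> emb u = h)"

definition bform :: "real \<Rightarrow> (real^'n, real \<times> real) l2 \<Rightarrow> (real^'n, real \<times> real) l2 \<Rightarrow> real" where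
  "bform \<alpha> h k = form \<alpha> (rep h) (rep k)"

lemma V_I: "u \<in> H20 \<Omega> \<Longrightarrow> emb u \<in> V" by (simp add: V_def)

lemma rep_V:
  assumes "h \<in> V"
  shows "rep h \<in> H20 \<Omega>" "emb (rep h) = h"
proof -
  have "\<exists>u. u \<in> H20 \<Omega> \<and> emb u = h" using assms by (auto simp: V_def)
  from someI_ex[OF this] show "rep h \<in> H20 \<Omega>" "emb (rep h) = h" by (simp_all add: rep_def)
qed

lemma form_zero:
  assumes "u \<in> H20 \<Omega>"
  shows "form \<alpha> (\<lambda>x. 0) w = 0"
proof -
  have "grd (\<lambda>x. 0) = 0" using H1_diff(2)[OF H20_H1[OF assms] H20_H1[OF assms]] by simp
  moreover have "sp (\<lambda>x. 0) = 0" using sp_diff[OF H20_H1[OF assms] H20_H1[OF assms]] by simp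
  ultimately show ?thesis by (simp add: form_def)
qed

text \<open>In the first argument this is the Lipschitz bound for equal classes. In the second,
  linearity reduces it to a test function of class 0.\<close>

lemma form_cong:
  assumes u: "u \<in> H20 \<Omega>" "u' \<in> H20 \<Omega>" "emb u = emb u'" and w: "w \<in> H20 \<Omega>" "w' \<in> H20 \<Omega>" "emb w = emb w'"
  shows "form \<alpha> u w = form \<alpha> u' w'"
proof -
  define d where "d x = w x - w' x" for x
  have d: "d \<in> H20 \<Omega>" "emb d = 0"
    using H20_diff[OF w(1,2)] H2_diff(3)[OF H20_H2[OF w(1)] H20_H2[OF w(2)]] w(3) by (simp_all add: d_def[abs_def])
  \<comment> \<open>The Lipschitz bound against u = 0, where the form vanishes, has the factor
    norm(emb d) = 0.\<close>
  have "form \<alpha> u d = 0"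
    using form_lipschitz[OF u(1) H20_zero[OF u(1)] d(1), of \<alpha>] by (simp add: d(2) form_zero[OF u(1)])
  moreover have "form \<alpha> u (\<lambda>x. 1 * d x + w' x) = 1 * form \<alpha> u d + form \<alpha> u w'"
    by (rule form_linear[OF u(1) d(1) w(2)])
  ultimately have "form \<alpha> u w = form \<alpha> u w'" by (simp add: d_def)
  also have "\<dots> = form \<alpha> u' w'" using form_lipschitz[OF u(1,2) w(2), of \<alpha>] u(3) by simp
  finally show ?thesis .
qed

lemma bform_emb: "u \<in> H20 \<Omega> \<Longrightarrow> w \<in> H20 \<Omega> \<Longrightarrow> bform \<alpha> (emb u) (emb w) = form \<alpha> u w"
  unfolding bform_def by (intro form_cong rep_V V_I)

lemma bform_lipschitz:
  assumes "h \<in> V" "k \<in> V" "j \<in> V"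
  shows "\<bar>bform \<alpha> h j - bform \<alpha> k j\<bar> \<le> form_const \<alpha> * (1 + norm h + norm k) * norm (h - k) * norm j"
  using form_lipschitz[OF rep_V(1)[OF assms(1)] rep_V(1)[OF assms(2)] rep_V(1)[OF assms(3)], of \<alpha>]
  by (simp add: bform_def rep_V(2) assms)

lemma form_const_nonneg: "0 \<le> form_const \<alpha>"
  by (simp add: form_const_def L4_const_nonneg)

lemma bform_linear:
  assumes "h \<in> V" "k \<in> V" "j \<in> V"
  shows "bform \<alpha> h (c *\<^sub>R k + j) = c * bform \<alpha> h k + bform \<alpha> h j"
proof -
  note r = rep_V(1)[OF assms(1)] rep_V(1)[OF assms(2)] rep_V(1)[OF assms(3)]
  have "c *\<^sub>R k + j = emb (\<lambda>x. c * rep k x + rep j x)"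
    unfolding emb_linear[OF H20_H2[OF r(2)] H20_H2[OF r(3)]] by (simp add: rep_V(2) assms)
  then have "bform \<alpha> h (c *\<^sub>R k + j) = bform \<alpha> (emb (rep h)) (emb (\<lambda>x. c * rep k x + rep j x))"
    by (simp add: rep_V(2) assms)
  also have "\<dots> = c * bform \<alpha> h k + bform \<alpha> h j"
    unfolding bform_emb[OF r(1) H20_linear[OF r(2,3)]] form_linear[OF r] by (simp add: bform_def)
  finally show ?thesis .
qed

text \<open>The first two terms are the inner product of the Hilbert space and the rest is
  \<open>form\<close>. \<open>v\<close> is only taken from H2, since no more is known of the time
  derivative of a weak solution.\<close>

lemma weak_form_iff:
  assumes u: "u \<in> H20 \<Omega>" and v: "v \<in> H2 \<Omega>" and w: "w \<in> H20 \<Omega>"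
  shows "L2_inner \<Omega> v w + L2_inner \<Omega> (weak_laplacian \<Omega> v) (weak_laplacian \<Omega> w)
      + \<alpha> * L2_inner \<Omega> (weak_gradient \<Omega> u) (weak_gradient \<Omega> w) = L2_inner \<Omega> (weak_divergence \<Omega> (\<lambda>x. flux (u x))) w
    \<longleftrightarrow> emb v \<bullet> emb w = form \<alpha> u w"
proof -
  note u1 = H1D[OF H20_H1[OF u]] and w1 = H1D[OF H20_H1[OF w]] and w2 = H2D[OF H20_H2[OF w]] and v2 = H2D[OF v]
  have "L2_inner \<Omega> v w + L2_inner \<Omega> (weak_laplacian \<Omega> v) (weak_laplacian \<Omega> w) = emb v \<bullet> emb w"
    unfolding emb_inner[OF v H20_H2[OF w]] lap_def cls_inner[OF H1D(1)[OF v2(1)] w1(1)] cls_inner[OF v2(2) w2(2)] ..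
  moreover have "L2_inner \<Omega> (weak_gradient \<Omega> u) (weak_gradient \<Omega> w) = grd u \<bullet> grd w"
    unfolding grd_def cls_inner[OF u1(2) w1(2)] ..
  ultimately show ?thesis unfolding form_divergence[OF u w] form_def by (simp only:) linarith
qed

lemma test_function_interval:
  fixes T :: real
  assumes \<theta>: "test_function {0<..<T} \<theta>"
  shows "\<theta> 0 = 0" "\<theta> T = 0" "(\<theta> has_real_derivative deriv \<theta> t) (at t within S)"
    "continuous_on S (deriv \<theta>)" "continuous_on S \<theta>"
proof -
  note s = test_function_smooth[OF \<theta>]
  show "\<theta> 0 = 0" "\<theta> T = 0" by (rule test_function_zero[OF \<theta>]; simp)+
  have d: "deriv \<theta> = partial 1 \<theta>" using smooth_real_derivative[OF s] by (intro ext DERIV_imp_deriv)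
  show "(\<theta> has_real_derivative deriv \<theta> t) (at t within S)"
    unfolding d using smooth_real_derivative[OF s] by (rule has_field_derivative_at_within)
  show "continuous_on S (deriv \<theta>)" unfolding d by (intro smooth_continuous smooth_partial s) simp
  show "continuous_on S \<theta>" by (rule smooth_continuous[OF s])
qed

text \<open>The integral over [0, T] of the derivative of \<theta> U is 0, because \<theta> vanishes
  at both ends; so the two integrals of the definition agree as elements of
  \<open>V\<close>.\<close>

lemma has_time_derivative_continuous:
  assumes T: "0 < T" and u: "\<And>t. t \<in> {0..T} \<Longrightarrow> u t \<in> H20 \<Omega>" and v: "\<And>t. t \<in> {0..T} \<Longrightarrow> v t \<in> H20 \<Omega>"
    and U: "\<And>t. t \<in> {0..T} \<Longrightarrow> ((\<lambda>t. emb (u t)) has_vector_derivative emb (v t)) (at t within {0..T})"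
    and cv: "continuous_on {0..T} (\<lambda>t. emb (v t))"
  shows "has_time_derivative {0<..<T} (H2 \<Omega>) (H2_norm \<Omega>) u v"
  unfolding has_time_derivative_def
proof (intro allI impI)
  fix \<theta> assume \<theta>: "test_function {0<..<T} \<theta>"
  note th = test_function_interval[OF \<theta>]
  have cu: "continuous_on {0..T} (\<lambda>t. emb (u t))"
    unfolding continuous_on_eq_continuous_within using U has_vector_derivative_continuous by blast
  have c1: "continuous_on {0..T} (\<lambda>t. deriv \<theta> t *\<^sub>R emb (u t))" by (intro continuous_intros th cu)
  have c2: "continuous_on {0..T} (\<lambda>t. (- \<theta> t) *\<^sub>R emb (v t))" by (intro continuous_intros th cv)
  have f1: "(\<lambda>x. deriv \<theta> t * u t x) \<in> H20 \<Omega>" "emb (\<lambda>x. deriv \<theta> t * u t x) = deriv \<theta> t *\<^sub>R emb (u t)"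
    and f2: "(\<lambda>x. - (\<theta> t * v t x)) \<in> H20 \<Omega>" "emb (\<lambda>x. - (\<theta> t * v t x)) = (- \<theta> t) *\<^sub>R emb (v t)" if "t \<in> {0..T}" for t
    using H20_scale[OF u[OF that], of "deriv \<theta> t"] H20_scale[OF v[OF that], of "- \<theta> t"] by simp_all
  have e1: "continuous_on {0..T} (\<lambda>t. emb (\<lambda>x. deriv \<theta> t * u t x))"
    using c1 by (rule continuous_on_eq) (simp add: f1(2))
  have e2: "continuous_on {0..T} (\<lambda>t. emb (\<lambda>x. - (\<theta> t * v t x)))"
    using c2 by (rule continuous_on_eq) (simp add: f2(2))
  \<comment> \<open>The definition asks for a function as the value of the integral; it exists
    because the image of H20 is a closed subspace.\<close>
  have "integral {0..T} (\<lambda>t. deriv \<theta> t *\<^sub>R emb (u t)) \<in> emb ` H20 \<Omega>"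
  proof (rule integral_in_closed_subspace[OF H20_subspace[OF u[of 0]] H20_image_closed integrable_continuous_interval[OF c1]])
    show "0 \<in> {0..T}" using T by simp
    fix t assume t: "t \<in> {0..T}"
    show "deriv \<theta> t *\<^sub>R emb (u t) \<in> emb ` H20 \<Omega>" unfolding f1(2)[OF t, symmetric] using f1(1)[OF t] by (rule imageI)
  qed
  then obtain J where J: "J \<in> H20 \<Omega>" "emb J = integral {0..T} (\<lambda>t. deriv \<theta> t *\<^sub>R emb (u t))" 
    by (elim imageE) (rule that, assumption, erule sym)
  have "((\<lambda>t. \<theta> t *\<^sub>R emb (v t) + deriv \<theta> t *\<^sub>R emb (u t)) has_integral \<theta> T *\<^sub>R emb (u T) - \<theta> 0 *\<^sub>R emb (u 0)) {0..T}"
  proof (rule fundamental_theorem_of_calculus)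
    fix t assume "t \<in> {0..T}"
    from has_vector_derivative_scaleR[OF th(3) U[OF this]]
    show "((\<lambda>t. \<theta> t *\<^sub>R emb (u t)) has_vector_derivative \<theta> t *\<^sub>R emb (v t) + deriv \<theta> t *\<^sub>R emb (u t)) (at t within {0..T})" .
  qed (use T in simp)
  then have "((\<lambda>t. \<theta> t *\<^sub>R emb (v t) + deriv \<theta> t *\<^sub>R emb (u t)) has_integral 0) {0..T}" by (simp add: th)
  from has_integral_diff[OF this integrable_integral[OF integrable_continuous_interval[OF c1]]]
  have "((\<lambda>t. \<theta> t *\<^sub>R emb (v t)) has_integral - emb J) {0..T}" unfolding J(2) by simp
  from has_integral_neg[OF this] have "((\<lambda>t. (- \<theta> t) *\<^sub>R emb (v t)) has_integral emb J) {0..T}" by simp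
  then have J2: "emb J = integral {0..T} (\<lambda>t. (- \<theta> t) *\<^sub>R emb (v t))" by (rule integral_unique[symmetric])
  have sub: "H20 \<Omega> \<subseteq> H2 \<Omega>" using H20_H2 by blast
  have "has_integral_in {0<..<T} (H2 \<Omega>) (H2_norm \<Omega>) (\<lambda>t x. deriv \<theta> t * u t x) J"
  proof (rule has_integral_in_continuous[OF T f1(1) e1 sub H2_norm_le_emb H2_norm_nonneg J(1)])
    show "emb J = integral {0..T} (\<lambda>t. emb (\<lambda>x. deriv \<theta> t * u t x))"
      unfolding J(2) by (intro integral_cong) (simp add: f1(2))
  qed
  moreover have "has_integral_in {0<..<T} (H2 \<Omega>) (H2_norm \<Omega>) (\<lambda>t x. - (\<theta> t * v t x)) J"
  proof (rule has_integral_in_continuous[OF T f2(1) e2 sub H2_norm_le_emb H2_norm_nonneg J(1)])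
    show "emb J = integral {0..T} (\<lambda>t. emb (\<lambda>x. - (\<theta> t * v t x)))"
      unfolding J2 by (intro integral_cong) (simp add: f2(2))
  qed
  ultimately show "\<exists>J. has_integral_in {0<..<T} (H2 \<Omega>) (H2_norm \<Omega>) (\<lambda>t x. deriv \<theta> t * u t x) J \<and>
      has_integral_in {0<..<T} (H2 \<Omega>) (H2_norm \<Omega>) (\<lambda>t x. - (\<theta> t * v t x)) J" by blast
qed

text \<open>The differential equation is solved in the space of classes; representatives of U and of
  its derivative are the solution and its time derivative.\<close>

lemma weak_solution_exists:
  assumes T: "0 < T" and \<alpha>: "0 \<le> \<alpha>" and u0: "u0 \<in> H20 \<Omega>"
  shows "\<exists>u. weak_solution \<Omega> \<alpha> T u0 u"
proof -
  have sub: "subspace V" and cl: "closed V" unfolding V_def by (rule H20_subspace[OF u0] H20_image_closed)+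
  have z: "(0 :: (real^'n, real \<times> real) l2) \<in> V" by (rule subspace_0[OF sub])
  have "\<exists>U U'. U 0 = emb u0 \<and> continuous_on {0..T} U' \<and> (\<forall>t\<in>{0..T}. U t \<in> V \<and> U' t \<in> V \<and>
            (U has_vector_derivative U' t) (at t within {0..T}) \<and> (\<forall>w\<in>V. inner (U' t) w = bform \<alpha> (U t) w))"
  proof (rule energy_ode_exists[OF sub cl _ _ _ bform_lipschitz form_const_nonneg _ V_I[OF u0] T])
    fix u v w assume V: "u \<in> V" "v \<in> V" "w \<in> V"
    show "bform \<alpha> u (v + w) = bform \<alpha> u v + bform \<alpha> u w" using bform_linear[OF V, of \<alpha> 1] by simp
  next
    fix u r w assume V: "u \<in> V" "w \<in> V"
    have "bform \<alpha> u 0 = 0" using bform_linear[OF V(1) z z, of \<alpha> 1] by simp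
    then show "bform \<alpha> u (r *\<^sub>R w) = r * bform \<alpha> u w" using bform_linear[OF V z, of \<alpha> r] by simp
  next
    fix w assume w: "w \<in> V"
    have "bform \<alpha> 0 w = form \<alpha> (\<lambda>x. 0) (rep w)"
      using bform_emb[OF H20_zero[OF u0] rep_V(1)[OF w], of \<alpha>] by (simp add: H2_zero(2)[OF H20_H2[OF u0]] rep_V(2)[OF w])
    then show "bform \<alpha> 0 w = 0" by (simp add: form_zero[OF u0])
  next
    fix u assume "u \<in> V"
    then show "bform \<alpha> u u \<le> 0" unfolding bform_def by (intro form_dissipative rep_V \<alpha>)
  qed
  then obtain U U' where U0: "U 0 = emb u0" and cU': "continuous_on {0..T} U'"
    and U: "\<forall>t\<in>{0..T}. U t \<in> V \<and> U' t \<in> V \<and> (U has_vector_derivative U' t) (at t within {0..T}) \<and>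
       (\<forall>w\<in>V. inner (U' t) w = bform \<alpha> (U t) w)" by (elim exE conjE) (rule that)
  define u where "u t = rep (U t)" for t
  define v where "v t = rep (U' t)" for t
  have u: "u t \<in> H20 \<Omega>" "emb (u t) = U t" and v: "v t \<in> H20 \<Omega>" "emb (v t) = U' t"
    and dU: "(U has_vector_derivative U' t) (at t within {0..T})" and eq: "\<forall>w\<in>V. inner (U' t) w = bform \<alpha> (U t) w"
    if "t \<in> {0..T}" for t
    using U[rule_format, OF that] by (simp_all add: u_def v_def rep_V)
  have cU: "continuous_on {0..T} U" 
    unfolding continuous_on_eq_continuous_within using dU has_vector_derivative_continuous by blast
  have cu: "continuous_on {0..T} (\<lambda>t. emb (u t))" using cU by (rule continuous_on_eq) (simp add: u)
  have cv: "continuous_on {0..T} (\<lambda>t. emb (v t))" using cU' by (rule continuous_on_eq) (simp add: v)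
  have s2: "H20 \<Omega> \<subseteq> H2 \<Omega>" and s1: "H20 \<Omega> \<subseteq> H10 \<Omega>" using H20_H2 H20_H10 by blast+
  have 1: "u \<in> bochner_Linf {0<..<T} (H20 \<Omega>) (H2_norm \<Omega>)"
    by (rule bochner_Linf_continuous[OF T u(1) cu order_refl H2_norm_le_emb H2_norm_nonneg])
  have 2: "u \<in> bochner_Lp 2 {0<..<T} (H10 \<Omega>) (H1_norm \<Omega>)"
    by (rule bochner_Lp_continuous[OF T u(1) cu s1 H1_norm_le_emb H1_norm_nonneg])
  have 3: "v \<in> bochner_Lp 2 {0<..<T} (H2 \<Omega>) (H2_norm \<Omega>)"
    by (rule bochner_Lp_continuous[OF T v(1) cv s2 H2_norm_le_emb H2_norm_nonneg])
  have 4: "has_time_derivative {0<..<T} (H2 \<Omega>) (H2_norm \<Omega>) u v"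
  proof (rule has_time_derivative_continuous[OF T u(1) v(1) _ cv])
    fix t assume t: "t \<in> {0..T}"
    show "((\<lambda>t. emb (u t)) has_vector_derivative emb (v t)) (at t within {0..T})"
      unfolding v(2)[OF t] by (rule has_vector_derivative_transform[OF t _ dU[OF t]]) (simp add: u)
  qed
  have 5: "AE t in lebesgue_on {0<..<T}. \<forall>w\<in>H20 \<Omega>.
           L2_inner \<Omega> (v t) w
           + L2_inner \<Omega> (weak_laplacian \<Omega> (v t)) (weak_laplacian \<Omega> w)
           + \<alpha> * L2_inner \<Omega> (weak_gradient \<Omega> (u t)) (weak_gradient \<Omega> w)
           = L2_inner \<Omega> (weak_divergence \<Omega> (\<lambda>x. flux (u t x))) w"
  proof (rule AE_I2, rule ballI)
    fix t w assume "t \<in> space (lebesgue_on {0<..<T})" and w: "w \<in> H20 \<Omega>"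
    then have t: "t \<in> {0..T}" by simp
    have "emb (v t) \<bullet> emb w = form \<alpha> (u t) w"
      unfolding v(2)[OF t] bform_emb[OF u(1)[OF t] w, symmetric] u(2)[OF t] using eq[OF t] V_I[OF w] by blast
    then show "L2_inner \<Omega> (v t) w
           + L2_inner \<Omega> (weak_laplacian \<Omega> (v t)) (weak_laplacian \<Omega> w)
           + \<alpha> * L2_inner \<Omega> (weak_gradient \<Omega> (u t)) (weak_gradient \<Omega> w)
           = L2_inner \<Omega> (weak_divergence \<Omega> (\<lambda>x. flux (u t x))) w"
      unfolding weak_form_iff[OF u(1)[OF t] H20_H2[OF v(1)[OF t]] w] .
  qed
  have 6: "has_initial_value \<Omega> T u u0"
    unfolding has_initial_value_def
  proof (intro exI[of _ u] conjI)
    \<comment> \<open>The constructed solution serves as its own continuous representative.\<close>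
    show "continuous_in {0..T} (H2 \<Omega>) (H2_norm \<Omega>) u"
      unfolding continuous_in_def
    proof (intro ballI conjI)
      fix t assume t: "t \<in> {0..T}"
      show "u t \<in> H2 \<Omega>" by (rule H20_H2[OF u(1)[OF t]])
      show "((\<lambda>r. H2_norm \<Omega> (\<lambda>x. u r x - u t x)) \<longlongrightarrow> 0) (at t within {0..T})"
      proof (rule Lim_null_comparison)
        have "norm (H2_norm \<Omega> (\<lambda>x. u r x - u t x)) \<le> 2 * norm (U r - U t)" if r: "r \<in> {0..T}" for r
          using H2_norm_le_emb[OF H20_diff[OF u(1)[OF r] u(1)[OF t]]]
          unfolding H2_diff(3)[OF H20_H2[OF u(1)[OF r]] H20_H2[OF u(1)[OF t]]] u(2)[OF r] u(2)[OF t]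
          by (simp add: H2_norm_nonneg)
        then show "\<forall>\<^sub>F r in at t within {0..T}. norm (H2_norm \<Omega> (\<lambda>x. u r x - u t x)) \<le> 2 * norm (U r - U t)"
          unfolding eventually_at_filter by (intro always_eventually) simp
        have "(U \<longlongrightarrow> U t) (at t within {0..T})" using cU t by (simp add: continuous_on_def)
        then have "((\<lambda>r. 2 * norm (U r - U t)) \<longlongrightarrow> 2 * norm (U t - U t)) (at t within {0..T})" by (intro tendsto_intros)
        then show "((\<lambda>r. 2 * norm (U r - U t)) \<longlongrightarrow> 0) (at t within {0..T})" by simp
      qed
    qed
    show "AE t in lebesgue_on {0<..<T}. AE x in lebesgue_on \<Omega>. u t x = u t x" by simp
    have 0: "0 \<in> {0..T}" using T by simp
    have "cls (u 0) = cls u0"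
      by (rule cls_cong_emb[OF H20_H2[OF u(1)[OF 0]] H20_H2[OF u0]]) (simp add: u(2)[OF 0] U0)
    then show "AE x in lebesgue_on \<Omega>. u 0 x = u0 x"
      using cls_eq_iff[OF H1D(1)[OF H20_H1[OF u(1)[OF 0]]] H1D(1)[OF H20_H1[OF u0]]] by simp
  qed
  show ?thesis
    unfolding weak_solution_def by (rule exI[of _ u]) (intro conjI IntI bexI[of _ v] 1 2 3 4 5 6)
qed

text \<open>A weak solution is in H20 only for almost every time. The continuous representative
  takes values in \<open>V\<close> on sets of times that meet every interval, and \<open>V\<close>
  is closed, so it takes values in \<open>V\<close> at all times.\<close>

lemma continuous_in_V:
  assumes T: "0 < T" and w: "continuous_in {0..T} (H2 \<Omega>) (H2_norm \<Omega>) w"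
    and ae: "AE t in lebesgue_on {0<..<T}. emb (w t) \<in> V"
  shows "continuous_on {0..T} (\<lambda>t. emb (w t))" "t \<in> {0..T} \<Longrightarrow> emb (w t) \<in> V"
proof -
  have w2: "w t \<in> H2 \<Omega>" and lim: "((\<lambda>r. H2_norm \<Omega> (\<lambda>x. w r x - w t x)) \<longlongrightarrow> 0) (at t within {0..T})" if "t \<in> {0..T}" for t
    using w that by (simp_all add: continuous_in_def)
  show c: "continuous_on {0..T} (\<lambda>t. emb (w t))"
    unfolding continuous_on_def
  proof (rule ballI, rule LIM_zero_cancel, rule Lim_null_comparison)
    fix t assume t: "t \<in> {0..T}"
    have "norm (emb (w r) - emb (w t)) \<le> H2_norm \<Omega> (\<lambda>x. w r x - w t x)" if r: "r \<in> {0..T}" for r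
      unfolding H2_diff(3)[OF w2[OF r] w2[OF t], symmetric] by (intro emb_le_H2_norm H2_diff w2 r t)
    then show "\<forall>\<^sub>F r in at t within {0..T}. norm (emb (w r) - emb (w t)) \<le> H2_norm \<Omega> (\<lambda>x. w r x - w t x)"
      unfolding eventually_at_filter by (intro always_eventually) simp
    show "((\<lambda>r. H2_norm \<Omega> (\<lambda>x. w r x - w t x)) \<longlongrightarrow> 0) (at t within {0..T})" by (rule lim[OF t])
  qed
  show "emb (w t) \<in> V" if t: "t \<in> {0..T}"
  proof (rule ccontr)
    assume no: "emb (w t) \<notin> V"
    have "open (- V)" using H20_image_closed by (simp add: V_def open_Compl)
    then obtain e where e: "e > 0" "\<And>h. dist h (emb (w t)) < e \<Longrightarrow> h \<notin> V"
      using no unfolding open_dist by (metis ComplD ComplI)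
    obtain d where d: "d > 0" "\<forall>s\<in>{0..T}. dist s t < d \<longrightarrow> dist (emb (w s)) (emb (w t)) < e"
      using c t e(1) unfolding continuous_on_iff by blast
    have "max 0 (t - d) < min T (t + d)" using t T d(1) by simp
    moreover have "{max 0 (t - d)<..<min T (t + d)} \<subseteq> {0<..<T}" by (intro subsetI) simp
    ultimately obtain s where s: "s \<in> {max 0 (t - d)<..<min T (t + d)}" "emb (w s) \<in> V"
      using AE_lebesgue_on_interval_ex[OF ae] by (meson lmeasurable_interval(2) fmeasurableD)
    then have "dist (emb (w s)) (emb (w t)) < e" by (intro d(2)[rule_format]) (auto simp: dist_real_def)
    then show False using e(2) s(2) by blast
  qed
qed

lemma bform_continuous:
  assumes W: "continuous_on S W" "\<And>t. t \<in> S \<Longrightarrow> W t \<in> V" and k: "k \<in> V"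
  shows "continuous_on S (\<lambda>t. bform \<alpha> (W t) k)"
  unfolding continuous_on_def
proof (rule ballI, rule LIM_zero_cancel, rule Lim_null_comparison)
  fix t assume t: "t \<in> S"
  have lim: "(W \<longlongrightarrow> W t) (at t within S)" using W(1) t by (simp add: continuous_on_def)
  let ?b = "\<lambda>r. form_const \<alpha> * (1 + norm (W r) + norm (W t)) * norm (W r - W t) * norm k"
  have "norm (bform \<alpha> (W r) k - bform \<alpha> (W t) k) \<le> ?b r" if "r \<in> S" for r
    unfolding real_norm_def by (intro bform_lipschitz W that t k)
  then show "\<forall>\<^sub>F r in at t within S. norm (bform \<alpha> (W r) k - bform \<alpha> (W t) k) \<le> ?b r"
    unfolding eventually_at_filter by (intro always_eventually) simp
  have "(?b \<longlongrightarrow> form_const \<alpha> * (1 + norm (W t) + norm (W t)) * norm (W t - W t) * norm k) (at t within S)"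
    by (intro tendsto_intros lim)
  then show "(?b \<longlongrightarrow> 0) (at t within S)" by simp
qed

text \<open>With Q a primitive of q, integration by parts shows that p - Q has weak derivative 0; by
  the du Bois-Reymond lemma it is constant.\<close>

lemma weak_time_derivative_integral:
  fixes p q :: "real \<Rightarrow> real"
  assumes T: "0 < T" and p: "continuous_on {0..T} p" and q: "continuous_on {0..T} q"
    and weak: "\<And>\<theta>. test_function {0<..<T} \<theta> \<Longrightarrow>
      \<exists>c. ((\<lambda>t. deriv \<theta> t * p t) has_integral c) {0..T} \<and> ((\<lambda>t. - (\<theta> t * q t)) has_integral c) {0..T}"
    and t: "t \<in> {0..T}"
  shows "(q has_integral p t - p 0) {0..t}"
proof -
  define Q where "Q t = integral {0..t} q" for t
  have Q': "(Q has_real_derivative q s) (at s within {0..T})" if "s \<in> {0..T}" for s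
    unfolding Q_def by (rule integral_has_real_derivative[OF q that])
  have cQ: "continuous_on {0..T} Q" using Q' by (rule DERIV_continuous_on)
  have "p t - Q t = p 0 - Q 0"
  proof (rule du_bois_reymond[of T "\<lambda>t. p t - Q t", OF _ T _ t])
    show "continuous_on {0..T} (\<lambda>t. p t - Q t)" by (intro continuous_intros p cQ)
    fix \<theta> assume \<theta>: "test_function {0<..<T} \<theta>"
    note th = test_function_interval[OF \<theta>]
    obtain c where c: "((\<lambda>t. deriv \<theta> t * p t) has_integral c) {0..T}" "((\<lambda>t. - (\<theta> t * q t)) has_integral c) {0..T}"
      using weak[OF \<theta>] by blast
    have "((\<lambda>t. deriv \<theta> t * Q t + q t * \<theta> t) has_integral \<theta> T * Q T - \<theta> 0 * Q 0) {0..T}"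
    proof (rule fundamental_theorem_of_calculus)
      fix s assume "s \<in> {0..T}"
      from DERIV_mult[OF th(3) Q'[OF this]]
      show "((\<lambda>t. \<theta> t * Q t) has_vector_derivative deriv \<theta> s * Q s + q s * \<theta> s) (at s within {0..T})"
        by (simp add: has_real_derivative_iff_has_vector_derivative)
    qed (use T in simp)
    then have "((\<lambda>t. deriv \<theta> t * Q t + q t * \<theta> t) has_integral 0) {0..T}" by (simp add: th)
    from has_integral_add[OF this c(2)] have "((\<lambda>t. deriv \<theta> t * Q t) has_integral c) {0..T}"
      by (simp add: mult.commute)
    from has_integral_diff[OF c(1) this] have "((\<lambda>t. deriv \<theta> t * (p t - Q t)) has_integral 0) {0..T}"
      by (simp add: right_diff_distrib)
    then show "integral {0..T} (\<lambda>t. deriv \<theta> t * (p t - Q t)) = 0" by (rule integral_unique)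
  qed
  then have "integral {0..t} q = p t - p 0" by (simp add: Q_def)
  moreover have "q integrable_on {0..t}"
    using t by (intro integrable_continuous_interval continuous_on_subset[OF q]) auto
  ultimately show ?thesis by (metis integrable_integral)
qed

text \<open>The weak time derivative is paired with an element of \<open>V\<close> before it is
  integrated: the equation determines exactly these pairings of \<open>ut\<close>, and they are
  scalar functions, so that the scalar du Bois-Reymond lemma applies.\<close>

lemma weak_solution_integral_form:
  assumes T: "0 < T" and u0: "u0 \<in> H20 \<Omega>" and sol: "weak_solution \<Omega> \<alpha> T u0 u"
  shows "\<exists>W. continuous_on {0..T} W \<and> (\<forall>t\<in>{0..T}. W t \<in> V) \<and> W 0 = emb u0 \<and>
    (\<forall>t\<in>{0..T}. \<forall>k\<in>V. ((\<lambda>s. bform \<alpha> (W s) k) has_integral W t \<bullet> k - W 0 \<bullet> k) {0..t}) \<and>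
    (AE t in lebesgue_on {0<..<T}. u t \<in> H20 \<Omega> \<and> emb (u t) = W t)"
proof -
  let ?M = "lebesgue_on {0<..<T}"
  have I: "{0<..<T} \<in> sets lebesgue" "{0<..<T} \<in> lmeasurable" by simp_all
  have uH: "AE t in ?M. u t \<in> H20 \<Omega>"
    using sol by (simp add: weak_solution_def bochner_Linf_def strongly_measurable_def)
  from sol obtain ut where utm: "ut \<in> bochner_Lp 2 {0<..<T} (H2 \<Omega>) (H2_norm \<Omega>)"
    and td: "has_time_derivative {0<..<T} (H2 \<Omega>) (H2_norm \<Omega>) u ut"
    and eq: "AE t in ?M. \<forall>w\<in>H20 \<Omega>.
           L2_inner \<Omega> (ut t) w
           + L2_inner \<Omega> (weak_laplacian \<Omega> (ut t)) (weak_laplacian \<Omega> w)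
           + \<alpha> * L2_inner \<Omega> (weak_gradient \<Omega> (u t)) (weak_gradient \<Omega> w)
           = L2_inner \<Omega> (weak_divergence \<Omega> (\<lambda>x. flux (u t x))) w"
    unfolding weak_solution_def by (elim conjE bexE) (rule that)
  have utH: "AE t in ?M. ut t \<in> H2 \<Omega>" using utm by (simp add: bochner_Lp_def strongly_measurable_def)
  from sol have "has_initial_value \<Omega> T u u0" unfolding weak_solution_def by (elim conjE)
  then obtain w where w: "continuous_in {0..T} (H2 \<Omega>) (H2_norm \<Omega>) w"
    and wu: "AE t in ?M. AE x in lebesgue_on \<Omega>. w t x = u t x" and w0: "AE x in lebesgue_on \<Omega>. w 0 x = u0 x"
    unfolding has_initial_value_def by (elim exE conjE) (rule that)
  have w2: "w t \<in> H2 \<Omega>" if "t \<in> {0..T}" for t using w that by (simp add: continuous_in_def)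
  have cong: "emb v = emb v'" if "AE x in lebesgue_on \<Omega>. v x = v' x" "v \<in> H2 \<Omega>" "v' \<in> H2 \<Omega>" for v v'
    using that cls_eq_iff[OF H1D(1)[OF H2D(1)[OF that(2)]] H1D(1)[OF H2D(1)[OF that(3)]]]
    by (intro emb_cong) simp_all
  have inI: "AE t in ?M. t \<in> {0..T}" by (rule AE_I2) simp
  have uW: "AE t in ?M. u t \<in> H20 \<Omega> \<and> emb (u t) = emb (w t)"
    using uH wu inI by eventually_elim (simp add: cong[OF _ w2 H20_H2, symmetric])
  have "AE t in ?M. emb (w t) \<in> V" using uW by eventually_elim (metis V_I)
  note cW = continuous_in_V(1)[OF T w this] and WV = continuous_in_V(2)[OF T w this]
  have "((\<lambda>s. bform \<alpha> (emb (w s)) k) has_integral emb (w t) \<bullet> k - emb (w 0) \<bullet> k) {0..t}"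
    if t: "t \<in> {0..T}" and k: "k \<in> V" for t k
  proof (rule weak_time_derivative_integral[where p = "\<lambda>t. emb (w t) \<bullet> k", OF T _ _ _ t])
    show cp: "continuous_on {0..T} (\<lambda>t. emb (w t) \<bullet> k)" by (intro continuous_intros cW)
    show cq: "continuous_on {0..T} (\<lambda>t. bform \<alpha> (emb (w t)) k)" by (rule bform_continuous[OF cW WV k])
    fix \<theta> assume \<theta>: "test_function {0<..<T} \<theta>"
    note th = test_function_interval[OF \<theta>]
    obtain J where J: "has_integral_in {0<..<T} (H2 \<Omega>) (H2_norm \<Omega>) (\<lambda>t x. deriv \<theta> t * u t x) J"
      "has_integral_in {0<..<T} (H2 \<Omega>) (H2_norm \<Omega>) (\<lambda>t x. - (\<theta> t * ut t x)) J"
      using td \<theta> unfolding has_time_derivative_def by blast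
    \<comment> \<open>The pairing with \<open>u\<close> or \<open>ut\<close> agrees with a
      continuous function only almost everywhere and on the open interval; both integrals have the
      same value.\<close>
    have transfer: "(g has_integral c) {0..T}"
      if g: "continuous_on {0..T} g" and hb: "has_bochner_integral ?M f c" and fg: "AE t in ?M. f t = g t" for f g :: "real \<Rightarrow> real" and c
    proof -
      have "g \<in> borel_measurable ?M"
        using I(1) by (intro continuous_imp_measurable_on_sets_lebesgue continuous_on_subset[OF g]) auto
      moreover have "f \<in> borel_measurable ?M" by (rule borel_measurable_integrable[OF integrable.intros[OF hb]])
      ultimately have hg: "has_bochner_integral ?M g c" using hb fg has_bochner_integral_cong_AE by blast
      from has_integral_integral_lebesgue_on[OF integrable.intros[OF hg] I(1)]
      have "(g has_integral c) {0<..<T}" unfolding has_bochner_integral_integral_eq[OF hg] .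
      then show ?thesis by (simp add: has_integral_Icc_iff_Ioo)
    qed
    have "((\<lambda>t. deriv \<theta> t * (emb (w t) \<bullet> k)) has_integral k \<bullet> emb J) {0..T}"
    proof (rule transfer[OF _ has_integral_in_inner[OF I(2) J(1), of k]])
      show "continuous_on {0..T} (\<lambda>t. deriv \<theta> t * (emb (w t) \<bullet> k))" by (intro continuous_intros th cp)
      show "AE t in ?M. k \<bullet> emb (\<lambda>x. deriv \<theta> t * u t x) = deriv \<theta> t * (emb (w t) \<bullet> k)"
        using uW by eventually_elim (simp add: H20_scale(2) inner_commute)
    qed
    moreover have "((\<lambda>t. - (\<theta> t * bform \<alpha> (emb (w t)) k)) has_integral k \<bullet> emb J) {0..T}"
    proof (rule transfer[OF _ has_integral_in_inner[OF I(2) J(2), of k]])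
      show "continuous_on {0..T} (\<lambda>t. - (\<theta> t * bform \<alpha> (emb (w t)) k))" by (intro continuous_intros th cq)
      show "AE t in ?M. k \<bullet> emb (\<lambda>x. - (\<theta> t * ut t x)) = - (\<theta> t * bform \<alpha> (emb (w t)) k)"
        using uW utH eq
      proof eventually_elim
        case (elim t)
        then have ut: "u t \<in> H20 \<Omega>" "emb (u t) = emb (w t)" by blast+
        note r = rep_V[OF k]
        have "emb (\<lambda>x. - (\<theta> t * ut t x)) = (- \<theta> t) *\<^sub>R emb (ut t)"
          using emb_linear[OF elim(2) H2_zero(1)[OF elim(2)], of "- \<theta> t"] by (simp add: H2_zero(2)[OF elim(2)])
        moreover have "emb (ut t) \<bullet> emb (rep k) = form \<alpha> (u t) (rep k)"
          using elim(3)[rule_format, OF r(1)] unfolding weak_form_iff[OF ut(1) elim(2) r(1)] .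
        moreover have "form \<alpha> (u t) (rep k) = bform \<alpha> (emb (w t)) k"
          using bform_emb[OF ut(1) r(1), of \<alpha>] ut(2) r(2) by simp
        ultimately show ?case using r(2) by (simp add: inner_commute)
      qed
    qed
    ultimately show "\<exists>c. ((\<lambda>t. deriv \<theta> t * (emb (w t) \<bullet> k)) has_integral c) {0..T} \<and>
        ((\<lambda>t. - (\<theta> t * bform \<alpha> (emb (w t)) k)) has_integral c) {0..T}" by blast
  qed
  moreover have "emb (w 0) = emb u0" using T by (intro cong[OF w0 w2 H20_H2[OF u0]]) simp
  ultimately show ?thesis using cW WV uW by (intro exI[of _ "\<lambda>t. emb (w t)"]) simp
qed

lemma weak_solution_unique:
  assumes T: "0 < T" and u0: "u0 \<in> H20 \<Omega>" and sol: "weak_solution \<Omega> \<alpha> T u0 u" "weak_solution \<Omega> \<alpha> T u0 v"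
  shows "AE t in lebesgue_on {0<..<T}. AE x in lebesgue_on \<Omega>. u t x = v t x"
proof -
  let ?M = "lebesgue_on {0<..<T}"
  obtain U where U: "continuous_on {0..T} U" "\<forall>t\<in>{0..T}. U t \<in> V" "U 0 = emb u0"
    "\<forall>t\<in>{0..T}. \<forall>k\<in>V. ((\<lambda>s. bform \<alpha> (U s) k) has_integral U t \<bullet> k - U 0 \<bullet> k) {0..t}"
    "AE t in ?M. u t \<in> H20 \<Omega> \<and> emb (u t) = U t"
    using weak_solution_integral_form[OF T u0 sol(1)] by (elim exE conjE) (rule that)
  obtain W where W: "continuous_on {0..T} W" "\<forall>t\<in>{0..T}. W t \<in> V" "W 0 = emb u0"
    "\<forall>t\<in>{0..T}. \<forall>k\<in>V. ((\<lambda>s. bform \<alpha> (W s) k) has_integral W t \<bullet> k - W 0 \<bullet> k) {0..t}"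
    "AE t in ?M. v t \<in> H20 \<Omega> \<and> emb (v t) = W t"
    using weak_solution_integral_form[OF T u0 sol(2)] by (elim exE conjE) (rule that)
  have "subspace V" unfolding V_def by (rule H20_subspace[OF u0])
  from integral_form_unique[OF this bform_lipschitz form_const_nonneg T U(1) U(2)[rule_format] W(1) W(2)[rule_format]
      U(4)[rule_format] W(4)[rule_format]]
  have UW: "U t = W t" if "t \<in> {0..T}" for t using U(3) W(3) that by simp
  have "AE t in ?M. t \<in> {0..T}" by (rule AE_I2) simp
  with U(5) W(5) show ?thesis
  proof eventually_elim
    case (elim t)
    then have uv: "u t \<in> H20 \<Omega>" "v t \<in> H20 \<Omega>" "emb (u t) = emb (v t)" using UW[OF elim(3)] by auto
    from cls_cong_emb[OF H20_H2[OF uv(1)] H20_H2[OF uv(2)] uv(3)]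
    show ?case using cls_eq_iff[OF H1D(1)[OF H20_H1[OF uv(1)]] H1D(1)[OF H20_H1[OF uv(2)]]] by blast
  qed
qed

end

theorem theorem6:
  fixes \<Omega> :: "(real^'n) set" and \<alpha> :: real and u0 :: "real^'n \<Rightarrow> real"
  assumes "CARD('n) \<le> 2"
    and "bounded_lipschitz_domain \<Omega>"
    and "\<alpha> > 0"
    and "u0 \<in> H20 \<Omega>"
  shows "\<forall>T>0. (\<exists>u. weak_solution \<Omega> \<alpha> T u0 u) \<and>
           (\<forall>u v. weak_solution \<Omega> \<alpha> T u0 u \<longrightarrow> weak_solution \<Omega> \<alpha> T u0 v \<longrightarrow>
              (AE t in lebesgue_on {0<..<T}. AE x in lebesgue_on \<Omega>. u t x = v t x))"
proof -
  interpret planar_domain \<Omega>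
    using assms(1,2) by unfold_locales (simp_all add: bounded_lipschitz_domain_def)
  show ?thesis
    using weak_solution_exists[OF _ less_imp_le[OF assms(3)] assms(4)] weak_solution_unique[OF _ assms(4)] by blast
qed

end
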